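(* Let $\Omega\subset\mathbb{R}^N$ be a bounded open set with Lipschitz boundary, $T>0$ and $Q_T=\Omega\times(0,T)$. Let $\boldsymbol b\in L^2(Q_T)^N$ and $c\in L^2(Q_T)$, and assume that there exists $l\in\mathbb{R}$ such that $c-\frac12\nabla\cdot\boldsymbol b\ge l$ in $Q_T$ in the sense of distributions. Let $g\in W^{1,\infty}(0,T;L^\infty(\Omega))$ with $g\ge m$ for some constant $m>0$, let $f\in L^2(Q_T)$ and let $u_0\in\mathbb{K}_{g(0)}$. Then the problem $$u(t)\in\mathbb{K}_{g(t)}\ \text{ for a.e. } t\in(0,T),\qquad u(0)=u_0,$$ $$\int_\Omega \partial_t u(t)\,(v-u(t))\,dx+\int_\Omega\boldsymbol b(t)\cdot\nabla u(t)\,(v-u(t))\,dx+\int_\Omega c(t)\,u(t)\,(v-u(t))\,dx\ \ge\ \int_\Omega f(t)\,(v-u(t))\,dx$$ $$\text{for all } v\in\mathbb{K}_{g(t)},\ \text{for a.e. } t\in(0,T),$$ has a unique solution $u\in L^\infty(0,T;W^{1,\infty}_0(\Omega))\cap C(\overline{Q}_T)$ with $\partial_t u\in L^2(Q_T)$.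
   Context: For $t\ge 0$, $\mathbb{K}_{g(t)}=\{v\in H^1_0(\Omega): |\nabla v(x)|\le g(x,t)\text{ for a.e. }x\in\Omega\}$. The symbols $\nabla$ and $\nabla\cdot$ denote the gradient and divergence in the space variable $x$ only. The inequality $c-\frac12\nabla\cdot\boldsymbol b\ge l$ in the sense of distributions means $\int_{Q_T}\big(c\,\varphi+\frac12\boldsymbol b\cdot\nabla\varphi\big)\ge l\int_{Q_T}\varphi$ for all nonnegative $\varphi\in C_c^\infty(Q_T)$. $W^{1,\infty}_0(\Omega)$ denotes the functions of $W^{1,\infty}(\Omega)$ vanishing on $\partial\Omega$. *)

theory Defs
  imports "HOL-Analysis.Analysis"
begin

text \<open>The space $\mathbb{R}^N$ is a Euclidean space \<open>'a\<close>; space-time functions take pairs \<open>(x, t)\<close>.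
  Classes of functions modulo null sets are represented by functions on the whole type, and all
  predicates below depend only on the values on the relevant set, almost everywhere where
  appropriate.\<close>

definition lipschitz_boundary :: "'a::euclidean_space set \<Rightarrow> bool" where
  "lipschitz_boundary \<Omega> \<longleftrightarrow>
    (\<forall>p\<in>frontier \<Omega>. \<exists>r>0. \<exists>e \<gamma> L. norm e = 1 \<and> L-lipschitz_on {y. y \<bullet> e = 0} (\<gamma> :: 'a \<Rightarrow> real) \<and>
       \<Omega> \<inter> ball p r = {x \<in> ball p r. \<gamma> (x - (x \<bullet> e) *\<^sub>R e) < x \<bullet> e})"

definition cylinder :: "'a set \<Rightarrow> real \<Rightarrow> ('a \<times> real) set" where
  "cylinder \<Omega> T = \<Omega> \<times> {0<..<T}"

primrec C_k :: "nat \<Rightarrow> ('a::euclidean_space \<Rightarrow> real) \<Rightarrow> bool" where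
  "C_k 0 \<phi> \<longleftrightarrow> continuous_on UNIV \<phi>"
| "C_k (Suc k) \<phi> \<longleftrightarrow> (\<forall>x. \<phi> differentiable at x) \<and>
     (\<forall>i\<in>Basis. C_k k (\<lambda>x. frechet_derivative \<phi> (at x) i))"

definition test_function :: "'a::euclidean_space set \<Rightarrow> ('a \<Rightarrow> real) \<Rightarrow> bool" where
  "test_function S \<phi> \<longleftrightarrow> (\<forall>k. C_k k \<phi>) \<and>
     compact (closure {x. \<phi> x \<noteq> 0}) \<and> closure {x. \<phi> x \<noteq> 0} \<subseteq> S"

definition grad :: "('a::euclidean_space \<Rightarrow> real) \<Rightarrow> 'a \<Rightarrow> 'a" where
  "grad \<phi> x = (THE D. GDERIV \<phi> x :> D)"

definition in_L2 :: "'a::euclidean_space set \<Rightarrow> ('a \<Rightarrow> 'b::euclidean_space) \<Rightarrow> bool" where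
  "in_L2 S f \<longleftrightarrow> f \<in> borel_measurable (lebesgue_on S) \<and>
     integrable (lebesgue_on S) (\<lambda>x. (norm (f x))\<^sup>2)"

definition in_Linf :: "'a::euclidean_space set \<Rightarrow> ('a \<Rightarrow> 'b::euclidean_space) \<Rightarrow> bool" where
  "in_Linf S f \<longleftrightarrow> f \<in> borel_measurable (lebesgue_on S) \<and>
     (\<exists>M. AE x in lebesgue_on S. norm (f x) \<le> M)"

definition locally_integrable :: "'a::euclidean_space set \<Rightarrow> ('a \<Rightarrow> 'b::euclidean_space) \<Rightarrow> bool" where
  "locally_integrable S f \<longleftrightarrow> (\<forall>K. compact K \<and> K \<subseteq> S \<longrightarrow> integrable (lebesgue_on K) f)"

definition has_weak_grad :: "'a::euclidean_space set \<Rightarrow> ('a \<Rightarrow> real) \<Rightarrow> ('a \<Rightarrow> 'a) \<Rightarrow> bool" where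
  "has_weak_grad \<Omega> v G \<longleftrightarrow> locally_integrable \<Omega> v \<and> locally_integrable \<Omega> G \<and>
     (\<forall>\<phi>. test_function \<Omega> \<phi> \<longrightarrow>
       (LINT x|lebesgue_on \<Omega>. v x *\<^sub>R grad \<phi> x) = - (LINT x|lebesgue_on \<Omega>. \<phi> x *\<^sub>R G x))"

text \<open>The weak derivatives are determined only up to null sets; a representative is chosen.\<close>

definition weak_grad :: "'a::euclidean_space set \<Rightarrow> ('a \<Rightarrow> real) \<Rightarrow> 'a \<Rightarrow> 'a" where
  "weak_grad \<Omega> v = (SOME G. has_weak_grad \<Omega> v G)"

definition has_weak_dt ::
    "'a::euclidean_space set \<Rightarrow> real \<Rightarrow> ('a \<times> real \<Rightarrow> real) \<Rightarrow> ('a \<times> real \<Rightarrow> real) \<Rightarrow> bool" where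
  "has_weak_dt \<Omega> T u w \<longleftrightarrow>
     locally_integrable (cylinder \<Omega> T) u \<and> locally_integrable (cylinder \<Omega> T) w \<and>
     (\<forall>\<phi>. test_function (cylinder \<Omega> T) \<phi> \<longrightarrow>
       (LINT z|lebesgue_on (cylinder \<Omega> T). u z * deriv (\<lambda>s. \<phi> (fst z, s)) (snd z))
       = - (LINT z|lebesgue_on (cylinder \<Omega> T). w z * \<phi> z))"

definition weak_dt ::
    "'a::euclidean_space set \<Rightarrow> real \<Rightarrow> ('a \<times> real \<Rightarrow> real) \<Rightarrow> 'a \<times> real \<Rightarrow> real" where
  "weak_dt \<Omega> T u = (SOME w. has_weak_dt \<Omega> T u w)"

definition in_H1 :: "'a::euclidean_space set \<Rightarrow> ('a \<Rightarrow> real) \<Rightarrow> bool" where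
  "in_H1 \<Omega> v \<longleftrightarrow> in_L2 \<Omega> v \<and> (\<exists>G. has_weak_grad \<Omega> v G \<and> in_L2 \<Omega> G)"

text \<open>The closure of the test functions in the \<open>H\<^sup>1\<close> norm:\<close>

definition in_H10 :: "'a::euclidean_space set \<Rightarrow> ('a \<Rightarrow> real) \<Rightarrow> bool" where
  "in_H10 \<Omega> v \<longleftrightarrow> in_H1 \<Omega> v \<and>
     (\<exists>\<phi> :: nat \<Rightarrow> 'a \<Rightarrow> real. (\<forall>n. test_function \<Omega> (\<phi> n)) \<and>
       (\<lambda>n. LINT x|lebesgue_on \<Omega>. (\<phi> n x - v x)\<^sup>2 + (norm (grad (\<phi> n) x - weak_grad \<Omega> v x))\<^sup>2)
         \<longlonglongrightarrow> 0)"

definition in_W1inf :: "'a::euclidean_space set \<Rightarrow> ('a \<Rightarrow> real) \<Rightarrow> bool" where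
  "in_W1inf \<Omega> v \<longleftrightarrow> in_Linf \<Omega> v \<and> (\<exists>G. has_weak_grad \<Omega> v G \<and> in_Linf \<Omega> G)"

text \<open>Vanishing on the boundary refers to the representative continuous up to the boundary:\<close>

definition in_W1inf0 :: "'a::euclidean_space set \<Rightarrow> ('a \<Rightarrow> real) \<Rightarrow> bool" where
  "in_W1inf0 \<Omega> v \<longleftrightarrow> in_W1inf \<Omega> v \<and>
     (\<exists>v'. continuous_on (closure \<Omega>) v' \<and> (AE x in lebesgue_on \<Omega>. v' x = v x) \<and>
           (\<forall>x\<in>frontier \<Omega>. v' x = 0))"

text \<open>Measurability of time-dependent functions with values in the dual spaces \<open>L\<^sup>\<infinity>(\<Omega>)\<close> and
  \<open>W\<^sup>1\<^sup>,\<^sup>\<infinity>(\<Omega>)\<close> is understood in the usual weak-star sense, so that \<open>L\<^sup>\<infinity>(0,T;L\<^sup>\<infinity>(\<Omega>))\<close> is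
  \<open>L\<^sup>\<infinity>\<close> of the space-time cylinder. Strong (Bochner) measurability would be too restrictive:
  a function whose gradient jumps along a moving surface is not strongly measurable with values
  in \<open>W\<^sup>1\<^sup>,\<^sup>\<infinity>(\<Omega>)\<close>.\<close>

definition in_Linf_W1inf0 :: "'a::euclidean_space set \<Rightarrow> real \<Rightarrow> ('a \<times> real \<Rightarrow> real) \<Rightarrow> bool" where
  "in_Linf_W1inf0 \<Omega> T u \<longleftrightarrow> u \<in> borel_measurable (lebesgue_on (cylinder \<Omega> T)) \<and>
     (\<exists>M. AE t in lebesgue_on {0<..<T}. in_W1inf0 \<Omega> (\<lambda>x. u (x, t)) \<and>
        (AE x in lebesgue_on \<Omega>. \<bar>u (x, t)\<bar> \<le> M \<and> norm (weak_grad \<Omega> (\<lambda>x. u (x, t)) x) \<le> M))"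

text \<open>An element of \<open>W\<^sup>1\<^sup>,\<^sup>\<infinity>(0,T;L\<^sup>\<infinity>(\<Omega>))\<close> has a representative that is continuous from \<open>[0,T]\<close>
  into \<open>L\<^sup>\<infinity>(\<Omega>)\<close>; this is the representative used, and it gives a meaning to the value at each
  time, in particular at time \<open>0\<close>.\<close>

definition in_W1inf_Linf :: "'a::euclidean_space set \<Rightarrow> real \<Rightarrow> ('a \<times> real \<Rightarrow> real) \<Rightarrow> bool" where
  "in_W1inf_Linf \<Omega> T g \<longleftrightarrow>
     in_Linf (cylinder \<Omega> T) g \<and> (\<exists>h. has_weak_dt \<Omega> T g h \<and> in_Linf (cylinder \<Omega> T) h) \<and>
     (\<forall>t\<in>{0..T}. in_Linf \<Omega> (\<lambda>x. g (x, t))) \<and>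
     (\<forall>t\<in>{0..T}. \<forall>\<epsilon>>0. \<exists>\<delta>>0. \<forall>s\<in>{0..T}. \<bar>s - t\<bar> < \<delta> \<longrightarrow>
        (AE x in lebesgue_on \<Omega>. \<bar>g (x, s) - g (x, t)\<bar> \<le> \<epsilon>))"

text \<open>The inequality \<open>c - (1/2) div b \<ge> l\<close> in the sense of distributions:\<close>

definition c_minus_half_div_ge ::
    "'a::euclidean_space set \<Rightarrow> real \<Rightarrow> ('a \<times> real \<Rightarrow> 'a) \<Rightarrow> ('a \<times> real \<Rightarrow> real) \<Rightarrow> real \<Rightarrow> bool" where
  "c_minus_half_div_ge \<Omega> T b c l \<longleftrightarrow>
     (\<forall>\<phi>. test_function (cylinder \<Omega> T) \<phi> \<and> (\<forall>z. 0 \<le> \<phi> z) \<longrightarrow>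
       l * (LINT z|lebesgue_on (cylinder \<Omega> T). \<phi> z)
       \<le> (LINT z|lebesgue_on (cylinder \<Omega> T).
            c z * \<phi> z + 1 / 2 * (b z \<bullet> grad (\<lambda>y. \<phi> (y, snd z)) (fst z))))"

definition constraint_set :: "'a::euclidean_space set \<Rightarrow> ('a \<Rightarrow> real) \<Rightarrow> ('a \<Rightarrow> real) set" where
  "constraint_set \<Omega> \<gamma> =
     {v. in_H10 \<Omega> v \<and> (AE x in lebesgue_on \<Omega>. norm (weak_grad \<Omega> v x) \<le> \<gamma> x)}"

definition is_solution ::
    "'a::euclidean_space set \<Rightarrow> real \<Rightarrow> ('a \<times> real \<Rightarrow> 'a) \<Rightarrow> ('a \<times> real \<Rightarrow> real) \<Rightarrow>
     ('a \<times> real \<Rightarrow> real) \<Rightarrow> ('a \<times> real \<Rightarrow> real) \<Rightarrow> ('a \<Rightarrow> real) \<Rightarrow> ('a \<times> real \<Rightarrow> real) \<Rightarrow> bool" where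
  "is_solution \<Omega> T b c g f u0 u \<longleftrightarrow>
     (AE t in lebesgue_on {0<..<T}. (\<lambda>x. u (x, t)) \<in> constraint_set \<Omega> (\<lambda>x. g (x, t))) \<and>
     (AE x in lebesgue_on \<Omega>. u (x, 0) = u0 x) \<and>
     (AE t in lebesgue_on {0<..<T}. \<forall>v \<in> constraint_set \<Omega> (\<lambda>x. g (x, t)).
        (LINT x|lebesgue_on \<Omega>. weak_dt \<Omega> T u (x, t) * (v x - u (x, t)))
      + (LINT x|lebesgue_on \<Omega>. (b (x, t) \<bullet> weak_grad \<Omega> (\<lambda>y. u (y, t)) x) * (v x - u (x, t)))
      + (LINT x|lebesgue_on \<Omega>. c (x, t) * u (x, t) * (v x - u (x, t)))
      \<ge> (LINT x|lebesgue_on \<Omega>. f (x, t) * (v x - u (x, t))))"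

definition solution_class :: "'a::euclidean_space set \<Rightarrow> real \<Rightarrow> ('a \<times> real \<Rightarrow> real) set" where
  "solution_class \<Omega> T =
     {u. in_Linf_W1inf0 \<Omega> T u \<and> continuous_on (closure (cylinder \<Omega> T)) u \<and>
         (\<exists>w. has_weak_dt \<Omega> T u w \<and> in_L2 (cylinder \<Omega> T) w)}"

end

theory Submission
  imports Defs "HOL-Complex_Analysis.Great_Picard"
begin

text \<open>Existence is proved by a semi-implicit time discretisation. The new iterate minimises a quadratic functional,
  with the lower order terms frozen at the old iterate, over the functions vanishing outside \<open>\<Omega>\<close> with gradient
  bounded by \<open>g\<close> at the new time. As \<open>g \<ge> m > 0\<close> is Lipschitz continuous in time, an admissible function becomes
  admissible at another time after multiplication by \<open>1 - C / m * \<bar>t - s\<bar>\<close>; testing with such multiples bounds the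
  difference quotients in \<open>L\<^sup>2\<close>. By Arzela-Ascoli the interpolants converge uniformly along a subsequence. Convex
  combinations of the pairs of difference quotients and gradients converge strongly in \<open>L\<^sup>2\<close>; this suffices, since
  these pairs enter the inequality linearly, against uniformly convergent functions.

  For uniqueness each inequality is tested with the other solution. At almost every time the condition on
  \<open>c - 1/2 div b\<close> can be applied to the square of the difference, so that Gronwall's lemma yields the claim.\<close>

text \<open>\<open>b\<close>, \<open>c\<close> and \<open>f\<close> are only square integrable, so
  all compactness comes from the gradient bound: because the boundary is Lipschitz, an admissible
  function has a representative on the whole space that vanishes off \<open>\<Omega>\<close> and is
  Lipschitz with one constant \<open>M\<close>. Two obstacles shape the rest. An inequality derived
  for a fixed test function holds off a null set of times depending on that function, while the
  admissible set itself moves with time; so countable uniformly dense families are drawn from the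
  admissible sets at rational times and carried to other times by rescaling. And the condition on
  \<open>c - 1/2 div b\<close> concerns smooth functions, whereas the difference of two solutions is
  merely Lipschitz in space. Since \<open>b\<close> and \<open>c\<close> are only L2, both the
  squares and the products of function and gradient must converge in L2, which an L2 approximation
  of function and gradient does not give; the bounded smooth truncation
  \<open>sin (e * y) / e\<close> provides it, with \<open>e\<close> tending to 0 at the end.\<close>

lemma C_k_SucD: "C_k (Suc k) \<phi> \<Longrightarrow> C_k k \<phi>"
proof (induction k arbitrary: \<phi>)
  case 0
  then show ?case by (auto simp: continuous_on_eq_continuous_at differentiable_imp_continuous_within)
next
  case (Suc k)
  then show ?case by auto
qed

lemma C_k_continuous: "C_k k \<phi> \<Longrightarrow> continuous_on UNIV \<phi>"
  by (induction k) (use C_k_SucD C_k.simps(1) in blast)+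

lemma C_k_const: "C_k k (\<lambda>x. c)"
proof (induction k arbitrary: c)
  case (Suc k)
  then show ?case by (simp add: frechet_derivative_const)
qed simp

lemma C_k_add:
  assumes "C_k k f" "C_k k g"
  shows "C_k k (\<lambda>x. f x + g x)"
  using assms
proof (induction k arbitrary: f g)
  case (Suc k)
  have "frechet_derivative (\<lambda>x. f x + g x) (at x) i = frechet_derivative f (at x) i + frechet_derivative g (at x) i" for x i
    using Suc.prems by (subst frechet_derivative_at[symmetric])
      (auto intro!: has_derivative_add simp: frechet_derivative_works[symmetric])
  then show ?case using Suc by (auto intro: differentiable_add)
qed (auto intro: continuous_intros)

lemma C_k_mult:
  assumes "C_k k f" "C_k k g"
  shows "C_k k (\<lambda>x. f x * g x)"
  using assms
proof (induction k arbitrary: f g)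
  case (Suc k)
  have "frechet_derivative (\<lambda>x. f x * g x) (at x) i
      = f x * frechet_derivative g (at x) i + frechet_derivative f (at x) i * g x" for x i
    using Suc.prems by (subst frechet_derivative_at[symmetric])
      (auto intro!: has_derivative_mult simp: frechet_derivative_works[symmetric])
  then show ?case using Suc C_k_SucD[OF Suc.prems(1)] C_k_SucD[OF Suc.prems(2)] by (auto intro!: differentiable_mult C_k_add)
qed (auto intro: continuous_intros)

lemma C_k_sum:
  assumes "\<And>i. i \<in> I \<Longrightarrow> C_k k (f i)"
  shows "C_k k (\<lambda>x. \<Sum>i\<in>I. f i x)"
  using assms by (induction I rule: infinite_finite_induct) (auto intro: C_k_add C_k_const)

lemma C_k_prod:
  assumes "\<And>i. i \<in> I \<Longrightarrow> C_k k (f i)"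
  shows "C_k k (\<lambda>x. \<Prod>i\<in>I. f i x)"
  using assms by (induction I rule: infinite_finite_induct) (auto intro: C_k_mult C_k_const)

lemma C_k_cmult: "C_k k f \<Longrightarrow> C_k k (\<lambda>x. c * f x)"
  by (intro C_k_mult C_k_const)

lemma C_k_diff: "C_k k f \<Longrightarrow> C_k k g \<Longrightarrow> C_k k (\<lambda>x. f x - g x)"
  using C_k_add[of k f "\<lambda>x. (-1) * g x"] C_k_cmult[of k g "-1"] by simp

lemma frechet_derivative_Basis_sum:
  assumes "\<phi> differentiable at x"
  shows "frechet_derivative \<phi> (at x) h = (\<Sum>i\<in>Basis. (h \<bullet> i) * frechet_derivative \<phi> (at x) i)"
proof -
  have l: "linear (frechet_derivative \<phi> (at x))" using assms by (rule linear_frechet_derivative)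
  have "frechet_derivative \<phi> (at x) h = frechet_derivative \<phi> (at x) (\<Sum>i\<in>Basis. (h \<bullet> i) *\<^sub>R i)"
    by (simp add: euclidean_representation)
  also have "\<dots> = (\<Sum>i\<in>Basis. (h \<bullet> i) * frechet_derivative \<phi> (at x) i)"
    by (simp add: linear_sum[OF l] linear_cmul[OF l])
  finally show ?thesis .
qed

lemma has_derivative_affine:
  assumes "bounded_linear L" "\<phi> differentiable at (L x + d)"
  shows "((\<lambda>x. \<phi> (L x + d)) has_derivative (\<lambda>h. frechet_derivative \<phi> (at (L x + d)) (L h))) (at x)"
proof -
  have "((\<lambda>x. L x + d) has_derivative L) (at x)"
    using bounded_linear_imp_has_derivative[OF assms(1)] by (auto intro!: derivative_eq_intros)
  from diff_chain_at[OF this] assms(2) show ?thesis by (auto simp: o_def frechet_derivative_works)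
qed

lemma C_k_affine:
  fixes L :: "'a::euclidean_space \<Rightarrow> 'b::euclidean_space"
  assumes "bounded_linear L" "C_k k \<phi>"
  shows "C_k k (\<lambda>x. \<phi> (L x + d))"
  using assms(2)
proof (induction k arbitrary: \<phi>)
  case 0
  have "continuous_on UNIV (\<lambda>x. L x + d)" using linear_continuous_on[OF assms(1)] by (intro continuous_intros) auto
  then show ?case using continuous_on_compose2[OF 0[simplified]] by auto
next
  case (Suc k)
  have hd: "((\<lambda>x. \<phi> (L x + d)) has_derivative (\<lambda>h. frechet_derivative \<phi> (at (L x + d)) (L h))) (at x)" for x
    using Suc.prems by (intro has_derivative_affine assms) auto
  have "frechet_derivative (\<lambda>x. \<phi> (L x + d)) (at x) j
      = (\<Sum>i\<in>Basis. (L j \<bullet> i) * frechet_derivative \<phi> (at (L x + d)) i)" for x j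
    using Suc.prems fun_cong[OF frechet_derivative_at[OF hd], of x j]
    by (simp add: frechet_derivative_Basis_sum[of \<phi> "L x + d" "L j"])
  moreover have "C_k k (\<lambda>x. \<Sum>i\<in>Basis. (L j \<bullet> i) * frechet_derivative \<phi> (at (L x + d)) i)" for j
    using Suc.prems by (intro C_k_sum C_k_cmult Suc.IH) auto
  moreover have "(\<lambda>x. \<phi> (L x + d)) differentiable at x" for x using hd unfolding differentiable_def by blast
  ultimately show ?case by simp
qed

lemma C_k_compose_real:
  fixes h :: "real \<Rightarrow> real"
  assumes "C_k k h" "C_k k \<phi>"
  shows "C_k k (\<lambda>x. h (\<phi> x))"
  using assms
proof (induction k arbitrary: h \<phi>)
  case 0
  then show ?case by (auto intro: continuous_on_compose2[OF 0(1)[simplified]])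
next
  case (Suc k)
  have hd: "((\<lambda>x. h (\<phi> x)) has_derivative
      (\<lambda>e. frechet_derivative h (at (\<phi> x)) (frechet_derivative \<phi> (at x) e))) (at x)" for x
    using Suc.prems diff_chain_at[of \<phi> _ x h] by (auto simp: o_def frechet_derivative_works)
  have "frechet_derivative (\<lambda>x. h (\<phi> x)) (at x) j
      = frechet_derivative h (at (\<phi> x)) 1 * frechet_derivative \<phi> (at x) j" for x j
  proof -
    have "frechet_derivative (\<lambda>x. h (\<phi> x)) (at x) j
        = frechet_derivative h (at (\<phi> x)) (frechet_derivative \<phi> (at x) j)"
      using fun_cong[OF frechet_derivative_at[OF hd]] by simp
    then show ?thesis using frechet_derivative_Basis_sum[of h "\<phi> x" "frechet_derivative \<phi> (at x) j"] Suc.prems(1) by simp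
  qed
  moreover have "C_k k (\<lambda>x. frechet_derivative h (at (\<phi> x)) 1 * frechet_derivative \<phi> (at x) j)"
    if "j \<in> Basis" for j using Suc.prems that
    by (intro C_k_mult Suc.IH[of "\<lambda>s. frechet_derivative h (at s) 1" \<phi>] C_k_SucD[OF Suc.prems(2)]) auto
  moreover have "(\<lambda>x. h (\<phi> x)) differentiable at x" for x using hd by (auto simp: differentiable_def)
  ultimately show ?case by simp
qed

section \<open>Smooth functions of one real variable and bump functions\<close>

lemma frechet_derivative_real:
  fixes h :: "real \<Rightarrow> real"
  assumes "(h has_real_derivative d) (at s)"
  shows "frechet_derivative h (at s) i = d * i"
  using frechet_derivative_at[of h "(*) d" s] assms by (simp add: has_field_derivative_def)

lemma C_k_SucI_real:
  fixes h :: "real \<Rightarrow> real"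
  assumes "\<And>s. (h has_real_derivative h' s) (at s)" "C_k k h'"
  shows "C_k (Suc k) h"
  using assms by (auto simp: frechet_derivative_real[OF assms(1)] differentiable_def has_field_derivative_def)

lemma C_k_sin_cos: "C_k k (sin :: real \<Rightarrow> real) \<and> C_k k (cos :: real \<Rightarrow> real)"
proof (induction k)
  case 0
  then show ?case by (auto intro: continuous_intros)
next
  case (Suc k)
  have "C_k (Suc k) (sin :: real \<Rightarrow> real)"
    by (rule C_k_SucI_real[of _ cos]) (use Suc in \<open>auto intro!: derivative_eq_intros\<close>)
  moreover have "C_k (Suc k) (cos :: real \<Rightarrow> real)" by (rule C_k_SucI_real[of _ "\<lambda>x. (-1) * sin x"])
      (use C_k_cmult[of k sin "-1"] Suc in \<open>auto intro!: derivative_eq_intros\<close>)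
  ultimately show ?case by simp
qed

text \<open>The family is closed under differentiation, which lets the smoothness of exp(-1/s), the
  case \<open>p = 1\<close>, be proved by an induction over all \<open>p\<close> at once.\<close>

definition bump_poly :: "real poly \<Rightarrow> real \<Rightarrow> real" where
  "bump_poly p s = (if s > 0 then poly p (1 / s) * exp (- 1 / s) else 0)"

lemma bump_poly_tendsto:
  fixes p :: "real poly"
  shows "((\<lambda>s. poly p (1 / s) * exp (- 1 / s)) \<longlongrightarrow> 0) (at_right 0)"
proof -
  have 1: "((\<lambda>y. poly p y * exp (- y)) \<longlongrightarrow> 0) at_top" proof -
    have a: "((\<lambda>y::real. y ^ k * exp (- y)) \<longlongrightarrow> 0) at_top" for k
      using tendsto_power_div_exp_0[of k] by (simp add: exp_minus field_simps)
    have "((\<lambda>y. \<Sum>i\<le>degree p. coeff p i * (y ^ i * exp (- y))) \<longlongrightarrow> (\<Sum>i\<le>degree p. coeff p i * 0)) at_top"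
      by (intro tendsto_sum tendsto_mult tendsto_const a)
    then show ?thesis by (simp add: poly_altdef sum_distrib_right mult.assoc)
  qed
  have "filterlim (\<lambda>s::real. 1 / s) at_top (at_right 0)"
    using filterlim_inverse_at_top_right by (simp add: inverse_eq_divide)
  from filterlim_compose[OF 1 this] show ?thesis by simp
qed

text \<open>With y = 1/s one has d/ds = - y^2 d/dy, so p(y) exp(-y) becomes y^2 (p - p')(y) exp(-y);
  the factor \<open>[:0, 0, 1:]\<close> is y^2. At 0 the exponential beats every polynomial.\<close>

lemma bump_poly_deriv:
  "(bump_poly p has_real_derivative bump_poly ([:0, 0, 1:] * (p - pderiv p)) s) (at s)"
proof -
  consider "s > 0" | "s < 0" | "s = 0" by linarith
  then show ?thesis proof cases
    case 1
    have "((\<lambda>s. poly p (1 / s) * exp (- 1 / s)) has_real_derivative bump_poly ([:0, 0, 1:] * (p - pderiv p)) s) (at s)"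
      using 1 by (auto intro!: derivative_eq_intros poly_DERIV[THEN DERIV_chain2]
          simp: bump_poly_def power2_eq_square field_simps)
    moreover have "eventually (\<lambda>s. poly p (1 / s) * exp (- 1 / s) = bump_poly p s) (nhds s)"
      using eventually_nhds_in_open[of "{0<..}" s] 1 by (auto elim: eventually_mono simp: bump_poly_def)
    ultimately show ?thesis using DERIV_cong_ev[OF refl _ refl] by fastforce
  next
    case 2
    have "eventually (\<lambda>s. 0 = bump_poly p s) (nhds s)"
      using eventually_nhds_in_open[of "{..<0}" s] 2 by (auto elim: eventually_mono simp: bump_poly_def)
    then show ?thesis using 2 DERIV_cong_ev[OF refl, of "\<lambda>_. 0" "bump_poly p" s 0 0] by (auto simp: bump_poly_def)
  next
    case 3
    \<comment> \<open>The difference quotient at 0 carries an extra factor 1/h, hence the polynomial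
      y * p(y).\<close>
    have "((\<lambda>h. poly ([:0, 1:] * p) (1 / h) * exp (- 1 / h)) \<longlongrightarrow> 0) (at_right 0)"
      by (rule bump_poly_tendsto)
    then have r: "((\<lambda>h. bump_poly p h / h) \<longlongrightarrow> 0) (at_right 0)"
      by (rule Lim_transform_eventually) (auto simp: eventually_at_right_field bump_poly_def intro!: exI[of _ 1])
    have l: "((\<lambda>h. bump_poly p h / h) \<longlongrightarrow> 0) (at_left 0)"
      by (rule Lim_transform_eventually[OF tendsto_const])
        (auto simp: eventually_at_left_field bump_poly_def intro!: exI[of _ "-1"])
    show ?thesis using filterlim_split_at[OF l r] 3 by (simp add: DERIV_def bump_poly_def)
  qed
qed

lemma C_k_bump_poly: "C_k k (bump_poly p)"
proof (induction k arbitrary: p)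
  case 0
  then show ?case using DERIV_isCont[OF bump_poly_deriv] by (simp add: continuous_on_eq_continuous_at)
next
  case (Suc k)
  show ?case by (rule C_k_SucI_real[OF bump_poly_deriv]) (rule Suc)
qed

text \<open>The factor \<open>n\<close> does not change the support but sharpens the profile:
  exp(-1/(n s)) tends to 1 for every s > 0, so the bumps tend to the indicator of the open
  box.\<close>

definition box_bump :: "'a::euclidean_space \<Rightarrow> 'a \<Rightarrow> real \<Rightarrow> 'a \<Rightarrow> real" where
  "box_bump a b n x = (\<Prod>i\<in>Basis. bump_poly 1 (n * (x \<bullet> i - a \<bullet> i)) * bump_poly 1 (n * (b \<bullet> i - x \<bullet> i)))"

lemma C_k_box_bump: "C_k k (box_bump a b n)"
proof -
  have 1: "C_k k (\<lambda>x. bump_poly 1 (n * (x \<bullet> i - a \<bullet> i)))" for i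
    using C_k_affine[OF bounded_linear_mult_right[THEN bounded_linear_compose, OF bounded_linear_inner_left], OF C_k_bump_poly[of k 1], of n i "- (n * (a \<bullet> i))"]
    by (simp add: algebra_simps)
  have 2: "C_k k (\<lambda>x. bump_poly 1 (n * (b \<bullet> i - x \<bullet> i)))" for i
    using C_k_affine[OF bounded_linear_mult_right[THEN bounded_linear_compose, OF bounded_linear_inner_left], OF C_k_bump_poly[of k 1], of "-n" i "n * (b \<bullet> i)"]
    by (simp add: algebra_simps)
  show ?thesis unfolding box_bump_def[abs_def] by (intro C_k_prod C_k_mult 1 2)
qed

lemma bump_poly_1_bounds: "0 \<le> bump_poly 1 s" "bump_poly 1 s \<le> 1" "bump_poly 1 s \<noteq> 0 \<longleftrightarrow> s > 0"
  by (auto simp: bump_poly_def)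

lemma box_bump_bounds: "0 \<le> box_bump a b n x" "box_bump a b n x \<le> 1"
  unfolding box_bump_def by (auto intro!: prod_nonneg prod_le_1 mult_nonneg_nonneg mult_le_one bump_poly_1_bounds)

lemma box_bump_support: "n > 0 \<Longrightarrow> box_bump a b n x \<noteq> 0 \<longleftrightarrow> x \<in> box a b"
  by (auto simp: box_bump_def bump_poly_1_bounds(3) mem_box zero_less_mult_iff)

lemma box_bump_tendsto:
  assumes "x \<in> box a b"
  shows "(\<lambda>n. box_bump a b (real (Suc n)) x) \<longlonglongrightarrow> 1"
proof -
  have 1: "(\<lambda>n. bump_poly 1 (real (Suc n) * s)) \<longlonglongrightarrow> 1" if "s > 0" for s proof -
    have "(\<lambda>n. (- 1 / s) * (1 / real (Suc n))) \<longlonglongrightarrow> (- 1 / s) * 0"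
      by (intro tendsto_mult tendsto_const lim_1_over_n[THEN LIMSEQ_Suc])
    from tendsto_exp[OF this] show ?thesis using that by (simp add: bump_poly_def zero_less_mult_iff mult.commute)
  qed
  have "(\<lambda>n. box_bump a b (real (Suc n)) x) \<longlonglongrightarrow> (\<Prod>i\<in>(Basis::'a set). 1 * 1)"
    unfolding box_bump_def by (intro tendsto_prod tendsto_mult 1) (use assms in \<open>auto simp: mem_box\<close>)
  then show ?thesis by simp
qed

subsection \<open>Test functions\<close>

lemma GDERIV_grad:
  assumes "\<phi> differentiable at x"
  shows "GDERIV \<phi> x :> grad \<phi> x" and "grad \<phi> x \<bullet> h = frechet_derivative \<phi> (at x) h"
proof -
  define D where "D = (\<Sum>i\<in>Basis. frechet_derivative \<phi> (at x) i *\<^sub>R i)"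
  have 1: "h \<bullet> D = frechet_derivative \<phi> (at x) h" for h
    using frechet_derivative_Basis_sum[OF assms, of h] by (simp add: D_def inner_sum_right mult.commute)
  have 2: "GDERIV \<phi> x :> D" unfolding gderiv_def 1 using assms frechet_derivative_works by blast
  have "D' = D" if "GDERIV \<phi> x :> D'" for D' proof -
    have "(\<lambda>h. h \<bullet> D') = (\<lambda>h. h \<bullet> D)"
      using that 2 has_derivative_unique unfolding gderiv_def by blast
    then show ?thesis by (metis inner_commute vector_eq_ldot)
  qed
  then have "grad \<phi> x = D" unfolding grad_def using 2 by blast
  then show "GDERIV \<phi> x :> grad \<phi> x" "grad \<phi> x \<bullet> h = frechet_derivative \<phi> (at x) h"
    using 1 2 by (auto simp: inner_commute)
qed

lemma grad_eq: "GDERIV \<phi> x :> D \<Longrightarrow> grad \<phi> x = D"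
  using GDERIV_grad(1)[of \<phi> x] has_derivative_unique[of \<phi> _ x]
  unfolding gderiv_def differentiable_def by (metis inner_commute vector_eq_ldot)

definition smooth :: "('a::euclidean_space \<Rightarrow> real) \<Rightarrow> bool" where
  "smooth \<phi> \<longleftrightarrow> (\<forall>k. C_k k \<phi>)"

lemma smooth_intros:
  "smooth f \<Longrightarrow> smooth g \<Longrightarrow> smooth (\<lambda>x. f x + g x)"
  "smooth f \<Longrightarrow> smooth g \<Longrightarrow> smooth (\<lambda>x. f x - g x)"
  "smooth f \<Longrightarrow> smooth g \<Longrightarrow> smooth (\<lambda>x. f x * g x)"
  "smooth (\<lambda>x. c)"
  "(\<And>i. i \<in> I \<Longrightarrow> smooth (F i)) \<Longrightarrow> smooth (\<lambda>x. \<Prod>i\<in>I. F i x)"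
  "smooth (box_bump a b n)" by (auto simp: smooth_def C_k_add C_k_diff C_k_mult C_k_const C_k_prod C_k_box_bump)

lemma smooth_compose: "smooth h \<Longrightarrow> smooth f \<Longrightarrow> smooth (\<lambda>x. h (f x))" for h :: "real \<Rightarrow> real"
  by (auto simp: smooth_def C_k_compose_real)

lemma smooth_affine: "bounded_linear L \<Longrightarrow> smooth \<phi> \<Longrightarrow> smooth (\<lambda>x. \<phi> (L x + d))"
  by (auto simp: smooth_def C_k_affine)

lemma smooth_differentiable: "smooth \<phi> \<Longrightarrow> \<phi> differentiable at x"
  using C_k.simps(2)[of 0 \<phi>] unfolding smooth_def by blast

lemma smooth_continuous: "smooth \<phi> \<Longrightarrow> continuous_on S \<phi>"
  using C_k_continuous[of 0 \<phi>] continuous_on_subset unfolding smooth_def by blast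

lemma smooth_frechet_derivative:
  assumes "smooth \<phi>"
  shows "smooth (\<lambda>x. frechet_derivative \<phi> (at x) h)"
proof -
  have "C_k k (\<lambda>x. frechet_derivative \<phi> (at x) i)" if "i \<in> Basis" for k i
    using assms[unfolded smooth_def, rule_format, of "Suc k"] that by auto
  then have "C_k k (\<lambda>x. \<Sum>i\<in>Basis. (h \<bullet> i) * frechet_derivative \<phi> (at x) i)" for k
    by (intro C_k_sum C_k_cmult)
  then show ?thesis using frechet_derivative_Basis_sum[OF smooth_differentiable[OF assms], of _ h] by (simp add: smooth_def)
qed

lemma smooth_grad_continuous:
  assumes "smooth \<phi>"
  shows "continuous_on S (grad \<phi>)"
proof -
  have "continuous_on S (\<lambda>x. grad \<phi> x \<bullet> i)" for i
    using smooth_continuous[OF smooth_frechet_derivative[OF assms, of i], of S]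
    by (simp add: GDERIV_grad(2)[OF smooth_differentiable[OF assms]])
  then show ?thesis by (subst continuous_on_componentwise) auto
qed

lemma test_functionI:
  assumes "smooth \<phi>" "compact K" "K \<subseteq> S" "\<And>x. x \<notin> K \<Longrightarrow> \<phi> x = 0"
  shows "test_function S \<phi>"
proof -
  have "closure {x. \<phi> x \<noteq> 0} \<subseteq> K" using assms by (intro closure_minimal compact_imp_closed) auto
  moreover from this have "compact (closure {x. \<phi> x \<noteq> 0})"
    using compact_Int_closed[OF assms(2) closed_closure, of "{x. \<phi> x \<noteq> 0}"] by (simp add: Int_absorb1)
  ultimately show ?thesis using assms unfolding test_function_def smooth_def by auto
qed

lemma test_functionE:
  assumes "test_function S \<phi>"
  obtains K where "smooth \<phi>" "compact K" "K \<subseteq> S" "\<And>x. x \<notin> K \<Longrightarrow> \<phi> x = 0"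
    "\<And>x h. x \<notin> K \<Longrightarrow> frechet_derivative \<phi> (at x) h = 0" "\<And>x. x \<notin> K \<Longrightarrow> grad \<phi> x = 0"
proof -
  define K where "K = closure {x. \<phi> x \<noteq> 0}"
  have 1: "smooth \<phi>" "compact K" "K \<subseteq> S" "\<And>x. x \<notin> K \<Longrightarrow> \<phi> x = 0"
    using assms closure_subset[of "{x. \<phi> x \<noteq> 0}"] unfolding test_function_def smooth_def K_def by auto
  have d: "frechet_derivative \<phi> (at x) h = 0" if "x \<notin> K" for x h proof -
    have ev: "eventually (\<lambda>y. \<phi> y = 0) (nhds x)" proof -
      have "eventually (\<lambda>y. y \<in> - K) (nhds x)"
        using that compact_imp_closed[OF 1(2)] by (intro eventually_nhds_in_open) auto
      then show ?thesis by eventually_elim (use 1(4) in auto)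
    qed
    have "(\<phi> has_derivative (\<lambda>h. 0)) (at x)" by (rule has_derivative_transform_eventually[of "\<lambda>_. 0"])
        (use ev that 1(4) in \<open>auto simp: eventually_at_filter elim: eventually_mono\<close>)
    then show ?thesis using frechet_derivative_at by metis
  qed
  moreover have "grad \<phi> x = 0" if "x \<notin> K" for x
    using GDERIV_grad(2)[OF smooth_differentiable[OF 1(1)], of x "grad \<phi> x"] d[OF that] by simp
  ultimately show ?thesis using that 1 by blast
qed

lemma test_function_smooth: "test_function S \<phi> \<Longrightarrow> smooth \<phi>"
  by (auto simp: test_function_def smooth_def)

lemma test_function_mono: "test_function S \<phi> \<Longrightarrow> S \<subseteq> S' \<Longrightarrow> test_function S' \<phi>"
  by (auto simp: test_function_def)

lemma test_function_mult:
  assumes "test_function S \<phi>" "smooth \<psi>"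
  shows "test_function S (\<lambda>x. \<phi> x * \<psi> x)"
proof -
  from assms(1) obtain K where "smooth \<phi>" "compact K" "K \<subseteq> S" "\<And>x. x \<notin> K \<Longrightarrow> \<phi> x = 0"
    by (rule test_functionE) (rule that)
  then show ?thesis by (intro test_functionI[of _ K] smooth_intros assms) auto
qed

lemma test_function_compose:
  assumes "test_function S \<phi>" "smooth h" "h 0 = 0"
  shows "test_function S (\<lambda>x. h (\<phi> x))"
proof -
  from assms(1) obtain K where "smooth \<phi>" "compact K" "K \<subseteq> S" "\<And>x. x \<notin> K \<Longrightarrow> \<phi> x = 0"
    by (rule test_functionE) (rule that)
  then show ?thesis by (intro test_functionI[of _ K] smooth_compose[OF assms(2)]) (auto simp: assms)
qed

lemma test_function_add:
  assumes "test_function S \<phi>" "test_function S \<psi>"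
  shows "test_function S (\<lambda>x. \<phi> x + \<psi> x)"
proof -
  from assms(1) obtain K where "smooth \<phi>" "compact K" "K \<subseteq> S" "\<And>x. x \<notin> K \<Longrightarrow> \<phi> x = 0"
    by (rule test_functionE) (rule that)
  moreover from assms(2) obtain K' where "smooth \<psi>" "compact K'" "K' \<subseteq> S" "\<And>x. x \<notin> K' \<Longrightarrow> \<psi> x = 0"
    by (rule test_functionE) (rule that)
  ultimately show ?thesis by (intro test_functionI[of _ "K \<union> K'"] smooth_intros) auto
qed

lemma test_function_cmult: "test_function S \<phi> \<Longrightarrow> test_function S (\<lambda>x. c * \<phi> x)"
  using test_function_mult[OF _ smooth_intros(4)[of c]] by (simp add: mult.commute)

lemma test_function_zero: "test_function S (\<lambda>x. 0)"
  by (rule test_functionI[of _ "{}"]) (auto intro: smooth_intros)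

lemma test_function_translate:
  assumes "test_function S \<phi>" "\<And>x. x \<in> S \<Longrightarrow> x + a \<in> S'"
  shows "test_function S' (\<lambda>x. \<phi> (x - a))"
proof -
  from assms(1) obtain K where K: "smooth \<phi>" "compact K" "K \<subseteq> S" "\<And>x. x \<notin> K \<Longrightarrow> \<phi> x = 0"
    by (rule test_functionE) (rule that)
  show ?thesis proof (rule test_functionI[of _ "(+) a ` K"])
    show "smooth (\<lambda>x. \<phi> (x - a))" using smooth_affine[OF bounded_linear_ident K(1), of "-a"] by simp
    show "compact ((+) a ` K)" using K(2) by (rule compact_translation)
    show "(+) a ` K \<subseteq> S'" using K(3) assms(2) by (auto simp: add.commute)
    show "\<phi> (x - a) = 0" if "x \<notin> (+) a ` K" for x using that by (intro K(4)) (auto simp: image_iff)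
  qed
qed

lemma test_function_product:
  fixes \<phi> :: "'a::euclidean_space \<Rightarrow> real" and \<rho> :: "'b::euclidean_space \<Rightarrow> real"
  assumes "test_function A \<phi>" "test_function B \<rho>"
  shows "test_function (A \<times> B) (\<lambda>z. \<phi> (fst z) * \<rho> (snd z))"
proof -
  from assms(1) obtain K where K: "smooth \<phi>" "compact K" "K \<subseteq> A" "\<And>x. x \<notin> K \<Longrightarrow> \<phi> x = 0"
    by (rule test_functionE) (rule that)
  from assms(2) obtain K' where K': "smooth \<rho>" "compact K'" "K' \<subseteq> B" "\<And>x. x \<notin> K' \<Longrightarrow> \<rho> x = 0"
    by (rule test_functionE) (rule that)
  have "smooth (\<lambda>z::'a\<times>'b. \<phi> (fst z))" "smooth (\<lambda>z::'a\<times>'b. \<rho> (snd z))"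
    using smooth_affine[OF bounded_linear_fst K(1), of 0] smooth_affine[OF bounded_linear_snd K'(1), of 0] by simp_all
  then show ?thesis
    using K K' by (intro test_functionI[of _ "K \<times> K'"] smooth_intros compact_Times) (auto simp: mem_Times_iff)
qed

lemma test_function_bounded:
  assumes "test_function S \<phi>"
  obtains B where "\<And>x. \<bar>\<phi> x\<bar> \<le> B" "\<And>x. norm (grad \<phi> x) \<le> B"
proof -
  from assms(1) obtain K where K: "smooth \<phi>" "compact K" "\<And>x. x \<notin> K \<Longrightarrow> \<phi> x = 0" "\<And>x. x \<notin> K \<Longrightarrow> grad \<phi> x = 0"
    by (rule test_functionE) (rule that)
  have "bounded (\<phi> ` K)" "bounded (grad \<phi> ` K)"
    by (auto intro!: compact_imp_bounded compact_continuous_image K smooth_continuous smooth_grad_continuous)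
  then obtain B1 B2 where B: "\<And>x. x \<in> K \<Longrightarrow> norm (\<phi> x) \<le> B1" "\<And>x. x \<in> K \<Longrightarrow> norm (grad \<phi> x) \<le> B2"
    by (auto simp: bounded_iff)
  show ?thesis proof
    show "\<bar>\<phi> x\<bar> \<le> max 0 (max B1 B2)" for x using B(1)[of x] K(3)[of x] by (cases "x \<in> K") auto
    show "norm (grad \<phi> x) \<le> max 0 (max B1 B2)" for x using B(2)[of x] K(4)[of x] by (cases "x \<in> K") auto
  qed
qed

lemma smooth_measurable: "smooth \<phi> \<Longrightarrow> \<phi> \<in> borel_measurable borel"
  by (intro borel_measurable_continuous_onI smooth_continuous)

lemma smooth_grad_borel_measurable: "smooth \<phi> \<Longrightarrow> grad \<phi> \<in> borel_measurable borel"
  by (intro borel_measurable_continuous_onI smooth_grad_continuous)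

lemma smooth_lipschitz_test_function:
  assumes "test_function S \<phi>"
  obtains L where "L \<ge> 0" "\<And>x y. \<bar>\<phi> x - \<phi> y\<bar> \<le> L * norm (x - y)"
proof -
  obtain B where B: "\<And>x. \<bar>\<phi> x\<bar> \<le> B" "\<And>x. norm (grad \<phi> x) \<le> B"
    using test_function_bounded[OF assms] by blast
  have "\<bar>\<phi> x - \<phi> y\<bar> \<le> B * norm (x - y)" for x y proof -
    have "norm (\<phi> x - \<phi> y) \<le> B * norm (x - y)"
    proof (rule differentiable_bound[of UNIV \<phi> "\<lambda>x h. h \<bullet> grad \<phi> x"])
      show "(\<phi> has_derivative (\<lambda>h. h \<bullet> grad \<phi> x)) (at x within UNIV)" for x
        using GDERIV_grad(1)[OF smooth_differentiable[OF test_function_smooth[OF assms]]] by (simp add: gderiv_def)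
      show "onorm (\<lambda>h. h \<bullet> grad \<phi> x) \<le> B" for x proof (rule onorm_le)
        show "norm (h \<bullet> grad \<phi> x) \<le> B * norm h" for h
          using Cauchy_Schwarz_ineq2[of h "grad \<phi> x"] mult_right_mono[OF B(2)[of x], of "norm h"] by (simp add: mult.commute)
      qed
    qed auto
    then show ?thesis by simp
  qed
  moreover have "B \<ge> 0" using B(2)[of 0] norm_ge_zero order_trans by blast
  ultimately show ?thesis using that by blast
qed

section \<open>The fundamental lemma of the calculus of variations\<close>

text \<open>The indicator of \<open>U\<close> is a pointwise limit of test functions with values in
  [0, 1]: cover \<open>U\<close> by countably many boxes whose closures lie in \<open>U\<close> and
  take one minus the product of the complements of the bumps. The index \<open>n\<close> controls
  both the number of boxes and their sharpness.\<close>

lemma fundamental_lemma_nonneg_open: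
  fixes w :: "'a::euclidean_space \<Rightarrow> real"
  assumes "open U" "integrable lborel w"
    and test: "\<And>\<phi>. test_function U \<phi> \<Longrightarrow> (\<And>x. 0 \<le> \<phi> x) \<Longrightarrow> 0 \<le> (\<integral>x. w x * \<phi> x \<partial>lborel)"
  shows "0 \<le> (\<integral>x. w x * indicator U x \<partial>lborel)"
proof (cases "U = {}")
  case False
  define F where "F = {B. \<exists>a b. B = box a b \<and> cbox a b \<subseteq> U}"
  obtain F' where F': "F' \<subseteq> F" "countable F'" "\<Union>F' = \<Union>F" using Lindelof[of F] unfolding F_def by blast
  have "\<Union>F = U" proof
    show "\<Union>F \<subseteq> U" unfolding F_def using box_subset_cbox by blast
    show "U \<subseteq> \<Union>F" proof
      fix x assume "x \<in> U"
      then obtain a b where "x \<in> box a b" "cbox a b \<subseteq> U" using open_contains_cbox[OF assms(1), of x] by metis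
      then show "x \<in> \<Union>F" unfolding F_def by blast
    qed
  qed
  with False F' have F'_ne: "F' \<noteq> {}" and F'_U: "\<Union>F' = U" by auto
  have "\<forall>n. \<exists>a b. from_nat_into F' n = box a b \<and> cbox a b \<subseteq> U"
    using from_nat_into[OF F'_ne] F'(1) unfolding F_def by blast
  then obtain a b where ab: "\<And>n. from_nat_into F' n = box (a n) (b n)" "\<And>n. cbox (a n) (b n) \<subseteq> U" by metis
  let ?p = "\<lambda>n x. \<Prod>i<n. 1 - box_bump (a i) (b i) (real (Suc n)) x"
  have cover: "(\<Union>n. box (a n) (b n)) = U" proof -
    have "(\<Union>n. box (a n) (b n)) = \<Union>(range (from_nat_into F'))" using ab(1) by simp
    then show ?thesis using range_from_nat_into[OF F'_ne F'(2)] F'_U by simp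
  qed
  define \<phi> where "\<phi> n x = 1 - ?p n x" for n x
  have smooth_\<phi>: "smooth (\<phi> n)" for n unfolding \<phi>_def[abs_def] by (intro smooth_intros)
  have test_\<phi>: "test_function U (\<phi> n)" for n
  proof (rule test_functionI[OF smooth_\<phi>, of "\<Union>i<n. cbox (a i) (b i)"])
    show "compact (\<Union>i<n. cbox (a i) (b i))" by auto
    show "(\<Union>i<n. cbox (a i) (b i)) \<subseteq> U" using ab(2) by auto
    show "\<phi> n x = 0" if "x \<notin> (\<Union>i<n. cbox (a i) (b i))" for x proof -
      have "box_bump (a i) (b i) (real (Suc n)) x = 0" if "i < n" for i
        using \<open>x \<notin> _\<close> that box_bump_support[of "real (Suc n)" "a i" "b i" x] box_subset_cbox[of "a i" "b i"] by auto
      then show ?thesis by (simp add: \<phi>_def)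
    qed
  qed
  have prod_bounds: "0 \<le> ?p n x"
      "?p n x \<le> 1" for n x using box_bump_bounds by (auto intro!: prod_nonneg prod_le_1)
  have lim: "(\<lambda>n. \<phi> n x) \<longlonglongrightarrow> indicator U x" for x proof (cases "x \<in> U")
    case False
    then have "x \<notin> box (a i) (b i)" for i using cover by auto
    then have "box_bump (a i) (b i) (real (Suc n)) x = 0" for i n using box_bump_support[of "real (Suc n)"] by auto
    then show ?thesis using False by (simp add: \<phi>_def)
  next
    case True
    then obtain j where j: "x \<in> box (a j) (b j)" using cover by auto
    \<comment> \<open>All factors lie in [0, 1], so the one box containing \<open>x\<close> already
      forces the product to 0.\<close>
    have le: "?p n x \<le> 1 - box_bump (a j) (b j) (real (Suc n)) x"
      if "n \<ge> Suc j" for n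
    proof -
      have "?p n x = (1 - box_bump (a j) (b j) (real (Suc n)) x) *
            (\<Prod>i\<in>{..<n} - {j}. 1 - box_bump (a i) (b i) (real (Suc n)) x)" using that by (subst prod.remove[of _ j]) auto
      also have "\<dots> \<le> (1 - box_bump (a j) (b j) (real (Suc n)) x) * 1"
        using box_bump_bounds by (intro mult_left_mono prod_le_1) auto
      finally show ?thesis by simp
    qed
    have "(\<lambda>n. \<Prod>i<n. 1 - box_bump (a i) (b i) (real (Suc n)) x) \<longlonglongrightarrow> 0"
    proof (rule tendsto_sandwich)
      show "\<forall>\<^sub>F n in sequentially. 0 \<le> ?p n x" using prod_bounds by auto
      show "\<forall>\<^sub>F n in sequentially. ?p n x
          \<le> 1 - box_bump (a j) (b j) (real (Suc n)) x" using le eventually_sequentially by blast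
      show "(\<lambda>n. 1 - box_bump (a j) (b j) (real (Suc n)) x) \<longlonglongrightarrow> 0"
        using tendsto_diff[OF tendsto_const[of 1] box_bump_tendsto[OF j]] by simp
    qed simp
    from tendsto_diff[OF tendsto_const[of 1] this] True show ?thesis by (simp add: \<phi>_def)
  qed
  have "(\<lambda>n. \<integral>x. w x * \<phi> n x \<partial>lborel) \<longlonglongrightarrow> (\<integral>x. w x * indicator U x \<partial>lborel)"
  proof (rule integral_dominated_convergence[where w="\<lambda>x. \<bar>w x\<bar>"])
    show "(\<lambda>x. w x * indicator U x) \<in> borel_measurable lborel"
      using assms by (auto intro!: borel_measurable_times borel_measurable_indicator)
    show "(\<lambda>x. w x * \<phi> n x) \<in> borel_measurable lborel" for n
      using assms smooth_measurable[OF smooth_\<phi>] by (auto intro!: borel_measurable_times)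
    show "AE x in lborel. (\<lambda>n. w x * \<phi> n x) \<longlonglongrightarrow> w x * indicator U x"
      by (auto intro!: tendsto_mult lim)
    show "AE x in lborel. norm (w x * \<phi> n x) \<le> \<bar>w x\<bar>" for n
      using prod_bounds[of n] by (auto intro!: AE_I2 mult_left_le simp: \<phi>_def abs_mult abs_le_iff)
    show "integrable lborel (\<lambda>x. \<bar>w x\<bar>)" using assms by auto
  qed
  then show ?thesis by (rule LIMSEQ_le_const) (use test[OF test_\<phi>] prod_bounds in \<open>auto simp: \<phi>_def\<close>)
qed simp

text \<open>By outer regularity the set where \<open>w\<close> is negative is approximated from
  outside by open sets, on each of which the integral is nonnegative by the previous lemma. In the
  limit the integral over the negativity set itself is nonnegative, which forces that set to be
  null.\<close>

lemma fundamental_lemma_nonneg: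
  fixes w :: "'a::euclidean_space \<Rightarrow> real"
  assumes "open S" and int: "integrable lborel w"
    and test: "\<And>\<phi>. test_function S \<phi> \<Longrightarrow> (\<And>x. 0 \<le> \<phi> x) \<Longrightarrow> 0 \<le> (\<integral>x. w x * \<phi> x \<partial>lborel)"
  shows "AE x in lborel. x \<in> S \<longrightarrow> 0 \<le> w x"
proof -
  have [measurable]: "w \<in> borel_measurable borel" using int by auto
  define A where "A = {x\<in>S. w x < 0}"
  have A[measurable]: "A \<in> sets borel" unfolding A_def using assms(1) by measurable
  have "\<exists>T. open T \<and> A \<subseteq> T \<and> emeasure lborel (T - A) < ennreal ((1/2)^n)" for n
    using outer_regular_lborel[OF A, of "(1/2)^n"] by (metis zero_less_divide_1_iff zero_less_numeral zero_less_power)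
  then obtain V where V: "\<And>n. open (V n)" "\<And>n. A \<subseteq> V n" "\<And>n. emeasure lborel (V n - A) < ennreal ((1/2)^n)"
    by metis
  define U where "U n = V n \<inter> S" for n
  have U: "open (U n)" "A \<subseteq> U n" "U n \<subseteq> S" for n
    using V(1)[of n] V(2)[of n] assms(1) by (auto simp: U_def A_def)
  have Um: "emeasure lborel (U n - A) < ennreal ((1/2)^n)" for n
    using V(1,3)[of n] by (intro le_less_trans[OF emeasure_mono V(3)[of n]]) (auto simp: U_def)
  have [measurable]: "U n \<in> sets borel" for n using U(1) by auto
  \<comment> \<open>The excess measures are below 2^-n, hence summable: by Borel-Cantelli almost
    every point leaves the excess sets eventually, which gives pointwise convergence of the
    indicators.\<close>
  have "AE x in lborel. eventually (\<lambda>n. x \<in> space lborel - (U n - A)) sequentially" proof (rule borel_cantelli_AE1)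
    show "emeasure lborel (U n - A) < \<infinity>" for n using Um[of n] by (metis ennreal_less_top infinity_ennreal_def less_trans)
    show "summable (\<lambda>n. measure lborel (U n - A))" proof (rule summable_comparison_test')
      show "summable (\<lambda>n. (1/2::real)^n)" by (simp add: summable_geometric)
      show "norm (measure lborel (U n - A)) \<le> (1/2)^n" if "n \<ge> 0" for n
        using Um[of n] by (simp add: measure_def enn2real_leI)
    qed
  qed measurable
  then have ev: "AE x in lborel. (\<lambda>n. w x * indicator (U n) x) \<longlonglongrightarrow> w x * indicator A x"
  proof eventually_elim
    case (elim x)
    then have "eventually (\<lambda>n. w x * indicator A x = w x * indicator (U n) x) sequentially"
      by eventually_elim (use U(2) in \<open>auto split: split_indicator\<close>)
    then show ?case by (rule Lim_transform_eventually[OF tendsto_const])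
  qed
  have "(\<lambda>n. \<integral>x. w x * indicator (U n) x \<partial>lborel) \<longlonglongrightarrow> (\<integral>x. w x * indicator A x \<partial>lborel)"
    by (rule integral_dominated_convergence[where w="\<lambda>x. \<bar>w x\<bar>"])
      (use ev int in \<open>auto split: split_indicator\<close>)
  moreover have "0 \<le> (\<integral>x. w x * indicator (U n) x \<partial>lborel)" for n
    by (rule fundamental_lemma_nonneg_open[OF U(1) int]) (use test test_function_mono[OF _ U(3)] in blast)
  ultimately have "0 \<le> (\<integral>x. w x * indicator A x \<partial>lborel)" using LIMSEQ_le_const by blast
  moreover have intA: "integrable lborel (\<lambda>x. - (w x * indicator A x))"
    using int by (auto intro!: integrable_real_mult_indicator)
  moreover have nn: "AE x in lborel. 0 \<le> - (w x * indicator A x)" by (auto simp: A_def split: split_indicator)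
  ultimately have "(\<integral>x. - (w x * indicator A x) \<partial>lborel) = 0" using integral_nonneg_AE[OF nn] by simp
  with integral_nonneg_eq_0_iff_AE[OF intA nn] have "AE x in lborel. - (w x * indicator A x) = 0" by simp
  then show ?thesis by eventually_elim (auto simp: A_def not_less split: split_indicator_asm)
qed

lemma fundamental_lemma_zero:
  fixes w :: "'a::euclidean_space \<Rightarrow> real"
  assumes "open S" and int: "integrable lborel w"
    and test: "\<And>\<phi>. test_function S \<phi> \<Longrightarrow> (\<integral>x. w x * \<phi> x \<partial>lborel) = 0"
  shows "AE x in lborel. x \<in> S \<longrightarrow> w x = 0"
proof -
  have "AE x in lborel. x \<in> S \<longrightarrow> 0 \<le> w x" "AE x in lborel. x \<in> S \<longrightarrow> 0 \<le> - w x"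
    by (rule fundamental_lemma_nonneg; use assms in simp)+
  then show ?thesis by eventually_elim auto
qed

section \<open>Borel representatives and Fubini for Lebesgue measure on subsets\<close>

lemma AE_lebesgue_on_iff:
  assumes "S \<in> sets borel"
  shows "(AE x in lebesgue_on S. P x) \<longleftrightarrow> (AE x in lborel. x \<in> S \<longrightarrow> P x)"
  using assms by (simp add: AE_restrict_space_iff AE_completion_iff)

text \<open>Completeness of Lebesgue measure: on the exceptional null set the preimages may be
  arbitrary. It spares separate measurability proofs for chosen representatives such as
  \<open>weak_grad\<close>.\<close>

lemma borel_measurable_lebesgue_on_AE:
  fixes f :: "'a::euclidean_space \<Rightarrow> 'b::euclidean_space"
  assumes S: "S \<in> sets borel" and f': "f' \<in> borel_measurable borel"
    and ae: "AE x in lebesgue_on S. f x = f' x"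
  shows "f \<in> borel_measurable (lebesgue_on S)"
proof -
  obtain N where N: "N \<in> null_sets lebesgue" "{x. \<not> (x \<in> S \<longrightarrow> f x = f' x)} \<subseteq> N"
  proof -
    have "AE x in lebesgue. x \<in> S \<longrightarrow> f x = f' x" using ae S by (simp add: AE_restrict_space_iff)
    then show ?thesis using that unfolding eventually_ae_filter by auto
  qed
  have "{x \<in> S. f x \<in> A} \<in> sets lebesgue" if "A \<in> sets borel" for A proof -
    have 1: "f' -` A \<in> sets borel" using measurable_sets[OF f' that] by simp
    have eq: "{x \<in> S. f x \<in> A} = (S \<inter> f' -` A - N) \<union> ({x \<in> S. f x \<in> A} \<inter> N)" using N(2) by auto
    have "{x \<in> S. f x \<in> A} \<inter> N \<in> sets lebesgue" using null_sets_completion_subset[OF _ N(1)] by blast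
    moreover have "S \<inter> f' -` A - N \<in> sets lebesgue" using 1 S N(1) by (intro sets.Diff sets.Int) auto
    ultimately show ?thesis by (subst eq) (intro sets.Un)
  qed
  moreover have "f -` A \<inter> S = {x \<in> S. f x \<in> A}" for A by auto
  ultimately show ?thesis using S by (intro measurableI) (simp_all add: sets_restrict_space_iff)
qed

text \<open>Product measures and translations are available for Borel functions on the whole space,
  while the data are only Lebesgue measurable on \<open>S\<close>. Passing to a Borel function that
  is 0 off \<open>S\<close> bridges the two settings.\<close>

lemma borel_rep:
  fixes f :: "'a::euclidean_space \<Rightarrow> 'b::euclidean_space"
  assumes f: "f \<in> borel_measurable (lebesgue_on S)" and S: "S \<in> sets borel"
  obtains f' where "f' \<in> borel_measurable borel" "\<And>x. x \<notin> S \<Longrightarrow> f' x = 0"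
    "AE x in lebesgue_on S. f x = f' x"
proof -
  have "(\<lambda>x. (if x \<in> S then f x else 0)) \<in> borel_measurable lebesgue"
    using f S by (intro borel_measurable_if_I) auto
  then have "(\<lambda>x. (if x \<in> S then f x else 0) \<bullet> i) \<in> borel_measurable (completion lborel)" for i
    by (intro borel_measurable_inner) auto
  then have "\<exists>g'. g' \<in> borel_measurable borel \<and> (AE x in lborel. (if x \<in> S then f x else 0) \<bullet> i = g' x)" for i
    using completion_ex_borel_measurable_real[of "\<lambda>x. (if x \<in> S then f x else 0) \<bullet> i" lborel]
    by (simp add: Bex_def)
  then have "\<exists>g'. \<forall>i. g' i \<in> borel_measurable borel \<and> (AE x in lborel. (if x \<in> S then f x else 0) \<bullet> i = g' i x)"
    by (intro choice) auto
  then obtain g' where g'[measurable]: "\<And>i::'b. g' i \<in> borel_measurable borel"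
    and ae: "\<And>i. AE x in lborel. (if x \<in> S then f x else 0) \<bullet> i = g' i x" by blast
  define f' where "f' x = indicator S x *\<^sub>R (\<Sum>i\<in>Basis. g' i x *\<^sub>R i)" for x
  have "AE x in lborel. \<forall>i\<in>Basis. (if x \<in> S then f x else 0) \<bullet> i = g' i x"
    using ae by (intro AE_finite_allI) auto
  then have "AE x in lborel. x \<in> S \<longrightarrow> f x = f' x" proof eventually_elim
    case (elim x)
    then have "x \<in> S \<Longrightarrow> (\<Sum>i\<in>Basis. (f x \<bullet> i) *\<^sub>R i) = (\<Sum>i\<in>Basis. g' i x *\<^sub>R i)"
      by (intro sum.cong) auto
    then show ?case by (simp add: f'_def euclidean_representation)
  qed
  then have "AE x in lebesgue_on S. f x = f' x" using S by (simp add: AE_lebesgue_on_iff)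
  moreover have "f' \<in> borel_measurable borel" unfolding f'_def using S by measurable
  ultimately show ?thesis using that[of f'] by (simp add: f'_def)
qed

lemma borel_rep_integral:
  fixes f :: "'a::euclidean_space \<Rightarrow> 'b::euclidean_space"
  assumes S: "S \<in> sets borel" and f': "f' \<in> borel_measurable borel" "\<And>x. x \<notin> S \<Longrightarrow> f' x = 0"
    and ae: "AE x in lebesgue_on S. f x = f' x"
  shows "integrable (lebesgue_on S) f \<longleftrightarrow> integrable lborel f'"
    and "integral\<^sup>L (lebesgue_on S) f = integral\<^sup>L lborel f'"
proof -
  have fm: "f \<in> borel_measurable (lebesgue_on S)" by (rule borel_measurable_lebesgue_on_AE[OF S f'(1) ae])
  have f'm: "f' \<in> borel_measurable (lebesgue_on S)" using f'(1) by (intro measurable_restrict_space1 measurable_completion) simp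
  have eq: "(\<lambda>x. indicator S x *\<^sub>R f' x) = f'" using f'(2) by (auto split: split_indicator)
  have "integrable (lebesgue_on S) f \<longleftrightarrow> integrable (lebesgue_on S) f'"
    using fm f'm ae by (intro integrable_cong_AE) auto
  also have "\<dots> \<longleftrightarrow> integrable lborel f'"
    using S f'(1) by (simp add: integrable_restrict_space eq integrable_completion)
  finally show "integrable (lebesgue_on S) f \<longleftrightarrow> integrable lborel f'" .
  have "integral\<^sup>L (lebesgue_on S) f = integral\<^sup>L (lebesgue_on S) f'" using fm f'm ae by (intro integral_cong_AE) auto
  also have "\<dots> = integral\<^sup>L lborel f'" using S f'(1) by (simp add: integral_restrict_space eq integral_completion)
  finally show "integral\<^sup>L (lebesgue_on S) f = integral\<^sup>L lborel f'" .
qed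

lemma AE_lborel_pair:
  fixes P :: "'a::euclidean_space \<times> 'b::euclidean_space \<Rightarrow> bool"
  assumes "AE z in lborel. P z"
  shows "AE x in lborel. AE y in lborel. P (x, y)" "AE y in lborel. AE x in lborel. P (x, y)"
proof -
  have 1: "AE z in lborel \<Otimes>\<^sub>M (lborel :: 'b measure). P z" unfolding lborel_prod by (rule assms)
  then show "AE x in lborel. AE y in lborel. P (x, y)" by (rule lborel_pair.AE_pair)
  \<comment> \<open>Exchanging the two almost-everywhere quantifiers needs a measurable exceptional
    set, so it is done for a null superset \<open>N\<close> of the failures of
    \<open>P\<close>.\<close>
  obtain N where N: "N \<in> sets (lborel \<Otimes>\<^sub>M lborel)" "{z. \<not> P z} \<subseteq> N" "emeasure (lborel \<Otimes>\<^sub>M lborel) N = 0"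
    using 1 unfolding eventually_ae_filter by (auto simp: space_pair_measure null_sets_def)
  have "AE z in lborel \<Otimes>\<^sub>M (lborel :: 'b measure). z \<notin> N"
    using N by (intro AE_not_in) (auto simp: null_sets_def)
  from lborel_pair.AE_pair[OF this] have "AE x in lborel. AE y in lborel. (x, y) \<notin> N" .
  moreover have "{x \<in> space (lborel \<Otimes>\<^sub>M (lborel :: 'b measure)). (fst x, snd x) \<notin> N} \<in> sets (lborel \<Otimes>\<^sub>M lborel)"
    using sets.compl_sets[OF N(1)] by (simp add: set_diff_eq)
  ultimately have "AE y in lborel. AE x in lborel. (x, y) \<notin> N"
    using lborel_pair.AE_commute[of "\<lambda>x y. (x, y) \<notin> N"] by simp
  then show "AE y in lborel. AE x in lborel. P (x, y)" proof eventually_elim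
    case (elim y)
    then show ?case by eventually_elim (use N in auto)
  qed
qed

lemma AE_lborel_pairI:
  fixes P :: "'a::euclidean_space \<times> 'b::euclidean_space \<Rightarrow> bool"
  assumes "{z. P z} \<in> sets borel"
  shows "AE x in lborel. AE y in lborel. P (x, y) \<Longrightarrow> AE z in lborel. P z"
    and "AE y in lborel. AE x in lborel. P (x, y) \<Longrightarrow> AE z in lborel. P z"
proof -
  have s: "{z \<in> space (lborel \<Otimes>\<^sub>M lborel). P z} \<in> sets (lborel \<Otimes>\<^sub>M (lborel :: 'b measure))"
    unfolding lborel_prod using assms by simp
  show 1: "AE x in lborel. AE y in lborel. P (x, y) \<Longrightarrow> AE z in lborel. P z"
    using lborel_pair.AE_pair_measure[OF s] unfolding lborel_prod by simp
  have s': "{z \<in> space (lborel \<Otimes>\<^sub>M lborel). P (fst z, snd z)} \<in> sets (lborel \<Otimes>\<^sub>M (lborel :: 'b measure))"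
    using s by simp
  show "AE y in lborel. AE x in lborel. P (x, y) \<Longrightarrow> AE z in lborel. P z"
    using 1 lborel_pair.AE_commute[of "\<lambda>x y. P (x, y)", OF s'] by simp
qed

lemma AE_lebesgue_on_pair:
  fixes P :: "'a::euclidean_space \<times> 'b::euclidean_space \<Rightarrow> bool"
  assumes A: "A \<in> sets borel" and B: "B \<in> sets borel"
    and "AE z in lebesgue_on (A \<times> B). P z"
  shows "AE x in lebesgue_on A. AE y in lebesgue_on B. P (x, y)"
    and "AE y in lebesgue_on B. AE x in lebesgue_on A. P (x, y)"
proof -
  have AB: "A \<times> B \<in> sets borel" using A B by (rule borel_Times)
  have "AE z in lborel. z \<in> A \<times> B \<longrightarrow> P z" using assms(3) by (simp add: AE_lebesgue_on_iff[OF AB])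
  from AE_lborel_pair[OF this] have *: "AE x in lborel. AE y in lborel. (x, y) \<in> A \<times> B \<longrightarrow> P (x, y)"
    "AE y in lborel. AE x in lborel. (x, y) \<in> A \<times> B \<longrightarrow> P (x, y)" by auto
  from *(1) have "AE x in lborel. x \<in> A \<longrightarrow> (AE y in lborel. y \<in> B \<longrightarrow> P (x, y))"
    by eventually_elim auto
  then show "AE x in lebesgue_on A. AE y in lebesgue_on B. P (x, y)"
    by (simp add: AE_lebesgue_on_iff[OF A] AE_lebesgue_on_iff[OF B])
  from *(2) have "AE y in lborel. y \<in> B \<longrightarrow> (AE x in lborel. x \<in> A \<longrightarrow> P (x, y))"
    by eventually_elim auto
  then show "AE y in lebesgue_on B. AE x in lebesgue_on A. P (x, y)"
    by (simp add: AE_lebesgue_on_iff[OF A] AE_lebesgue_on_iff[OF B])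
qed

lemma lebesgue_on_section_measurable:
  fixes f :: "'a::euclidean_space \<times> 'b::euclidean_space \<Rightarrow> 'c::euclidean_space"
  assumes A: "A \<in> sets borel" and B: "B \<in> sets borel"
    and f: "f \<in> borel_measurable (lebesgue_on (A \<times> B))"
  shows "AE y in lebesgue_on B. (\<lambda>x. f (x, y)) \<in> borel_measurable (lebesgue_on A)"
    and "AE x in lebesgue_on A. (\<lambda>y. f (x, y)) \<in> borel_measurable (lebesgue_on B)"
proof -
  obtain f' where f'[measurable]: "f' \<in> borel_measurable borel"
    and ae: "AE z in lebesgue_on (A \<times> B). f z = f' z"
    by (rule borel_rep[OF f borel_Times[OF A B]]) (rule that)
  show "AE y in lebesgue_on B. (\<lambda>x. f (x, y)) \<in> borel_measurable (lebesgue_on A)"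
    using AE_lebesgue_on_pair(2)[OF A B ae] by eventually_elim (rule borel_measurable_lebesgue_on_AE[OF A], auto)
  show "AE x in lebesgue_on A. (\<lambda>y. f (x, y)) \<in> borel_measurable (lebesgue_on B)"
    using AE_lebesgue_on_pair(1)[OF A B ae] by eventually_elim (rule borel_measurable_lebesgue_on_AE[OF B], auto)
qed

text \<open>Lebesgue measure on a product set is the completion of the product measure, so sections
  are measurable only for almost every base point. Everything is transferred to a Borel
  representative on \<open>lborel\<close> and back.\<close>

lemma lebesgue_on_Fubini:
  fixes f :: "'a::euclidean_space \<times> 'b::euclidean_space \<Rightarrow> 'c::euclidean_space"
  assumes A: "A \<in> sets borel" and B: "B \<in> sets borel"
    and f: "integrable (lebesgue_on (A \<times> B)) f"
  shows "AE y in lebesgue_on B. integrable (lebesgue_on A) (\<lambda>x. f (x, y))"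
    and "integrable (lebesgue_on B) (\<lambda>y. \<integral>x. f (x, y) \<partial>lebesgue_on A)"
    and "(\<integral>y. (\<integral>x. f (x, y) \<partial>lebesgue_on A) \<partial>lebesgue_on B) = integral\<^sup>L (lebesgue_on (A \<times> B)) f"
    and "AE x in lebesgue_on A. integrable (lebesgue_on B) (\<lambda>y. f (x, y))"
    and "integrable (lebesgue_on A) (\<lambda>x. \<integral>y. f (x, y) \<partial>lebesgue_on B)"
    and "(\<integral>x. (\<integral>y. f (x, y) \<partial>lebesgue_on B) \<partial>lebesgue_on A) = integral\<^sup>L (lebesgue_on (A \<times> B)) f"
proof -
  have AB: "A \<times> B \<in> sets borel" using A B by (rule borel_Times)
  obtain f' where f'[measurable]: "f' \<in> borel_measurable borel" and f'0: "\<And>z. z \<notin> A \<times> B \<Longrightarrow> f' z = 0"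
    and ae: "AE z in lebesgue_on (A \<times> B). f z = f' z"
    by (rule borel_rep[OF borel_measurable_integrable[OF f] AB]) (rule that)
  note rep = borel_rep_integral[OF AB f' f'0 ae]
  have int: "integrable (lborel \<Otimes>\<^sub>M lborel) (case_prod (curry f'))" using rep f by (simp add: lborel_prod)
  have eq: "integral\<^sup>L (lborel \<Otimes>\<^sub>M lborel) (case_prod (curry f')) = integral\<^sup>L (lebesgue_on (A \<times> B)) f"
    using rep by (simp add: lborel_prod)
  have ae1: "AE y in lebesgue_on B. AE x in lebesgue_on A. f (x, y) = f' (x, y)"
    and ae2: "AE x in lebesgue_on A. AE y in lebesgue_on B. f (x, y) = f' (x, y)"
    using AE_lebesgue_on_pair[OF A B ae] by auto
  have 1: "AE y in lebesgue_on B. integrable (lebesgue_on A) (\<lambda>x. f (x, y)) = integrable lborel (\<lambda>x. f' (x, y))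
      \<and> (\<integral>x. f (x, y) \<partial>lebesgue_on A) = (\<integral>x. f' (x, y) \<partial>lborel)" using ae1
  proof eventually_elim
    case (elim y)
    show ?case using borel_rep_integral[OF A _ _ elim] f'0 by auto
  qed
  have 2: "AE x in lebesgue_on A. integrable (lebesgue_on B) (\<lambda>y. f (x, y)) = integrable lborel (\<lambda>y. f' (x, y))
      \<and> (\<integral>y. f (x, y) \<partial>lebesgue_on B) = (\<integral>y. f' (x, y) \<partial>lborel)" using ae2
  proof eventually_elim
    case (elim x)
    show ?case using borel_rep_integral[OF B _ _ elim] f'0 by auto
  qed
  have i1: "integrable lborel (\<lambda>y. \<integral>x. f' (x, y) \<partial>lborel)"
    using lborel_pair.integrable_snd[OF int] by simp
  have i2: "integrable lborel (\<lambda>x. \<integral>y. f' (x, y) \<partial>lborel)"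
    using lborel_pair.integrable_fst[OF int] by simp
  have z1: "(\<integral>x. f' (x, y) \<partial>lborel) = 0" if "y \<notin> B" for y using f'0 that by simp
  have z2: "(\<integral>y. f' (x, y) \<partial>lborel) = 0" if "x \<notin> A" for x using f'0 that by simp
  have ae1': "AE y in lebesgue_on B. (\<integral>x. f (x, y) \<partial>lebesgue_on A) = (\<integral>x. f' (x, y) \<partial>lborel)"
    using 1 by eventually_elim auto
  have ae2': "AE x in lebesgue_on A. (\<integral>y. f (x, y) \<partial>lebesgue_on B) = (\<integral>y. f' (x, y) \<partial>lborel)"
    using 2 by eventually_elim auto
  have m1: "(\<lambda>y. \<integral>x. f' (x, y) \<partial>lborel) \<in> borel_measurable borel"
    using borel_measurable_integrable[OF i1] by simp
  have m2: "(\<lambda>x. \<integral>y. f' (x, y) \<partial>lborel) \<in> borel_measurable borel"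
    using borel_measurable_integrable[OF i2] by simp
  note r1 = borel_rep_integral[OF B m1 z1 ae1', simplified]
  note r2 = borel_rep_integral[OF A m2 z2 ae2', simplified]
  have "AE y in lborel. y \<in> B \<longrightarrow> integrable lborel (\<lambda>x. f' (x, y))"
    using lborel_pair.AE_integrable_snd[OF int] by eventually_elim simp
  then have "AE y in lebesgue_on B. integrable lborel (\<lambda>x. f' (x, y))" by (simp add: AE_lebesgue_on_iff[OF B])
  with 1 show "AE y in lebesgue_on B. integrable (lebesgue_on A) (\<lambda>x. f (x, y))" by eventually_elim auto
  have "AE x in lborel. x \<in> A \<longrightarrow> integrable lborel (\<lambda>y. f' (x, y))"
    using lborel_pair.AE_integrable_fst[OF int] by eventually_elim simp
  then have "AE x in lebesgue_on A. integrable lborel (\<lambda>y. f' (x, y))" by (simp add: AE_lebesgue_on_iff[OF A])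
  with 2 show "AE x in lebesgue_on A. integrable (lebesgue_on B) (\<lambda>y. f (x, y))" by eventually_elim auto
  show "integrable (lebesgue_on B) (\<lambda>y. \<integral>x. f (x, y) \<partial>lebesgue_on A)" using r1(1) i1 by simp
  show "integrable (lebesgue_on A) (\<lambda>x. \<integral>y. f (x, y) \<partial>lebesgue_on B)" using r2(1) i2 by simp
  show "(\<integral>y. (\<integral>x. f (x, y) \<partial>lebesgue_on A) \<partial>lebesgue_on B) = integral\<^sup>L (lebesgue_on (A \<times> B)) f"
    using r1(2) lborel_pair.integral_snd[OF int] eq by simp
  show "(\<integral>x. (\<integral>y. f (x, y) \<partial>lebesgue_on B) \<partial>lebesgue_on A) = integral\<^sup>L (lebesgue_on (A \<times> B)) f"
    using r2(2) lborel_pair.integral_fst[OF int] eq by simp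
qed

lemma AE_lebesgue_on_fst:
  assumes A: "A \<in> sets borel" and B: "B \<in> sets borel" and ae: "AE x in lebesgue_on A. P x"
  shows "AE z in lebesgue_on (A \<times> B :: ('a::euclidean_space \<times> 'b::euclidean_space) set). P (fst z)"
proof -
  have "AE x in lborel. x \<in> A \<longrightarrow> P x" using ae by (simp add: AE_lebesgue_on_iff[OF A])
  then obtain N where N: "N \<in> sets borel" "{x. \<not> (x \<in> A \<longrightarrow> P x)} \<subseteq> N" "emeasure lborel N = 0"
    unfolding eventually_ae_filter by (auto simp: null_sets_def)
  have "AE x in lborel. x \<notin> N" using N by (intro AE_not_in) (auto simp: null_sets_def)
  then have "AE x in lborel. AE y in lborel. fst (x, y :: 'b) \<notin> N" by eventually_elim simp
  moreover have "{z :: 'a \<times> 'b. fst z \<notin> N} \<in> sets borel" proof -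
    have "{z :: 'a \<times> 'b. fst z \<notin> N} = (- N) \<times> UNIV" by auto
    then show ?thesis using borel_Times[of "-N" "UNIV :: 'b set"] N(1) by (auto simp: Compl_eq_Diff_UNIV)
  qed
  ultimately have "AE z in lborel. fst (z :: 'a \<times> 'b) \<notin> N"
    using AE_lborel_pairI(1)[of "\<lambda>z. fst z \<notin> N"] by blast
  then have "AE z in lborel. z \<in> A \<times> B \<longrightarrow> P (fst z)" by eventually_elim (use N(2) in auto)
  then show ?thesis by (simp add: AE_lebesgue_on_iff[OF borel_Times[OF A B]])
qed

lemma lebesgue_on_measurable_fst:
  fixes f :: "'a::euclidean_space \<Rightarrow> 'c::euclidean_space"
  assumes A: "A \<in> sets borel" and B: "B \<in> sets borel" and f: "f \<in> borel_measurable (lebesgue_on A)"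
  shows "(\<lambda>z::'a \<times> 'b::euclidean_space. f (fst z)) \<in> borel_measurable (lebesgue_on (A \<times> B))"
proof -
  obtain f' where f'[measurable]: "f' \<in> borel_measurable borel" and ae: "AE x in lebesgue_on A. f x = f' x"
    by (rule borel_rep[OF f A]) (rule that)
  show ?thesis by (rule borel_measurable_lebesgue_on_AE[OF borel_Times[OF A B] _ AE_lebesgue_on_fst[OF A B ae]])
      (auto simp flip: borel_prod)
qed

lemma lebesgue_onI:
  "f \<in> borel_measurable borel \<Longrightarrow> f \<in> borel_measurable (lebesgue_on S)"
  by (intro measurable_restrict_space1 measurable_completion) simp

lemma finite_measure_bounded_set:
  assumes "S \<in> sets borel" "bounded S"
  shows "finite_measure (lebesgue_on S)"
  using bounded_set_imp_lmeasurable[OF assms(2)] assms(1) by (intro finite_measure_lebesgue_on) auto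

lemma integrable_bounded_set:
  fixes f :: "'a::euclidean_space \<Rightarrow> 'b::euclidean_space"
  assumes "S \<in> sets borel" "bounded S" "f \<in> borel_measurable (lebesgue_on S)"
    "AE x in lebesgue_on S. norm (f x) \<le> B"
  shows "integrable (lebesgue_on S) f"
proof -
  interpret finite_measure "lebesgue_on S" by (rule finite_measure_bounded_set[OF assms(1,2)])
  show ?thesis using assms integrable_const_bound by blast
qed

lemma integrable_bounded_scaleR:
  fixes f :: "'x \<Rightarrow> 'b::euclidean_space" and h :: "'x \<Rightarrow> real"
  assumes f: "integrable M f" and h: "h \<in> borel_measurable M" "\<And>x. x \<in> space M \<Longrightarrow> \<bar>h x\<bar> \<le> B"
  shows "integrable M (\<lambda>x. h x *\<^sub>R f x)"
proof (rule Bochner_Integration.integrable_bound)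
  show "integrable M (\<lambda>x. B *\<^sub>R f x)" using f by simp
  show "(\<lambda>x. h x *\<^sub>R f x) \<in> borel_measurable M" using f h(1) by auto
  show "AE x in M. norm (h x *\<^sub>R f x) \<le> norm (B *\<^sub>R f x)"
    by (intro AE_I2) (use h(2) in \<open>force intro!: mult_right_mono\<close>)
qed

subsection \<open>Square integrable functions\<close>

text \<open>Stated for an arbitrary measure so that one set of rules serves both
  \<open>\<Omega>\<close> and the space-time cylinder.\<close>

definition L2_fun :: "'x measure \<Rightarrow> ('x \<Rightarrow> 'b::euclidean_space) \<Rightarrow> bool" where
  "L2_fun M f \<longleftrightarrow> f \<in> borel_measurable M \<and> integrable M (\<lambda>x. (norm (f x))^2)"

lemma in_L2_iff: "in_L2 S f \<longleftrightarrow> L2_fun (lebesgue_on S) f"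
  by (simp add: in_L2_def L2_fun_def)

lemma L2_measurable: "L2_fun M f \<Longrightarrow> f \<in> borel_measurable M"
  by (simp add: L2_fun_def)

lemma L2_cong_AE:
  assumes "L2_fun M f" "AE x in M. f x = g x" "g \<in> borel_measurable M"
  shows "L2_fun M g"
proof -
  have [measurable]: "f \<in> borel_measurable M" "g \<in> borel_measurable M" using assms by (auto simp: L2_fun_def)
  have "integrable M (\<lambda>x. (norm (f x))^2) \<longleftrightarrow> integrable M (\<lambda>x. (norm (g x))^2)"
    by (rule integrable_cong_AE) (use assms in auto)
  then show ?thesis using assms by (simp add: L2_fun_def)
qed

lemma L2_bound:
  fixes f :: "'x \<Rightarrow> 'b::euclidean_space"
  assumes "f \<in> borel_measurable M" "integrable M h" "AE x in M. (norm (f x))^2 \<le> h x"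
  shows "L2_fun M f"
  unfolding L2_fun_def
proof
  show "integrable M (\<lambda>x. (norm (f x))^2)" by (rule Bochner_Integration.integrable_bound[OF assms(2)]) (use assms in auto)
qed (use assms in simp)

lemma norm_add_power2_le: "(norm (a + b))^2 \<le> 2 * (norm a)^2 + 2 * (norm (b::'b::real_normed_vector))^2"
proof -
  have "(norm (a + b))^2 \<le> (norm a + norm b)^2" by (intro power_mono norm_triangle_ineq) auto
  also have "\<dots> \<le> 2 * (norm a)^2 + 2 * (norm b)^2" using sum_squares_bound[of "norm a" "norm b"] by (simp add: power2_sum)
  finally show ?thesis .
qed

lemma L2_add:
  assumes "L2_fun M f" "L2_fun M g"
  shows "L2_fun M (\<lambda>x. f x + g x)"
  by (rule L2_bound[where h="\<lambda>x. 2 * (norm (f x))^2 + 2 * (norm (g x))^2"])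
    (use assms norm_add_power2_le in \<open>auto simp: L2_fun_def\<close>)

lemma L2_scaleR: "L2_fun M f \<Longrightarrow> L2_fun M (\<lambda>x. c *\<^sub>R f x)"
  by (auto simp: L2_fun_def power_mult_distrib)

lemma L2_diff: "L2_fun M f \<Longrightarrow> L2_fun M g \<Longrightarrow> L2_fun M (\<lambda>x. f x - g x)"
  using L2_add[of M f "\<lambda>x. (-1) *\<^sub>R g x"] L2_scaleR[of M g "-1"] by simp

lemma L2_norm: "L2_fun M f \<Longrightarrow> L2_fun M (\<lambda>x. norm (f x))"
  by (auto simp: L2_fun_def)

lemma L2_bounded_mult:
  fixes h :: "'x \<Rightarrow> real"
  assumes "L2_fun M f" "h \<in> borel_measurable M" "AE x in M. \<bar>h x\<bar> \<le> B"
  shows "L2_fun M (\<lambda>x. h x *\<^sub>R f x)"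
proof (rule L2_bound[where h="\<lambda>x. B^2 * (norm (f x))^2"])
  show "AE x in M. (norm (h x *\<^sub>R f x))^2 \<le> B^2 * (norm (f x))^2" using assms(3) proof eventually_elim
    case (elim x)
    then have "\<bar>h x\<bar>^2 \<le> B^2" by (intro power_mono) auto
    then show ?case by (simp add: power_mult_distrib mult_right_mono)
  qed
qed (use assms in \<open>auto simp: L2_fun_def\<close>)

lemma L2_inner_bounded:
  fixes f h :: "'x \<Rightarrow> 'b::euclidean_space"
  assumes "L2_fun M f" "h \<in> borel_measurable M" "AE x in M. norm (h x) \<le> B"
  shows "L2_fun M (\<lambda>x. f x \<bullet> h x)"
proof (rule L2_bound[where h="\<lambda>x. B^2 * (norm (f x))^2"])
  show "AE x in M. (norm (f x \<bullet> h x))^2 \<le> B^2 * (norm (f x))^2" using assms(3) proof eventually_elim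
    case (elim x)
    have "norm (f x \<bullet> h x) \<le> B * norm (f x)"
      using Cauchy_Schwarz_ineq2[of "f x" "h x"] mult_left_mono[OF elim, of "norm (f x)"] by (simp add: mult.commute)
    then have "(norm (f x \<bullet> h x))^2 \<le> (B * norm (f x))^2" by (intro power_mono) auto
    then show ?case by (simp add: power_mult_distrib)
  qed
qed (use assms in \<open>auto simp: L2_fun_def\<close>)

lemma L2_bounded:
  assumes "finite_measure M" "f \<in> borel_measurable M" "AE x in M. norm (f x) \<le> B"
  shows "L2_fun M f"
proof -
  interpret finite_measure M by fact
  show ?thesis
    by (rule L2_bound[where h="\<lambda>x. B^2"]) (use assms in \<open>auto elim!: eventually_mono intro!: power_mono\<close>)
qed

lemma L2_inner_integrable:
  fixes f g :: "'x \<Rightarrow> 'b::euclidean_space"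
  assumes "L2_fun M f" "L2_fun M g"
  shows "integrable M (\<lambda>x. f x \<bullet> g x)"
proof (rule Bochner_Integration.integrable_bound)
  show "integrable M (\<lambda>x. (norm (f x))^2 + (norm (g x))^2)" using assms by (auto simp: L2_fun_def)
  have "norm (a \<bullet> b) \<le> norm ((norm a)^2 + (norm b)^2)" for a b :: 'b proof -
    have "\<bar>a \<bullet> b\<bar> \<le> norm a * norm b" by (rule Cauchy_Schwarz_ineq2)
    also have "\<dots> \<le> (norm a)^2 + (norm b)^2" proof -
      have "2 * (norm a * norm b) \<le> (norm a)^2 + (norm b)^2"
        using sum_squares_bound[of "norm a" "norm b"] by (simp add: mult.assoc)
      moreover have "0 \<le> norm a * norm b" by simp
      ultimately show ?thesis by linarith
    qed
    finally show ?thesis by simp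
  qed
  then show "AE x in M. norm (f x \<bullet> g x) \<le> norm ((norm (f x))^2 + (norm (g x))^2)" by auto
qed (use assms in \<open>auto simp: L2_fun_def\<close>)

lemma L2_mult_integrable:
  fixes f g :: "'x \<Rightarrow> real"
  assumes "L2_fun M f" "L2_fun M g"
  shows "integrable M (\<lambda>x. f x * g x)"
  using L2_inner_integrable[OF assms] by (simp add: inner_real_def mult.commute)

lemma L2_integrable:
  assumes "finite_measure M" "L2_fun M f"
  shows "integrable M f"
proof -
  have "integrable M (\<lambda>x. norm (f x) * 1)"
    by (rule L2_mult_integrable[OF L2_norm[OF assms(2)] L2_bounded[OF assms(1), where B=1]]) auto
  then show ?thesis using assms by (subst integrable_norm_iff[symmetric]) (auto simp: L2_fun_def)
qed

text \<open>The integral of the squared norm of \<open>f - t g\<close> is a nonnegative quadratic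
  polynomial in \<open>t\<close>.\<close>

lemma L2_Cauchy_Schwarz:
  fixes f g :: "'x \<Rightarrow> 'b::euclidean_space"
  assumes f: "L2_fun M f" and g: "L2_fun M g"
  shows "(\<integral>x. f x \<bullet> g x \<partial>M)^2 \<le> (\<integral>x. (norm (f x))^2 \<partial>M) * (\<integral>x. (norm (g x))^2 \<partial>M)"
proof -
  define A B C where "A = (\<integral>x. (norm (f x))^2 \<partial>M)" and "B = (\<integral>x. (norm (g x))^2 \<partial>M)"
    and "C = (\<integral>x. f x \<bullet> g x \<partial>M)"
  have q: "0 \<le> A - 2 * t * C + t^2 * B" for t proof -
    have e: "(norm (a - t *\<^sub>R b))^2 = (norm a)^2 - 2 * t * (a \<bullet> b) + t^2 * (norm b)^2" for a b :: 'b
      unfolding power2_norm_eq_inner by (simp add: inner_diff_left inner_diff_right inner_commute power2_eq_square algebra_simps)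
    have "0 \<le> (\<integral>x. (norm (f x - t *\<^sub>R g x))^2 \<partial>M)" by simp
    also have "\<dots> = (\<integral>x. (norm (f x))^2 - 2 * t * (f x \<bullet> g x) + t^2 * (norm (g x))^2 \<partial>M)"
      by (simp only: e)
    also have "\<dots> = A - 2 * t * C + t^2 * B" using f g L2_inner_integrable[OF f g] by (simp add: A_def B_def C_def L2_fun_def)
    finally show ?thesis .
  qed
  have B: "B \<ge> 0" by (simp add: B_def)
  show ?thesis proof (cases "B = 0")
    case True
    have "C = 0" proof (rule ccontr)
      assume "C \<noteq> 0"
      \<comment> \<open>With \<open>B = 0\<close> the polynomial is affine, and this
        \<open>t\<close> gives it the value -1.\<close>
      then show False using q[of "(A + 1) / (2 * C)"] True by simp
    qed
    then show ?thesis using True by (simp add: A_def B_def C_def)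
  next
    case False
    \<comment> \<open>\<open>C / B\<close> is the minimiser of the quadratic polynomial.\<close>
    then have "0 \<le> (A - 2 * (C / B) * C + (C / B)^2 * B) * B" using q[of "C / B"] B by simp
    also have "\<dots> = A * B - C^2" using False by (simp add: power2_eq_square field_simps)
    finally show ?thesis by (simp add: A_def B_def C_def)
  qed
qed

lemma L2_Cauchy_Schwarz_sqrt:
  fixes f g :: "'x \<Rightarrow> 'b::euclidean_space"
  assumes f: "L2_fun M f" and g: "L2_fun M g"
  shows "\<bar>\<integral>x. f x \<bullet> g x \<partial>M\<bar> \<le> sqrt (\<integral>x. (norm (f x))^2 \<partial>M) * sqrt (\<integral>x. (norm (g x))^2 \<partial>M)"
  using real_sqrt_le_mono[OF L2_Cauchy_Schwarz[OF f g]] by (simp add: real_sqrt_mult)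

lemma L2_integral_add_le:
  assumes "L2_fun M f" "L2_fun M g"
  shows "(\<integral>x. (norm (f x + g x))^2 \<partial>M) \<le> 2 * (\<integral>x. (norm (f x))^2 \<partial>M) + 2 * (\<integral>x. (norm (g x))^2 \<partial>M)"
proof -
  have "(\<integral>x. (norm (f x + g x))^2 \<partial>M) \<le> (\<integral>x. 2 * (norm (f x))^2 + 2 * (norm (g x))^2 \<partial>M)"
    using assms L2_add[OF assms] norm_add_power2_le by (intro integral_mono) (auto simp: L2_fun_def)
  also have "\<dots> = 2 * (\<integral>x. (norm (f x))^2 \<partial>M) + 2 * (\<integral>x. (norm (g x))^2 \<partial>M)"
    using assms by (simp add: L2_fun_def)
  finally show ?thesis .
qed

section \<open>Strong convergence in L2\<close>

definition L2_lim :: "'x measure \<Rightarrow> (nat \<Rightarrow> 'x \<Rightarrow> 'b::euclidean_space) \<Rightarrow> ('x \<Rightarrow> 'b) \<Rightarrow> bool" where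
  "L2_lim M F f \<longleftrightarrow> (\<forall>n. L2_fun M (F n)) \<and> L2_fun M f \<and> (\<lambda>n. \<integral>x. (norm (F n x - f x))^2 \<partial>M) \<longlonglongrightarrow> 0"

lemma L2_lim_const: "L2_fun M f \<Longrightarrow> L2_lim M (\<lambda>n. f) f"
  by (simp add: L2_lim_def)

lemma L2_lim_inner:
  fixes f g :: "'x \<Rightarrow> 'b::euclidean_space"
  assumes F: "L2_lim M F f" and G: "L2_lim M G g"
  shows "(\<lambda>n. \<integral>x. F n x \<bullet> G n x \<partial>M) \<longlonglongrightarrow> (\<integral>x. f x \<bullet> g x \<partial>M)"
proof -
  let ?d = "\<lambda>n. (\<integral>x. F n x \<bullet> G n x \<partial>M) - (\<integral>x. f x \<bullet> g x \<partial>M)"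
  define dF dG where "dF n = (\<integral>x. (norm (F n x - f x))^2 \<partial>M)" and "dG n = (\<integral>x. (norm (G n x - g x))^2 \<partial>M)" for n
  have l: "dF \<longlonglongrightarrow> 0" "dG \<longlonglongrightarrow> 0" using F G by (auto simp: L2_lim_def dF_def[abs_def] dG_def[abs_def])
  have L: "L2_fun M (F n)" "L2_fun M f" "L2_fun M (G n)" "L2_fun M g" for n using F G by (auto simp: L2_lim_def)
  define Gb where "Gb n = 2 * dG n + 2 * (\<integral>x. (norm (g x))^2 \<partial>M)" for n
  have Gb: "(\<integral>x. (norm (G n x))^2 \<partial>M) \<le> Gb n" for n
    using L2_integral_add_le[OF L2_diff[OF L(3)[of n] L(4)] L(4)] by (simp add: Gb_def dG_def)
  have Gbl: "Gb \<longlonglongrightarrow> 2 * 0 + 2 * (\<integral>x. (norm (g x))^2 \<partial>M)"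
    unfolding Gb_def[abs_def] by (intro tendsto_intros l)
  have "(\<lambda>n. ?d n) \<longlonglongrightarrow> 0" proof (rule Lim_null_comparison)
    show "(\<lambda>n. sqrt (dF n) * sqrt (Gb n) + sqrt (\<integral>x. (norm (f x))^2 \<partial>M) * sqrt (dG n)) \<longlonglongrightarrow> 0"
      using tendsto_add[OF tendsto_mult[OF tendsto_real_sqrt[OF l(1)] tendsto_real_sqrt[OF Gbl]]
          tendsto_mult[OF tendsto_const tendsto_real_sqrt[OF l(2)]], of "sqrt (\<integral>x. (norm (f x))^2 \<partial>M)"] by simp
    show "\<forall>\<^sub>F n in sequentially. norm (?d n)
        \<le> sqrt (dF n) * sqrt (Gb n) + sqrt (\<integral>x. (norm (f x))^2 \<partial>M) * sqrt (dG n)"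
    proof (intro always_eventually allI)
      fix n
      have "?d n = (\<integral>x. F n x \<bullet> G n x - f x \<bullet> g x \<partial>M)"
        using L by (intro Bochner_Integration.integral_diff[symmetric] L2_inner_integrable)
      also have "\<dots> = (\<integral>x. (F n x - f x) \<bullet> G n x + f x \<bullet> (G n x - g x) \<partial>M)"
        by (simp add: inner_diff_left inner_diff_right)
      also have "\<dots> = (\<integral>x. (F n x - f x) \<bullet> G n x \<partial>M) + (\<integral>x. f x \<bullet> (G n x - g x) \<partial>M)"
        using L by (intro Bochner_Integration.integral_add L2_inner_integrable L2_diff)
      finally have eq: "?d n = \<dots>" .
      have "\<bar>\<integral>x. (F n x - f x) \<bullet> G n x \<partial>M\<bar> \<le> sqrt (dF n) * sqrt (\<integral>x. (norm (G n x))^2 \<partial>M)"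
        unfolding dF_def using L by (intro L2_Cauchy_Schwarz_sqrt L2_diff)
      also have "\<dots> \<le> sqrt (dF n) * sqrt (Gb n)"
        using Gb[of n] by (intro mult_left_mono real_sqrt_le_mono) (auto simp: dF_def)
      finally have 1: "\<bar>\<integral>x. (F n x - f x) \<bullet> G n x \<partial>M\<bar> \<le> sqrt (dF n) * sqrt (Gb n)" .
      have "\<bar>\<integral>x. f x \<bullet> (G n x - g x) \<partial>M\<bar> \<le> sqrt (\<integral>x. (norm (f x))^2 \<partial>M) * sqrt (dG n)"
        unfolding dG_def using L by (intro L2_Cauchy_Schwarz_sqrt L2_diff)
      with 1 show "norm (?d n) \<le> sqrt (dF n) * sqrt (Gb n) + sqrt (\<integral>x. (norm (f x))^2 \<partial>M) * sqrt (dG n)"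
        unfolding eq by (simp add: abs_le_iff)
    qed
  qed
  then show ?thesis using LIM_zero_iff by blast
qed

lemma L2_lim_mult:
  fixes f g :: "'x \<Rightarrow> real"
  assumes "L2_lim M F f" "L2_lim M G g"
  shows "(\<lambda>n. \<integral>x. F n x * G n x \<partial>M) \<longlonglongrightarrow> (\<integral>x. f x * g x \<partial>M)"
  using L2_lim_inner[OF assms] by (simp add: inner_real_def mult.commute)

lemma L2_lim_comparison:
  assumes "\<And>n. F n \<in> borel_measurable M" "L2_fun M f" "\<And>n. integrable M (h n)"
    and "\<And>n. AE x in M. (norm (F n x - f x))^2 \<le> h n x" "(\<lambda>n. \<integral>x. h n x \<partial>M) \<longlonglongrightarrow> 0"
  shows "L2_lim M F f"
proof -
  have D: "L2_fun M (\<lambda>x. F n x - f x)" for n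
    by (rule L2_bound[OF _ assms(3,4)]) (use assms L2_measurable[OF assms(2)] in auto)
  have "L2_fun M (F n)" for n using L2_add[OF D assms(2), of n] by simp
  moreover have "(\<lambda>n. \<integral>x. (norm (F n x - f x))^2 \<partial>M) \<longlonglongrightarrow> 0"
  proof (rule Lim_null_comparison[OF _ assms(5)], intro always_eventually allI)
    fix n
    show "norm (\<integral>x. (norm (F n x - f x))^2 \<partial>M) \<le> integral\<^sup>L M (h n)"
      using D[of n] assms(3,4)[of n] by (auto simp: L2_fun_def intro!: integral_mono_AE)
  qed
  ultimately show ?thesis using assms(2) by (simp add: L2_lim_def)
qed

lemma L2_lim_inner_bounded:
  fixes f :: "'x \<Rightarrow> 'b::euclidean_space"
  assumes F: "L2_lim M F f" and h: "h \<in> borel_measurable M" "AE x in M. norm (h x) \<le> B"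
  shows "L2_lim M (\<lambda>n x. F n x \<bullet> h x) (\<lambda>x. f x \<bullet> h x)"
proof (rule L2_lim_comparison[where h="\<lambda>n x. B^2 * (norm (F n x - f x))^2"])
  have L: "L2_fun M (F n)" "L2_fun M f" for n using F by (auto simp: L2_lim_def)
  note [measurable] = L[THEN L2_measurable] h(1)
  show "(\<lambda>x. F n x \<bullet> h x) \<in> borel_measurable M" for n by measurable
  show "L2_fun M (\<lambda>x. f x \<bullet> h x)" by (rule L2_inner_bounded[OF L(2) h])
  show "integrable M (\<lambda>x. B^2 * (norm (F n x - f x))^2)" for n using L2_diff[OF L(1,2)] by (auto simp: L2_fun_def)
  show "AE x in M. (norm (F n x \<bullet> h x - f x \<bullet> h x))^2 \<le> B^2 * (norm (F n x - f x))^2" for n using h(2)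
  proof eventually_elim
    case (elim x)
    have "norm ((F n x - f x) \<bullet> h x) \<le> B * norm (F n x - f x)"
      using Cauchy_Schwarz_ineq2[of "F n x - f x" "h x"] mult_left_mono[OF elim, of "norm (F n x - f x)"]
      by (simp add: mult.commute)
    then have "(norm ((F n x - f x) \<bullet> h x))^2 \<le> (B * norm (F n x - f x))^2" by (intro power_mono) auto
    then show ?case by (simp add: power_mult_distrib inner_diff_left)
  qed
  show "(\<lambda>n. \<integral>x. B^2 * (norm (F n x - f x))^2 \<partial>M) \<longlonglongrightarrow> 0"
    using tendsto_mult[OF tendsto_const, of "\<lambda>n. \<integral>x. (norm (F n x - f x))^2 \<partial>M" 0 sequentially "B^2"] F
    by (simp add: L2_lim_def)
qed

section \<open>Strongly convergent convex combinations of a bounded sequence\<close>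

text \<open>Convex combinations of the tail from index \<open>n\<close> on that arise by repeated
  halving. The parallelogram law needs midpoints only, and a property passes to the whole hull once
  it is stable under that single operation.\<close>

inductive midhull :: "(nat \<Rightarrow> 'x \<Rightarrow> 'b::real_vector) \<Rightarrow> nat \<Rightarrow> ('x \<Rightarrow> 'b) \<Rightarrow> bool" for f n where
  base: "n \<le> k \<Longrightarrow> midhull f n (f k)"
| mid: "midhull f n g \<Longrightarrow> midhull f n h \<Longrightarrow> midhull f n (\<lambda>x. (1/2) *\<^sub>R (g x + h x))"

lemma midhull_mono: "midhull f n g \<Longrightarrow> m \<le> n \<Longrightarrow> midhull f m g"
  by (induction rule: midhull.induct) (auto intro: midhull.intros)

text \<open>Weighting the squared increments by 2^n against the rate 4^-n keeps their sum
  integrable; hence almost everywhere the increments decay geometrically, the sequence converges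
  pointwise, and Fatou's lemma identifies the limit in L2.\<close>

lemma L2_Cauchy_imp_lim:
  fixes H :: "nat \<Rightarrow> 'x \<Rightarrow> 'b::euclidean_space"
  assumes L: "\<And>n. L2_fun M (H n)"
    and C: "\<And>n k. n \<le> k \<Longrightarrow> (\<integral>x. (norm (H n x - H k x))^2 \<partial>M) \<le> (1/4)^n"
  obtains g where "L2_lim M H g" "AE x in M. (\<lambda>n. H n x) \<longlonglongrightarrow> g x"
proof -
  note [measurable] = L[THEN L2_measurable]
  define D where "D n x = 2^n * (norm (H n x - H (Suc n) x))^2" for n x
  have D_int: "integrable M (D n)" for n using L2_diff[OF L L] unfolding D_def[abs_def] by (auto simp: L2_fun_def)
  have D_nn: "0 \<le> D n x" for n x by (simp add: D_def)
  have "(\<integral>\<^sup>+x. ennreal (D n x) \<partial>M) \<le> ennreal ((1/2)^n)" for n proof -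
    have "(\<integral>\<^sup>+x. ennreal (D n x) \<partial>M) = ennreal (\<integral>x. D n x \<partial>M)"
      by (rule nn_integral_eq_integral[OF D_int]) (simp add: D_nn)
    also have "(\<integral>x. D n x \<partial>M) = 2^n * (\<integral>x. (norm (H n x - H (Suc n) x))^2 \<partial>M)"
      unfolding D_def by simp
    also have "\<dots> \<le> 2^n * (1/4)^n" by (intro mult_left_mono C) auto
    also have "\<dots> = (1/2)^n" by (simp flip: power_mult_distrib)
    finally show ?thesis by (simp add: ennreal_leI)
  qed
  then have "(\<Sum>n. \<integral>\<^sup>+x. ennreal (D n x) \<partial>M) \<le> (\<Sum>n. ennreal ((1/2)^n))"
    by (intro suminf_le) auto
  also have "\<dots> = ennreal (\<Sum>n. (1/2)^n)" by (intro suminf_ennreal2) (auto simp: summable_geometric)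
  finally have "(\<integral>\<^sup>+x. (\<Sum>n. ennreal (D n x)) \<partial>M) < \<infinity>"
    by (subst nn_integral_suminf) (auto simp: D_def intro: le_less_trans)
  then have "AE x in M. (\<Sum>n. ennreal (D n x)) \<noteq> \<infinity>" by (intro nn_integral_PInf_AE) (auto simp: D_def)
  then have conv: "AE x in M. convergent (\<lambda>n. H n x)" proof eventually_elim
    case (elim x)
    then have "summable (\<lambda>n. D n x)" using D_nn by (intro summable_suminf_not_top) auto
    then have "bounded (range (\<lambda>n. D n x))" using summable_LIMSEQ_zero convergent_imp_bounded by blast
    then obtain K where K: "\<And>n. D n x \<le> K" unfolding bounded_iff using D_nn by auto
    have "norm (H (Suc n) x - H n x) \<le> sqrt K * (sqrt (1/2))^n" for n proof -
      have "(norm (H (Suc n) x - H n x))^2 = D n x * (1/2)^n"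
        by (simp add: D_def norm_minus_commute field_simps flip: power_mult_distrib)
      also have "\<dots> \<le> K * (1/2)^n" using K by (intro mult_right_mono) auto
      finally have "norm (H (Suc n) x - H n x) \<le> sqrt (K * (1/2)^n)" by (rule real_le_rsqrt)
      then show ?thesis by (simp only: real_sqrt_mult real_sqrt_power)
    qed
    note bd = this
    have sK: "summable (\<lambda>n. sqrt K * (sqrt (1/2))^n)"
      by (intro summable_mult summable_geometric) (simp add: real_sqrt_divide)
    have "summable (\<lambda>n. H (Suc n) x - H n x)" by (rule summable_comparison_test'[OF sK, of 0]) (rule bd)
    then have "convergent (\<lambda>n. \<Sum>i<n. H (Suc i) x - H i x)" by (simp add: summable_iff_convergent)
    then have "convergent (\<lambda>n. H n x - H 0 x)" by (simp only: sum_lessThan_telescope[of "\<lambda>n. H n x"])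
    then show ?case by (simp add: convergent_diff_const_right_iff)
  qed
  define g where "g x = lim (\<lambda>n. H n x)" for x
  have gm[measurable]: "g \<in> borel_measurable M" unfolding g_def by measurable
  have lim: "AE x in M. (\<lambda>n. H n x) \<longlonglongrightarrow> g x"
    using conv by eventually_elim (simp add: g_def convergent_LIMSEQ_iff)
  \<comment> \<open>Fatou's lemma in the second index of the Cauchy estimate.\<close>
  have nn: "(\<integral>\<^sup>+x. ennreal ((norm (H n x - g x))^2) \<partial>M) \<le> ennreal ((1/4)^n)" for n proof -
    have "(\<integral>\<^sup>+x. ennreal ((norm (H n x - g x))^2) \<partial>M)
        = (\<integral>\<^sup>+x. liminf (\<lambda>k. ennreal ((norm (H n x - H k x))^2)) \<partial>M)"
    proof (rule nn_integral_cong_AE)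
      show "AE x in M. ennreal ((norm (H n x - g x))^2) = liminf (\<lambda>k. ennreal ((norm (H n x - H k x))^2))" using lim
      proof eventually_elim
        case (elim x)
        have "(\<lambda>k. ennreal ((norm (H n x - H k x))^2)) \<longlonglongrightarrow> ennreal ((norm (H n x - g x))^2)"
          by (intro tendsto_ennrealI tendsto_intros elim)
        then show ?case by (rule lim_imp_Liminf[OF sequentially_bot, symmetric])
      qed
    qed
    also have "\<dots> \<le> liminf (\<lambda>k. \<integral>\<^sup>+x. ennreal ((norm (H n x - H k x))^2) \<partial>M)"
      by (rule nn_integral_liminf) measurable
    also have "\<dots> \<le> limsup (\<lambda>k. \<integral>\<^sup>+x. ennreal ((norm (H n x - H k x))^2) \<partial>M)"
      by (rule Liminf_le_Limsup) simp
    also have "\<dots> \<le> ennreal ((1/4)^n)" proof (rule Limsup_bounded)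
      show "\<forall>\<^sub>F k in sequentially. (\<integral>\<^sup>+x. ennreal ((norm (H n x - H k x))^2) \<partial>M) \<le> ennreal ((1/4)^n)"
        using eventually_ge_at_top[of n]
      proof eventually_elim
        case (elim k)
        have "integrable M (\<lambda>x. (norm (H n x - H k x))^2)" using L2_diff[OF L L] by (auto simp: L2_fun_def)
        then show ?case using C[OF elim] by (subst nn_integral_eq_integral) (auto intro: ennreal_leI)
      qed
    qed
    finally show ?thesis .
  qed
  have Lg: "L2_fun M (\<lambda>x. H n x - g x)" for n proof -
    have "(\<integral>\<^sup>+x. ennreal (norm ((norm (H n x - g x))^2)) \<partial>M) < \<infinity>"
      using nn[of n] by (auto intro: le_less_trans)
    then show ?thesis by (auto simp: L2_fun_def integrable_iff_bounded)
  qed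
  have "L2_fun M g" using L2_diff[OF L[of 0] Lg[of 0]] by simp
  moreover have "(\<lambda>n. \<integral>x. (norm (H n x - g x))^2 \<partial>M) \<longlonglongrightarrow> 0"
  proof (rule Lim_null_comparison)
    show "(\<lambda>n. (1/4::real)^n) \<longlonglongrightarrow> 0" by (rule LIMSEQ_realpow_zero) auto
    have "(\<integral>x. (norm (H n x - g x))^2 \<partial>M) \<le> (1/4)^n" for n
      using nn[of n] Lg[of n] by (subst (asm) nn_integral_eq_integral) (auto simp: L2_fun_def)
    then show "\<forall>\<^sub>F n in sequentially. norm (\<integral>x. (norm (H n x - g x))^2 \<partial>M) \<le> (1/4)^n" by auto
  qed
  ultimately show ?thesis using that lim L by (simp add: L2_lim_def)
qed

text \<open>This takes the place of weak compactness. The infimum of the squared norm over the hull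
  of the tail increases with \<open>n\<close> and is bounded by \<open>B\<close>, so it converges.
  Near-minimisers form a Cauchy sequence by the parallelogram law, because the midpoint of two of
  them lies in the hull again and cannot be shorter than the infimum.\<close>

theorem L2_bounded_midhull_lim:
  fixes f :: "nat \<Rightarrow> 'x \<Rightarrow> 'b::euclidean_space"
  assumes L: "\<And>n. L2_fun M (f n)" and bound: "\<And>n. (\<integral>x. (norm (f n x))^2 \<partial>M) \<le> B"
  obtains F g where "\<And>n. midhull f n (F n)" "L2_lim M F g" "AE x in M. (\<lambda>n. F n x) \<longlonglongrightarrow> g x"
proof -
  define q where "q h = (\<integral>x. (norm (h x))^2 \<partial>M)" for h :: "'x \<Rightarrow> 'b"
  define m where "m n = Inf (q ` Collect (midhull f n))" for n
  define \<delta> :: "nat \<Rightarrow> real" where "\<delta> n = 1 / real (Suc n)" for n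
  have \<delta>: "\<delta> n > 0" "n \<le> k \<Longrightarrow> \<delta> k \<le> \<delta> n" "\<delta> \<longlonglongrightarrow> 0" for n k
    using LIMSEQ_Suc[OF lim_1_over_n[where 'a=real]] by (auto simp: \<delta>_def[abs_def] frac_le)
  have LH: "L2_fun M h" if "midhull f n h" for n h using that by induction (auto intro: L L2_scaleR L2_add)
  have bdd: "bdd_below (q ` Collect (midhull f n))" for n by (rule bdd_belowI[of _ 0]) (auto simp: q_def)
  have m_le: "m n \<le> q h" if "midhull f n h" for n h unfolding m_def using that bdd by (intro cInf_lower) auto
  have m_mono: "m n \<le> m k" if "n \<le> k" for n k unfolding m_def proof (rule cInf_superset_mono)
    show "q ` Collect (midhull f k) \<noteq> {}" using midhull.base[of k k f] by blast
    show "bdd_below (q ` Collect (midhull f n))" by (rule bdd)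
    show "q ` Collect (midhull f k) \<subseteq> q ` Collect (midhull f n)" using midhull_mono[OF _ that, of f] by blast
  qed
  have m_bound: "m n \<le> B" for n using m_le[OF midhull.base[of n n f]] bound[of n] by (simp add: q_def)
  have "\<exists>h. midhull f n h \<and> q h < m n + \<delta> n" for n proof -
    have "q ` Collect (midhull f n) \<noteq> {}" using midhull.base[of n n f] by blast
    from cInf_lessD[OF this, of "m n + \<delta> n"] \<delta>(1)[of n] show ?thesis unfolding m_def by auto
  qed
  then obtain H where H: "\<And>n. midhull f n (H n)" "\<And>n. q (H n) < m n + \<delta> n" by metis
  have "incseq m" using m_mono by (auto simp: incseq_def)
  then obtain m' where m': "m \<longlonglongrightarrow> m'" using incseq_convergent[of m B] m_bound by blast
  have m_le': "m n \<le> m'" for n using \<open>incseq m\<close> m' incseq_le by blast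
  \<comment> \<open>This is what the parallelogram law leaves: 2(m n + \<delta> n) + 2(m k +
    \<delta> k) - 4 m n, with \<open>m k\<close> estimated by the limit \<open>m'\<close> and
    \<open>\<delta> k\<close> by \<open>\<delta> n\<close>.\<close>
  define \<epsilon> where "\<epsilon> n = 2 * (m' - m n) + 4 * \<delta> n" for n
  have cauchy: "(\<integral>x. (norm (H n x - H k x))^2 \<partial>M) \<le> \<epsilon> n" if "n \<le> k" for n k proof -
    have hn: "midhull f n (H n)" "midhull f n (H k)" using H(1) midhull_mono that by blast+
    define P where "P x = (1/2::real) *\<^sub>R (H n x + H k x)" for x
    have P: "midhull f n P" unfolding P_def by (rule midhull.mid[OF hn])
    have L': "L2_fun M (H n)" "L2_fun M (H k)" "L2_fun M P" using LH hn P by auto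
    have par: "(norm (a - b))^2 = 2 * (norm a)^2 + 2 * (norm b)^2 - 4 * (norm ((1/2::real) *\<^sub>R (a + b)))^2" for a b :: 'b
      unfolding power2_norm_eq_inner
      by (simp add: inner_diff_left inner_diff_right inner_add_left inner_add_right inner_commute field_simps)
    have "(\<integral>x. (norm (H n x - H k x))^2 \<partial>M)
        = (\<integral>x. 2 * (norm (H n x))^2 + 2 * (norm (H k x))^2 - 4 * (norm (P x))^2 \<partial>M)"
      unfolding P_def by (subst par) simp
    also have "\<dots> = 2 * q (H n) + 2 * q (H k) - 4 * q P" using L' by (simp add: q_def L2_fun_def)
    also have "\<dots> \<le> 2 * (m n + \<delta> n) + 2 * (m k + \<delta> k) - 4 * m n"
      using H(2)[of n] H(2)[of k] m_le[OF P] by (intro diff_mono add_mono mult_left_mono) simp_all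
    also have "\<dots> \<le> \<epsilon> n" proof -
      have "\<delta> k \<le> \<delta> n" using that by (rule \<delta>(2))
      then have "2 * \<delta> k \<le> 2 * \<delta> n" by simp
      moreover have "2 * m k \<le> 2 * m'" using m_le'[of k] by simp
      ultimately show ?thesis unfolding \<epsilon>_def by (simp add: algebra_simps)
    qed
    finally show ?thesis .
  qed
  have "\<epsilon> \<longlonglongrightarrow> 2 * (m' - m') + 4 * 0"
    unfolding \<epsilon>_def[abs_def] by (intro tendsto_intros m' \<delta>(3))
  then have "\<epsilon> \<longlonglongrightarrow> 0" by simp
  then have "\<exists>N>k. \<epsilon> N < (1/4)^j" for j k :: nat proof -
    have "eventually (\<lambda>n. \<epsilon> n < (1/4)^j) sequentially"
      using order_tendstoD(2)[OF \<open>\<epsilon> \<longlonglongrightarrow> 0\<close>] by auto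
    from eventually_conj[OF this eventually_gt_at_top[of k]] show ?thesis using eventually_happens'[OF sequentially_bot] by blast
  qed
  then have "\<exists>N. \<epsilon> N < (1/4)^j" "\<exists>N. \<epsilon> N < (1/4)^(Suc j) \<and> k < N" for j k :: nat by blast+
  \<comment> \<open>A subsequence with tolerances (1/4)^j, the rate at which L2 convergence also
    yields convergence almost everywhere.\<close>
  then have "\<exists>r. \<forall>j. \<epsilon> (r j) < (1/4)^j \<and> r j < r (Suc j)" by (intro dependent_nat_choice)
  then obtain r where r: "\<And>j. \<epsilon> (r j) < (1/4)^j" "\<And>j. r j < r (Suc j)" by blast
  have sr: "strict_mono r" using r(2) by (simp add: strict_mono_Suc_iff)
  have "\<exists>g. L2_lim M (\<lambda>n. H (r n)) g \<and> (AE x in M. (\<lambda>n. H (r n) x) \<longlonglongrightarrow> g x)"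
  proof -
    have *: "(\<integral>x. (norm (H (r n) x - H (r k) x))^2 \<partial>M) \<le> (1/4)^n" if "n \<le> k" for n k
      using cauchy[of "r n" "r k"] r(1)[of n] strict_mono_leD[OF sr that] by linarith
    have "L2_fun M (H (r n))" for n using LH H(1) by blast
    then show ?thesis by (rule L2_Cauchy_imp_lim[of M "\<lambda>n. H (r n)"]) (use * in auto)
  qed
  then obtain g where g: "L2_lim M (\<lambda>n. H (r n)) g" "AE x in M. (\<lambda>n. H (r n) x) \<longlonglongrightarrow> g x" by blast
  have "midhull f n (H (r n))" for n using H(1) midhull_mono seq_suble[OF sr] by blast
  then show ?thesis by (intro that[of "\<lambda>n. H (r n)" g] g)
qed

subsection \<open>Weak derivatives\<close>

lemma lborel_translate:
  fixes f :: "'a::euclidean_space \<Rightarrow> 'b::euclidean_space"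
  assumes "f \<in> borel_measurable borel"
  shows "integrable lborel (\<lambda>z. f (z + c)) \<longleftrightarrow> integrable lborel f"
    and "(\<integral>z. f (z + c) \<partial>lborel) = integral\<^sup>L lborel f"
proof -
  have m: "(\<lambda>z. c + z) \<in> lborel \<rightarrow>\<^sub>M borel" by simp
  have d: "distr lborel borel (\<lambda>z. c + z) = lborel" by (rule lborel_distr_plus)
  show "integrable lborel (\<lambda>z. f (z + c)) \<longleftrightarrow> integrable lborel f"
    using integrable_distr_eq[OF m assms] unfolding d by (simp add: add.commute)
  show "(\<integral>z. f (z + c) \<partial>lborel) = integral\<^sup>L lborel f"
    using integral_distr[OF m assms] unfolding d by (simp add: add.commute)
qed

lemma AE_lborel_translate:
  fixes c :: "'a::euclidean_space"
  assumes "AE x in lborel. P x"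
  shows "AE x in lborel. P (x + c)"
proof -
  obtain N where N: "N \<in> sets borel" "{x. \<not> P x} \<subseteq> N" "emeasure lborel N = 0"
    using assms unfolding eventually_ae_filter by (auto simp: null_sets_def)
  have "AE x in lborel. x \<notin> N" using N by (intro AE_not_in) (auto simp: null_sets_def)
  then have "AE x in distr lborel borel ((+) c). x \<notin> N" unfolding lborel_distr_plus .
  then have "AE x in lborel. c + x \<notin> N" using N(1) by (subst (asm) AE_distr_iff) (auto simp: Collect_neg_eq)
  then show ?thesis by eventually_elim (use N(2) in \<open>auto simp: add.commute\<close>)
qed

lemma integrable_compact_support:
  fixes f :: "'a::euclidean_space \<Rightarrow> 'b::euclidean_space"
  assumes "compact K" "continuous_on UNIV f" "\<And>x. x \<notin> K \<Longrightarrow> f x = 0"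
  shows "integrable lborel f"
proof -
  have "(\<lambda>x. indicator K x *\<^sub>R f x) = f" using assms(3) by (auto split: split_indicator)
  then show ?thesis using borel_integrable_compact[OF assms(1) continuous_on_subset[OF assms(2)]] by simp
qed

lemma smooth_line_derivative:
  assumes "smooth \<phi>"
  shows "((\<lambda>s. \<phi> (z + s *\<^sub>R e)) has_real_derivative frechet_derivative \<phi> (at (z + s *\<^sub>R e)) e) (at s)"
proof -
  have d: "\<phi> differentiable at (z + s *\<^sub>R e)" by (rule smooth_differentiable[OF assms])
  have "((\<lambda>s. z + s *\<^sub>R e) has_derivative (\<lambda>k. k *\<^sub>R e)) (at s)" by (auto intro!: derivative_eq_intros)
  from diff_chain_at[OF this frechet_derivative_works[THEN iffD1, OF d]] show ?thesis
    by (simp add: has_field_derivative_def o_def linear_cmul[OF linear_frechet_derivative[OF d]] mult_commute_abs)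
qed

lemma frechet_derivative_translate:
  assumes "smooth \<phi>"
  shows "frechet_derivative (\<lambda>x. \<phi> (x - a)) (at z) = frechet_derivative \<phi> (at (z - a))"
  using frechet_derivative_at[OF has_derivative_affine[OF bounded_linear_ident smooth_differentiable[OF assms], where x=z and d="-a"]]
  by (simp only: add_uminus_conv_diff)

text \<open>Tested against \<open>\<phi>\<close>, the right-hand side becomes by Fubini an average
  over \<open>s\<close> of the weak derivative paired with the translate of \<open>\<phi>\<close> by
  \<open>s e\<close>. The weak formulation moves the derivative onto \<open>\<phi>\<close>, and
  integrating in \<open>s\<close> gives back an increment of \<open>\<phi>\<close>. The lemma serves
  spatial directions, with the whole space as domain, as well as the time direction, where segments
  must stay in the cylinder.\<close>

lemma translation_lemma:
  fixes u w :: "'a::euclidean_space \<Rightarrow> real"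
  assumes "open S'" and u: "integrable lborel u" and w: "integrable lborel w" and h: "h > 0"
    and weak: "\<And>\<phi>. test_function S \<phi> \<Longrightarrow>
      (\<integral>z. u z * frechet_derivative \<phi> (at z) e \<partial>lborel) = - (\<integral>z. w z * \<phi> z \<partial>lborel)"
    and shift: "\<And>z s. z \<in> S' \<Longrightarrow> s \<in> {0..h} \<Longrightarrow> z + s *\<^sub>R e \<in> S"
  shows "AE z in lborel. z \<in> S' \<longrightarrow>
    u (z + h *\<^sub>R e) - u z = (\<integral>s. indicator {0..h} s * w (z + s *\<^sub>R e) \<partial>lborel)"
proof -
  let ?W = "\<lambda>s z. indicator {0..h} s * w (z + s *\<^sub>R e)"
  have [measurable]: "u \<in> borel_measurable borel" "w \<in> borel_measurable borel"
    using u w borel_measurable_integrable by force+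
  define J where "J z = (\<integral>s. ?W s z \<partial>lborel)" for z
  have W: "integrable (lborel \<Otimes>\<^sub>M lborel) (\<lambda>(s, z). ?W s z)" proof (rule lborel_pair.Fubini_integrable)
    show "(\<lambda>(s, z). ?W s z) \<in> borel_measurable (lborel \<Otimes>\<^sub>M lborel)" by measurable
    have "(\<integral>z. norm (?W s z) \<partial>lborel) = indicator {0..h} s * (\<integral>z. \<bar>w z\<bar> \<partial>lborel)" for s
      using lborel_translate(2)[of "\<lambda>z. \<bar>w z\<bar>" "s *\<^sub>R e"] by (simp add: abs_mult)
    then show "integrable lborel (\<lambda>s. \<integral>z. norm (case (s, z) of (s, z) \<Rightarrow> ?W s z) \<partial>lborel)"
      using h by simp
    show "AE s in lborel. integrable lborel (\<lambda>z. case (s, z) of (s, z) \<Rightarrow> ?W s z)"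
      using w lborel_translate(1)[of w] by auto
  qed
  have J: "integrable lborel J" using lborel_pair.integrable_snd[OF W] by (simp add: J_def[abs_def])
  have uh: "integrable lborel (\<lambda>z. u (z + h *\<^sub>R e))" using u lborel_translate(1)[of u] by simp
  have "AE z in lborel. z \<in> S' \<longrightarrow> u (z + h *\<^sub>R e) - u z - J z = 0"
  proof (rule fundamental_lemma_zero[OF \<open>open S'\<close>])
    show "integrable lborel (\<lambda>z. u (z + h *\<^sub>R e) - u z - J z)" using uh u J by simp
    fix \<phi> :: "'a \<Rightarrow> real" assume \<phi>: "test_function S' \<phi>"
    let ?D = "\<lambda>s z. frechet_derivative \<phi> (at (z - s *\<^sub>R e)) e"
    have sm: "smooth \<phi>" using \<phi> by (rule test_function_smooth)
    have [measurable]: "\<phi> \<in> borel_measurable borel"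
      "(\<lambda>z. frechet_derivative \<phi> (at z) e) \<in> borel_measurable borel"
      by (rule smooth_measurable, use sm smooth_frechet_derivative in blast)+
    obtain B where B: "\<And>x. \<bar>\<phi> x\<bar> \<le> B" "\<And>x. norm (grad \<phi> x) \<le> B"
      by (rule test_function_bounded[OF \<phi>]) (rule that)
    have B0: "B \<ge> 0" using B(1)[of 0] by linarith
    have DB: "\<bar>frechet_derivative \<phi> (at z) e\<bar> \<le> B * norm e" for z proof -
      have "\<bar>grad \<phi> z \<bullet> e\<bar> \<le> norm (grad \<phi> z) * norm e" by (rule Cauchy_Schwarz_ineq2)
      also have "\<dots> \<le> B * norm e" by (intro mult_right_mono B) auto
      finally show ?thesis by (simp add: GDERIV_grad(2)[OF smooth_differentiable[OF sm]])
    qed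
    have mult_int: "integrable lborel (\<lambda>z. f z * \<phi> (z - c))" if "integrable lborel f" for f :: "'a \<Rightarrow> real" and c
      using integrable_bounded_scaleR[OF that, of "\<lambda>z. \<phi> (z - c)" B] B(1) by (simp add: mult.commute)
    have 1: "(\<integral>z. u (z + h *\<^sub>R e) * \<phi> z \<partial>lborel) = (\<integral>z. u z * \<phi> (z - h *\<^sub>R e) \<partial>lborel)"
      using lborel_translate(2)[of "\<lambda>z. u z * \<phi> (z - h *\<^sub>R e)" "h *\<^sub>R e"] by simp
    have int2: "integrable (lborel \<Otimes>\<^sub>M lborel) (\<lambda>(s, z). ?W s z * \<phi> z)"
      using integrable_bounded_scaleR[OF W, of "\<lambda>p. \<phi> (snd p)" B] B(1) by (simp add: case_prod_beta' mult.commute)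
    have int3: "integrable (lborel \<Otimes>\<^sub>M lborel) (\<lambda>(s, z). indicator {0..h} s * (u z * ?D s z))"
    proof (rule Bochner_Integration.integrable_bound)
      have "integrable (lborel \<Otimes>\<^sub>M lborel) (\<lambda>(s::real, z). indicator {0..h} s * u z)"
        using u h by (intro lborel_pair.Fubini_integrable) (auto simp: abs_mult)
      then show "integrable (lborel \<Otimes>\<^sub>M lborel) (\<lambda>p. (B * norm e) * (case p of (s::real, z) \<Rightarrow> indicator {0..h} s * u z))"
        by simp
      have "(\<lambda>p. frechet_derivative \<phi> (at (snd p - fst p *\<^sub>R e)) e) \<in> borel_measurable (lborel \<Otimes>\<^sub>M lborel)"
        by (rule measurable_compose[of "\<lambda>p. snd p - fst p *\<^sub>R e" _ borel]) measurable
      then show "(\<lambda>(s, z). indicator {0..h} s * (u z * ?D s z)) \<in> borel_measurable (lborel \<Otimes>\<^sub>M lborel)"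
        by (simp add: case_prod_beta')
      have "\<bar>i * (a * d)\<bar> \<le> \<bar>B * norm e * (i * a)\<bar>" if "\<bar>d\<bar> \<le> B * norm e" for i a d :: real
      proof -
        have "\<bar>i * a\<bar> * \<bar>d\<bar> \<le> \<bar>i * a\<bar> * (B * norm e)" using that by (intro mult_left_mono) auto
        then show ?thesis using B0 by (simp add: abs_mult mult_ac)
      qed
      then show "AE p in lborel \<Otimes>\<^sub>M lborel. norm (case p of (s, z) \<Rightarrow> indicator {0..h} s * (u z * ?D s z))
          \<le> norm ((B * norm e) * (case p of (s::real, z) \<Rightarrow> indicator {0..h} s * u z))"
        using DB by (auto split: prod.split)
    qed
    \<comment> \<open>The derivative at \<open>z - s e\<close> in direction \<open>e\<close> is
      minus the \<open>s\<close>-derivative of the translate, so only the endpoints 0 and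
      \<open>h\<close> remain.\<close>
    have FTC: "(\<integral>s. indicator {0..h} s * ?D s z \<partial>lborel) = \<phi> z - \<phi> (z - h *\<^sub>R e)" for z proof -
      have "(\<integral>s. indicator {0..h} s *\<^sub>R (?D s z) \<partial>lborel)
          = (- \<phi> (z - h *\<^sub>R e)) - (- \<phi> (z - 0 *\<^sub>R e))"
      proof (rule integral_FTC_atLeastAtMost)
        show "0 \<le> h" using h by simp
        show "continuous_on {0..h} (\<lambda>s. ?D s z)"
          by (rule continuous_on_compose2[OF smooth_continuous[OF smooth_frechet_derivative[OF sm, of e], of UNIV]])
            (auto intro!: continuous_intros)
        fix s
        have l: "linear (frechet_derivative \<phi> (at (z - s *\<^sub>R e)))"
          by (rule linear_frechet_derivative[OF smooth_differentiable[OF sm]])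
        have "((\<lambda>s. - \<phi> (z - s *\<^sub>R e)) has_real_derivative ?D s z) (at s)"
          using DERIV_minus[OF smooth_line_derivative[OF sm, of z "- e" s]] by (simp add: linear_neg[OF l])
        then show "((\<lambda>s. - \<phi> (z - s *\<^sub>R e)) has_vector_derivative ?D s z) (at s within {0..h})"
          by (simp add: has_real_derivative_iff_has_vector_derivative has_vector_derivative_at_within)
      qed
      then show ?thesis by simp
    qed
    have "(\<integral>z. J z * \<phi> z \<partial>lborel) = (\<integral>z. (\<integral>s. ?W s z * \<phi> z \<partial>lborel) \<partial>lborel)"
      unfolding J_def by simp
    also have "\<dots> = (\<integral>s. (\<integral>z. ?W s z * \<phi> z \<partial>lborel) \<partial>lborel)"
      by (rule lborel_pair.Fubini_integral[OF int2])
    also have "\<dots> = (\<integral>s. (\<integral>z. - (indicator {0..h} s * (u z * ?D s z)) \<partial>lborel) \<partial>lborel)"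
    proof (rule Bochner_Integration.integral_cong[OF refl])
      fix s :: real
      show "(\<integral>z. ?W s z * \<phi> z \<partial>lborel)
          = (\<integral>z. - (indicator {0..h} s * (u z * ?D s z)) \<partial>lborel)"
      proof (cases "s \<in> {0..h}")
        case True
        \<comment> \<open>This is where the segment condition \<open>shift\<close> enters: the
          translate of a test function of \<open>S'\<close> is a test function of
          \<open>S\<close>.\<close>
        have "test_function S (\<lambda>z. \<phi> (z - s *\<^sub>R e))"
          by (rule test_function_translate[OF \<phi>]) (use shift True in auto)
        from weak[OF this] have "(\<integral>z. u z * ?D s z \<partial>lborel)
            = - (\<integral>z. w z * \<phi> (z - s *\<^sub>R e) \<partial>lborel)"
          by (simp add: frechet_derivative_translate[OF sm])
        moreover have "(\<integral>z. w (z + s *\<^sub>R e) * \<phi> z \<partial>lborel) = (\<integral>z. w z * \<phi> (z - s *\<^sub>R e) \<partial>lborel)"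
          using lborel_translate(2)[of "\<lambda>z. w z * \<phi> (z - s *\<^sub>R e)" "s *\<^sub>R e"] by simp
        ultimately show ?thesis using True by simp
      qed simp
    qed
    also have "\<dots> = - (\<integral>s. (\<integral>z. indicator {0..h} s * (u z * ?D s z) \<partial>lborel) \<partial>lborel)"
      by simp
    also have "\<dots> = - (\<integral>z. (\<integral>s. indicator {0..h} s * (u z * ?D s z) \<partial>lborel) \<partial>lborel)"
      using lborel_pair.Fubini_integral[OF int3] by simp
    also have "\<dots> = - (\<integral>z. u z * (\<phi> z - \<phi> (z - h *\<^sub>R e)) \<partial>lborel)"
      unfolding FTC[symmetric] by (simp add: mult.left_commute)
    also have "\<dots> = (\<integral>z. u z * \<phi> (z - h *\<^sub>R e) \<partial>lborel) - (\<integral>z. u z * \<phi> z \<partial>lborel)"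
      using mult_int[OF u, of 0] mult_int[OF u, of "h *\<^sub>R e"] by (simp add: right_diff_distrib)
    finally have 2: "(\<integral>z. J z * \<phi> z \<partial>lborel) = \<dots>" .
    show "(\<integral>z. (u (z + h *\<^sub>R e) - u z - J z) * \<phi> z \<partial>lborel) = 0"
      using mult_int[OF u, of 0] mult_int[OF uh, of 0] mult_int[OF J, of 0] 1 2 by (simp add: left_diff_distrib)
  qed
  then show ?thesis by eventually_elim (auto simp: J_def)
qed

text \<open>The difference quotients have integral 0 by translation invariance, and they converge
  dominatedly to the derivative.\<close>

lemma integral_frechet_derivative_test_function:
  fixes p :: "'a::euclidean_space \<Rightarrow> real"
  assumes p: "test_function S p"
  shows "(\<integral>x. frechet_derivative p (at x) h \<partial>lborel) = 0"
proof -
  from p obtain K where K: "smooth p" "compact K" "\<And>x. x \<notin> K \<Longrightarrow> p x = 0"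
    by (rule test_functionE) (rule that)
  obtain L where L: "L \<ge> 0" "\<And>x y. \<bar>p x - p y\<bar> \<le> L * norm (x - y)"
    by (rule smooth_lipschitz_test_function[OF p]) (rule that)
  obtain R where R: "\<And>x. x \<in> K \<Longrightarrow> norm x \<le> R"
    using compact_imp_bounded[OF K(2)] unfolding bounded_iff by blast
  have int_p: "integrable lborel p" by (rule integrable_compact_support[OF K(2) smooth_continuous[OF K(1)] K(3)])
  note [measurable] = smooth_measurable[OF K(1)] smooth_measurable[OF smooth_frechet_derivative[OF K(1), of h]]
  \<comment> \<open>All quotients are bounded by \<open>L * norm h\<close> and vanish off the ball
    of radius \<open>R + norm h\<close>, because the shift has length at most
    \<open>norm h\<close>.\<close>
  define q where "q n x = real (Suc n) * (p (x + (1 / real (Suc n)) *\<^sub>R h) - p x)" for n x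
  have "(\<lambda>n. \<integral>x. q n x \<partial>lborel) \<longlonglongrightarrow> (\<integral>x. frechet_derivative p (at x) h \<partial>lborel)"
  proof (rule integral_dominated_convergence[where w="\<lambda>x. L * norm h * indicator (cball 0 (R + norm h)) x"])
    show "q n \<in> borel_measurable lborel" for n unfolding q_def by measurable
    show "(\<lambda>x. frechet_derivative p (at x) h) \<in> borel_measurable lborel" by measurable
    have "integrable lborel (indicator (cball (0::'a) (R + norm h)) :: _ \<Rightarrow> real)"
      using emeasure_lborel_cball_finite by (intro integrable_real_indicator) auto
    then show "integrable lborel (\<lambda>x::'a. L * norm h * indicator (cball 0 (R + norm h)) x)" by simp
    show "AE x in lborel. (\<lambda>n. q n x) \<longlonglongrightarrow> frechet_derivative p (at x) h" proof (rule AE_I2)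
      fix x
      have "((\<lambda>t. p (x + t *\<^sub>R h)) has_real_derivative frechet_derivative p (at x) h) (at 0)"
        using smooth_line_derivative[OF K(1), of x h 0] by simp
      then have "((\<lambda>t. (p (x + t *\<^sub>R h) - p x) / t) \<longlongrightarrow> frechet_derivative p (at x) h) (at 0)"
        by (simp add: DERIV_def)
      moreover have "filterlim (\<lambda>n. 1 / real (Suc n)) (at 0) sequentially"
        using LIMSEQ_Suc[OF lim_1_over_n[where 'a=real]] by (auto simp: filterlim_at)
      ultimately have "(\<lambda>n. (p (x + (1 / real (Suc n)) *\<^sub>R h) - p x) / (1 / real (Suc n)))
          \<longlonglongrightarrow> frechet_derivative p (at x) h" by (rule filterlim_compose)
      then show "(\<lambda>n. q n x) \<longlonglongrightarrow> frechet_derivative p (at x) h" by (simp add: q_def mult.commute)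
    qed
    show "AE x in lborel. norm (q n x) \<le> L * norm h * indicator (cball 0 (R + norm h)) x" for n proof (rule AE_I2)
      fix x :: 'a
      define y where "y = x + (1 / real (Suc n)) *\<^sub>R h"
      have ny: "norm (y - x) = norm h / real (Suc n)" by (simp add: y_def)
      have "norm h / real (Suc n) \<le> norm h" by (simp add: field_simps)
      with ny have nyh: "norm (y - x) \<le> norm h" by simp
      show "norm (q n x) \<le> L * norm h * indicator (cball 0 (R + norm h)) x" proof (cases "x \<in> cball 0 (R + norm h)")
        case True
        have "\<bar>q n x\<bar> = real (Suc n) * \<bar>p y - p x\<bar>" by (simp add: q_def y_def abs_mult)
        also have "\<dots> \<le> real (Suc n) * (L * norm (y - x))" by (intro mult_left_mono L) auto
        also have "\<dots> = L * norm h" using ny by simp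
        finally show ?thesis using True by simp
      next
        case False
        then have "norm x > R + norm h" by simp
        moreover have "norm x \<le> norm y + norm (y - x)" by (metis norm_minus_commute norm_triangle_sub)
        ultimately have "norm y > R" "norm x > R" using nyh norm_ge_zero[of h] by linarith+
        then have "p y = 0" "p x = 0" using R K(3) by (meson not_le)+
        then show ?thesis using L(1) by (simp add: q_def y_def)
      qed
    qed
  qed
  moreover have "(\<integral>x. q n x \<partial>lborel) = 0" for n proof -
    have "integrable lborel (\<lambda>x. p (x + (1 / real (Suc n)) *\<^sub>R h))" using int_p lborel_translate(1)[of p] by simp
    then show ?thesis unfolding q_def using int_p lborel_translate(2)[of p "(1 / real (Suc n)) *\<^sub>R h"] by simp
  qed
  ultimately show ?thesis using LIMSEQ_unique[of "\<lambda>n. 0" _ 0] by simp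
qed

lemma frechet_derivative_mult:
  assumes "smooth f" "smooth g"
  shows "frechet_derivative (\<lambda>x. f x * g x) (at x) i
      = f x * frechet_derivative g (at x) i + frechet_derivative f (at x) i * g x"
proof -
  have "((\<lambda>x. f x * g x) has_derivative
      (\<lambda>h. f x * frechet_derivative g (at x) h + frechet_derivative f (at x) h * g x)) (at x)"
    using assms[THEN smooth_differentiable, of x] unfolding frechet_derivative_works by (rule has_derivative_mult)
  from fun_cong[OF frechet_derivative_at[OF this], of i] show ?thesis by simp
qed

lemma integral_by_parts_test_function:
  fixes \<phi> \<psi> :: "'a::euclidean_space \<Rightarrow> real"
  assumes \<phi>: "test_function S \<phi>" and \<psi>: "smooth \<psi>"
  shows "(\<integral>x. \<phi> x * frechet_derivative \<psi> (at x) h \<partial>lborel) = - (\<integral>x. \<psi> x * frechet_derivative \<phi> (at x) h \<partial>lborel)"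
proof -
  from \<phi> obtain K where K: "smooth \<phi>" "compact K" "\<And>x. x \<notin> K \<Longrightarrow> \<phi> x = 0"
    "\<And>x h. x \<notin> K \<Longrightarrow> frechet_derivative \<phi> (at x) h = 0" by (rule test_functionE) (rule that)
  note c = smooth_continuous[OF K(1), of UNIV] smooth_continuous[OF \<psi>, of UNIV]
    smooth_continuous[OF smooth_frechet_derivative[OF K(1), of h], of UNIV]
    smooth_continuous[OF smooth_frechet_derivative[OF \<psi>, of h], of UNIV]
  have i1: "integrable lborel (\<lambda>x. \<phi> x * frechet_derivative \<psi> (at x) h)"
    by (rule integrable_compact_support[OF K(2)]) (auto intro!: continuous_intros c simp: K)
  have i2: "integrable lborel (\<lambda>x. frechet_derivative \<phi> (at x) h * \<psi> x)"
    by (rule integrable_compact_support[OF K(2)]) (auto intro!: continuous_intros c simp: K)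
  have "0 = (\<integral>x. frechet_derivative (\<lambda>x. \<phi> x * \<psi> x) (at x) h \<partial>lborel)"
    using integral_frechet_derivative_test_function[OF test_function_mult[OF \<phi> \<psi>]] by simp
  also have "\<dots> = (\<integral>x. \<phi> x * frechet_derivative \<psi> (at x) h \<partial>lborel) + (\<integral>x. frechet_derivative \<phi> (at x) h * \<psi> x \<partial>lborel)"
    using i1 i2 by (simp add: frechet_derivative_mult[OF K(1) \<psi>])
  finally show ?thesis by (simp add: mult.commute)
qed

section \<open>Local integrability and uniqueness of weak derivatives\<close>

lemma lebesgue_on_mono_integrable:
  fixes f :: "'a::euclidean_space \<Rightarrow> 'b::euclidean_space"
  assumes "integrable (lebesgue_on S) f" "K \<subseteq> S" "K \<in> sets lebesgue" "S \<in> sets lebesgue"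
  shows "integrable (lebesgue_on K) f"
proof -
  have "integrable lebesgue (\<lambda>x. indicator S x *\<^sub>R f x)" using assms by (simp add: integrable_restrict_space)
  from integrable_mult_indicator[OF assms(3) this] have "integrable lebesgue (\<lambda>x. indicator K x *\<^sub>R f x)"
    using assms(2) by (rule_tac Bochner_Integration.integrable_cong[THEN iffD1, OF refl]) (auto split: split_indicator)
  then show ?thesis using assms by (simp add: integrable_restrict_space)
qed

lemma integrable_imp_locally_integrable:
  fixes f :: "'a::euclidean_space \<Rightarrow> 'b::euclidean_space"
  assumes "integrable (lebesgue_on S) f" "S \<in> sets lebesgue"
  shows "locally_integrable S f"
  unfolding locally_integrable_def
  using lebesgue_on_mono_integrable[OF assms(1) _ _ assms(2)] by (auto simp: lmeasurable_compact fmeasurableD)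

lemma test_function_locally_integrable:
  fixes G :: "'a::euclidean_space \<Rightarrow> 'b::euclidean_space"
  assumes \<phi>: "test_function S \<phi>" and G: "locally_integrable S G" and S: "open S"
  shows "integrable (lebesgue_on S) (\<lambda>x. \<phi> x *\<^sub>R G x)"
proof -
  from \<phi> obtain K where K: "smooth \<phi>" "compact K" "K \<subseteq> S" "\<And>x. x \<notin> K \<Longrightarrow> \<phi> x = 0"
    by (rule test_functionE) (rule that)
  obtain B where B: "\<And>x. \<bar>\<phi> x\<bar> \<le> B" by (rule test_function_bounded[OF \<phi>]) (rule that)
  have KL: "K \<in> sets lebesgue" using K(2) by (simp add: lmeasurable_compact fmeasurableD)
  have GK: "integrable (lebesgue_on K) G" using G[unfolded locally_integrable_def, rule_format, of K] K by simp
  have "integrable (lebesgue_on K) (\<lambda>x. \<phi> x *\<^sub>R G x)"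
    by (rule integrable_bounded_scaleR[OF GK lebesgue_onI[OF smooth_measurable[OF K(1)]] B])
  then have "integrable lebesgue (\<lambda>x. indicator K x *\<^sub>R (\<phi> x *\<^sub>R G x))"
    using KL by (simp add: integrable_restrict_space)
  moreover have "(\<lambda>x. indicator K x *\<^sub>R (\<phi> x *\<^sub>R G x)) = (\<lambda>x. indicator S x *\<^sub>R (\<phi> x *\<^sub>R G x))"
    by (rule ext) (use K in \<open>auto split: split_indicator\<close>)
  ultimately show ?thesis using S by (simp add: integrable_restrict_space)
qed

text \<open>On a closed box inside \<open>S\<close> the function is integrable, so the integrable
  version applies there; countably many such boxes cover \<open>S\<close>.\<close>

lemma fundamental_lemma_locally_integrable:
  fixes h :: "'a::euclidean_space \<Rightarrow> real"
  assumes S: "open S" and h: "locally_integrable S h"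
    and test: "\<And>\<phi>. test_function S \<phi> \<Longrightarrow> (\<integral>x. \<phi> x * h x \<partial>lebesgue_on S) = 0"
  shows "AE x in lebesgue_on S. h x = 0"
proof -
  have box: "AE x in lborel. x \<in> box a b \<longrightarrow> h x = 0" if ab: "cbox a b \<subseteq> S" for a b proof -
    have hc: "integrable (lebesgue_on (cbox a b)) h" using h[unfolded locally_integrable_def, rule_format, of "cbox a b"] ab by simp
    obtain h' where h': "h' \<in> borel_measurable borel" "\<And>x. x \<notin> cbox a b \<Longrightarrow> h' x = 0"
      "AE x in lebesgue_on (cbox a b). h x = h' x" by (rule borel_rep[OF borel_measurable_integrable[OF hc]]) (simp, rule that)
    have cb: "cbox a b \<in> sets borel" by simp
    have ae: "AE x in lborel. x \<in> cbox a b \<longrightarrow> h x = h' x" using h'(3) by (simp add: AE_lebesgue_on_iff)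
    have int': "integrable lborel h'" using borel_rep_integral(1)[OF cb h'] hc by simp
    have "AE x in lborel. x \<in> box a b \<longrightarrow> h' x = 0" proof (rule fundamental_lemma_zero[OF open_box int'])
      fix \<phi> assume \<phi>: "test_function (box a b) \<phi>"
      have \<phi>S: "test_function S \<phi>" using \<phi> test_function_mono box_subset_cbox ab by blast
      from \<phi> obtain K where K: "smooth \<phi>" "K \<subseteq> box a b" "\<And>x. x \<notin> K \<Longrightarrow> \<phi> x = 0"
        by (rule test_functionE) (rule that)
      then have \<phi>0: "\<phi> x = 0" if "x \<notin> cbox a b" for x using that box_subset_cbox by blast
      have "AE x in lborel. x \<in> S \<longrightarrow> \<phi> x * h x = \<phi> x * h' x"
        using ae by eventually_elim (use \<phi>0 in force)
      then have "AE x in lebesgue_on S. \<phi> x * h x = \<phi> x * h' x" using S by (simp add: AE_lebesgue_on_iff)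
      moreover have "(\<lambda>x. \<phi> x * h' x) \<in> borel_measurable borel" using smooth_measurable[OF K(1)] h'(1) by simp
      ultimately have "(\<integral>x. \<phi> x * h x \<partial>lebesgue_on S) = (\<integral>x. \<phi> x * h' x \<partial>lborel)"
        using S ab \<phi>0 by (intro borel_rep_integral(2)) auto
      then show "(\<integral>x. h' x * \<phi> x \<partial>lborel) = 0" using test[OF \<phi>S] by (simp add: mult.commute)
    qed
    with ae show ?thesis by eventually_elim (use box_subset_cbox in auto)
  qed
  define F where "F = {B. \<exists>a b. B = box a b \<and> cbox a b \<subseteq> S}"
  obtain F' where F': "F' \<subseteq> F" "countable F'" "\<Union>F' = \<Union>F" using Lindelof[of F] unfolding F_def by blast
  have hAE: "AE x in lborel. \<forall>B\<in>F'. x \<in> B \<longrightarrow> h x = 0"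
    using F'(1) box by (subst AE_ball_countable[OF F'(2)]) (auto simp: F_def)
  have cov: "\<exists>B\<in>F'. x \<in> B" if xS: "x \<in> S" for x proof -
    obtain a b where "x \<in> box a b" "cbox a b \<subseteq> S" using open_contains_cbox[OF S xS] by metis
    then have "x \<in> \<Union>F" unfolding F_def by blast
    then show ?thesis using F'(3) by blast
  qed
  from hAE have "AE x in lborel. x \<in> S \<longrightarrow> h x = 0" proof eventually_elim
    case (elim x)
    then show ?case using cov[of x] by blast
  qed
  then show ?thesis using S by (simp add: AE_lebesgue_on_iff)
qed

lemma locally_integrable_diff:
  "locally_integrable S f \<Longrightarrow> locally_integrable S g \<Longrightarrow> locally_integrable S (\<lambda>x. f x - g x)"
  by (auto simp: locally_integrable_def)

text \<open>This makes the arbitrary choice in \<open>weak_grad\<close> harmless: every weak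
  gradient agrees with it almost everywhere.\<close>

lemma has_weak_grad_unique:
  assumes S: "open S" and G: "has_weak_grad S v G" and H: "has_weak_grad S v H"
  shows "AE x in lebesgue_on S. G x = H x"
proof -
  have l: "locally_integrable S (\<lambda>x. G x - H x)" using G H by (intro locally_integrable_diff) (auto simp: has_weak_grad_def)
  have "AE x in lebesgue_on S. (G x - H x) \<bullet> i = 0" for i proof (rule fundamental_lemma_locally_integrable[OF S])
    show "locally_integrable S (\<lambda>x. (G x - H x) \<bullet> i)" using l by (auto simp: locally_integrable_def)
    fix \<phi> assume \<phi>: "test_function S \<phi>"
    have iG: "integrable (lebesgue_on S) (\<lambda>x. \<phi> x *\<^sub>R G x)" and iH: "integrable (lebesgue_on S) (\<lambda>x. \<phi> x *\<^sub>R H x)"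
      using G H by (auto intro!: test_function_locally_integrable[OF \<phi> _ S] simp: has_weak_grad_def)
    have "(\<integral>x. \<phi> x * ((G x - H x) \<bullet> i) \<partial>lebesgue_on S)
        = (\<integral>x. (\<phi> x *\<^sub>R G x - \<phi> x *\<^sub>R H x) \<bullet> i \<partial>lebesgue_on S)"
      by (simp add: inner_diff_left right_diff_distrib)
    also have "\<dots> = ((\<integral>x. \<phi> x *\<^sub>R G x \<partial>lebesgue_on S) - (\<integral>x. \<phi> x *\<^sub>R H x \<partial>lebesgue_on S)) \<bullet> i"
      using iG iH by (subst integral_inner_left) auto
    also have "\<dots> = 0" proof -
      have "- (\<integral>x. \<phi> x *\<^sub>R G x \<partial>lebesgue_on S) = - (\<integral>x. \<phi> x *\<^sub>R H x \<partial>lebesgue_on S)"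
        using G[unfolded has_weak_grad_def, THEN conjunct2, THEN conjunct2, rule_format, OF \<phi>]
          H[unfolded has_weak_grad_def, THEN conjunct2, THEN conjunct2, rule_format, OF \<phi>] by (rule trans[OF sym])
      then show ?thesis by simp
    qed
    finally show "(\<integral>x. \<phi> x * ((G x - H x) \<bullet> i) \<partial>lebesgue_on S) = 0" .
  qed
  then have "AE x in lebesgue_on S. \<forall>i\<in>Basis. (G x - H x) \<bullet> i = 0" by (intro AE_finite_allI) auto
  then show ?thesis by eventually_elim (auto intro: euclidean_eqI simp: inner_diff_left)
qed

lemma has_weak_dt_unique:
  assumes "open \<Omega>" and w: "has_weak_dt \<Omega> T u w" and w': "has_weak_dt \<Omega> T u w'"
  shows "AE z in lebesgue_on (cylinder \<Omega> T). w z = w' z"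
proof -
  have S: "open (cylinder \<Omega> T)" unfolding cylinder_def by (intro open_Times assms) auto
  have "AE z in lebesgue_on (cylinder \<Omega> T). w z - w' z = 0" proof (rule fundamental_lemma_locally_integrable[OF S])
    show "locally_integrable (cylinder \<Omega> T) (\<lambda>z. w z - w' z)"
      using w w' by (intro locally_integrable_diff) (auto simp: has_weak_dt_def)
    fix \<phi> assume \<phi>: "test_function (cylinder \<Omega> T) \<phi>"
    have i: "integrable (lebesgue_on (cylinder \<Omega> T)) (\<lambda>z. \<phi> z * w z)"
      "integrable (lebesgue_on (cylinder \<Omega> T)) (\<lambda>z. \<phi> z * w' z)"
      using w w' test_function_locally_integrable[OF \<phi> _ S, of w] test_function_locally_integrable[OF \<phi> _ S, of w']
      by (simp_all add: has_weak_dt_def)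
    have "- (\<integral>z. w z * \<phi> z \<partial>lebesgue_on (cylinder \<Omega> T)) = - (\<integral>z. w' z * \<phi> z \<partial>lebesgue_on (cylinder \<Omega> T))"
      using w[unfolded has_weak_dt_def, THEN conjunct2, THEN conjunct2, rule_format, OF \<phi>]
        w'[unfolded has_weak_dt_def, THEN conjunct2, THEN conjunct2, rule_format, OF \<phi>] by (rule trans[OF sym])
    then show "(\<integral>z. \<phi> z * (w z - w' z) \<partial>lebesgue_on (cylinder \<Omega> T)) = 0"
      using i by (simp add: right_diff_distrib mult.commute)
  qed
  then show ?thesis by eventually_elim simp
qed

lemma L2_lim_cong_AE:
  assumes "L2_lim M F f" "AE x in M. f x = g x" "g \<in> borel_measurable M"
  shows "L2_lim M F g"
proof -
  have L: "L2_fun M (F n)" "L2_fun M f" for n using assms(1) by (auto simp: L2_lim_def)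
  have Lg: "L2_fun M g" by (rule L2_cong_AE[OF L(2) assms(2,3)])
  note [measurable] = L[THEN L2_measurable] assms(3)
  have "(\<integral>x. (norm (F n x - f x))^2 \<partial>M) = (\<integral>x. (norm (F n x - g x))^2 \<partial>M)" for n
    by (rule integral_cong_AE) (use assms(2) in \<open>auto elim: eventually_mono\<close>)
  then show ?thesis using assms(1) Lg by (simp add: L2_lim_def)
qed

lemma L2_lim_linear:
  assumes F: "L2_lim M F f" and G: "L2_lim M G g"
  shows "L2_lim M (\<lambda>n x. a *\<^sub>R F n x + b *\<^sub>R G n x) (\<lambda>x. a *\<^sub>R f x + b *\<^sub>R g x)"
proof (rule L2_lim_comparison[where h="\<lambda>n x. 2 * (a^2 * (norm (F n x - f x))^2) + 2 * (b^2 * (norm (G n x - g x))^2)"])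
  have L: "L2_fun M (F n)" "L2_fun M f" "L2_fun M (G n)" "L2_fun M g" for n using F G by (auto simp: L2_lim_def)
  note [measurable] = L[THEN L2_measurable]
  show "(\<lambda>x. a *\<^sub>R F n x + b *\<^sub>R G n x) \<in> borel_measurable M" for n by measurable
  show "L2_fun M (\<lambda>x. a *\<^sub>R f x + b *\<^sub>R g x)" using L by (intro L2_add L2_scaleR)
  have i: "integrable M (\<lambda>x. (norm (F n x - f x))^2)" "integrable M (\<lambda>x. (norm (G n x - g x))^2)" for n
    using L2_diff[OF L(1,2)] L2_diff[OF L(3,4)] by (auto simp: L2_fun_def)
  then show "integrable M (\<lambda>x. 2 * (a^2 * (norm (F n x - f x))^2) + 2 * (b^2 * (norm (G n x - g x))^2))" for n by auto
  show "AE x in M. (norm (a *\<^sub>R F n x + b *\<^sub>R G n x - (a *\<^sub>R f x + b *\<^sub>R g x)))^2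
      \<le> 2 * (a^2 * (norm (F n x - f x))^2) + 2 * (b^2 * (norm (G n x - g x))^2)" for n
  proof (rule AE_I2)
    fix x
    have "a *\<^sub>R F n x + b *\<^sub>R G n x - (a *\<^sub>R f x + b *\<^sub>R g x) = a *\<^sub>R (F n x - f x) + b *\<^sub>R (G n x - g x)"
      by (simp add: algebra_simps)
    then show "(norm (a *\<^sub>R F n x + b *\<^sub>R G n x - (a *\<^sub>R f x + b *\<^sub>R g x)))^2
      \<le> 2 * (a^2 * (norm (F n x - f x))^2) + 2 * (b^2 * (norm (G n x - g x))^2)"
      using norm_add_power2_le[of "a *\<^sub>R (F n x - f x)" "b *\<^sub>R (G n x - g x)"] by (simp add: power_mult_distrib)
  qed
  have l: "(\<lambda>n. \<integral>x. (norm (F n x - f x))^2 \<partial>M) \<longlonglongrightarrow> 0" "(\<lambda>n. \<integral>x. (norm (G n x - g x))^2 \<partial>M) \<longlonglongrightarrow> 0"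
    using F G by (auto simp: L2_lim_def)
  have "(\<lambda>n. 2 * (a^2 * (\<integral>x. (norm (F n x - f x))^2 \<partial>M)) + 2 * (b^2 * (\<integral>x. (norm (G n x - g x))^2 \<partial>M)))
      \<longlonglongrightarrow> 2 * (a^2 * 0) + 2 * (b^2 * 0)" by (intro tendsto_intros l)
  then show "(\<lambda>n. \<integral>x. 2 * (a^2 * (norm (F n x - f x))^2) + 2 * (b^2 * (norm (G n x - g x))^2) \<partial>M) \<longlonglongrightarrow> 0"
    using i by simp
qed

lemma lebesgue_on_integral_eq:
  fixes f :: "'a::euclidean_space \<Rightarrow> 'b::euclidean_space"
  assumes "S \<in> sets borel" "f \<in> borel_measurable borel" "\<And>x. x \<notin> S \<Longrightarrow> f x = 0"
  shows "integral\<^sup>L (lebesgue_on S) f = integral\<^sup>L lborel f"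
  using borel_rep_integral(2)[OF assms, of f] by simp

lemma grad_linear:
  assumes "\<phi> differentiable at x" "\<psi> differentiable at x"
  shows "grad (\<lambda>x. a * \<phi> x + b * \<psi> x) x = a *\<^sub>R grad \<phi> x + b *\<^sub>R grad \<psi> x"
proof (rule grad_eq)
  show "GDERIV (\<lambda>x. a * \<phi> x + b * \<psi> x) x :> a *\<^sub>R grad \<phi> x + b *\<^sub>R grad \<psi> x"
    using GDERIV_grad(1)[OF assms(1)] GDERIV_grad(1)[OF assms(2)] unfolding gderiv_def
    by (auto intro!: derivative_eq_intros simp: inner_add_right)
qed

section \<open>Density arguments and the exterior of a Lipschitz domain\<close>

lemma AE_lborel_dense:
  fixes x :: "'a::euclidean_space"
  assumes "AE z in lborel. P z" "\<epsilon> > 0"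
  obtains z where "z \<in> ball x \<epsilon>" "P z"
proof (rule ccontr)
  assume c: "\<not> thesis"
  obtain N where N: "N \<in> sets borel" "{z. \<not> P z} \<subseteq> N" "emeasure lborel N = 0"
    using assms(1) unfolding eventually_ae_filter by (auto simp: null_sets_def)
  have "ball x \<epsilon> \<subseteq> N" using c that N(2) by blast
  then have "emeasure lborel (ball x \<epsilon>) \<le> emeasure lborel N" using N(1) by (intro emeasure_mono) auto
  then have "emeasure lborel (ball x \<epsilon>) = 0" using N(3) by simp
  then show False using assms(2) content_ball_pos[of \<epsilon> x] by (simp add: measure_def)
qed

text \<open>Separability that is inherited by subsets: the approximants belong to \<open>A\<close>
  itself, so they keep every property that defines \<open>A\<close>. Each member gets a code from a
  countable set such that members with a common code are uniformly close, and one member per code is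
  kept. It is the tool for making null sets of times independent of the test function.\<close>

lemma countable_uniform_dense:
  fixes F :: "'i \<Rightarrow> 'a::euclidean_space \<Rightarrow> 'b::euclidean_space"
  assumes S: "compact S" and F: "\<And>i. i \<in> A \<Longrightarrow> continuous_on S (F i)"
  obtains D where "D \<subseteq> A" "countable D"
    "\<And>i \<epsilon>. i \<in> A \<Longrightarrow> \<epsilon> > 0 \<Longrightarrow> \<exists>d\<in>D. \<forall>x\<in>S. norm (F i x - F d x) < \<epsilon>"
proof -
  obtain Y :: "'b set" where Y: "countable Y" "\<And>X. open X \<Longrightarrow> X \<noteq> {} \<Longrightarrow> \<exists>y\<in>Y. y \<in> X"
    by (rule countable_dense_setE) (rule that)
  have "\<exists>xs. set xs \<subseteq> S \<and> S \<subseteq> (\<Union>x\<in>set xs. ball x (1 / real (Suc k)))" for k proof -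
    have "S \<subseteq> (\<Union>x\<in>S. ball x (1 / real (Suc k)))" by force
    then obtain T where "T \<subseteq> S" "finite T" "S \<subseteq> (\<Union>x\<in>T. ball x (1 / real (Suc k)))"
      using compactE_image[OF S, of S "\<lambda>x. ball x (1 / real (Suc k))"] by (metis open_ball)
    moreover obtain xs where "set xs = T" using \<open>finite T\<close> finite_list by blast
    ultimately show ?thesis by blast
  qed
  then obtain xs where xs: "\<And>k. set (xs k) \<subseteq> S" "\<And>k. S \<subseteq> (\<Union>x\<in>set (xs k). ball x (1 / real (Suc k)))"
    by metis
  define e where "e n = 1 / real (Suc n)" for n
  have e: "e n > 0" for n by (simp add: e_def)
  \<comment> \<open>A code consists of a mesh index at which the oscillation is below
    \<open>e n\<close>, and of a list of values from the countable dense set \<open>Y\<close> on the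
    finite net of that mesh. Two members with the same code differ by at most four such
    errors.\<close>
  define R where "R n i c \<longleftrightarrow> (\<forall>x\<in>S. \<forall>y\<in>S. dist x y < 1 / real (Suc (fst c)) \<longrightarrow> norm (F i x - F i y) < e n)
      \<and> length (snd c) = length (xs (fst c))
      \<and> (\<forall>m<length (xs (fst c)). norm (F i (xs (fst c) ! m) - snd c ! m) < e n)" for n i c
  have ex: "\<exists>c\<in>UNIV \<times> lists Y. R n i c" if i: "i \<in> A" for n i proof -
    have "uniformly_continuous_on S (F i)" using F[OF i] S by (rule compact_uniformly_continuous)
    then obtain d where d: "d > 0" "\<And>x y. x \<in> S \<Longrightarrow> y \<in> S \<Longrightarrow> dist x y < d \<Longrightarrow> dist (F i x) (F i y) < e n"
      unfolding uniformly_continuous_on_def using e[of n] by (metis dist_commute)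
    obtain k where k: "1 / real (Suc k) < d" using d(1) nat_approx_posE by (metis inverse_eq_divide)
    have "\<exists>y\<in>Y. norm (F i x - y) < e n" for x using Y(2)[of "ball (F i x) (e n)"] e[of n] by (auto simp: dist_norm)
    then obtain y where y: "\<And>x. y x \<in> Y" "\<And>x. norm (F i x - y x) < e n" by metis
    have "R n i (k, map y (xs k))" unfolding R_def using d(2) k y(2) by (auto simp: dist_norm)
    moreover have "(k, map y (xs k)) \<in> UNIV \<times> lists Y" using y(1) by auto
    ultimately show ?thesis by blast
  qed
  have close: "norm (F i x - F j x) < 4 * e n" if "R n i c" "R n j c" "x \<in> S" for n i j c x proof -
    obtain x0 where x0: "x0 \<in> set (xs (fst c))" "dist x0 x < 1 / real (Suc (fst c))"
      using xs(2)[of "fst c"] \<open>x \<in> S\<close> by auto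
    then obtain m where m: "m < length (xs (fst c))" "xs (fst c) ! m = x0" by (metis in_set_conv_nth)
    have x0S: "x0 \<in> S" using x0(1) xs(1) by blast
    have a: "norm (F i x0 - F i x) < e n" "norm (F j x0 - F j x) < e n" using that x0S x0(2) unfolding R_def by blast+
    have b: "norm (F i x0 - snd c ! m) < e n" "norm (F j x0 - snd c ! m) < e n" using that m unfolding R_def by blast+
    have "F i x - F j x = - (F i x0 - F i x) + (F i x0 - snd c ! m) - (F j x0 - snd c ! m) + (F j x0 - F j x)" by simp
    also have "norm \<dots> \<le> norm (F i x0 - F i x) + norm (F i x0 - snd c ! m) + norm (F j x0 - snd c ! m) + norm (F j x0 - F j x)"
      by (smt (verit) norm_minus_cancel norm_triangle_ineq norm_triangle_ineq4)
    finally show ?thesis using a b by linarith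
  qed
  define pick where "pick n c = (SOME i. i \<in> A \<and> R n i c)" for n c
  define D where "D = (\<lambda>(n, c). pick n c) ` {(n, c). c \<in> UNIV \<times> lists Y \<and> (\<exists>i\<in>A. R n i c)}"
  have pick: "pick n c \<in> A \<and> R n (pick n c) c" if "\<exists>i\<in>A. R n i c" for n c
    unfolding pick_def using someI_ex[of "\<lambda>i. i \<in> A \<and> R n i c"] that by blast
  show ?thesis proof
    show "D \<subseteq> A" unfolding D_def using pick by auto
    have "countable (UNIV \<times> (UNIV \<times> lists Y) :: (nat \<times> nat \<times> 'b list) set)"
      using Y(1) by (intro countable_SIGMA countable_lists) auto
    then show "countable D" unfolding D_def by (intro countable_image) (erule countable_subset[rotated], auto)
    fix i \<epsilon> assume i: "i \<in> A" and \<epsilon>: "\<epsilon> > (0::real)"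
    obtain n where "1 / real (Suc n) < \<epsilon> / 4" using nat_approx_posE[of "\<epsilon> / 4"] \<epsilon> by (auto simp: inverse_eq_divide)
    then have n: "4 * e n < \<epsilon>" by (simp add: e_def)
    obtain c where c: "c \<in> UNIV \<times> lists Y" "R n i c" using ex[OF i] by blast
    have p: "pick n c \<in> A \<and> R n (pick n c) c" using pick i c by blast
    have "pick n c \<in> D" unfolding D_def using c i by blast
    moreover have "\<forall>x\<in>S. norm (F i x - F (pick n c) x) < \<epsilon>" using close[OF c(2)] p n by fastforce
    ultimately show "\<exists>d\<in>D. \<forall>x\<in>S. norm (F i x - F d x) < \<epsilon>" by blast
  qed
qed

text \<open>Moving from \<open>p\<close> against the direction \<open>e\<close> leads below the
  Lipschitz graph by a definite amount, so a whole ball there misses \<open>\<Omega>\<close>. Its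
  use: a continuous function that vanishes almost everywhere outside \<open>\<Omega>\<close>
  vanishes at every point outside \<open>\<Omega>\<close>.\<close>

lemma lipschitz_boundary_exterior:
  fixes \<Omega> :: "'a::euclidean_space set"
  assumes "lipschitz_boundary \<Omega>" "open \<Omega>" "p \<notin> \<Omega>" "\<epsilon> > 0"
  obtains q \<delta> where "\<delta> > 0" "ball q \<delta> \<subseteq> ball p \<epsilon>" "ball q \<delta> \<inter> \<Omega> = {}"
proof (cases "p \<in> closure \<Omega>")
  case False
  then obtain \<delta> where "\<delta> > 0" "ball p \<delta> \<subseteq> - closure \<Omega>"
    using open_contains_ball[of "- closure \<Omega>"] by auto
  then show ?thesis using that[of "min \<delta> \<epsilon>" p] closure_subset[of \<Omega>] assms(4) by fastforce
next
  case True
  then have "p \<in> frontier \<Omega>" using assms by (simp add: frontier_def interior_open)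
  then obtain r e \<gamma> L where r: "r > 0" and e: "norm e = 1"
    and \<gamma>: "L-lipschitz_on {y. y \<bullet> e = 0} (\<gamma> :: 'a \<Rightarrow> real)"
    and \<Omega>: "\<Omega> \<inter> ball p r = {x \<in> ball p r. \<gamma> (x - (x \<bullet> e) *\<^sub>R e) < x \<bullet> e}"
    using assms(1) unfolding lipschitz_boundary_def by blast
  have L: "L \<ge> 0" using \<gamma> lipschitz_on_nonneg by blast
  have ee: "e \<bullet> e = 1" using e by (simp add: norm_eq_1)
  define s where "s = min \<epsilon> r / 2"
  have s: "s > 0" "2 * s \<le> \<epsilon>" "2 * s \<le> r" using assms(4) r by (auto simp: s_def)
  define q where "q = p - s *\<^sub>R e"
  \<comment> \<open>Within distance \<delta> of \<open>q\<close> the graph drops by at most 2 L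
    \<delta>, the 2 coming from the projection along \<open>e\<close>, and the height changes by at
    most \<delta>; together this is less than the shift \<open>s\<close>.\<close>
  define \<delta> where "\<delta> = s / (2 * L + 2)"
  have \<delta>: "\<delta> > 0" using s L by (simp add: \<delta>_def)
  have \<delta>s: "(2 * L + 1) * \<delta> < s" "\<delta> \<le> s" proof -
    have "(2 * L + 2) * \<delta> = s" using L by (simp add: \<delta>_def)
    then show "(2 * L + 1) * \<delta> < s" using \<delta> by (simp add: algebra_simps)
    have "1 * \<delta> \<le> (2 * L + 2) * \<delta>" using L \<delta> by (intro mult_right_mono) auto
    then show "\<delta> \<le> s" using \<open>(2 * L + 2) * \<delta> = s\<close> by simp
  qed
  have q: "q - (q \<bullet> e) *\<^sub>R e = p - (p \<bullet> e) *\<^sub>R e" "q \<bullet> e = p \<bullet> e - s"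
    by (auto simp: q_def inner_diff_left ee algebra_simps)
  have pg: "p \<bullet> e \<le> \<gamma> (p - (p \<bullet> e) *\<^sub>R e)"
    using \<Omega> assms(3) r by (metis (mono_tags, lifting) IntE centre_in_ball mem_Collect_eq not_le)
  have "x \<in> ball p \<epsilon> \<and> x \<notin> \<Omega>" if x: "x \<in> ball q \<delta>" for x proof -
    have "dist p q = s" using s e by (simp add: q_def dist_norm)
    then have pd: "dist p x < 2 * s" using dist_triangle[of p x q] x \<delta>s by simp
    have xq: "norm (x - q) < \<delta>" using x by (simp add: dist_norm norm_minus_commute)
    have xe: "\<bar>(x - q) \<bullet> e\<bar> \<le> norm (x - q)" using Cauchy_Schwarz_ineq2[of "x - q" e] e by simp
    have "x - (x \<bullet> e) *\<^sub>R e - (q - (q \<bullet> e) *\<^sub>R e) = (x - q) - ((x - q) \<bullet> e) *\<^sub>R e"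
      by (simp add: algebra_simps inner_diff_left)
    also have "norm \<dots> \<le> norm (x - q) + norm (((x - q) \<bullet> e) *\<^sub>R e)" by (rule norm_triangle_ineq4)
    also have "\<dots> \<le> 2 * norm (x - q)" using xe e by simp
    finally have n: "norm (x - (x \<bullet> e) *\<^sub>R e - (q - (q \<bullet> e) *\<^sub>R e)) \<le> 2 * norm (x - q)" .
    have "\<bar>\<gamma> (x - (x \<bullet> e) *\<^sub>R e) - \<gamma> (q - (q \<bullet> e) *\<^sub>R e)\<bar> \<le> L * norm (x - (x \<bullet> e) *\<^sub>R e - (q - (q \<bullet> e) *\<^sub>R e))"
      using lipschitz_onD[OF \<gamma>, of "x - (x \<bullet> e) *\<^sub>R e" "q - (q \<bullet> e) *\<^sub>R e"]
      by (simp add: dist_norm inner_diff_left ee)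
    also have "\<dots> \<le> L * (2 * norm (x - q))" using n L by (intro mult_left_mono)
    finally have "\<gamma> (x - (x \<bullet> e) *\<^sub>R e) \<ge> \<gamma> (q - (q \<bullet> e) *\<^sub>R e) - 2 * L * norm (x - q)" by simp
    then have "\<gamma> (x - (x \<bullet> e) *\<^sub>R e) - x \<bullet> e \<ge> s - 2 * L * norm (x - q) - norm (x - q)"
      using pg q xe by (simp add: inner_diff_left abs_le_iff)
    moreover have "s - 2 * L * norm (x - q) - norm (x - q) > 0" proof -
      have "(2 * L + 1) * norm (x - q) \<le> (2 * L + 1) * \<delta>" using xq L by (intro mult_left_mono) auto
      then show ?thesis using \<delta>s(1) by (simp add: algebra_simps)
    qed
    ultimately have "\<not> \<gamma> (x - (x \<bullet> e) *\<^sub>R e) < x \<bullet> e" by linarith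
    moreover have "x \<in> ball p r" using pd s by simp
    ultimately have "x \<notin> \<Omega>" using \<Omega> by blast
    then show ?thesis using pd s by simp
  qed
  then show ?thesis using that[OF \<delta>, of q] by blast
qed

subsection \<open>Sobolev functions vanishing on the boundary\<close>

locale bounded_domain =
  fixes \<Omega> :: "'a::euclidean_space set"
  assumes open_dom: "open \<Omega>" and bounded_dom: "bounded \<Omega>"
begin

abbreviation "NN \<equiv> lebesgue_on \<Omega>"

lemma dom_sets [simp]: "\<Omega> \<in> sets borel" "\<Omega> \<in> sets lebesgue"
  using open_dom by auto

lemma dom_finite: "finite_measure NN"
  by (rule finite_measure_bounded_set[OF dom_sets(1) bounded_dom])

lemma test_function_L2:
  assumes "test_function S \<phi>"
  shows "L2_fun NN \<phi>" "L2_fun NN (grad \<phi>)"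
proof -
  have sm: "smooth \<phi>" by (rule test_function_smooth[OF assms])
  obtain B where B: "\<And>x. \<bar>\<phi> x\<bar> \<le> B" "\<And>x. norm (grad \<phi> x) \<le> B"
    by (rule test_function_bounded[OF assms]) (rule that)
  show "L2_fun NN \<phi>" using B by (intro L2_bounded[where B=B] dom_finite lebesgue_onI smooth_measurable sm) auto
  show "L2_fun NN (grad \<phi>)"
    using B by (intro L2_bounded[where B=B] dom_finite lebesgue_onI smooth_grad_borel_measurable sm) auto
qed

text \<open>The closure in L2 of the graph of the gradient on test functions. Carrying the gradient
  explicitly avoids the chosen representative \<open>weak_grad\<close> and makes linearity and
  closedness immediate.\<close>

definition H10_grad :: "('a \<Rightarrow> real) \<Rightarrow> ('a \<Rightarrow> 'a) \<Rightarrow> bool" where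
  "H10_grad v G \<longleftrightarrow> (\<exists>\<phi>. (\<forall>n. test_function \<Omega> (\<phi> n)) \<and> L2_lim NN \<phi> v
     \<and> L2_lim NN (\<lambda>n. grad (\<phi> n)) G)"

lemma H10_grad_L2:
  assumes "H10_grad v G"
  shows "L2_fun NN v" "L2_fun NN G"
  using assms by (auto simp: H10_grad_def L2_lim_def)

lemma H10_grad_cong_AE:
  assumes "H10_grad v G" "AE x in NN. v x = v' x" "v' \<in> borel_measurable NN"
    "AE x in NN. G x = G' x" "G' \<in> borel_measurable NN"
  shows "H10_grad v' G'"
proof -
  obtain \<phi> where \<phi>: "\<forall>n. test_function \<Omega> (\<phi> n)" "L2_lim NN \<phi> v"
    "L2_lim NN (\<lambda>n. grad (\<phi> n)) G" using assms(1) unfolding H10_grad_def by blast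
  show ?thesis unfolding H10_grad_def
    using L2_lim_cong_AE[OF \<phi>(2) assms(2,3)] L2_lim_cong_AE[OF \<phi>(3) assms(4,5)] \<phi>(1) by blast
qed

lemma H10_grad_test_function: "test_function \<Omega> \<phi> \<Longrightarrow> H10_grad \<phi> (grad \<phi>)"
  unfolding H10_grad_def by (intro exI[of _ "\<lambda>n. \<phi>"]) (auto intro!: L2_lim_const test_function_L2)

lemma H10_grad_linear:
  assumes "H10_grad v G" "H10_grad v' G'"
  shows "H10_grad (\<lambda>x. a * v x + b * v' x) (\<lambda>x. a *\<^sub>R G x + b *\<^sub>R G' x)"
proof -
  obtain \<phi> where \<phi>: "\<And>n. test_function \<Omega> (\<phi> n)" "L2_lim NN \<phi> v"
    "L2_lim NN (\<lambda>n. grad (\<phi> n)) G" using assms(1) unfolding H10_grad_def by blast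
  obtain \<psi> where \<psi>: "\<And>n. test_function \<Omega> (\<psi> n)" "L2_lim NN \<psi> v'"
    "L2_lim NN (\<lambda>n. grad (\<psi> n)) G'" using assms(2) unfolding H10_grad_def by blast
  have "grad (\<lambda>x. a * \<phi> n x + b * \<psi> n x) = (\<lambda>x. a *\<^sub>R grad (\<phi> n) x + b *\<^sub>R grad (\<psi> n) x)" for n
    by (rule ext, rule grad_linear) (rule smooth_differentiable[OF test_function_smooth], rule \<phi>(1) \<psi>(1))+
  then show ?thesis unfolding H10_grad_def
    using L2_lim_linear[OF \<phi>(2) \<psi>(2), of a b] L2_lim_linear[OF \<phi>(3) \<psi>(3), of a b] \<phi>(1) \<psi>(1)
    by (intro exI[of _ "\<lambda>n x. a * \<phi> n x + b * \<psi> n x"]) (auto intro!: test_function_add test_function_cmult)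
qed

text \<open>A diagonal argument: an approximating pair is itself approximated by a test
  function.\<close>

lemma H10_grad_closed:
  assumes v: "L2_fun NN v" and G: "L2_fun NN G"
    and approx: "\<And>\<epsilon>. \<epsilon> > 0 \<Longrightarrow> \<exists>v' G'. H10_grad v' G' \<and>
      (\<integral>x. (norm (v' x - v x))^2 \<partial>NN) < \<epsilon> \<and> (\<integral>x. (norm (G' x - G x))^2 \<partial>NN) < \<epsilon>"
  shows "H10_grad v G"
proof -
  have "\<exists>\<phi>. test_function \<Omega> \<phi> \<and> (\<integral>x. (norm (\<phi> x - v x))^2 \<partial>NN) < 1 / real (Suc n) \<and>
      (\<integral>x. (norm (grad \<phi> x - G x))^2 \<partial>NN) < 1 / real (Suc n)" for n
  proof -
    \<comment> \<open>The quarter absorbs the two factors 2 in the estimate of the squared norm of a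
      sum, applied to two errors below \<open>e\<close>.\<close>
    define e where "e = 1 / real (Suc n) / 4"
    have e: "e > 0" by (simp add: e_def)
    obtain v' G' where vG: "H10_grad v' G'" "(\<integral>x. (norm (v' x - v x))^2 \<partial>NN) < e"
      "(\<integral>x. (norm (G' x - G x))^2 \<partial>NN) < e" using approx[OF e] by blast
    then obtain \<phi> where \<phi>: "\<And>n. test_function \<Omega> (\<phi> n)" "L2_lim NN \<phi> v'" "L2_lim NN (\<lambda>n. grad (\<phi> n)) G'"
      unfolding H10_grad_def by blast
    have "eventually (\<lambda>n. (\<integral>x. (norm (\<phi> n x - v' x))^2 \<partial>NN) < e) sequentially"
      "eventually (\<lambda>n. (\<integral>x. (norm (grad (\<phi> n) x - G' x))^2 \<partial>NN) < e) sequentially"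
      using \<phi>(2,3) e order_tendstoD(2) unfolding L2_lim_def by blast+
    then have "eventually (\<lambda>n. (\<integral>x. (norm (\<phi> n x - v' x))^2 \<partial>NN) < e \<and> (\<integral>x. (norm (grad (\<phi> n) x - G' x))^2 \<partial>NN) < e) sequentially"
      by (rule eventually_conj)
    then obtain k where k: "(\<integral>x. (norm (\<phi> k x - v' x))^2 \<partial>NN) < e" "(\<integral>x. (norm (grad (\<phi> k) x - G' x))^2 \<partial>NN) < e"
      using eventually_happens'[OF sequentially_bot] by blast
    have 1: "(\<integral>x. (norm (\<phi> k x - v x))^2 \<partial>NN) < 4 * e"
      using L2_integral_add_le[OF L2_diff[OF test_function_L2(1)[OF \<phi>(1)[of k]] H10_grad_L2(1)[OF vG(1)]]
          L2_diff[OF H10_grad_L2(1)[OF vG(1)] v]] k(1) vG(2) by simp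
    have 2: "(\<integral>x. (norm (grad (\<phi> k) x - G x))^2 \<partial>NN) < 4 * e"
      using L2_integral_add_le[OF L2_diff[OF test_function_L2(2)[OF \<phi>(1)[of k]] H10_grad_L2(2)[OF vG(1)]]
          L2_diff[OF H10_grad_L2(2)[OF vG(1)] G]] k(2) vG(3) by simp
    have e4: "4 * e = 1 / real (Suc n)" unfolding e_def by (metis nonzero_mult_div_cancel_left times_divide_eq_right zero_neq_numeral)
    show ?thesis using 1[unfolded e4] 2[unfolded e4] \<phi>(1)[of k] by blast
  qed
  then have "\<exists>\<phi>. \<forall>n. test_function \<Omega> (\<phi> n) \<and> (\<integral>x. (norm (\<phi> n x - v x))^2 \<partial>NN) < 1 / real (Suc n) \<and>
      (\<integral>x. (norm (grad (\<phi> n) x - G x))^2 \<partial>NN) < 1 / real (Suc n)" by (intro choice allI)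
  then obtain \<phi> where \<phi>: "\<And>n. test_function \<Omega> (\<phi> n)" "\<And>n. (\<integral>x. (norm (\<phi> n x - v x))^2 \<partial>NN) < 1 / real (Suc n)"
    "\<And>n. (\<integral>x. (norm (grad (\<phi> n) x - G x))^2 \<partial>NN) < 1 / real (Suc n)" by blast
  have l0: "X \<longlonglongrightarrow> 0" if "\<And>n. 0 \<le> X n" "\<And>n. X n < 1 / real (Suc n)" for X :: "nat \<Rightarrow> real"
  proof (rule Lim_null_comparison)
    show "(\<lambda>n. 1 / real (Suc n)) \<longlonglongrightarrow> 0" by (rule LIMSEQ_Suc[OF lim_1_over_n])
    show "\<forall>\<^sub>F n in sequentially. norm (X n) \<le> 1 / real (Suc n)"
      using that by (intro always_eventually) (auto intro: less_imp_le)
  qed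
  have "L2_lim NN \<phi> v" "L2_lim NN (\<lambda>n. grad (\<phi> n)) G"
    unfolding L2_lim_def using v G test_function_L2[OF \<phi>(1)] \<phi>(2,3) by (auto intro!: l0)
  then show ?thesis unfolding H10_grad_def using \<phi>(1) by blast
qed

text \<open>Here \<open>\<psi>\<close> need not vanish near the boundary, since the approximants of
  \<open>v\<close> do. Equivalently, the extension of \<open>v\<close> by zero has the extension of
  \<open>G\<close> by zero as weak gradient on the whole space.\<close>

lemma H10_grad_by_parts:
  assumes vG: "H10_grad v G" and \<psi>: "test_function UNIV \<psi>"
  shows "(\<integral>x. v x * (grad \<psi> x \<bullet> h) \<partial>NN) = - (\<integral>x. \<psi> x * (G x \<bullet> h) \<partial>NN)"
proof -
  obtain \<phi> where \<phi>: "\<And>n. test_function \<Omega> (\<phi> n)" "L2_lim NN \<phi> v" "L2_lim NN (\<lambda>n. grad (\<phi> n)) G"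
    using vG unfolding H10_grad_def by blast
  have s\<psi>: "smooth \<psi>" by (rule test_function_smooth[OF \<psi>])
  have L\<psi>: "L2_fun NN \<psi>" "L2_fun NN (grad \<psi>)" using test_function_L2[OF \<psi>] by auto
  have eq: "(\<integral>x. \<phi> n x * (grad \<psi> x \<bullet> h) \<partial>NN) = - (\<integral>x. \<psi> x * (grad (\<phi> n) x \<bullet> h) \<partial>NN)" for n
  proof -
    from \<phi>(1)[of n] obtain K where K: "smooth (\<phi> n)" "K \<subseteq> \<Omega>" "\<And>x. x \<notin> K \<Longrightarrow> \<phi> n x = 0" "\<And>x. x \<notin> K \<Longrightarrow> grad (\<phi> n) x = 0"
      by (rule test_functionE) (rule that)
    have K0: "\<phi> n x = 0 \<and> grad (\<phi> n) x = 0" if "x \<notin> \<Omega>" for x using K that by blast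
    note [measurable] = smooth_measurable[OF K(1)] smooth_measurable[OF s\<psi>]
      smooth_grad_borel_measurable[OF K(1)] smooth_grad_borel_measurable[OF s\<psi>]
    have "(\<integral>x. \<phi> n x * (grad \<psi> x \<bullet> h) \<partial>NN) = (\<integral>x. \<phi> n x * (grad \<psi> x \<bullet> h) \<partial>lborel)"
      by (rule lebesgue_on_integral_eq) (simp_all add: K0)
    also have "\<dots> = - (\<integral>x. \<psi> x * (grad (\<phi> n) x \<bullet> h) \<partial>lborel)"
      using integral_by_parts_test_function[OF \<phi>(1) s\<psi>]
      by (simp add: GDERIV_grad(2)[OF smooth_differentiable[OF s\<psi>]] GDERIV_grad(2)[OF smooth_differentiable[OF K(1)]])
    also have "(\<integral>x. \<psi> x * (grad (\<phi> n) x \<bullet> h) \<partial>lborel) = (\<integral>x. \<psi> x * (grad (\<phi> n) x \<bullet> h) \<partial>NN)"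
      by (rule lebesgue_on_integral_eq[symmetric]) (simp_all add: K0)
    finally show ?thesis .
  qed
  have "(\<lambda>n. \<integral>x. \<phi> n x * (grad \<psi> x \<bullet> h) \<partial>NN) \<longlonglongrightarrow> (\<integral>x. v x * (grad \<psi> x \<bullet> h) \<partial>NN)"
    by (intro L2_lim_mult \<phi> L2_lim_const L2_inner_bounded[where B="norm h"] L\<psi>) auto
  moreover have "(\<lambda>n. \<integral>x. \<psi> x * (grad (\<phi> n) x \<bullet> h) \<partial>NN) \<longlonglongrightarrow> (\<integral>x. \<psi> x * (G x \<bullet> h) \<partial>NN)"
    by (intro L2_lim_mult L2_lim_const L\<psi> L2_lim_inner_bounded[where B="norm h"] \<phi>) auto
  ultimately show ?thesis unfolding eq by (rule LIMSEQ_unique[OF _ tendsto_minus])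
qed

lemma H10_grad_has_weak_grad:
  assumes vG: "H10_grad v G"
  shows "has_weak_grad \<Omega> v G"
proof -
  have li: "locally_integrable \<Omega> v" "locally_integrable \<Omega> G"
    using H10_grad_L2[OF vG] L2_integrable[OF dom_finite] by (auto intro!: integrable_imp_locally_integrable)
  have "(\<integral>x. v x *\<^sub>R grad \<phi> x \<partial>NN) = - (\<integral>x. \<phi> x *\<^sub>R G x \<partial>NN)" if \<phi>: "test_function \<Omega> \<phi>" for \<phi>
  proof (rule euclidean_eqI)
    fix i :: 'a assume "i \<in> Basis"
    obtain B where B: "\<And>x. \<bar>\<phi> x\<bar> \<le> B" "\<And>x. norm (grad \<phi> x) \<le> B"
      by (rule test_function_bounded[OF \<phi>]) (rule that)
    have i1: "integrable NN (\<lambda>x. v x *\<^sub>R grad \<phi> x)" proof (rule Bochner_Integration.integrable_bound)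
      show "integrable NN (\<lambda>x. B * v x)" using L2_integrable[OF dom_finite H10_grad_L2(1)[OF vG]] by simp
      show "(\<lambda>x. v x *\<^sub>R grad \<phi> x) \<in> borel_measurable NN"
        using H10_grad_L2(1)[OF vG] test_function_L2(2)[OF \<phi>] by (auto simp: L2_fun_def)
      have "norm (grad \<phi> x) \<le> \<bar>B\<bar>" for x using B(2)[of x] by linarith
      then show "AE x in NN. norm (v x *\<^sub>R grad \<phi> x) \<le> norm (B * v x)"
        by (auto intro!: AE_I2 mult_left_mono simp: abs_mult mult.commute[of B])
    qed
    have i2: "integrable NN (\<lambda>x. \<phi> x *\<^sub>R G x)"
      by (rule test_function_locally_integrable[OF \<phi> li(2) open_dom])
    have "(\<integral>x. v x *\<^sub>R grad \<phi> x \<partial>NN) \<bullet> i = (\<integral>x. v x * (grad \<phi> x \<bullet> i) \<partial>NN)"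
      using integral_inner_left[of i NN "\<lambda>x. v x *\<^sub>R grad \<phi> x"] i1 by simp
    also have "\<dots> = - (\<integral>x. \<phi> x * (G x \<bullet> i) \<partial>NN)"
      using \<phi> by (intro H10_grad_by_parts[OF vG] test_function_mono[OF \<phi>]) auto
    also have "(\<integral>x. \<phi> x * (G x \<bullet> i) \<partial>NN) = (\<integral>x. \<phi> x *\<^sub>R G x \<partial>NN) \<bullet> i"
      using integral_inner_left[of i NN "\<lambda>x. \<phi> x *\<^sub>R G x"] i2 by simp
    finally show "(\<integral>x. v x *\<^sub>R grad \<phi> x \<partial>NN) \<bullet> i = (- (\<integral>x. \<phi> x *\<^sub>R G x \<partial>NN)) \<bullet> i" by simp
  qed
  then show ?thesis using li by (simp add: has_weak_grad_def)
qed

lemma weak_grad_AE: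
  assumes "has_weak_grad \<Omega> v G"
  shows "AE x in NN. weak_grad \<Omega> v x = G x"
  using has_weak_grad_unique[OF open_dom _ assms] someI[of "has_weak_grad \<Omega> v" G] assms unfolding weak_grad_def by blast

lemma AE_eq_L2_fun:
  fixes f :: "'c::euclidean_space \<Rightarrow> 'b::euclidean_space"
  assumes G: "L2_fun (lebesgue_on S) G" and "AE x in lebesgue_on S. f x = G x" and S: "S \<in> sets borel"
  shows "L2_fun (lebesgue_on S) f"
proof (rule L2_cong_AE[OF G])
  show "AE x in lebesgue_on S. G x = f x" using assms(2) by eventually_elim simp
  obtain G' where G': "G' \<in> borel_measurable borel" "AE x in lebesgue_on S. G x = G' x"
    by (rule borel_rep[OF L2_measurable[OF G] S]) (rule that)
  have "AE x in lebesgue_on S. f x = G' x" using assms(2) G'(2) by eventually_elim simp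
  then show "f \<in> borel_measurable (lebesgue_on S)" by (rule borel_measurable_lebesgue_on_AE[OF S G'(1)])
qed

lemma in_H10_H10_grad:
  assumes "in_H10 \<Omega> v"
  shows "H10_grad v (weak_grad \<Omega> v)"
proof -
  obtain G where G: "has_weak_grad \<Omega> v G" "in_L2 \<Omega> G" and v: "in_L2 \<Omega> v"
    using assms unfolding in_H10_def in_H1_def by blast
  have LG: "L2_fun NN (weak_grad \<Omega> v)"
    using G(2) by (intro AE_eq_L2_fun[OF _ weak_grad_AE[OF G(1)]]) (simp_all add: in_L2_iff)
  have Lv: "L2_fun NN v" using v by (simp add: in_L2_iff)
  obtain \<phi> where \<phi>: "\<And>n. test_function \<Omega> (\<phi> n)"
    "(\<lambda>n. \<integral>x. (\<phi> n x - v x)^2 + (norm (grad (\<phi> n) x - weak_grad \<Omega> v x))^2 \<partial>NN) \<longlonglongrightarrow> 0"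
    using assms unfolding in_H10_def by blast
  have L: "L2_fun NN (\<lambda>x. \<phi> n x - v x)" "L2_fun NN (\<lambda>x. grad (\<phi> n) x - weak_grad \<Omega> v x)" for n
    using test_function_L2[OF \<phi>(1)] Lv LG by (auto intro: L2_diff)
  have i: "integrable NN (\<lambda>x. (\<phi> n x - v x)^2)" "integrable NN (\<lambda>x. (norm (grad (\<phi> n) x - weak_grad \<Omega> v x))^2)" for n
    using L[of n] by (auto simp: L2_fun_def)
  have s: "(\<lambda>n. (\<integral>x. (\<phi> n x - v x)^2 \<partial>NN) + (\<integral>x. (norm (grad (\<phi> n) x - weak_grad \<Omega> v x))^2 \<partial>NN)) \<longlonglongrightarrow> 0"
    using \<phi>(2) i by simp
  have "(\<lambda>n. \<integral>x. (\<phi> n x - v x)^2 \<partial>NN) \<longlonglongrightarrow> 0" "(\<lambda>n. \<integral>x. (norm (grad (\<phi> n) x - weak_grad \<Omega> v x))^2 \<partial>NN) \<longlonglongrightarrow> 0"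
    by (rule Lim_null_comparison[OF _ s], simp)+
  then have "L2_lim NN \<phi> v" "L2_lim NN (\<lambda>n. grad (\<phi> n)) (weak_grad \<Omega> v)"
    using test_function_L2[OF \<phi>(1)] Lv LG by (auto simp: L2_lim_def)
  then show ?thesis unfolding H10_grad_def using \<phi>(1) by blast
qed

lemma H10_grad_in_H10:
  assumes vG: "H10_grad v G"
  shows "in_H10 \<Omega> v" "AE x in NN. weak_grad \<Omega> v x = G x"
proof -
  show ae: "AE x in NN. weak_grad \<Omega> v x = G x" by (rule weak_grad_AE[OF H10_grad_has_weak_grad[OF vG]])
  have LG: "L2_fun NN (weak_grad \<Omega> v)" by (rule AE_eq_L2_fun[OF H10_grad_L2(2)[OF vG] ae]) simp
  obtain \<phi> where \<phi>: "\<And>n. test_function \<Omega> (\<phi> n)" "L2_lim NN \<phi> v" "L2_lim NN (\<lambda>n. grad (\<phi> n)) (weak_grad \<Omega> v)"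
  proof -
    have "AE x in NN. G x = weak_grad \<Omega> v x" using ae by eventually_elim simp
    then have "H10_grad v (weak_grad \<Omega> v)"
      using H10_grad_cong_AE[OF vG, of v "weak_grad \<Omega> v"] L2_measurable[OF LG] L2_measurable[OF H10_grad_L2(1)[OF vG]] by simp
    then show ?thesis using that unfolding H10_grad_def by blast
  qed
  have L: "L2_fun NN (\<lambda>x. \<phi> n x - v x)" "L2_fun NN (\<lambda>x. grad (\<phi> n) x - weak_grad \<Omega> v x)" for n
    using test_function_L2[OF \<phi>(1)] H10_grad_L2(1)[OF vG] LG by (auto intro: L2_diff)
  have i: "integrable NN (\<lambda>x. (\<phi> n x - v x)^2)" "integrable NN (\<lambda>x. (norm (grad (\<phi> n) x - weak_grad \<Omega> v x))^2)" for n
    using L[of n] by (auto simp: L2_fun_def)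
  have "(\<lambda>n. (\<integral>x. (\<phi> n x - v x)^2 \<partial>NN) + (\<integral>x. (norm (grad (\<phi> n) x - weak_grad \<Omega> v x))^2 \<partial>NN)) \<longlonglongrightarrow> 0 + 0"
    using \<phi>(2,3) by (intro tendsto_add) (auto simp: L2_lim_def)
  then have "(\<lambda>n. \<integral>x. (\<phi> n x - v x)^2 + (norm (grad (\<phi> n) x - weak_grad \<Omega> v x))^2 \<partial>NN) \<longlonglongrightarrow> 0"
    using i by simp
  moreover have "in_H1 \<Omega> v"
    unfolding in_H1_def using H10_grad_L2[OF vG] H10_grad_has_weak_grad[OF vG] by (auto simp: in_L2_iff)
  ultimately show "in_H10 \<Omega> v" unfolding in_H10_def using \<phi>(1) by blast
qed

lemma constraint_set_iff:
  "v \<in> constraint_set \<Omega> \<gamma> \<longleftrightarrow> (\<exists>G. H10_grad v G \<and> (AE x in NN. norm (G x) \<le> \<gamma> x))"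
proof
  assume "v \<in> constraint_set \<Omega> \<gamma>"
  then show "\<exists>G. H10_grad v G \<and> (AE x in NN. norm (G x) \<le> \<gamma> x)"
    using in_H10_H10_grad unfolding constraint_set_def by blast
next
  assume "\<exists>G. H10_grad v G \<and> (AE x in NN. norm (G x) \<le> \<gamma> x)"
  then obtain G where G: "H10_grad v G" "AE x in NN. norm (G x) \<le> \<gamma> x" by blast
  have "AE x in NN. norm (weak_grad \<Omega> v x) \<le> \<gamma> x" using G(2) H10_grad_in_H10(2)[OF G(1)] by eventually_elim simp
  then show "v \<in> constraint_set \<Omega> \<gamma>" using H10_grad_in_H10(1)[OF G(1)] by (simp add: constraint_set_def)
qed

text \<open>The gradients converge strongly only after forming midpoint combinations. The pointwise
  bound by \<gamma> is convex and survives them, and the same combinations of the functions stay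
  within the same distance of \<open>v0\<close>, so closedness of \<open>H10_grad\<close>
  applies.\<close>

lemma H10_grad_uniform_limit:
  fixes v :: "nat \<Rightarrow> 'a \<Rightarrow> real"
  assumes vG: "\<And>n. H10_grad (v n) (G n)" and \<gamma>: "\<And>n. AE x in NN. norm (G n x) \<le> \<gamma> x"
    and bd: "AE x in NN. \<gamma> x \<le> M"
    and v0: "L2_fun NN v0"
    and lim: "\<And>\<epsilon>. \<epsilon> > 0 \<Longrightarrow> \<exists>N. \<forall>n\<ge>N. AE x in NN. \<bar>v n x - v0 x\<bar> \<le> \<epsilon>"
  shows "v0 \<in> constraint_set \<Omega> \<gamma>"
proof -
  interpret finite_measure NN by (rule dom_finite)
  have GM: "AE x in NN. norm (G n x) \<le> M" for n using \<gamma>[of n] bd by eventually_elim simp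
  have "(\<integral>x. (norm (G n x))^2 \<partial>NN) \<le> measure NN (space NN) * M^2" for n proof -
    have "(\<integral>x. (norm (G n x))^2 \<partial>NN) \<le> (\<integral>x. M^2 \<partial>NN)"
      using GM[of n] H10_grad_L2(2)[OF vG[of n]]
      by (intro integral_mono_AE) (auto simp: L2_fun_def elim!: eventually_mono intro!: power_mono)
    then show ?thesis by simp
  qed
  then obtain F G0 where F: "\<And>n. midhull G n (F n)" "L2_lim NN F G0" "AE x in NN. (\<lambda>n. F n x) \<longlonglongrightarrow> G0 x"
    by (rule L2_bounded_midhull_lim[OF H10_grad_L2(2)[OF vG]]) (rule that)
  have F\<gamma>: "AE x in NN. norm (h x) \<le> \<gamma> x" if "midhull G n h" for n h using that proof induction
    case (base k)
    then show ?case using \<gamma> by simp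
  next
    case (mid g h)
    from mid.IH show ?case proof eventually_elim
      case (elim x)
      then show ?case using norm_triangle_ineq[of "g x" "h x"] by simp
    qed
  qed
  \<comment> \<open>By induction over the hull: each combination of gradients is the gradient of a
    function still uniformly close to \<open>v0\<close>.\<close>
  have near: "\<exists>v'. H10_grad v' h \<and> (AE x in NN. \<bar>v' x - v0 x\<bar> \<le> \<epsilon>)"
    if N: "\<forall>n\<ge>N. AE x in NN. \<bar>v n x - v0 x\<bar> \<le> \<epsilon>" and "midhull G N h" for h N \<epsilon>
    using that(2)
  proof induction
    case (base k)
    then show ?case using vG N by blast
  next
    case (mid g h)
    then obtain v1 v2 where v1: "H10_grad v1 g" "AE x in NN. \<bar>v1 x - v0 x\<bar> \<le> \<epsilon>"
      and v2: "H10_grad v2 h" "AE x in NN. \<bar>v2 x - v0 x\<bar> \<le> \<epsilon>" by blast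
    have "H10_grad (\<lambda>x. (1/2) * v1 x + (1/2) * v2 x) (\<lambda>x. (1/2) *\<^sub>R (g x + h x))"
      using H10_grad_linear[OF v1(1) v2(1), of "1/2" "1/2"] by (simp add: scaleR_add_right)
    moreover have "AE x in NN. \<bar>(1/2) * v1 x + (1/2) * v2 x - v0 x\<bar> \<le> \<epsilon>"
      using v1(2) v2(2) by eventually_elim (auto simp: abs_le_iff)
    ultimately show ?case by blast
  qed
  have "H10_grad v0 G0" proof (rule H10_grad_closed[OF v0])
    show "L2_fun NN G0" using F(2) by (simp add: L2_lim_def)
    fix \<epsilon> :: real assume \<epsilon>: "\<epsilon> > 0"
    define c where "c = measure NN (space NN)"
    have c: "c \<ge> 0" by (simp add: c_def)
    \<comment> \<open>Chosen so that the uniform error squared times the measure \<open>c\<close> of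
      the domain stays below \<epsilon>; the \<open>c + 1\<close> avoids dividing by zero.\<close>
    define \<epsilon>1 where "\<epsilon>1 = sqrt (\<epsilon> / (2 * (c + 1)))"
    have \<epsilon>1: "\<epsilon>1 > 0" "c * \<epsilon>1^2 < \<epsilon>" proof -
      show "\<epsilon>1 > 0" using \<epsilon> c by (simp add: \<epsilon>1_def)
      have "c * \<epsilon>1^2 = c / (c + 1) * (\<epsilon> / 2)" using \<epsilon> c by (simp add: \<epsilon>1_def)
      also have "\<dots> \<le> 1 * (\<epsilon> / 2)" using c \<epsilon> by (intro mult_right_mono) auto
      finally show "c * \<epsilon>1^2 < \<epsilon>" using \<epsilon> by simp
    qed
    obtain N where N: "\<forall>n\<ge>N. AE x in NN. \<bar>v n x - v0 x\<bar> \<le> \<epsilon>1" using lim[OF \<epsilon>1(1)] by blast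
    have "eventually (\<lambda>n. (\<integral>x. (norm (F n x - G0 x))^2 \<partial>NN) < \<epsilon>) sequentially"
      using F(2) \<epsilon> order_tendstoD(2) unfolding L2_lim_def by blast
    from eventually_conj[OF this eventually_ge_at_top[of N]]
    obtain k where k: "(\<integral>x. (norm (F k x - G0 x))^2 \<partial>NN) < \<epsilon>" "k \<ge> N"
      using eventually_happens'[OF sequentially_bot] by blast
    obtain v' where v': "H10_grad v' (F k)" "AE x in NN. \<bar>v' x - v0 x\<bar> \<le> \<epsilon>1"
      using near[OF N midhull_mono[OF F(1) k(2)]] by blast
    have "(\<integral>x. (norm (v' x - v0 x))^2 \<partial>NN) \<le> (\<integral>x. \<epsilon>1^2 \<partial>NN)"
      using v'(2) L2_diff[OF H10_grad_L2(1)[OF v'(1)] v0]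
      by (intro integral_mono_AE) (auto simp: L2_fun_def power2_le_iff_abs_le elim!: eventually_mono)
    also have "\<dots> = c * \<epsilon>1^2" by (simp add: c_def)
    finally show "\<exists>v' G'. H10_grad v' G' \<and> (\<integral>x. (norm (v' x - v0 x))^2 \<partial>NN) < \<epsilon> \<and> (\<integral>x. (norm (G' x - G0 x))^2 \<partial>NN) < \<epsilon>"
      using k(1) v'(1) \<epsilon>1(2) by force
  qed
  moreover have "AE x in NN. \<forall>n. norm (F n x) \<le> \<gamma> x" using F\<gamma>[OF F(1)] by (subst AE_all_countable) blast
  then have "AE x in NN. norm (G0 x) \<le> \<gamma> x" using F(3) proof eventually_elim
    case (elim x)
    then show ?case using LIMSEQ_le_const2[OF tendsto_norm[OF elim(2)]] by blast
  qed
  ultimately show ?thesis unfolding constraint_set_iff by blast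
qed

end

section \<open>From smooth test functions to bounded Sobolev functions\<close>

lemma L2_lim_comparison2:
  fixes F :: "nat \<Rightarrow> 'x \<Rightarrow> 'b::euclidean_space" and P :: "nat \<Rightarrow> 'x \<Rightarrow> 'c::euclidean_space"
    and Q :: "nat \<Rightarrow> 'x \<Rightarrow> 'd::euclidean_space"
  assumes P: "L2_lim M P p" and Q: "L2_lim M Q q"
    and F: "\<And>n. F n \<in> borel_measurable M" "L2_fun M f"
    and le: "\<And>n. AE x in M. norm (F n x - f x) \<le> a * norm (P n x - p x) + b * norm (Q n x - q x)"
  shows "L2_lim M F f"
proof (rule L2_lim_comparison[where h="\<lambda>n x. 2 * (a^2 * (norm (P n x - p x))^2) + 2 * (b^2 * (norm (Q n x - q x))^2)"])
  have L: "L2_fun M (P n)" "L2_fun M p" "L2_fun M (Q n)" "L2_fun M q" for n using P Q by (auto simp: L2_lim_def)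
  have i: "integrable M (\<lambda>x. (norm (P n x - p x))^2)" "integrable M (\<lambda>x. (norm (Q n x - q x))^2)" for n
    using L2_diff[OF L(1,2)] L2_diff[OF L(3,4)] by (auto simp: L2_fun_def)
  then show "integrable M (\<lambda>x. 2 * (a^2 * (norm (P n x - p x))^2) + 2 * (b^2 * (norm (Q n x - q x))^2))" for n by auto
  show "AE x in M. (norm (F n x - f x))^2
      \<le> 2 * (a^2 * (norm (P n x - p x))^2) + 2 * (b^2 * (norm (Q n x - q x))^2)" for n using le[of n]
  proof eventually_elim
    case (elim x)
    then have "(norm (F n x - f x))^2 \<le> (a * norm (P n x - p x) + b * norm (Q n x - q x))^2" by (intro power_mono) auto
    also have "\<dots> \<le> 2 * (a * norm (P n x - p x))^2 + 2 * (b * norm (Q n x - q x))^2"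
      using norm_add_power2_le[of "a * norm (P n x - p x)" "b * norm (Q n x - q x)"] by simp
    finally show ?case by (simp add: power_mult_distrib)
  qed
  have l: "(\<lambda>n. \<integral>x. (norm (P n x - p x))^2 \<partial>M) \<longlonglongrightarrow> 0" "(\<lambda>n. \<integral>x. (norm (Q n x - q x))^2 \<partial>M) \<longlonglongrightarrow> 0"
    using P Q by (auto simp: L2_lim_def)
  have "(\<lambda>n. 2 * (a^2 * (\<integral>x. (norm (P n x - p x))^2 \<partial>M)) + 2 * (b^2 * (\<integral>x. (norm (Q n x - q x))^2 \<partial>M)))
      \<longlonglongrightarrow> 2 * (a^2 * 0) + 2 * (b^2 * 0)" by (intro tendsto_intros l)
  then show "(\<lambda>n. \<integral>x. 2 * (a^2 * (norm (P n x - p x))^2) + 2 * (b^2 * (norm (Q n x - q x))^2) \<partial>M) \<longlonglongrightarrow> 0"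
    using i by simp
qed (use F in auto)

lemma L2_lim_dominated_bounded:
  fixes F :: "nat \<Rightarrow> 'x \<Rightarrow> 'b::euclidean_space"
  assumes "finite_measure M" and [measurable]: "\<And>n. F n \<in> borel_measurable M" "f \<in> borel_measurable M"
    and B: "\<And>n. AE x in M. norm (F n x) \<le> B" and lim: "AE x in M. (\<lambda>n. F n x) \<longlonglongrightarrow> f x"
  shows "L2_lim M F f"
proof -
  interpret finite_measure M by fact
  have "AE x in M. \<forall>n. norm (F n x) \<le> B" using B by (subst AE_all_countable) blast
  then have fB: "AE x in M. norm (f x) \<le> B" using lim proof eventually_elim
    case (elim x)
    then show ?case using LIMSEQ_le_const2[OF tendsto_norm[OF elim(2)]] by blast
  qed
  have "(\<lambda>n. \<integral>x. (norm (F n x - f x))^2 \<partial>M) \<longlonglongrightarrow> (\<integral>x. 0 \<partial>M)"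
  proof (rule integral_dominated_convergence[where w="\<lambda>x. (2 * B)^2"])
    show "AE x in M. norm ((norm (F n x - f x))^2) \<le> (2 * B)^2" for n using B[of n] fB proof eventually_elim
      case (elim x)
      then have "norm (F n x - f x) \<le> 2 * B" using norm_triangle_ineq4[of "F n x" "f x"] by simp
      then have "(norm (F n x - f x))^2 \<le> (2 * B)^2" by (intro power_mono) auto
      then show ?case by simp
    qed
    show "AE x in M. (\<lambda>n. (norm (F n x - f x))^2) \<longlonglongrightarrow> 0" using lim proof eventually_elim
      case (elim x)
      have "(\<lambda>n. (norm (F n x - f x))^2) \<longlonglongrightarrow> (norm (f x - f x))^2" by (intro tendsto_intros elim)
      then show ?case by simp
    qed
  qed auto
  moreover have "L2_fun M (F n)" for n by (rule L2_bounded[OF assms(1) _ B]) simp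
  moreover have "L2_fun M f" by (rule L2_bounded[OF assms(1) _ fB]) simp
  ultimately show ?thesis by (simp add: L2_lim_def)
qed

lemma sin_lipschitz: "\<bar>sin a - sin b\<bar> \<le> \<bar>a - b\<bar>" for a b :: real
proof -
  have "\<bar>sin ((a - b) / 2)\<bar> * \<bar>cos ((a + b) / 2)\<bar> \<le> \<bar>(a - b) / 2\<bar> * 1"
    by (intro mult_mono abs_sin_x_le_abs_x abs_cos_le_one) auto
  then show ?thesis by (simp add: sin_diff_sin abs_mult)
qed

lemma cos_lipschitz: "\<bar>cos a - cos b\<bar> \<le> \<bar>a - b\<bar>" for a b :: real
proof -
  have "\<bar>sin ((a + b) / 2)\<bar> * \<bar>sin ((b - a) / 2)\<bar> \<le> 1 * \<bar>(b - a) / 2\<bar>"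
    by (intro mult_mono abs_sin_x_le_abs_x abs_sin_le_one) auto
  then show ?thesis by (simp add: cos_diff_cos abs_mult abs_minus_commute)
qed

context bounded_domain
begin

text \<open>With \<open>b\<close> and \<open>c\<close> only in L2, the squares and the products with
  the gradient must converge in L2, but the test functions approximating \<open>w\<close> have no
  common sup bound. Replacing them by \<open>sin (e * y) / e\<close>, which is smooth, vanishes at 0
  and is bounded by 1/e, makes both converge for fixed \<open>e\<close>; then \<open>e\<close> tends
  to 0, where the bounds on \<open>w\<close> and \<open>G\<close> give domination.\<close>

lemma weighted_sin_inequality:
  assumes b: "L2_fun NN b" and c: "L2_fun NN c"
    and test: "\<And>\<sigma>. test_function \<Omega> \<sigma> \<Longrightarrow> l * (\<integral>x. \<sigma> x * \<sigma> x \<partial>NN)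
        \<le> (\<integral>x. c x * (\<sigma> x * \<sigma> x) \<partial>NN) + (\<integral>x. b x \<bullet> (\<sigma> x *\<^sub>R grad \<sigma> x) \<partial>NN)"
    and w: "H10_grad w G" and GM: "AE x in NN. norm (G x) \<le> M"
    and wB: "AE x in NN. \<bar>w x\<bar> \<le> B"
  shows "l * (\<integral>x. w x * w x \<partial>NN)
        \<le> (\<integral>x. c x * (w x * w x) \<partial>NN) + (\<integral>x. b x \<bullet> (w x *\<^sub>R G x) \<partial>NN)"
proof -
  let ?P = "\<lambda>r v. l * (\<integral>x. r x \<partial>NN) \<le> (\<integral>x. c x * r x \<partial>NN) + (\<integral>x. b x \<bullet> v x \<partial>NN)"
  let ?s = "\<lambda>n x. sin (1 / real (Suc n) * w x) / (1 / real (Suc n))"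
  note fin = dom_finite
  note [measurable] = H10_grad_L2[OF w, THEN L2_measurable]
  have one: "L2_fun NN (\<lambda>x. 1::real)" by (rule L2_bounded[OF fin, where B=1]) auto
  \<comment> \<open>The inequality is linear in the square and in the vector field, so L2
    convergence of these two suffices; both limits below are of this form.\<close>
  have pass: "?P (\<lambda>x. s x * s x) v"
    if "\<And>n. ?P (\<lambda>x. S n x * S n x) (V n)"
      and S: "L2_lim NN (\<lambda>n x. S n x * S n x) (\<lambda>x. s x * s x)" and V: "L2_lim NN V v"
    for S :: "nat \<Rightarrow> 'a \<Rightarrow> real" and s :: "'a \<Rightarrow> real" and V :: "nat \<Rightarrow> 'a \<Rightarrow> 'a" and v
  proof (rule LIMSEQ_le)
    show "(\<lambda>n. l * (\<integral>x. 1 * (S n x * S n x) \<partial>NN)) \<longlonglongrightarrow> l * (\<integral>x. s x * s x \<partial>NN)"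
      using L2_lim_mult[OF L2_lim_const[OF one] S] by (intro tendsto_intros) simp
    show "(\<lambda>n. (\<integral>x. c x * (S n x * S n x) \<partial>NN) + (\<integral>x. b x \<bullet> V n x \<partial>NN)) \<longlonglongrightarrow> (\<integral>x. c x * (s x * s x) \<partial>NN) + (\<integral>x. b x \<bullet> v x \<partial>NN)"
      by (intro tendsto_intros L2_lim_mult L2_lim_inner L2_lim_const b c S V)
    show "\<exists>N. \<forall>n\<ge>N. l * (\<integral>x. 1 * (S n x * S n x) \<partial>NN) \<le> (\<integral>x. c x * (S n x * S n x) \<partial>NN) + (\<integral>x. b x \<bullet> V n x \<partial>NN)"
      using that(1) by simp
  qed
  \<comment> \<open>First limit: \<open>e\<close> fixed, test functions tending to
    \<open>w\<close>.\<close>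
  have step: "?P (\<lambda>x. (sin (e * w x) / e) * (sin (e * w x) / e)) (\<lambda>x. (sin (e * w x) / e) *\<^sub>R (cos (e * w x) *\<^sub>R G x))" if e: "e > 0" for e
  proof -
    obtain \<phi> where \<phi>: "\<And>n. test_function \<Omega> (\<phi> n)" "L2_lim NN \<phi> w" "L2_lim NN (\<lambda>n. grad (\<phi> n)) G"
      using w unfolding H10_grad_def by blast
    define h where "h y = (1/e) * sin (e * y)" for y
    define S where "S n x = h (\<phi> n x)" for n x
    define s where "s x = h (w x)" for x
    define H where "H x = cos (e * w x) *\<^sub>R G x" for x
    have sm: "smooth (\<phi> n)" for n by (rule test_function_smooth[OF \<phi>(1)])
    have ss: "smooth (sin :: real \<Rightarrow> real)" using C_k_sin_cos by (simp add: smooth_def)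
    have [simp]: "smooth h" unfolding h_def[abs_def] using smooth_affine[OF bounded_linear_mult_right ss, of e 0]
      by (intro smooth_intros) simp
    then have tS: "test_function \<Omega> (S n)" for n
      unfolding S_def[abs_def] by (rule test_function_compose[OF \<phi>(1)]) (simp_all add: h_def)
    have gS: "grad (S n) x = cos (e * \<phi> n x) *\<^sub>R grad (\<phi> n) x" for n x proof (rule grad_eq)
      have "(\<phi> n has_derivative (\<lambda>k. k \<bullet> grad (\<phi> n) x)) (at x)"
        using GDERIV_grad(1)[OF smooth_differentiable[OF sm]] by (simp add: gderiv_def)
      then have "((\<lambda>x. (1/e) * sin (e * \<phi> n x)) has_derivative (\<lambda>k. k \<bullet> (cos (e * \<phi> n x) *\<^sub>R grad (\<phi> n) x))) (at x)"
        using e by (auto intro!: derivative_eq_intros simp: mult_ac)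
      then show "GDERIV (S n) x :> cos (e * \<phi> n x) *\<^sub>R grad (\<phi> n) x" by (simp add: gderiv_def S_def[abs_def] h_def)
    qed
    have hl: "\<bar>h y - h z\<bar> \<le> \<bar>y - z\<bar>" for y z proof -
      have "\<bar>sin (e * y) - sin (e * z)\<bar> \<le> e * \<bar>y - z\<bar>"
        using sin_lipschitz[of "e * y" "e * z"] e by (simp add: abs_mult flip: right_diff_distrib)
      then have "(1/e) * \<bar>sin (e * y) - sin (e * z)\<bar> \<le> (1/e) * (e * \<bar>y - z\<bar>)"
        using e by (intro mult_left_mono) auto
      moreover have "h y - h z = (1/e) * (sin (e * y) - sin (e * z))" by (simp add: h_def right_diff_distrib)
      ultimately show ?thesis using e by (simp add: abs_mult)
    qed
    have cl: "\<bar>cos (e * y) - cos (e * z)\<bar> \<le> e * \<bar>y - z\<bar>" for y z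
      using cos_lipschitz[of "e * y" "e * z"] e by (simp add: abs_mult flip: right_diff_distrib)
    have hB: "\<bar>h y\<bar> \<le> 1/e" for y using abs_sin_le_one[of "e * y"] e by (simp add: h_def abs_mult divide_simps)
    note [measurable] = H10_grad_L2[OF H10_grad_test_function[OF \<phi>(1)], THEN L2_measurable]
    have [measurable]: "h \<in> borel_measurable borel" unfolding h_def[abs_def] by measurable
    have Lb: "L2_fun NN s" "L2_fun NN H" proof -
      show "L2_fun NN s" unfolding s_def using hB by (intro L2_bounded[OF fin, where B="1/e"]) auto
      have "norm (cos (e * w x) *\<^sub>R G x) \<le> norm (G x)" for x
        using mult_right_mono[OF abs_cos_le_one[of "e * w x"], of "norm (G x)"] by simp
      then show "L2_fun NN H" unfolding H_def using GM
        by (intro L2_bounded[OF fin, where B=M]) (auto elim!: eventually_mono intro: order_trans)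
    qed
    have HM: "AE x in NN. norm (H x) \<le> M" using GM proof eventually_elim
      case (elim x)
      then show ?case using mult_right_mono[OF abs_cos_le_one[of "e * w x"], of "norm (G x)"] by (simp add: H_def)
    qed
    have S_lim: "L2_lim NN S s" by (rule L2_lim_comparison2[OF \<phi>(2) \<phi>(2), where a=1 and b=0])
        (use hl Lb(1) L2_measurable[OF test_function_L2(1)[OF tS]] in \<open>auto simp: S_def s_def\<close>)
    \<comment> \<open>The gradient is cos(e \<phi>) grad \<phi>; the difference of the cosines
      multiplies the limit gradient \<open>G\<close>, which is bounded by \<open>M\<close>, and is
      controlled by the L2 distance of the functions.\<close>
    have gS_lim: "L2_lim NN (\<lambda>n. grad (S n)) H"
    proof (rule L2_lim_comparison2[OF \<phi>(3) \<phi>(2), where a=1 and b="e * M"])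
      show "grad (S n) \<in> borel_measurable NN" for n using test_function_L2(2)[OF tS] by (simp add: L2_fun_def)
      show "AE x in NN. norm (grad (S n) x - H x) \<le> 1 * norm (grad (\<phi> n) x - G x) + e * M * norm (\<phi> n x - w x)" for n
        using GM
      proof eventually_elim
        case (elim x)
        have "grad (S n) x - H x = cos (e * \<phi> n x) *\<^sub>R (grad (\<phi> n) x - G x) + (cos (e * \<phi> n x) - cos (e * w x)) *\<^sub>R G x"
          by (simp add: gS H_def algebra_simps)
        also have "norm \<dots> \<le> \<bar>cos (e * \<phi> n x)\<bar> * norm (grad (\<phi> n) x - G x) + \<bar>cos (e * \<phi> n x) - cos (e * w x)\<bar> * norm (G x)"
          by (rule order_trans[OF norm_triangle_ineq]) simp
        also have "\<dots> \<le> 1 * norm (grad (\<phi> n) x - G x) + (e * \<bar>\<phi> n x - w x\<bar>) * M"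
          using e by (intro add_mono mult_mono cl elim abs_cos_le_one) auto
        finally show ?case by (simp add: mult_ac)
      qed
    qed (rule Lb)
    have sq_lim: "L2_lim NN (\<lambda>n x. S n x * S n x) (\<lambda>x. s x * s x)"
    proof (rule L2_lim_comparison2[OF S_lim S_lim, where a="2/e" and b=0])
      show "L2_fun NN (\<lambda>x. s x * s x)"
        using L2_bounded_mult[OF Lb(1), of s "1/e"] hB L2_measurable[OF Lb(1)] by (simp add: s_def)
      show "AE x in NN. norm (S n x * S n x - s x * s x) \<le> 2/e * norm (S n x - s x) + 0 * norm (S n x - s x)" for n
      proof (rule AE_I2)
        fix x
        have "S n x * S n x - s x * s x = (S n x + s x) * (S n x - s x)" by (simp add: algebra_simps)
        moreover have "\<bar>S n x + s x\<bar> \<le> 2/e" using hB[of "\<phi> n x"] hB[of "w x"] by (simp add: S_def s_def)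
        then have "\<bar>S n x + s x\<bar> * \<bar>S n x - s x\<bar> \<le> 2/e * \<bar>S n x - s x\<bar>" by (rule mult_right_mono) simp
        ultimately show "norm (S n x * S n x - s x * s x) \<le> 2/e * norm (S n x - s x) + 0 * norm (S n x - s x)"
          by (simp add: abs_mult)
      qed
      show "(\<lambda>x. S n x * S n x) \<in> borel_measurable NN" for n unfolding S_def by measurable
    qed
    have V_lim: "L2_lim NN (\<lambda>n x. S n x *\<^sub>R grad (S n) x) (\<lambda>x. s x *\<^sub>R H x)"
    proof (rule L2_lim_comparison2[OF gS_lim S_lim, where a="1/e" and b=M])
      show "L2_fun NN (\<lambda>x. s x *\<^sub>R H x)"
        using L2_bounded_mult[OF Lb(2), of s "1/e"] hB L2_measurable[OF Lb(1)] by (simp add: s_def)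
      show "(\<lambda>x. S n x *\<^sub>R grad (S n) x) \<in> borel_measurable NN" for n
        by (rule borel_measurable_scaleR[OF test_function_L2[OF tS, THEN L2_measurable]])
      show "AE x in NN. norm (S n x *\<^sub>R grad (S n) x - s x *\<^sub>R H x) \<le> 1/e * norm (grad (S n) x - H x) + M * norm (S n x - s x)" for n
        using HM
      proof eventually_elim
        case (elim x)
        have "S n x *\<^sub>R grad (S n) x - s x *\<^sub>R H x = S n x *\<^sub>R (grad (S n) x - H x) + (S n x - s x) *\<^sub>R H x"
          by (simp add: algebra_simps)
        also have "norm \<dots> \<le> \<bar>S n x\<bar> * norm (grad (S n) x - H x) + \<bar>S n x - s x\<bar> * norm (H x)"
          by (rule order_trans[OF norm_triangle_ineq]) simp
        also have "\<dots> \<le> 1/e * norm (grad (S n) x - H x) + \<bar>S n x - s x\<bar> * M"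
          using hB[of "\<phi> n x"] by (intro add_mono mult_right_mono mult_left_mono elim) (auto simp: S_def)
        finally show ?case by (simp add: mult.commute)
      qed
    qed
    from pass[OF test[OF tS] sq_lim V_lim] show ?thesis by (simp add: s_def h_def H_def)
  qed
  have B0: "AE x in NN. B \<ge> 0" using wB by eventually_elim simp
  have M0: "AE x in NN. M \<ge> 0" using GM by eventually_elim (use norm_ge_zero order_trans in blast)
  have sl: "(\<lambda>n. sin (1 / real (Suc n) * y) / (1 / real (Suc n))) \<longlonglongrightarrow> y" for y :: real proof -
    have "((\<lambda>t. sin (t * y) / t) \<longlongrightarrow> cos (0 * y) * y) (at 0)" proof -
      have "((\<lambda>t. sin (t * y)) has_real_derivative cos (0 * y) * y) (at 0)" by (auto intro!: derivative_eq_intros)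
      then show ?thesis by (simp add: DERIV_def)
    qed
    moreover have "filterlim (\<lambda>n. 1 / real (Suc n)) (at 0) sequentially"
      using LIMSEQ_Suc[OF lim_1_over_n[where 'a=real]] by (auto simp: filterlim_at)
    ultimately have "(\<lambda>n. sin (1 / real (Suc n) * y) / (1 / real (Suc n))) \<longlonglongrightarrow> cos (0 * y) * y"
      by (rule filterlim_compose)
    then show ?thesis by simp
  qed
  have cl: "(\<lambda>n. cos (1 / real (Suc n) * y)) \<longlonglongrightarrow> 1" for y :: real proof -
    have "(\<lambda>n. cos (1 / real (Suc n) * y)) \<longlonglongrightarrow> cos (0 * y)"
      by (intro tendsto_intros LIMSEQ_Suc[OF lim_1_over_n])
    then show ?thesis by simp
  qed
  have sle: "\<bar>sin (1 / real (Suc n) * y) / (1 / real (Suc n))\<bar> \<le> \<bar>y\<bar>" for y :: real and n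
    using mult_left_mono[OF abs_sin_x_le_abs_x[of "1 / real (Suc n) * y"], of "real (Suc n)"] by (simp add: abs_mult mult.commute)
  \<comment> \<open>Second limit, along e = 1/(n+1): the truncations are dominated by
    \<open>\<bar>w\<bar>\<close> and hence by \<open>B\<close>, the vector fields by
    \<open>B * M\<close>.\<close>
  show ?thesis proof (rule pass[OF step])
    show "1 / real (Suc n) > 0" for n by simp
    show "L2_lim NN (\<lambda>n x. ?s n x * ?s n x) (\<lambda>x. w x * w x)"
    proof (rule L2_lim_dominated_bounded[OF fin, where B="B * B"])
      show "AE x in NN. norm (?s n x * ?s n x) \<le> B * B" for n using wB B0 proof eventually_elim
        case (elim x)
        have "\<bar>sin (1 / real (Suc n) * w x) / (1 / real (Suc n))\<bar> \<le> B" using sle[of n "w x"] elim by linarith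
        then show ?case unfolding real_norm_def abs_mult using elim by (intro mult_mono) auto
      qed
      show "AE x in NN. (\<lambda>n. ?s n x * ?s n x) \<longlonglongrightarrow> w x * w x" by (intro AE_I2 tendsto_mult sl)
    qed measurable
    show "L2_lim NN (\<lambda>n x. ?s n x *\<^sub>R (cos (1 / real (Suc n) * w x) *\<^sub>R G x)) (\<lambda>x. w x *\<^sub>R G x)"
    proof (rule L2_lim_dominated_bounded[OF fin, where B="B * (1 * M)"])
      show "AE x in NN. norm (?s n x *\<^sub>R (cos (1 / real (Suc n) * w x) *\<^sub>R G x)) \<le> B * (1 * M)" for n
        using wB B0 GM M0
      proof eventually_elim
        case (elim x)
        have "\<bar>sin (1 / real (Suc n) * w x) / (1 / real (Suc n))\<bar> \<le> B" using sle[of n "w x"] elim by linarith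
        then show ?case unfolding norm_scaleR using elim by (intro mult_mono abs_cos_le_one) auto
      qed
      show "AE x in NN. (\<lambda>n. ?s n x *\<^sub>R (cos (1 / real (Suc n) * w x) *\<^sub>R G x)) \<longlonglongrightarrow> w x *\<^sub>R G x"
      proof (rule AE_I2)
        fix x
        show "(\<lambda>n. ?s n x *\<^sub>R (cos (1 / real (Suc n) * w x) *\<^sub>R G x)) \<longlonglongrightarrow> w x *\<^sub>R G x"
          using tendsto_scaleR[OF sl tendsto_scaleR[OF cl tendsto_const]] by simp
      qed
    qed measurable
  qed
qed

end

section \<open>Lipschitz representatives and the convex sets of admissible functions\<close>

locale lipschitz_domain = bounded_domain +
  assumes lipschitz_dom: "lipschitz_boundary \<Omega>"
begin

text \<open>Defined on the whole space, since the extension by zero has a Lipschitz constant for the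
  Euclidean distance even where \<open>\<Omega>\<close> is not convex. Pointwise values replace
  equality almost everywhere from here on.\<close>

definition lip0 :: "real \<Rightarrow> ('a \<Rightarrow> real) set" where
  "lip0 M = {V. M-lipschitz_on UNIV V \<and> (\<forall>x. x \<notin> \<Omega> \<longrightarrow> V x = 0)}"

lemma lip0_continuous: "V \<in> lip0 M \<Longrightarrow> continuous_on S V"
  unfolding lip0_def using lipschitz_on_continuous_on continuous_on_subset by blast

lemma lip0_measurable: "V \<in> lip0 M \<Longrightarrow> V \<in> borel_measurable borel"
  by (intro borel_measurable_continuous_onI lip0_continuous)

lemma lip0_le: "V \<in> lip0 M \<Longrightarrow> \<bar>V x - V y\<bar> \<le> M * norm (x - y)"
  unfolding lip0_def by (auto dest: lipschitz_onD[of _ _ _ x y] simp: dist_norm)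

lemma lip0I:
  assumes "M \<ge> 0" "\<And>x y. \<bar>V x - V y\<bar> \<le> M * norm (x - y)" "\<And>x. x \<notin> \<Omega> \<Longrightarrow> V x = 0"
  shows "V \<in> lip0 M"
  unfolding lip0_def using assms by (auto intro!: lipschitz_onI simp: dist_norm)

lemma lip0_linear:
  assumes "V \<in> lip0 M" "W \<in> lip0 M"
  shows "(\<lambda>x. a * V x + b * W x) \<in> lip0 ((\<bar>a\<bar> + \<bar>b\<bar>) * M)"
proof (rule lip0I)
  have "0 \<le> M" using assms(1) lipschitz_on_nonneg by (auto simp: lip0_def)
  then show "0 \<le> (\<bar>a\<bar> + \<bar>b\<bar>) * M" by simp
  fix x y
  have "\<bar>a * V x + b * W x - (a * V y + b * W y)\<bar> \<le> \<bar>a\<bar> * \<bar>V x - V y\<bar> + \<bar>b\<bar> * \<bar>W x - W y\<bar>"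
  proof -
    have "a * V x + b * W x - (a * V y + b * W y) = a * (V x - V y) + b * (W x - W y)" by (simp add: algebra_simps)
    then show ?thesis using abs_triangle_ineq[of "a * (V x - V y)" "b * (W x - W y)"] by (simp add: abs_mult)
  qed
  also have "\<dots> \<le> \<bar>a\<bar> * (M * norm (x - y)) + \<bar>b\<bar> * (M * norm (x - y))"
    using lip0_le[OF assms(1)] lip0_le[OF assms(2)] by (intro add_mono mult_left_mono) auto
  finally show "\<bar>a * V x + b * W x - (a * V y + b * W y)\<bar> \<le> (\<bar>a\<bar> + \<bar>b\<bar>) * M * norm (x - y)"
    by (simp add: algebra_simps)
qed (use assms in \<open>auto simp: lip0_def\<close>)

text \<open>A point \<open>p\<close> on the sphere enclosing \<open>\<Omega>\<close> is outside, so
  every member vanishes there and the Lipschitz constant times the diameter bounds all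
  values.\<close>

lemma lip0_bounded:
  obtains B where "B \<ge> 0" "\<And>V x. V \<in> lip0 M \<Longrightarrow> \<bar>V x\<bar> \<le> B"
proof -
  obtain R where R: "R > 0" "\<And>x. x \<in> \<Omega> \<Longrightarrow> norm x < R"
    using bounded_dom unfolding bounded_pos_less by auto
  obtain p :: 'a where p: "norm p = R" using vector_choose_size[of R] R(1) by (metis less_imp_le)
  then have pn: "p \<notin> \<Omega>" using R(2) by fastforce
  have "\<bar>V x\<bar> \<le> \<bar>M\<bar> * (2 * R)" if V: "V \<in> lip0 M" for V x proof (cases "x \<in> \<Omega>")
    case True
    have "\<bar>V x\<bar> \<le> M * norm (x - p)" using lip0_le[OF V, of x p] V pn by (simp add: lip0_def)
    also have "\<dots> \<le> \<bar>M\<bar> * (2 * R)" using norm_triangle_ineq4[of x p] p R(2)[OF True] by (intro mult_mono) auto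
    finally show ?thesis .
  next
    case False
    then show ?thesis using V R(1) by (simp add: lip0_def)
  qed
  then show ?thesis using that[of "\<bar>M\<bar> * (2 * R)"] R(1) by simp
qed

lemma lip0_L2:
  assumes "V \<in> lip0 M"
  shows "L2_fun NN V"
proof -
  obtain B where "\<And>V x. V \<in> lip0 M \<Longrightarrow> \<bar>V x\<bar> \<le> B" by (rule lip0_bounded) (rule that)
  then show ?thesis using assms by (intro L2_bounded[OF dom_finite, where B=B] lebesgue_onI lip0_measurable) auto
qed

text \<open>A Lipschitz function that reaches \<epsilon> at one point stays above \<epsilon>/2 on a
  ball whose radius depends only on \<open>M\<close> and \<epsilon>, which costs a fixed amount of
  L2 norm. Equicontinuity in time is later derived from L2 estimates in this way.\<close>

lemma lip0_L2_small:
  assumes "\<epsilon> > 0"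
  obtains \<delta> where "\<delta> > 0" "\<And>V x. V \<in> lip0 M \<Longrightarrow> (\<integral>x. (V x)^2 \<partial>NN) < \<delta> \<Longrightarrow> \<bar>V x\<bar> < \<epsilon>"
proof -
  define r where "r = \<epsilon> / (2 * (\<bar>M\<bar> + 1))"
  have r: "r > 0" using assms by (simp add: r_def)
  define \<delta> where "\<delta> = (\<epsilon> / 2)^2 * measure lborel (ball (0::'a) r)"
  have \<delta>: "\<delta> > 0" using assms r content_ball_pos[of r "0::'a"] by (simp add: \<delta>_def)
  have "\<bar>V x\<bar> < \<epsilon>" if V: "V \<in> lip0 M" and small: "(\<integral>x. (V x)^2 \<partial>NN) < \<delta>" for V x
  proof (rule ccontr)
    assume "\<not> \<bar>V x\<bar> < \<epsilon>"
    then have Vx: "\<bar>V x\<bar> \<ge> \<epsilon>" by simp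
    have big: "\<bar>V y\<bar> \<ge> \<epsilon> / 2" if "y \<in> ball x r" for y proof -
      have "\<bar>V x - V y\<bar> \<le> M * norm (x - y)" by (rule lip0_le[OF V])
      also have "\<dots> \<le> (\<bar>M\<bar> + 1) * r" using that r by (intro mult_mono) (auto simp: dist_norm)
      also have "\<dots> = \<epsilon> / 2" by (simp add: r_def field_simps)
      finally show ?thesis using Vx by linarith
    qed
    then have sub: "ball x r \<subseteq> \<Omega>" using V assms unfolding lip0_def by force
    have "\<delta> = (\<integral>y. (\<epsilon> / 2)^2 * indicator (ball x r) y \<partial>lborel)"
      using r by (simp add: \<delta>_def content_ball emeasure_lborel_ball_finite)
    also have "\<dots> \<le> (\<integral>y. (V y)^2 \<partial>lborel)" proof (rule integral_mono)
      show "integrable lborel (\<lambda>y. (\<epsilon> / 2)^2 * indicator (ball x r) y)"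
        using emeasure_lborel_ball_finite by (intro integrable_mult_right integrable_real_indicator) auto
      have z: "\<And>x. x \<notin> \<Omega> \<Longrightarrow> (V x)^2 = 0" using V by (simp add: lip0_def)
      have m: "(\<lambda>x. (V x)^2) \<in> borel_measurable borel" using lip0_measurable[OF V] by simp
      have "integrable NN (\<lambda>x. (V x)^2)" using lip0_L2[OF V] by (simp add: L2_fun_def)
      then show "integrable lborel (\<lambda>x. (V x)^2)"
        using borel_rep_integral(1)[OF dom_sets(1) m z, of "\<lambda>x. (V x)^2"] by simp
      show "(\<epsilon> / 2)^2 * indicator (ball x r) y \<le> (V y)^2" for y
        using big[of y] assms power_mono[of "\<epsilon> / 2" "\<bar>V y\<bar>" 2] by (cases "y \<in> ball x r") auto
    qed
    also have "\<dots> = (\<integral>x. (V x)^2 \<partial>NN)"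
      using lip0_measurable[OF V] V by (intro lebesgue_on_integral_eq[symmetric]) (auto simp: lip0_def)
    finally show False using small by simp
  qed
  then show ?thesis using that \<delta> by blast
qed

lemma lip0_compact:
  assumes F: "\<And>n. F n \<in> lip0 M"
  obtains r V where "strict_mono (r :: nat \<Rightarrow> nat)" "V \<in> lip0 M"
    "\<And>\<epsilon>. \<epsilon> > 0 \<Longrightarrow> \<exists>N. \<forall>n\<ge>N. \<forall>x. \<bar>F (r n) x - V x\<bar> < \<epsilon>"
proof -
  have M0: "M \<ge> 0" using F[of 0] lipschitz_on_nonneg by (auto simp: lip0_def)
  obtain B where B: "\<And>V x. V \<in> lip0 M \<Longrightarrow> \<bar>V x\<bar> \<le> B" by (rule lip0_bounded) (rule that)
  have "compact (closure \<Omega>)" using bounded_dom by simp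
  then obtain g r where g: "continuous_on (closure \<Omega>) g" "strict_mono (r :: nat \<Rightarrow> nat)"
    "\<And>e. 0 < e \<Longrightarrow> \<exists>N. \<forall>n x. n \<ge> N \<and> x \<in> closure \<Omega> \<longrightarrow> norm (F (r n) x - g x) < e"
  proof (rule Arzela_Ascoli[of "closure \<Omega>" F B])
    show "norm (F n x) \<le> B" for n x using B[OF F] by simp
    fix x :: 'a and e :: real assume "x \<in> closure \<Omega>" "e > 0"
    then show "\<exists>d>0. \<forall>n y. y \<in> closure \<Omega> \<and> norm (x - y) < d \<longrightarrow> norm (F n x - F n y) < e"
    proof (intro exI[of _ "e / (M + 1)"] conjI allI impI)
      show "0 < e / (M + 1)" using \<open>e > 0\<close> M0 by simp
      fix n y assume y: "y \<in> closure \<Omega> \<and> norm (x - y) < e / (M + 1)"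
      have "norm (F n x - F n y) \<le> M * norm (x - y)" using lip0_le[OF F] by simp
      also have "\<dots> \<le> (M + 1) * norm (x - y)" by (intro mult_right_mono) auto
      also have "\<dots> < e" using y M0 by (simp add: field_simps)
      finally show "norm (F n x - F n y) < e" .
    qed
  qed (rule that)
  \<comment> \<open>Setting the limit to 0 off \<open>\<Omega>\<close>, where all members of the
    sequence vanish, extends the uniform convergence from the closure of \<open>\<Omega>\<close> to
    the whole space.\<close>
  define V where "V x = (if x \<in> \<Omega> then g x else 0)" for x
  have unif: "\<exists>N. \<forall>n\<ge>N. \<forall>x. \<bar>F (r n) x - V x\<bar> < \<epsilon>" if \<epsilon>: "\<epsilon> > 0" for \<epsilon>
  proof -
    obtain N where N: "\<And>n x. n \<ge> N \<Longrightarrow> x \<in> closure \<Omega> \<Longrightarrow> norm (F (r n) x - g x) < \<epsilon>"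
      using g(3)[OF \<epsilon>] by blast
    have "\<bar>F (r n) x - V x\<bar> < \<epsilon>" if "n \<ge> N" for n x
      using N[OF that, of x] F[of "r n"] \<epsilon> closure_subset[of \<Omega>] by (auto simp: V_def lip0_def)
    then show ?thesis by blast
  qed
  have lim: "(\<lambda>n. F (r n) x) \<longlonglongrightarrow> V x" for x
    unfolding LIMSEQ_def dist_norm using unif by (metis real_norm_def)
  have "V \<in> lip0 M" proof (rule lip0I[OF M0])
    show "\<bar>V x - V y\<bar> \<le> M * norm (x - y)" for x y
      by (rule LIMSEQ_le_const2[OF tendsto_rabs[OF tendsto_diff[OF lim lim]]]) (use lip0_le[OF F] in blast)
  qed (simp add: V_def)
  then show ?thesis using that g(2) unif by blast
qed

text \<open>Extended by zero, \<open>v\<close> has a weak gradient bounded by \<open>M\<close> on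
  the whole space, so by the translation lemma each fixed increment satisfies the Lipschitz estimate
  almost everywhere. Fubini turns this into an estimate between almost all pairs of points, which
  gives a Lipschitz function on a dense set and hence on its closure. The exterior balls force it to
  vanish off \<open>\<Omega>\<close>.\<close>

lemma H10_grad_lip0:
  assumes vG: "H10_grad v G" and GM: "AE x in NN. norm (G x) \<le> M" and M0: "M \<ge> 0"
  obtains V where "V \<in> lip0 M" "AE x in NN. V x = v x"
proof -
  obtain v0 where v0[measurable]: "v0 \<in> borel_measurable borel" and v00: "\<And>x. x \<notin> \<Omega> \<Longrightarrow> v0 x = 0"
    and v0eq: "AE x in NN. v x = v0 x"
    by (rule borel_rep[OF L2_measurable[OF H10_grad_L2(1)[OF vG]] dom_sets(1)]) (rule that)
  obtain G0 where G0[measurable]: "G0 \<in> borel_measurable borel" and G00: "\<And>x. x \<notin> \<Omega> \<Longrightarrow> G0 x = 0"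
    and G0eq: "AE x in NN. G x = G0 x"
    by (rule borel_rep[OF L2_measurable[OF H10_grad_L2(2)[OF vG]] dom_sets(1)]) (rule that)
  \<comment> \<open>The truncation makes the bound hold everywhere: the gradient will be integrated
    along segments, which are null sets where an almost everywhere bound says nothing.\<close>
  define G1 where "G1 x = (if norm (G0 x) \<le> M then G0 x else 0)" for x
  have G1[measurable]: "G1 \<in> borel_measurable borel" unfolding G1_def by measurable
  have G10: "G1 x = 0" if "x \<notin> \<Omega>" for x using G00[OF that] by (simp add: G1_def)
  have G1M: "norm (G1 x) \<le> M" for x using M0 by (simp add: G1_def)
  have G1eq: "AE x in NN. G x = G1 x" using G0eq GM by eventually_elim (simp add: G1_def)
  have int_v0: "integrable lborel v0"
    using borel_rep_integral(1)[OF dom_sets(1) v0 v00 v0eq] L2_integrable[OF dom_finite H10_grad_L2(1)[OF vG]] by simp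
  have int_G1: "integrable lborel G1"
    using borel_rep_integral(1)[OF dom_sets(1) G1 G10 G1eq] L2_integrable[OF dom_finite H10_grad_L2(2)[OF vG]] by simp
  have key: "AE x in lborel. \<bar>v0 (x + y) - v0 x\<bar> \<le> M * norm y" for y proof -
    have "AE z in lborel. z \<in> UNIV \<longrightarrow> v0 (z + 1 *\<^sub>R y) - v0 z = (\<integral>s. indicator {0..1} s * (G1 (z + s *\<^sub>R y) \<bullet> y) \<partial>lborel)"
    proof (rule translation_lemma[where S=UNIV])
      show "integrable lborel (\<lambda>x. G1 x \<bullet> y)" using int_G1 by simp
      fix \<psi> :: "'a \<Rightarrow> real" assume \<psi>: "test_function UNIV \<psi>"
      have s\<psi>: "smooth \<psi>" by (rule test_function_smooth[OF \<psi>])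
      note [measurable] = smooth_measurable[OF s\<psi>] smooth_grad_borel_measurable[OF s\<psi>]
      have "(\<integral>x. v0 x * frechet_derivative \<psi> (at x) y \<partial>lborel) = (\<integral>x. v0 x * (grad \<psi> x \<bullet> y) \<partial>lborel)"
        by (simp add: GDERIV_grad(2)[OF smooth_differentiable[OF s\<psi>]])
      also have "\<dots> = (\<integral>x. v x * (grad \<psi> x \<bullet> y) \<partial>NN)"
        by (rule borel_rep_integral(2)[symmetric]) (use v0eq v00 in \<open>auto elim: eventually_mono\<close>)
      also have "\<dots> = - (\<integral>x. \<psi> x * (G x \<bullet> y) \<partial>NN)" by (rule H10_grad_by_parts[OF vG \<psi>])
      also have "(\<integral>x. \<psi> x * (G x \<bullet> y) \<partial>NN) = (\<integral>x. (G1 x \<bullet> y) * \<psi> x \<partial>lborel)"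
        by (rule borel_rep_integral(2)) (use G1eq G10 in \<open>auto elim: eventually_mono\<close>)
      finally show "(\<integral>x. v0 x * frechet_derivative \<psi> (at x) y \<partial>lborel) = - (\<integral>x. (G1 x \<bullet> y) * \<psi> x \<partial>lborel)" .
    qed (use int_v0 in auto)
    then show ?thesis proof eventually_elim
      case (elim x)
      have bd: "\<bar>indicator {0..1} s * (G1 (x + s *\<^sub>R y) \<bullet> y)\<bar> \<le> indicator {0..1} s * (M * norm y)" for s :: real
        using Cauchy_Schwarz_ineq2[of "G1 (x + s *\<^sub>R y)" y] mult_right_mono[OF G1M[of "x + s *\<^sub>R y"], of "norm y"]
        by (auto split: split_indicator)
      have "\<bar>v0 (x + y) - v0 x\<bar> = \<bar>\<integral>s. indicator {0..1} s * (G1 (x + s *\<^sub>R y) \<bullet> y) \<partial>lborel\<bar>" using elim by simp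
      also have "\<dots> \<le> (\<integral>s. \<bar>indicator {0..1} s * (G1 (x + s *\<^sub>R y) \<bullet> y)\<bar> \<partial>lborel)" by (rule integral_abs_bound)
      also have "\<dots> \<le> (\<integral>s. indicator {0..1::real} s * (M * norm y) \<partial>lborel)"
        using bd M0 by (intro integral_mono_AE') auto
      finally show ?case by simp
    qed
  qed
  \<comment> \<open>The exceptional set in \<open>key\<close> depends on the increment; joint
    measurability allows the roles of point and increment to be exchanged.\<close>
  have "AE z in lborel. \<bar>v0 (fst z + snd z) - v0 (fst z)\<bar> \<le> M * norm (snd z)" proof (rule AE_lborel_pairI(2))
    have "(\<lambda>z::'a\<times>'a. \<bar>v0 (fst z + snd z) - v0 (fst z)\<bar> - M * norm (snd z)) \<in> borel_measurable borel"
      unfolding borel_prod[symmetric] by measurable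
    from measurable_sets[OF this, of "{..0}"]
    have "{z::'a\<times>'a. \<bar>v0 (fst z + snd z) - v0 (fst z)\<bar> - M * norm (snd z) \<le> 0} \<in> sets borel"
      by (simp add: vimage_def)
    then show "{z::'a\<times>'a. \<bar>v0 (fst z + snd z) - v0 (fst z)\<bar> \<le> M * norm (snd z)} \<in> sets borel" by simp
  qed (use key in simp)
  from AE_lborel_pair(1)[OF this] have "AE x in lborel. AE y in lborel. \<bar>v0 (x + y) - v0 x\<bar> \<le> M * norm y" by simp
  then have good: "AE x in lborel. AE z in lborel. \<bar>v0 z - v0 x\<bar> \<le> M * norm (z - x)" proof eventually_elim
    case (elim x)
    from AE_lborel_translate[OF this, of "-x"] show ?case by simp
  qed
  \<comment> \<open>For two points of \<open>A\<close> almost every \<open>z\<close> is good for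
    both, so they can be compared through some \<open>z\<close> close to \<open>x\<close>.\<close>
  define A where "A = {x. AE z in lborel. \<bar>v0 z - v0 x\<bar> \<le> M * norm (z - x)}"
  have lipA: "M-lipschitz_on A v0" proof (rule lipschitz_onI)
    fix x y assume "x \<in> A" "y \<in> A"
    then have ae: "AE z in lborel. \<bar>v0 z - v0 x\<bar> \<le> M * norm (z - x) \<and> \<bar>v0 z - v0 y\<bar> \<le> M * norm (z - y)"
      by (simp add: A_def)
    show "dist (v0 x) (v0 y) \<le> M * dist x y" proof (rule field_le_epsilon)
      fix e :: real assume e: "e > 0"
      define d where "d = (e / 2) / (M + 1)"
      have d: "d > 0" using e M0 by (simp add: d_def)
      obtain z where z: "z \<in> ball x d" "\<bar>v0 z - v0 x\<bar> \<le> M * norm (z - x)" "\<bar>v0 z - v0 y\<bar> \<le> M * norm (z - y)"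
        by (rule AE_lborel_dense[OF ae d]) (use that in blast)
      have zx: "norm (z - x) \<le> d" using z(1) by (simp add: dist_norm norm_minus_commute)
      have "norm (z - y) \<le> norm (z - x) + norm (x - y)" using norm_triangle_ineq[of "z - x" "x - y"] by simp
      then have "M * norm (z - y) \<le> M * (d + norm (x - y))" using M0 zx by (intro mult_left_mono) auto
      moreover have "M * norm (z - x) \<le> M * d" using M0 zx by (intro mult_left_mono)
      moreover have "2 * (M * d) \<le> e" proof -
        have "2 * (M * d) \<le> 2 * ((M + 1) * d)" using d by (intro mult_left_mono mult_right_mono) auto
        also have "(M + 1) * d = e / 2" proof -
          have K: "K * (e / 2 / K) = e / 2" if "K \<noteq> 0" for K :: real using that by simp
          show ?thesis unfolding d_def by (rule K) (use M0 in linarith)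
        qed
        also have "2 * (e / 2) = e" by simp
        finally show ?thesis .
      qed
      ultimately show "dist (v0 x) (v0 y) \<le> M * dist x y + e" using z(2,3) by (simp add: dist_norm distrib_left)
    qed
  qed (rule M0)
  have "closure A = UNIV" proof -
    have "x \<in> closure A" for x unfolding closure_approachable proof (intro allI impI)
      fix e :: real assume "e > 0"
      then obtain z where "z \<in> ball x e" "AE y in lborel. \<bar>v0 y - v0 z\<bar> \<le> M * norm (y - z)"
        by (rule AE_lborel_dense[OF good])
      then show "\<exists>y\<in>A. dist y x < e" by (auto simp: A_def dist_commute)
    qed
    then show ?thesis by blast
  qed
  then obtain V where V: "M-lipschitz_on UNIV V" "\<And>x. x \<in> A \<Longrightarrow> V x = v0 x"
    using lipschitz_extend_closure[OF lipA] by auto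
  have AEA: "AE x in lborel. V x = v0 x" using good by eventually_elim (use V(2) in \<open>auto simp: A_def\<close>)
  \<comment> \<open>Near \<open>p\<close> there is a ball off \<open>\<Omega>\<close>, in which some
    point has \<open>V = v0 = 0\<close>; at distance less than \<open>e\<close> the Lipschitz bound
    contradicts the size of \<open>V p\<close>.\<close>
  have V0: "V p = 0" if p: "p \<notin> \<Omega>" for p proof (rule ccontr)
    assume np: "V p \<noteq> 0"
    define e where "e = \<bar>V p\<bar> / (M + 1)"
    have e: "e > 0" using np M0 by (simp add: e_def)
    obtain q \<delta> where q: "\<delta> > 0" "ball q \<delta> \<subseteq> ball p e" "ball q \<delta> \<inter> \<Omega> = {}"
      by (rule lipschitz_boundary_exterior[OF lipschitz_dom open_dom p e]) (rule that)
    obtain z where z: "z \<in> ball q \<delta>" "V z = v0 z" by (rule AE_lborel_dense[OF AEA q(1)]) (rule that)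
    have "z \<notin> \<Omega>" using z(1) q(3) by blast
    then have "V z = 0" using z(2) v00 by simp
    moreover have "z \<in> ball p e" using z q by blast
    ultimately have "\<bar>V p\<bar> \<le> M * dist p z" "dist p z < e"
      using lipschitz_onD[OF V(1), of p z] by (auto simp: dist_real_def)
    moreover have "M * dist p z \<le> (M + 1) * dist p z" by (intro mult_right_mono) auto
    moreover have "(M + 1) * dist p z < (M + 1) * e" using \<open>dist p z < e\<close> M0 by (intro mult_strict_left_mono) auto
    moreover have "(M + 1) * e = \<bar>V p\<bar>" using M0 by (simp add: e_def)
    ultimately show False by linarith
  qed
  have "AE x in lborel. x \<in> \<Omega> \<longrightarrow> V x = v0 x" using AEA by eventually_elim simp
  then have "AE x in NN. V x = v0 x" by (simp add: AE_lebesgue_on_iff)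
  then have "AE x in NN. V x = v x" using v0eq by eventually_elim simp
  moreover have "V \<in> lip0 M" using V(1) V0 by (simp add: lip0_def)
  ultimately show ?thesis using that by blast
qed

text \<open>The admissible functions through their Lipschitz representatives; \<open>M\<close> is
  meant to be an upper bound of \<gamma>, so that by \<open>constraint_set_Kset\<close> nothing is
  lost up to null sets.\<close>

definition Kset :: "real \<Rightarrow> ('a \<Rightarrow> real) \<Rightarrow> ('a \<Rightarrow> real) set" where
  "Kset M \<gamma> = lip0 M \<inter> constraint_set \<Omega> \<gamma>"

lemma constraint_set_cong_AE:
  assumes "v \<in> constraint_set \<Omega> \<gamma>" "AE x in NN. v x = v' x" "v' \<in> borel_measurable NN"
  shows "v' \<in> constraint_set \<Omega> \<gamma>"
proof -
  obtain G where G: "H10_grad v G" "AE x in NN. norm (G x) \<le> \<gamma> x" using assms(1) unfolding constraint_set_iff by blast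
  have "H10_grad v' G" by (rule H10_grad_cong_AE[OF G(1) assms(2,3) _ L2_measurable[OF H10_grad_L2(2)[OF G(1)]]]) simp
  then show ?thesis using G(2) unfolding constraint_set_iff by blast
qed

lemma constraint_set_Kset:
  assumes v: "v \<in> constraint_set \<Omega> \<gamma>" and \<gamma>: "AE x in NN. \<gamma> x \<le> M" and M0: "M \<ge> 0"
  obtains V where "V \<in> Kset M \<gamma>" "AE x in NN. V x = v x"
proof -
  obtain G where G: "H10_grad v G" "AE x in NN. norm (G x) \<le> \<gamma> x" using v unfolding constraint_set_iff by blast
  have "AE x in NN. norm (G x) \<le> M" using G(2) \<gamma> by eventually_elim simp
  then obtain V where V: "V \<in> lip0 M" "AE x in NN. V x = v x" by (rule H10_grad_lip0[OF G(1) _ M0]) (rule that)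
  have "AE x in NN. v x = V x" using V(2) by eventually_elim simp
  then have "V \<in> constraint_set \<Omega> \<gamma>"
    using V(1) by (intro constraint_set_cong_AE[OF v] lebesgue_onI lip0_measurable)
  then show ?thesis using that V by (simp add: Kset_def)
qed

lemma Kset_convex:
  assumes "U \<in> Kset M \<gamma>" "V \<in> Kset M \<gamma>" "0 \<le> s" "s \<le> 1"
  shows "(\<lambda>x. (1 - s) * U x + s * V x) \<in> Kset M \<gamma>"
proof -
  obtain G H where G: "H10_grad U G" "AE x in NN. norm (G x) \<le> \<gamma> x"
    and H: "H10_grad V H" "AE x in NN. norm (H x) \<le> \<gamma> x"
    using assms(1,2) unfolding Kset_def Int_iff constraint_set_iff by blast
  have "AE x in NN. norm ((1 - s) *\<^sub>R G x + s *\<^sub>R H x) \<le> \<gamma> x" using G(2) H(2) proof eventually_elim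
    case (elim x)
    have "norm ((1 - s) *\<^sub>R G x + s *\<^sub>R H x) \<le> (1 - s) * norm (G x) + s * norm (H x)"
      using norm_triangle_ineq[of "(1 - s) *\<^sub>R G x" "s *\<^sub>R H x"] assms by simp
    also have "\<dots> \<le> (1 - s) * \<gamma> x + s * \<gamma> x" using assms elim by (intro add_mono mult_left_mono) auto
    finally show ?case by (simp add: algebra_simps)
  qed
  then have "(\<lambda>x. (1 - s) * U x + s * V x) \<in> constraint_set \<Omega> \<gamma>"
    using H10_grad_linear[OF G(1) H(1), of "1 - s" s] unfolding constraint_set_iff by blast
  moreover have "(\<lambda>x. (1 - s) * U x + s * V x) \<in> lip0 M"
    using lip0_linear[of U M V "1 - s" s] assms by (simp add: Kset_def)
  ultimately show ?thesis by (simp add: Kset_def)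
qed

lemma Kset_compact:
  assumes F: "\<And>n. F n \<in> Kset M \<gamma>" and \<gamma>: "AE x in NN. \<gamma> x \<le> M"
  obtains r V where "strict_mono (r :: nat \<Rightarrow> nat)" "V \<in> Kset M \<gamma>"
    "\<And>\<epsilon>. \<epsilon> > 0 \<Longrightarrow> \<exists>N. \<forall>n\<ge>N. \<forall>x. \<bar>F (r n) x - V x\<bar> < \<epsilon>"
proof -
  have FL: "F n \<in> lip0 M" for n using F by (simp add: Kset_def)
  obtain r V where rV: "strict_mono (r :: nat \<Rightarrow> nat)" "V \<in> lip0 M"
    "\<And>\<epsilon>. \<epsilon> > 0 \<Longrightarrow> \<exists>N. \<forall>n\<ge>N. \<forall>x. \<bar>F (r n) x - V x\<bar> < \<epsilon>"
    by (rule lip0_compact[of F M, OF FL]) (rule that)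
  have "\<exists>G. H10_grad (F (r n)) G \<and> (AE x in NN. norm (G x) \<le> \<gamma> x)" for n
    using F[of "r n"] unfolding Kset_def Int_iff constraint_set_iff by blast
  then have "\<exists>G. \<forall>n. H10_grad (F (r n)) (G n) \<and> (AE x in NN. norm (G n x) \<le> \<gamma> x)"
    by (intro choice allI)
  then obtain G where G: "\<And>n. H10_grad (F (r n)) (G n)" "\<And>n. AE x in NN. norm (G n x) \<le> \<gamma> x" by blast
  have "V \<in> constraint_set \<Omega> \<gamma>" proof (rule H10_grad_uniform_limit[OF G \<gamma> lip0_L2[OF rV(2)]])
    fix \<epsilon> :: real assume "\<epsilon> > 0"
    then obtain N where "\<forall>n\<ge>N. \<forall>x. \<bar>F (r n) x - V x\<bar> < \<epsilon>" using rV(3) by blast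
    then show "\<exists>N. \<forall>n\<ge>N. AE x in NN. \<bar>F (r n) x - V x\<bar> \<le> \<epsilon>"
      by (intro exI[of _ N]) (auto intro: less_imp_le)
  qed
  then show ?thesis using that[of r V] rV by (simp add: Kset_def)
qed

end

subsection \<open>Weak time derivatives\<close>

lemma cylinder_sets [simp]: "open \<Omega> \<Longrightarrow> cylinder \<Omega> T \<in> sets borel"
  unfolding cylinder_def by (intro borel_open open_Times) auto

lemma cylinder_open: "open \<Omega> \<Longrightarrow> open (cylinder \<Omega> T)"
  unfolding cylinder_def by (intro open_Times) auto

lemma cylinder_bounded: "bounded \<Omega> \<Longrightarrow> bounded (cylinder \<Omega> T)"
  unfolding cylinder_def by (intro bounded_Times) auto

lemma deriv_section:
  fixes \<phi> :: "'a::euclidean_space \<times> real \<Rightarrow> real"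
  assumes "smooth \<phi>"
  shows "((\<lambda>s. \<phi> (x, s)) has_real_derivative frechet_derivative \<phi> (at (x, t)) (0, 1)) (at t)"
    and "deriv (\<lambda>s. \<phi> (x, s)) t = frechet_derivative \<phi> (at (x, t)) (0, 1)"
proof -
  show 1: "((\<lambda>s. \<phi> (x, s)) has_real_derivative frechet_derivative \<phi> (at (x, t)) (0, 1)) (at t)"
    using smooth_line_derivative[OF assms, of "(x, 0)" "(0, 1)" t] by simp
  from this show "deriv (\<lambda>s. \<phi> (x, s)) t = frechet_derivative \<phi> (at (x, t)) (0, 1)" by (rule DERIV_imp_deriv)
qed

lemma AE_interval_pick:
  fixes a b s \<delta> :: real
  assumes "AE t in lebesgue_on {a<..<b}. P t" "a < b" "s \<in> {a..b}" "\<delta> > 0"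
  obtains \<tau> where "\<tau> \<in> {a<..<b}" "\<bar>\<tau> - s\<bar> < \<delta>" "P \<tau>"
proof -
  have ae: "AE t in lborel. t \<in> {a<..<b} \<longrightarrow> P t" using assms(1) by (simp add: AE_lebesgue_on_iff)
  define lo hi where "lo = max a (s - \<delta>)" and "hi = min b (s + \<delta>)"
  have lh: "lo < hi" using assms by (auto simp: lo_def hi_def)
  obtain \<tau> where \<tau>: "\<tau> \<in> ball ((lo + hi) / 2) ((hi - lo) / 2)" "\<tau> \<in> {a<..<b} \<longrightarrow> P \<tau>"
    by (rule AE_lborel_dense[OF ae, of "(hi - lo) / 2" "(lo + hi) / 2"]) (use lh in auto)
  have "lo < \<tau>" "\<tau> < hi" using \<tau>(1) by (auto simp: dist_real_def abs_if field_simps split: if_splits)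
  then show ?thesis using that[of \<tau>] \<tau>(2) by (auto simp: lo_def hi_def)
qed

lemma AE_le_of_approx:
  assumes "\<And>\<epsilon>. \<epsilon> > 0 \<Longrightarrow> AE x in M. f x \<le> g x + (\<epsilon>::real)"
  shows "AE x in M. f x \<le> g x"
proof -
  have "AE x in M. \<forall>n::nat. f x \<le> g x + 1 / real (Suc n)" by (subst AE_all_countable) (use assms in simp)
  then show ?thesis proof eventually_elim
    case (elim x)
    have "(\<lambda>n. g x + 1 / real (Suc n)) \<longlonglongrightarrow> g x + 0"
      by (intro tendsto_intros LIMSEQ_Suc[OF lim_1_over_n])
    then show ?case using LIMSEQ_le_const[of "\<lambda>n. g x + 1 / real (Suc n)" "g x" "f x"] elim by simp
  qed
qed

context bounded_domain
begin

text \<open>The translation lemma in direction (0, 1), with both orders of the almost everywhere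
  quantifiers. A fixed Borel representative \<open>w'\<close> is needed because the right-hand side
  integrates along a single vertical line.\<close>

lemma weak_dt_increment:
  assumes T: "T > 0" and u: "has_weak_dt \<Omega> T u w"
    and iu: "integrable (lebesgue_on (cylinder \<Omega> T)) u" and iw: "integrable (lebesgue_on (cylinder \<Omega> T)) w"
    and w': "w' \<in> borel_measurable borel" "\<And>z. z \<notin> cylinder \<Omega> T \<Longrightarrow> w' z = 0"
      "AE z in lebesgue_on (cylinder \<Omega> T). w z = w' z"
    and h: "h > 0"
  shows "AE t in lebesgue_on {0<..<T - h}. AE x in NN.
     u (x, t + h) - u (x, t) = (\<integral>s. indicator {0..h} s * w' (x, t + s) \<partial>lborel)"
    and "AE x in NN. AE t in lebesgue_on {0<..<T - h}.
     u (x, t + h) - u (x, t) = (\<integral>s. indicator {0..h} s * w' (x, t + s) \<partial>lborel)"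
proof -
  let ?Q = "cylinder \<Omega> T" and ?LQ = "lebesgue_on (cylinder \<Omega> T)"
  have Q: "?Q \<in> sets borel" using open_dom by simp
  obtain u' where u': "u' \<in> borel_measurable borel" "\<And>z. z \<notin> ?Q \<Longrightarrow> u' z = 0"
      "AE z in ?LQ. u z = u' z" by (rule borel_rep[OF borel_measurable_integrable[OF iu] Q]) (rule that)
  note [measurable] = u'(1) w'(1)
  have iu': "integrable lborel u'" using borel_rep_integral(1)[OF Q u'] iu by simp
  have iw': "integrable lborel w'" using borel_rep_integral(1)[OF Q w'] iw by simp
  have "AE z in lborel. z \<in> \<Omega> \<times> {0<..<T - h} \<longrightarrow>
      u' (z + h *\<^sub>R (0, 1)) - u' z = (\<integral>s. indicator {0..h} s * w' (z + s *\<^sub>R (0, 1)) \<partial>lborel)"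
  proof (rule translation_lemma[OF _ iu' iw' h])
    show "open (\<Omega> \<times> {0<..<T - h})" using open_dom by (intro open_Times) auto
    show "z + s *\<^sub>R (0, 1) \<in> ?Q" if "z \<in> \<Omega> \<times> {0<..<T - h}" "s \<in> {0..h}" for z s
      using that by (auto simp: cylinder_def)
    fix \<phi> assume \<phi>: "test_function ?Q \<phi>"
    have sm: "smooth \<phi>" by (rule test_function_smooth[OF \<phi>])
    note [measurable] = smooth_measurable[OF sm] smooth_measurable[OF smooth_frechet_derivative[OF sm, of "(0, 1)"]]
    have "(\<integral>z. u' z * frechet_derivative \<phi> (at z) (0, 1) \<partial>lborel) = (\<integral>z. u z * frechet_derivative \<phi> (at z) (0, 1) \<partial>?LQ)"
      by (rule borel_rep_integral(2)[OF Q, symmetric]) (use u' in \<open>auto elim: eventually_mono\<close>)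
    also have "\<dots> = (\<integral>z. u z * deriv (\<lambda>s. \<phi> (fst z, s)) (snd z) \<partial>?LQ)"
      by (simp add: deriv_section(2)[OF sm])
    also have "\<dots> = - (\<integral>z. w z * \<phi> z \<partial>?LQ)" using u \<phi> unfolding has_weak_dt_def by simp
    also have "(\<integral>z. w z * \<phi> z \<partial>?LQ) = (\<integral>z. w' z * \<phi> z \<partial>lborel)"
      by (rule borel_rep_integral(2)[OF Q]) (use w' in \<open>auto elim: eventually_mono\<close>)
    finally show "(\<integral>z. u' z * frechet_derivative \<phi> (at z) (0, 1) \<partial>lborel) = - (\<integral>z. w' z * \<phi> z \<partial>lborel)" .
  qed
  moreover have ae: "AE z in lborel. z \<in> ?Q \<longrightarrow> u z = u' z" using u'(3) by (simp add: AE_lebesgue_on_iff[OF Q])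
  moreover have "AE z in lborel. z + (0, h) \<in> ?Q \<longrightarrow> u (z + (0, h)) = u' (z + (0, h))"
    by (rule AE_lborel_translate[OF ae])
  ultimately have "AE z in lborel. z \<in> \<Omega> \<times> {0<..<T - h} \<longrightarrow>
      u (fst z, snd z + h) - u z = (\<integral>s. indicator {0..h} s * w' (fst z, snd z + s) \<partial>lborel)"
  proof eventually_elim
    case (elim z)
    show ?case proof
      assume "z \<in> \<Omega> \<times> {0<..<T - h}"
      then obtain x t where "z = (x, t)" "x \<in> \<Omega>" "0 < t" "t < T - h" by auto
      then show "u (fst z, snd z + h) - u z = (\<integral>s. indicator {0..h} s * w' (fst z, snd z + s) \<partial>lborel)"
        using elim h by (simp add: cylinder_def)
    qed
  qed
  then have "AE z in lebesgue_on (\<Omega> \<times> {0<..<T - h}).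
      u (fst z, snd z + h) - u z = (\<integral>s. indicator {0..h} s * w' (fst z, snd z + s) \<partial>lborel)"
    by (subst AE_lebesgue_on_iff) (auto intro!: borel_Times)
  from AE_lebesgue_on_pair[OF dom_sets(1) _ this] show "AE t in lebesgue_on {0<..<T - h}. AE x in NN.
     u (x, t + h) - u (x, t) = (\<integral>s. indicator {0..h} s * w' (x, t + s) \<partial>lborel)"
   "AE x in NN. AE t in lebesgue_on {0<..<T - h}.
     u (x, t + h) - u (x, t) = (\<integral>s. indicator {0..h} s * w' (x, t + s) \<partial>lborel)" by simp_all
qed

text \<open>\<open>C\<close> bounds the weak time derivative and \<open>M\<close> bounds
  \<open>g\<close> from above. Almost everywhere in the cylinder these bounds hold for almost every
  time only; continuity into the space of bounded functions upgrades them to every time, the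
  endpoints included.\<close>

lemma W1inf_Linf_bounds:
  assumes T: "T > 0" and g: "in_W1inf_Linf \<Omega> T g" and m: "AE z in lebesgue_on (cylinder \<Omega> T). g z \<ge> m"
  obtains C M where "C \<ge> 0" "M \<ge> 0"
    "\<And>t. t \<in> {0..T} \<Longrightarrow> AE x in NN. m \<le> g (x, t) \<and> g (x, t) \<le> M"
    "\<And>s t. s \<in> {0..T} \<Longrightarrow> t \<in> {0..T} \<Longrightarrow> AE x in NN. \<bar>g (x, t) - g (x, s)\<bar> \<le> C * \<bar>t - s\<bar>"
proof -
  let ?Q = "cylinder \<Omega> T" and ?LQ = "lebesgue_on (cylinder \<Omega> T)"
  have Q: "?Q \<in> sets borel" using open_dom by simp
  obtain w where w: "has_weak_dt \<Omega> T g w" "in_Linf ?Q w" and gL: "in_Linf ?Q g" using g unfolding in_W1inf_Linf_def by blast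
  have cont: "\<exists>\<delta>>0. \<forall>s\<in>{0..T}. \<bar>s - t\<bar> < \<delta> \<longrightarrow> (AE x in NN. \<bar>g (x, s) - g (x, t)\<bar> \<le> \<epsilon>)"
    if "t \<in> {0..T}" "\<epsilon> > 0" for t \<epsilon> using g that unfolding in_W1inf_Linf_def by blast
  obtain M0 where M0: "AE z in ?LQ. norm (g z) \<le> M0" and gm: "g \<in> borel_measurable ?LQ"
    using gL unfolding in_Linf_def by blast
  obtain C0 where C0: "AE z in ?LQ. norm (w z) \<le> C0" and wm: "w \<in> borel_measurable ?LQ"
    using w(2) unfolding in_Linf_def by blast
  define C where "C = max 0 C0"
  define M where "M = max 0 M0"
  have C: "C \<ge> 0" and M: "M \<ge> 0" by (auto simp: C_def M_def)
  have ig: "integrable ?LQ g" by (rule integrable_bounded_set[OF Q cylinder_bounded[OF bounded_dom] gm M0])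
  have iw: "integrable ?LQ w" by (rule integrable_bounded_set[OF Q cylinder_bounded[OF bounded_dom] wm C0])
  obtain w0 where w0: "w0 \<in> borel_measurable borel" "\<And>z. z \<notin> ?Q \<Longrightarrow> w0 z = 0"
      "AE z in ?LQ. w z = w0 z" by (rule borel_rep[OF wm Q]) (rule that)
  \<comment> \<open>Truncated so that the bound by \<open>C\<close> holds on every vertical
    line.\<close>
  define w1 where "w1 z = (if \<bar>w0 z\<bar> \<le> C then w0 z else 0)" for z
  have w1: "w1 \<in> borel_measurable borel" "\<And>z. z \<notin> ?Q \<Longrightarrow> w1 z = 0"
    unfolding w1_def[abs_def] using w0(1,2) by auto
  have w1eq: "AE z in ?LQ. w z = w1 z" using w0(3) C0 by eventually_elim (auto simp: w1_def C_def)
  have w1C: "\<bar>w1 z\<bar> \<le> C" for z using C by (simp add: w1_def)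
  have inc: "AE t in lebesgue_on {0<..<T - h}. AE x in NN. \<bar>g (x, t + h) - g (x, t)\<bar> \<le> C * h" if h: "h > 0" for h
  proof -
    have "AE t in lebesgue_on {0<..<T - h}. AE x in NN.
       g (x, t + h) - g (x, t) = (\<integral>s. indicator {0..h} s * w1 (x, t + s) \<partial>lborel)"
      by (rule weak_dt_increment(1)[OF T w(1) ig iw w1(1) _ w1eq h]) (rule w1(2))
    then show ?thesis proof eventually_elim
    case (elim t)
    then show ?case proof eventually_elim
      case (elim x)
      have "\<bar>\<integral>s. indicator {0..h} s * w1 (x, t + s) \<partial>lborel\<bar> \<le> (\<integral>s. \<bar>indicator {0..h} s * w1 (x, t + s)\<bar> \<partial>lborel)"
        by (rule integral_abs_bound)
      also have "\<dots> \<le> (\<integral>s. indicator {0..h} s * C \<partial>lborel)"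
        using w1C C h by (intro integral_mono_AE') (auto split: split_indicator)
      also have "\<dots> = C * h" using h by simp
      finally show ?case using elim by simp
    qed
  qed
  qed
  have lip1: "AE x in NN. \<bar>g (x, s + h) - g (x, s)\<bar> \<le> C * h" if sh: "0 \<le> s" "0 < h" "s + h \<le> T" "h < T" for s h
  proof (rule AE_le_of_approx)
    fix \<epsilon> :: real assume "\<epsilon> > 0"
    then have e2: "\<epsilon> / 2 > 0" by simp
    have sT: "s \<in> {0..T}" "s + h \<in> {0..T}" using sh by auto
    obtain \<delta>1 where \<delta>1: "\<delta>1 > 0" "\<And>r. r \<in> {0..T} \<Longrightarrow> \<bar>r - s\<bar> < \<delta>1 \<Longrightarrow> AE x in NN. \<bar>g (x, r) - g (x, s)\<bar> \<le> \<epsilon> / 2"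
      using cont[OF sT(1) e2] by blast
    obtain \<delta>2 where \<delta>2: "\<delta>2 > 0" "\<And>r. r \<in> {0..T} \<Longrightarrow> \<bar>r - (s + h)\<bar> < \<delta>2 \<Longrightarrow> AE x in NN. \<bar>g (x, r) - g (x, s + h)\<bar> \<le> \<epsilon> / 2"
      using cont[OF sT(2) e2] by blast
    \<comment> \<open>A good time \<tau> near \<open>s\<close>, so that both \<tau> and \<tau> + h
      are close to the prescribed times.\<close>
    obtain \<tau> where \<tau>: "\<tau> \<in> {0<..<T - h}" "\<bar>\<tau> - s\<bar> < min \<delta>1 \<delta>2" "AE x in NN. \<bar>g (x, \<tau> + h) - g (x, \<tau>)\<bar> \<le> C * h"
      by (rule AE_interval_pick[OF inc[OF sh(2)], of s "min \<delta>1 \<delta>2"]) (use sh \<delta>1 \<delta>2 in auto)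
    have a: "AE x in NN. \<bar>g (x, \<tau>) - g (x, s)\<bar> \<le> \<epsilon> / 2" by (rule \<delta>1(2)) (use \<tau> sh in auto)
    have b: "AE x in NN. \<bar>g (x, \<tau> + h) - g (x, s + h)\<bar> \<le> \<epsilon> / 2" by (rule \<delta>2(2)) (use \<tau> sh in auto)
    from a b \<tau>(3) show "AE x in NN. \<bar>g (x, s + h) - g (x, s)\<bar> \<le> C * h + \<epsilon>" by eventually_elim linarith
  qed
  have lip2: "AE x in NN. \<bar>g (x, s + h) - g (x, s)\<bar> \<le> C * h" if sh: "0 \<le> s" "0 < h" "s + h \<le> T" for s h
  proof (cases "h < T")
    case False
    \<comment> \<open>For an increment of the full length \<open>T\<close> the interval of good
      starting times is empty; the increment is split at \<open>T / 2\<close>.\<close>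
    then have "s = 0" "h = T" using sh by auto
    have "AE x in NN. \<bar>g (x, 0 + T / 2) - g (x, 0)\<bar> \<le> C * (T / 2)" by (rule lip1) (use T in auto)
    moreover have "AE x in NN. \<bar>g (x, T / 2 + T / 2) - g (x, T / 2)\<bar> \<le> C * (T / 2)" by (rule lip1) (use T in auto)
    ultimately show ?thesis unfolding \<open>s = 0\<close> \<open>h = T\<close> proof eventually_elim
      case (elim x)
      have "T / 2 + T / 2 = T" by simp
      with elim show ?case by (simp only: add_0)
    qed
  qed (use lip1 sh in blast)
  have lip: "AE x in NN. \<bar>g (x, t) - g (x, s)\<bar> \<le> C * \<bar>t - s\<bar>" if "s \<in> {0..T}" "t \<in> {0..T}" for s t
  proof -
    consider "s < t" | "t < s" | "s = t" by linarith
    then show ?thesis proof cases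
      case 1
      then show ?thesis using lip2[of s "t - s"] that by simp
    next
      case 2
      then show ?thesis using lip2[of t "s - t"] that by (simp add: abs_minus_commute)
    qed (use C in simp)
  qed
  have mM: "AE t in lebesgue_on {0<..<T}. AE x in NN. m \<le> g (x, t) \<and> g (x, t) \<le> M" proof -
    have "AE z in lebesgue_on (\<Omega> \<times> {0<..<T}). m \<le> g z \<and> g z \<le> M"
      using m M0 unfolding cylinder_def by eventually_elim (auto simp: M_def)
    then show ?thesis by (intro AE_lebesgue_on_pair(2)) auto
  qed
  have mM': "AE x in NN. m \<le> g (x, t) \<and> g (x, t) \<le> M" if t: "t \<in> {0..T}" for t proof -
    have near: "AE x in NN. m \<le> g (x, t) + \<epsilon> \<and> g (x, t) \<le> M + \<epsilon>" if \<epsilon>: "\<epsilon> > 0" for \<epsilon>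
    proof -
      obtain \<delta> where \<delta>: "\<delta> > 0" "\<And>r. r \<in> {0..T} \<Longrightarrow> \<bar>r - t\<bar> < \<delta> \<Longrightarrow> AE x in NN. \<bar>g (x, r) - g (x, t)\<bar> \<le> \<epsilon>"
        using cont[OF t \<epsilon>] by blast
      obtain \<tau> where \<tau>: "\<tau> \<in> {0<..<T}" "\<bar>\<tau> - t\<bar> < \<delta>" "AE x in NN. m \<le> g (x, \<tau>) \<and> g (x, \<tau>) \<le> M"
        by (rule AE_interval_pick[OF mM T t \<delta>(1)]) (rule that)
      have "AE x in NN. \<bar>g (x, \<tau>) - g (x, t)\<bar> \<le> \<epsilon>" by (rule \<delta>(2)) (use \<tau> in auto)
      with \<tau>(3) show ?thesis by eventually_elim (auto simp: abs_le_iff)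
    qed
    have "AE x in NN. m \<le> g (x, t)" by (rule AE_le_of_approx) (use near in \<open>auto elim: eventually_mono\<close>)
    moreover have "AE x in NN. g (x, t) \<le> M" by (rule AE_le_of_approx) (use near in \<open>auto elim: eventually_mono\<close>)
    ultimately show ?thesis by eventually_elim simp
  qed
  show ?thesis using that[OF C M mM' lip] by blast
qed

end

section \<open>Squares of primitives\<close>

lemma double_integral_triangle:
  fixes f r :: "real \<Rightarrow> real"
  assumes f: "integrable lborel f" and r: "integrable lborel r"
  shows "integrable lborel (\<lambda>t. r t * (\<integral>s. indicator {..t} s * f s \<partial>lborel))"
    and "(\<integral>t. r t * (\<integral>s. indicator {..t} s * f s \<partial>lborel) \<partial>lborel)
       = (\<integral>s. f s * (\<integral>t. indicator {s..} t * r t \<partial>lborel) \<partial>lborel)"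
proof -
  have [measurable]: "f \<in> borel_measurable borel" "r \<in> borel_measurable borel" using f r by auto
  have [measurable]: "(\<lambda>(t, s). indicator {..t} s :: real) \<in> borel_measurable (lborel \<Otimes>\<^sub>M (lborel :: real measure))"
  proof -
    have "(\<lambda>(t, s). indicator {..t} s :: real) = indicator {p :: real \<times> real. snd p \<le> fst p}"
      by (auto simp: fun_eq_iff split: split_indicator)
    moreover have "closed {p :: real \<times> real. snd p \<le> fst p}" by (intro closed_Collect_le continuous_intros)
    then have "{p :: real \<times> real. snd p \<le> fst p} \<in> sets (lborel \<Otimes>\<^sub>M lborel)"
      unfolding lborel_prod by simp
    ultimately show ?thesis by simp
  qed
  have I: "integrable (lborel \<Otimes>\<^sub>M lborel) (\<lambda>(t, s). indicator {..t} s * (r t * f s))"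
  proof (rule Bochner_Integration.integrable_bound)
    have "integrable (lborel \<Otimes>\<^sub>M lborel) (\<lambda>(t, s). r t * f s)"
      using f r by (intro lborel_pair.Fubini_integrable) (auto simp: abs_mult)
    then show "integrable (lborel \<Otimes>\<^sub>M lborel) (\<lambda>p. (case p of (t, s) \<Rightarrow> r t * f s))" .
    show "(\<lambda>(t, s). indicator {..t} s * (r t * f s)) \<in> borel_measurable (lborel \<Otimes>\<^sub>M lborel)"
      unfolding case_prod_beta'
      by (intro borel_measurable_times measurable_compose[OF measurable_fst] measurable_compose[OF measurable_snd])
        (simp_all add: case_prod_beta'[symmetric])
  qed (auto split: prod.split split_indicator)
  have eq1: "(\<lambda>t. \<integral>s. indicator {..t} s * (r t * f s) \<partial>lborel) = (\<lambda>t. r t * (\<integral>s. indicator {..t} s * f s \<partial>lborel))"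
    by (rule ext) (simp add: mult.left_commute)
  have eq2: "(\<integral>t. indicator {..t} s * (r t * f s) \<partial>lborel) = f s * (\<integral>t. indicator {s..} t * r t \<partial>lborel)" for s
  proof -
    have "(\<lambda>t. indicator {..t} s * (r t * f s)) = (\<lambda>t. f s * (indicator {s..} t * r t))"
      by (auto simp: fun_eq_iff split: split_indicator)
    then show ?thesis by simp
  qed
  show "integrable lborel (\<lambda>t. r t * (\<integral>s. indicator {..t} s * f s \<partial>lborel))"
    using lborel_pair.integrable_fst[OF I] by (simp add: eq1)
  show "(\<integral>t. r t * (\<integral>s. indicator {..t} s * f s \<partial>lborel) \<partial>lborel)
       = (\<integral>s. f s * (\<integral>t. indicator {s..} t * r t \<partial>lborel) \<partial>lborel)"
    using lborel_pair.Fubini_integral[OF I] unfolding eq2 by (simp add: mult.left_commute)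
qed

text \<open>The chain rule for the square of an absolutely continuous function, without
  differentiating: Fubini on the triangle turns the integral of \<open>f F\<close> into the integral
  of \<open>f\<close> times the complementary primitive, so the integral of \<open>f F\<close>
  occurs on both sides.\<close>

lemma square_of_primitive:
  fixes f :: "real \<Rightarrow> real"
  assumes f: "integrable lborel f"
  defines "F \<equiv> \<lambda>t. \<integral>s. indicator {..t} s * f s \<partial>lborel"
  shows "integrable lborel (\<lambda>t. f t * F t)" and "2 * (\<integral>t. f t * F t \<partial>lborel) = (integral\<^sup>L lborel f)^2"
proof -
  have i: "integrable lborel (\<lambda>s. indicator {..t} s * f s)" "integrable lborel (\<lambda>s. indicator {t..} s * f s)" for t
    using f by (auto intro: integrable_real_mult_indicator[of _ _ f] simp: mult.commute[of "indicator _ _"])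
  have FT: "(\<integral>t. indicator {s..} t * f t \<partial>lborel) = integral\<^sup>L lborel f - F s" for s proof -
    have "(\<integral>t. indicator {s..} t * f t \<partial>lborel) + F s = (\<integral>t. indicator {s..} t * f t + indicator {..s} t * f t \<partial>lborel)"
      unfolding F_def using i by simp
    also have "\<dots> = integral\<^sup>L lborel f" proof (rule integral_cong_AE)
      have "AE t in lborel. t \<noteq> s" by (rule AE_lborel_singleton)
      then show "AE t in lborel. indicator {s..} t * f t + indicator {..s} t * f t = f t"
        by eventually_elim (auto split: split_indicator)
    qed (use f i in auto)
    finally show ?thesis by simp
  qed
  show iF: "integrable lborel (\<lambda>t. f t * F t)" unfolding F_def by (rule double_integral_triangle(1)[OF f f])
  have "(\<integral>t. f t * F t \<partial>lborel) = (\<integral>s. f s * (integral\<^sup>L lborel f - F s) \<partial>lborel)"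
    using double_integral_triangle(2)[OF f f] unfolding FT F_def .
  also have "\<dots> = (integral\<^sup>L lborel f)^2 - (\<integral>t. f t * F t \<partial>lborel)"
    using f iF by (simp add: right_diff_distrib power2_eq_square)
  finally show "2 * (\<integral>t. f t * F t \<partial>lborel) = (integral\<^sup>L lborel f)^2" by simp
qed

section \<open>The minimisation behind one time step\<close>

context lipschitz_domain
begin

text \<open>Minimise half the squared L2 distance to \<open>w\<close> minus the linear functional
  given by \<psi>; a minimiser exists by compactness, and convexity gives the first-order condition.
  The source lives on space-time, so L2 data are never averaged in time.\<close>

lemma Kset_minimizer:
  fixes \<psi> :: "'a \<times> real \<Rightarrow> real"
  assumes I: "I \<in> sets borel" and \<psi>: "integrable (lebesgue_on (\<Omega> \<times> I)) \<psi>"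
    and w: "w \<in> lip0 M" and ne: "Kset M \<gamma> \<noteq> {}" and \<gamma>: "AE x in NN. \<gamma> x \<le> M"
  obtains U where "U \<in> Kset M \<gamma>"
    "\<And>V. V \<in> Kset M \<gamma> \<Longrightarrow> (\<integral>x. (U x - w x) * (V x - U x) \<partial>NN)
        \<ge> (\<integral>z. \<psi> z * (V (fst z) - U (fst z)) \<partial>lebesgue_on (\<Omega> \<times> I))"
proof -
  let ?P = "lebesgue_on (\<Omega> \<times> I)"
  obtain B where B: "B \<ge> 0" "\<And>V x. V \<in> lip0 M \<Longrightarrow> \<bar>V x\<bar> \<le> B" by (rule lip0_bounded) (rule that)
  have KL: "V \<in> lip0 M" if "V \<in> Kset M \<gamma>" for V using that by (simp add: Kset_def)
  have int\<psi>: "integrable ?P (\<lambda>z. \<psi> z * V (fst z))" if "V \<in> lip0 M" for V proof -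
    have "(\<lambda>z. V (fst z)) \<in> borel_measurable ?P"
      by (rule lebesgue_on_measurable_fst[OF dom_sets(1) I lebesgue_onI[OF lip0_measurable[OF that]]])
    from integrable_bounded_scaleR[OF \<psi> this B(2)[OF that]] show ?thesis by (simp add: mult.commute)
  qed
  define J where "J V = (\<integral>x. (V x - w x) * (V x - w x) \<partial>NN) / 2 - (\<integral>z. \<psi> z * V (fst z) \<partial>?P)" for V
  have LL: "L2_fun NN (\<lambda>x. V x - W x)" if "V \<in> lip0 M" "W \<in> lip0 M" for V W using that by (intro L2_diff lip0_L2)
  have Jb: "J V \<ge> - (\<integral>z. B * \<bar>\<psi> z\<bar> \<partial>?P)" if V: "V \<in> lip0 M" for V proof -
    have "(\<integral>z. \<psi> z * V (fst z) \<partial>?P) \<le> (\<integral>z. B * \<bar>\<psi> z\<bar> \<partial>?P)"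
    proof (rule integral_mono[OF int\<psi>[OF V]])
      show "integrable ?P (\<lambda>z. B * \<bar>\<psi> z\<bar>)" using \<psi> by simp
      show "\<psi> z * V (fst z) \<le> B * \<bar>\<psi> z\<bar>" for z
        using B(2)[OF V, of "fst z"] abs_le_D1[of "\<psi> z * V (fst z)"] mult_left_mono[OF B(2)[OF V, of "fst z"], of "\<bar>\<psi> z\<bar>"]
        by (simp add: abs_mult mult.commute)
    qed
    moreover have "0 \<le> (\<integral>x. (V x - w x) * (V x - w x) \<partial>NN)" by simp
    ultimately show ?thesis unfolding J_def by linarith
  qed
  define j where "j = Inf (J ` Kset M \<gamma>)"
  have bdd: "bdd_below (J ` Kset M \<gamma>)" using Jb KL by (intro bdd_belowI2) auto
  have j_le: "j \<le> J V" if "V \<in> Kset M \<gamma>" for V unfolding j_def using that bdd by (intro cInf_lower) auto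
  have "\<exists>V\<in>Kset M \<gamma>. J V < j + 1 / real (Suc n)" for n
    using cInf_lessD[of "J ` Kset M \<gamma>" "j + 1 / real (Suc n)"] ne unfolding j_def by auto
  then obtain F where F: "\<And>n. F n \<in> Kset M \<gamma>" "\<And>n. J (F n) < j + 1 / real (Suc n)" by metis
  obtain r U where U: "strict_mono (r :: nat \<Rightarrow> nat)" "U \<in> Kset M \<gamma>"
    "\<And>\<epsilon>. \<epsilon> > 0 \<Longrightarrow> \<exists>N. \<forall>n\<ge>N. \<forall>x. \<bar>F (r n) x - U x\<bar> < \<epsilon>"
    by (rule Kset_compact[OF F(1) \<gamma>]) (rule that)
  have lim: "(\<lambda>n. F (r n) x) \<longlonglongrightarrow> U x" for x
    unfolding LIMSEQ_def dist_norm using U(3) by (metis real_norm_def)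
  have Jlim: "(\<lambda>n. J (F (r n))) \<longlonglongrightarrow> J U" proof -
    have "L2_lim NN (\<lambda>n x. F (r n) x - w x) (\<lambda>x. U x - w x)"
    proof (rule L2_lim_dominated_bounded[OF dom_finite, where B="2 * B"])
      show "(\<lambda>x. F (r n) x - w x) \<in> borel_measurable NN" for n using LL[OF KL[OF F(1)] w] by (simp add: L2_fun_def)
      show "(\<lambda>x. U x - w x) \<in> borel_measurable NN" using LL[OF KL[OF U(2)] w] by (simp add: L2_fun_def)
      show "AE x in NN. norm (F (r n) x - w x) \<le> 2 * B" for n
        using B(2)[OF KL[OF F(1)]] B(2)[OF w] by (intro AE_I2) (smt (verit) real_norm_def)
      show "AE x in NN. (\<lambda>n. F (r n) x - w x) \<longlonglongrightarrow> U x - w x" by (intro AE_I2 tendsto_intros lim)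
    qed
    then have 1: "(\<lambda>n. \<integral>x. (F (r n) x - w x) * (F (r n) x - w x) \<partial>NN) \<longlonglongrightarrow> (\<integral>x. (U x - w x) * (U x - w x) \<partial>NN)"
      by (rule L2_lim_mult) fact
    have 2: "(\<lambda>n. \<integral>z. \<psi> z * F (r n) (fst z) \<partial>?P) \<longlonglongrightarrow> (\<integral>z. \<psi> z * U (fst z) \<partial>?P)"
    proof (rule integral_dominated_convergence[where w="\<lambda>z. B * \<bar>\<psi> z\<bar>"])
      show "(\<lambda>z. \<psi> z * U (fst z)) \<in> borel_measurable ?P" using int\<psi>[OF KL[OF U(2)]] by auto
      show "(\<lambda>z. \<psi> z * F (r n) (fst z)) \<in> borel_measurable ?P" for n using int\<psi>[OF KL[OF F(1)]] by auto
      show "integrable ?P (\<lambda>z. B * \<bar>\<psi> z\<bar>)" using \<psi> by simp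
      show "AE z in ?P. (\<lambda>n. \<psi> z * F (r n) (fst z)) \<longlonglongrightarrow> \<psi> z * U (fst z)"
        by (intro AE_I2 tendsto_intros lim)
      show "AE z in ?P. norm (\<psi> z * F (r n) (fst z)) \<le> B * \<bar>\<psi> z\<bar>" for n
        using B(2)[OF KL[OF F(1)]] by (auto simp: abs_mult mult.commute[of B] intro!: AE_I2 mult_left_mono)
    qed
    show ?thesis unfolding J_def by (intro tendsto_intros 1 2) simp
  qed
  have JU: "J U \<le> j" proof (rule LIMSEQ_le[OF Jlim])
    show "(\<lambda>n. j + 1 / real (Suc (r n))) \<longlonglongrightarrow> j"
      using tendsto_add[OF tendsto_const LIMSEQ_subseq_LIMSEQ[OF LIMSEQ_Suc[OF lim_1_over_n[where 'a=real]] U(1)], of j]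
      by (simp add: o_def)
    show "\<exists>N. \<forall>n\<ge>N. J (F (r n)) \<le> j + 1 / real (Suc (r n))" using F(2) less_imp_le by blast
  qed
  have "(\<integral>z. \<psi> z * (V (fst z) - U (fst z)) \<partial>?P) \<le> (\<integral>x. (U x - w x) * (V x - U x) \<partial>NN)" if V: "V \<in> Kset M \<gamma>" for V
  proof -
    define a where "a = (\<integral>x. (U x - w x) * (V x - U x) \<partial>NN) - (\<integral>z. \<psi> z * (V (fst z) - U (fst z)) \<partial>?P)"
    define b where "b = (\<integral>x. (V x - U x) * (V x - U x) \<partial>NN) / 2"
    have b: "b \<ge> 0" by (simp add: b_def)
    have i1: "integrable NN (\<lambda>x. (U x - w x) * (U x - w x))" "integrable NN (\<lambda>x. (U x - w x) * (V x - U x))"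
        "integrable NN (\<lambda>x. (V x - U x) * (V x - U x))" using LL KL U(2) V w by (auto intro!: L2_mult_integrable)
    have i2: "integrable ?P (\<lambda>z. \<psi> z * U (fst z))" "integrable ?P (\<lambda>z. \<psi> z * V (fst z))"
      using int\<psi> KL U(2) V by auto
    \<comment> \<open>Moving from the minimiser towards \<open>V\<close> by the fraction
      \<open>s\<close> changes the functional by exactly s a + s^2 b.\<close>
    have ineq: "0 \<le> s * a + s^2 * b" if s: "0 < s" "s \<le> 1" for s proof -
      define W where "W x = (1 - s) * U x + s * V x" for x
      have W: "W \<in> Kset M \<gamma>" unfolding W_def[abs_def] using s by (intro Kset_convex U V) auto
      have "J W = J U + s * a + s^2 * b" proof -
        have "(\<integral>x. (W x - w x) * (W x - w x) \<partial>NN) = (\<integral>x. (U x - w x) * (U x - w x) + 2 * s * ((U x - w x) * (V x - U x)) + s^2 * ((V x - U x) * (V x - U x)) \<partial>NN)"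
          by (rule Bochner_Integration.integral_cong) (auto simp: W_def power2_eq_square algebra_simps)
        also have "\<dots> = (\<integral>x. (U x - w x) * (U x - w x) \<partial>NN) + 2 * s * (\<integral>x. (U x - w x) * (V x - U x) \<partial>NN) + s^2 * (\<integral>x. (V x - U x) * (V x - U x) \<partial>NN)"
          using i1 by simp
        finally have 1: "(\<integral>x. (W x - w x) * (W x - w x) \<partial>NN) = \<dots>" .
        have "(\<integral>z. \<psi> z * W (fst z) \<partial>?P) = (\<integral>z. \<psi> z * U (fst z) + s * (\<psi> z * (V (fst z) - U (fst z))) \<partial>?P)"
          by (rule Bochner_Integration.integral_cong) (auto simp: W_def algebra_simps)
        also have "\<dots> = (\<integral>z. \<psi> z * U (fst z) \<partial>?P) + s * (\<integral>z. \<psi> z * (V (fst z) - U (fst z)) \<partial>?P)"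
          using i2 by (subst Bochner_Integration.integral_add) (auto simp: right_diff_distrib)
        finally show ?thesis using 1 by (simp add: J_def a_def b_def algebra_simps)
      qed
      then show ?thesis using j_le[OF W] JU by simp
    qed
    have "a \<ge> 0" proof (rule ccontr)
      assume "\<not> a \<ge> 0"
      then have a: "a < 0" by simp
      \<comment> \<open>Small enough that s b < - a, which would make the change negative.\<close>
      define s where "s = min 1 (- a / (2 * (b + 1)))"
      have s: "0 < s" "s \<le> 1" using a b by (auto simp: s_def intro!: divide_neg_pos)
      have "s * (b + 1) \<le> - a / (2 * (b + 1)) * (b + 1)" using b by (intro mult_right_mono) (auto simp: s_def)
      also have "\<dots> = - a / 2" using b by (simp add: field_simps add_nonneg_eq_0_iff)
      finally have "s * b < - a" using a s by (simp add: distrib_left)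
      then have "s * (a + s * b) < 0" using s by (intro mult_pos_neg) auto
      then show False using ineq[OF s] by (simp add: power2_eq_square distrib_left mult.assoc)
    qed
    then show ?thesis by (simp add: a_def)
  qed
  then show ?thesis using that U(2) by blast
qed

end

lemma fundamental_lemma_nonneg_lebesgue_on:
  fixes k :: "'a::euclidean_space \<Rightarrow> real"
  assumes S: "open S" and k: "integrable (lebesgue_on S) k"
    and test: "\<And>\<rho>. test_function S \<rho> \<Longrightarrow> (\<And>x. 0 \<le> \<rho> x) \<Longrightarrow> 0 \<le> (\<integral>x. \<rho> x * k x \<partial>lebesgue_on S)"
  shows "AE x in lebesgue_on S. 0 \<le> k x"
proof -
  have Sb: "S \<in> sets borel" using S by simp
  obtain k' where k': "k' \<in> borel_measurable borel" "\<And>x. x \<notin> S \<Longrightarrow> k' x = 0" "AE x in lebesgue_on S. k x = k' x"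
    by (rule borel_rep[OF borel_measurable_integrable[OF k] Sb]) (rule that)
  have "AE x in lborel. x \<in> S \<longrightarrow> 0 \<le> k' x" proof (rule fundamental_lemma_nonneg[OF S])
    show "integrable lborel k'" using borel_rep_integral(1)[OF Sb k'] k by simp
    fix \<rho> assume \<rho>: "test_function S \<rho>" "\<And>x. 0 \<le> \<rho> x"
    have "(\<integral>x. \<rho> x * k x \<partial>lebesgue_on S) = (\<integral>x. k' x * \<rho> x \<partial>lborel)"
      using smooth_measurable[OF test_function_smooth[OF \<rho>(1)]] k'
      by (intro borel_rep_integral(2)[OF Sb]) (auto elim: eventually_mono)
    then show "0 \<le> (\<integral>x. k' x * \<rho> x \<partial>lborel)" using test[OF \<rho>] by simp
  qed
  then have "AE x in lebesgue_on S. 0 \<le> k' x" by (simp add: AE_lebesgue_on_iff[OF Sb])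
  with k'(3) show ?thesis by eventually_elim simp
qed

lemma tendsto_1_over_SucI:
  fixes X :: "nat \<Rightarrow> 'b::real_normed_vector"
  assumes "\<And>n. norm (X n - L) \<le> 1 / real (Suc n)"
  shows "X \<longlonglongrightarrow> L"
proof -
  have "(\<lambda>n. X n - L) \<longlonglongrightarrow> 0"
    by (rule Lim_null_comparison[OF always_eventually LIMSEQ_Suc[OF lim_1_over_n]]) (use assms in blast)
  then show ?thesis by (simp add: LIM_zero_iff)
qed

lemma primitive_continuous:
  fixes f :: "real \<Rightarrow> real"
  assumes "integrable lborel f"
  shows "isCont (\<lambda>t. \<integral>s. indicator {..t} s * f s \<partial>lborel) t"
  unfolding continuous_at_sequentially
proof (intro allI impI)
  fix X assume X: "X \<longlonglongrightarrow> t"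
  have [measurable]: "f \<in> borel_measurable borel" using assms by auto
  have "(\<lambda>n. \<integral>s. indicator {..X n} s * f s \<partial>lborel) \<longlonglongrightarrow> (\<integral>s. indicator {..t} s * f s \<partial>lborel)"
  proof (rule integral_dominated_convergence[where w="\<lambda>s. \<bar>f s\<bar>"])
    have "AE s in lborel. s \<noteq> t" by (rule AE_lborel_singleton)
    then show "AE s in lborel. (\<lambda>n. indicator {..X n} s * f s) \<longlonglongrightarrow> indicator {..t} s * f s"
    proof eventually_elim
      case (elim s)
      consider "s < t" | "t < s" using elim by linarith
      then have "eventually (\<lambda>n. indicator {..t} s * f s = indicator {..X n} s * f s) sequentially" proof cases
        case ord: 1
        from order_tendstoD(1)[OF X ord] show ?thesis by eventually_elim (use ord in \<open>auto split: split_indicator\<close>)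
      next
        case ord: 2
        from order_tendstoD(2)[OF X ord] show ?thesis by eventually_elim (use ord in \<open>auto split: split_indicator\<close>)
      qed
      then show ?case by (rule Lim_transform_eventually[OF tendsto_const])
    qed
  qed (use assms in \<open>auto split: split_indicator\<close>)
  then show "((\<lambda>t. \<integral>s. indicator {..t} s * f s \<partial>lborel) \<circ> X) \<longlonglongrightarrow> (\<integral>s. indicator {..t} s * f s \<partial>lborel)"
    by (simp add: o_def)
qed

lemma integrable_indicator_lebesgue_on:
  fixes y :: "'a::euclidean_space \<Rightarrow> real"
  assumes "integrable (lebesgue_on S) y" "A \<in> sets borel"
  shows "integrable (lebesgue_on S) (\<lambda>s. indicator A s * y s)"
  using integrable_bounded_scaleR[OF assms(1) lebesgue_onI[OF borel_measurable_indicator[OF assms(2)]], of 1]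
  by (simp split: split_indicator)

text \<open>Iterating the integral inequality improves the constant bound \<open>Y\<close> to Y (K
  t)^n / n!, which tends to 0. No continuity of \<open>y\<close> is required, only integrability and
  boundedness.\<close>

lemma gronwall_zero:
  fixes y :: "real \<Rightarrow> real"
  assumes K: "K \<ge> 0" and y: "\<And>t. t \<in> {0..T} \<Longrightarrow> 0 \<le> y t \<and> y t \<le> Y"
    and int: "integrable (lebesgue_on {0<..<T}) y"
    and le: "\<And>t. t \<in> {0..T} \<Longrightarrow> y t \<le> K * (\<integral>s. indicator {..t} s * y s \<partial>lebesgue_on {0<..<T})"
    and t: "t \<in> {0..T}"
  shows "y t = 0"
proof -
  have bound: "y t \<le> Y * (K * t) ^ n / fact n" if "t \<in> {0..T}" for n t using that proof (induction n arbitrary: t)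
    case 0
    then show ?case using y by simp
  next
    case (Suc n)
    have "(\<integral>s. indicator {..t} s * y s \<partial>lebesgue_on {0<..<T})
        \<le> (\<integral>s. indicator {0..t} s * (Y * (K * s) ^ n / fact n) \<partial>lebesgue_on {0<..<T})"
    proof (rule integral_mono_AE)
      show "integrable (lebesgue_on {0<..<T}) (\<lambda>s. indicator {..t} s * y s)"
        by (rule integrable_indicator_lebesgue_on[OF int]) simp
      show "integrable (lebesgue_on {0<..<T}) (\<lambda>s. indicator {0..t} s * (Y * (K * s) ^ n / fact n))"
      proof (rule integrable_bounded_set)
        show "(\<lambda>s. indicator {0..t} s * (Y * (K * s) ^ n / fact n)) \<in> borel_measurable (lebesgue_on {0<..<T})"
          by (intro lebesgue_onI) measurable
        show "AE s in lebesgue_on {0<..<T}. norm (indicator {0..t} s * (Y * (K * s) ^ n / fact n)) \<le> \<bar>Y\<bar> * (K * t) ^ n / fact n"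
          using K Suc.prems by (intro AE_I2) (auto simp: abs_mult intro!: divide_right_mono mult_left_mono power_mono split: split_indicator)
      qed auto
      show "AE s in lebesgue_on {0<..<T}. indicator {..t} s * y s \<le> indicator {0..t} s * (Y * (K * s) ^ n / fact n)"
        using Suc by (intro AE_I2) (auto split: split_indicator)
    qed
    also have "\<dots> = (\<integral>s. indicator {0<..<T} s * (indicator {0..t} s * (Y * (K * s) ^ n / fact n)) \<partial>lborel)"
      by (rule borel_rep_integral(2)) (auto intro!: AE_I2)
    also have "\<dots> = (\<integral>s. (Y * K ^ n / fact n) * (s ^ n * indicator {0..t} s) \<partial>lborel)"
    proof (rule integral_cong_AE)
      have "AE s in lborel. s \<noteq> (0::real)" "AE s in lborel. s \<noteq> T" by (rule AE_lborel_singleton)+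
      then show "AE s in lborel. indicator {0<..<T} s * (indicator {0..t} s * (Y * (K * s) ^ n / fact n))
          = (Y * K ^ n / fact n) * (s ^ n * indicator {0..t} s)"
        by eventually_elim (use Suc.prems in \<open>auto split: split_indicator simp: power_mult_distrib\<close>)
    qed auto
    also have "\<dots> = (Y * K ^ n / fact n) * (t ^ Suc n / Suc n)" using integral_power[of 0 t n] Suc.prems by simp
    finally have "y t \<le> K * ((Y * K ^ n / fact n) * (t ^ Suc n / Suc n))"
      using le[OF Suc.prems] K by (meson mult_left_mono order_trans)
    then show ?case by (simp add: power_mult_distrib mult_ac)
  qed
  have "(\<lambda>n. Y * ((K * t) ^ n / fact n)) \<longlonglongrightarrow> Y * 0"
    using summable_LIMSEQ_zero[OF summable_exp[of "K * t"]] by (intro tendsto_intros) (simp add: divide_inverse mult.commute)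
  then have "y t \<le> 0" using bound[OF t] by (intro LIMSEQ_le_const[of "\<lambda>n. Y * ((K * t) ^ n / fact n)"]) auto
  then show ?thesis using y[OF t] by simp
qed

section \<open>The energy identity and the condition on c - 1/2 div b at almost every time\<close>

context bounded_domain
begin

lemma L2_section:
  fixes f :: "'a \<times> real \<Rightarrow> 'c::euclidean_space"
  assumes "in_L2 (cylinder \<Omega> T) f"
  shows "AE t in lebesgue_on {0<..<T}. L2_fun NN (\<lambda>x. f (x, t))"
proof -
  have f: "f \<in> borel_measurable (lebesgue_on (\<Omega> \<times> {0<..<T}))" "integrable (lebesgue_on (\<Omega> \<times> {0<..<T})) (\<lambda>z. (norm (f z))^2)"
    using assms by (auto simp: in_L2_def cylinder_def)
  have I: "{0<..<T} \<in> sets borel" by simp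
  from lebesgue_on_section_measurable(1)[OF dom_sets(1) I f(1)] lebesgue_on_Fubini(1)[OF dom_sets(1) I f(2)]
  show ?thesis by eventually_elim (simp add: L2_fun_def)
qed

lemma continuous_closure_cylinder:
  fixes u :: "'a \<times> real \<Rightarrow> real"
  assumes T: "T > 0" and uc: "continuous_on (closure (cylinder \<Omega> T)) u"
  shows "u \<in> borel_measurable (lebesgue_on (cylinder \<Omega> T))"
    and "\<exists>B. \<forall>z\<in>closure (cylinder \<Omega> T). norm (u z) \<le> B"
    and "t \<in> {0..T} \<Longrightarrow> (\<lambda>x. u (x, t)) \<in> borel_measurable NN"
proof -
  have "compact (closure (cylinder \<Omega> T))" using cylinder_bounded[OF bounded_dom] by simp
  from compact_imp_bounded[OF compact_continuous_image[OF uc this]]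
  show "\<exists>B. \<forall>z\<in>closure (cylinder \<Omega> T). norm (u z) \<le> B" unfolding bounded_iff by blast
  show "u \<in> borel_measurable (lebesgue_on (cylinder \<Omega> T))"
    using continuous_on_subset[OF uc closure_subset] open_dom by (intro continuous_imp_measurable_on_sets_lebesgue) auto
  assume "t \<in> {0..T}"
  then have "continuous_on \<Omega> (\<lambda>x. u (x, t))" by (intro continuous_on_compose2[OF uc])
    (use T closure_subset[of \<Omega>] in \<open>auto simp: cylinder_def closure_Times intro!: continuous_intros\<close>)
  then show "(\<lambda>x. u (x, t)) \<in> borel_measurable NN" by (intro continuous_imp_measurable_on_sets_lebesgue) auto
qed

text \<open>The exceptional set of points must not depend on the time. Countably many rational
  increments give one null set; for the remaining times both sides are continuous in
  \<open>t\<close>.\<close>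

lemma weak_dt_pointwise:
  assumes T: "T > 0" and u: "has_weak_dt \<Omega> T u w" and uc: "continuous_on (closure (cylinder \<Omega> T)) u"
    and iw: "integrable (lebesgue_on (cylinder \<Omega> T)) w"
    and w': "w' \<in> borel_measurable borel" "\<And>z. z \<notin> cylinder \<Omega> T \<Longrightarrow> w' z = 0"
      "AE z in lebesgue_on (cylinder \<Omega> T). w z = w' z"
  shows "AE x in NN. integrable lborel (\<lambda>s. w' (x, s)) \<and>
    (\<forall>t\<in>{0..T}. u (x, t) - u (x, 0) = (\<integral>s. indicator {..t} s * w' (x, s) \<partial>lborel))"
proof -
  let ?Q = "cylinder \<Omega> T"
  have Q: "?Q \<in> sets borel" using open_dom by simp
  have cl: "closure ?Q = closure \<Omega> \<times> {0..T}" using T by (simp add: cylinder_def closure_Times)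
  note um = continuous_closure_cylinder(1)[OF T uc]
  obtain B where B: "\<And>z. z \<in> closure ?Q \<Longrightarrow> norm (u z) \<le> B" using continuous_closure_cylinder(2)[OF T uc] by blast
  have iu: "integrable (lebesgue_on ?Q) u" by (rule integrable_bounded_set[OF Q cylinder_bounded[OF bounded_dom] um, of B])
      (use B closure_subset[of ?Q] in \<open>auto intro!: AE_I2\<close>)
  have iw': "integrable lborel w'" using borel_rep_integral(1)[OF Q w'] iw by simp
  have w'i: "AE x in NN. integrable lborel (\<lambda>s. w' (x, s))" proof -
    have "integrable (lborel \<Otimes>\<^sub>M lborel) w'" unfolding lborel_prod by (rule iw')
    from lborel_pair.AE_integrable_fst'[OF this] show ?thesis by (simp add: AE_lebesgue_on_iff) (auto elim: eventually_mono)
  qed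
  define H where "H = {h \<in> \<rat>. 0 < h \<and> h < T}"
  have "countable H" unfolding H_def by (rule countable_subset[OF _ countable_rat]) auto
  moreover have "AE x in NN. AE t in lebesgue_on {0<..<T - h}.
     u (x, t + h) - u (x, t) = (\<integral>s. indicator {0..h} s * w' (x, t + s) \<partial>lborel)" if "h \<in> H" for h
  proof -
    have h: "h > 0" using that by (simp add: H_def)
    show ?thesis by (rule weak_dt_increment(2)[OF T u iu iw w'(1) _ w'(3) h]) (rule w'(2))
  qed
  ultimately have inc: "AE x in NN. \<forall>h\<in>H. AE t in lebesgue_on {0<..<T - h}.
     u (x, t + h) - u (x, t) = (\<integral>s. indicator {0..h} s * w' (x, t + s) \<partial>lborel)"
    by (subst AE_ball_countable) auto
  have "AE x in NN. x \<in> \<Omega>" by (rule AE_I2) simp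
  with inc w'i show ?thesis proof eventually_elim
    case (elim x)
    define \<Phi> where "\<Phi> t = (\<integral>s. indicator {..t} s * w' (x, s) \<partial>lborel)" for t
    have \<Phi>c: "isCont \<Phi> t" for t unfolding \<Phi>_def[abs_def] by (rule primitive_continuous[OF elim(2)])
    have [measurable]: "(\<lambda>s. w' (x, s)) \<in> borel_measurable borel" using elim(2) by auto
    have ii: "integrable lborel (\<lambda>s. indicator {..t} s * w' (x, s))" for t
      using elim(2) integrable_real_mult_indicator[of "{..t}" lborel "\<lambda>s. w' (x, s)"] by (simp add: mult.commute)
    \<comment> \<open>\<open>w'\<close> is 0 off the cylinder, so the primitive from minus infinity
      starts at time 0.\<close>
    have \<Phi>0: "\<Phi> 0 = 0" proof -
      have "(\<lambda>s. indicator {..0} s * w' (x, s)) = (\<lambda>s. 0)"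
        using w'(2)[of "(x, _)"] by (auto simp: cylinder_def fun_eq_iff split: split_indicator)
      then show ?thesis by (simp add: \<Phi>_def)
    qed
    have shift: "(\<integral>s. indicator {0..h} s * w' (x, t + s) \<partial>lborel) = \<Phi> (t + h) - \<Phi> t" if "h \<ge> 0" for t h
    proof -
      have "(\<integral>s. indicator {0..h} s * w' (x, t + s) \<partial>lborel) = (\<integral>s. indicator {t..t+h} (s + t) * w' (x, s + t) \<partial>lborel)"
        by (intro Bochner_Integration.integral_cong) (auto split: split_indicator simp: add.commute)
      also have "\<dots> = (\<integral>s. indicator {t..t+h} s * w' (x, s) \<partial>lborel)"
        by (rule lborel_translate(2)) measurable
      also have "\<dots> = (\<integral>s. indicator {..t+h} s * w' (x, s) - indicator {..t} s * w' (x, s) \<partial>lborel)"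
      proof (rule integral_cong_AE)
        have "AE s in lborel. s \<noteq> t" by (rule AE_lborel_singleton)
        then show "AE s in lborel. indicator {t..t+h} s * w' (x, s) = indicator {..t+h} s * w' (x, s) - indicator {..t} s * w' (x, s)"
          by eventually_elim (use that in \<open>auto split: split_indicator\<close>)
      qed auto
      also have "\<dots> = \<Phi> (t + h) - \<Phi> t" using ii by (simp add: \<Phi>_def)
      finally show ?thesis .
    qed
    have uxc: "continuous_on {0..T} (\<lambda>t. u (x, t))"
      by (rule continuous_on_compose2[OF uc]) (use \<open>x \<in> \<Omega>\<close> closure_subset[of \<Omega>] cl in \<open>auto intro!: continuous_intros\<close>)
    \<comment> \<open>The increment formula holds for almost every starting time; good starting
      times tending to 0 and continuity give it at the starting time 0.\<close>
    have rat: "u (x, h) - u (x, 0) = \<Phi> h" if hH: "h \<in> H" for h proof -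
      have h: "0 < h" "h < T" using hH by (auto simp: H_def)
      have ae: "AE t in lebesgue_on {0<..<T - h}. u (x, t + h) - u (x, t) = \<Phi> (t + h) - \<Phi> t"
        using bspec[OF elim(1) hH] by (simp only: shift[OF less_imp_le[OF h(1)]])
      have "\<exists>\<tau>. \<tau> \<in> {0<..<T - h} \<and> \<bar>\<tau> - 0\<bar> < 1 / real (Suc n) \<and> u (x, \<tau> + h) - u (x, \<tau>) = \<Phi> (\<tau> + h) - \<Phi> \<tau>" for n
      proof -
        obtain \<tau> where "\<tau> \<in> {0<..<T - h}" "\<bar>\<tau> - 0\<bar> < 1 / real (Suc n)" "u (x, \<tau> + h) - u (x, \<tau>) = \<Phi> (\<tau> + h) - \<Phi> \<tau>"
          by (rule AE_interval_pick[OF ae, of 0 "1 / real (Suc n)"]) (use h in auto)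
        then show ?thesis by blast
      qed
      then obtain \<tau> where \<tau>: "\<And>n. \<tau> n \<in> {0<..<T - h}" "\<And>n. \<bar>\<tau> n - 0\<bar> < 1 / real (Suc n)"
        "\<And>n. u (x, \<tau> n + h) - u (x, \<tau> n) = \<Phi> (\<tau> n + h) - \<Phi> (\<tau> n)" by metis
      have \<tau>0: "\<tau> \<longlonglongrightarrow> 0" using \<tau>(2) by (intro tendsto_1_over_SucI) (auto intro: less_imp_le)
      have \<tau>T: "\<tau> n + h \<in> {0..T}" "\<tau> n \<in> {0..T}" for n using \<tau>(1)[of n] h by auto
      from \<tau>0 have \<tau>h: "(\<lambda>n. \<tau> n + h) \<longlonglongrightarrow> 0 + h" by (intro tendsto_intros)
      have "(\<lambda>n. u (x, \<tau> n + h) - u (x, \<tau> n)) \<longlonglongrightarrow> u (x, 0 + h) - u (x, 0)"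
      proof (rule tendsto_diff)
        show "(\<lambda>n. u (x, \<tau> n + h)) \<longlonglongrightarrow> u (x, 0 + h)"
          by (rule continuous_on_tendsto_compose[OF uxc \<tau>h]) (use h \<tau>T in \<open>auto intro!: always_eventually\<close>)
        show "(\<lambda>n. u (x, \<tau> n)) \<longlonglongrightarrow> u (x, 0)"
          by (rule continuous_on_tendsto_compose[OF uxc \<tau>0]) (use T \<tau>T in \<open>auto intro!: always_eventually\<close>)
      qed
      moreover have "(\<lambda>n. \<Phi> (\<tau> n + h) - \<Phi> (\<tau> n)) \<longlonglongrightarrow> \<Phi> (0 + h) - \<Phi> 0"
        by (intro tendsto_diff isCont_tendsto_compose[OF \<Phi>c] \<tau>0 \<tau>h)
      ultimately show ?thesis using \<tau>(3) LIMSEQ_unique \<Phi>0 by auto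
    qed
    have "u (x, t) - u (x, 0) = \<Phi> t" if t: "t \<in> {0..T}" for t proof -
      have "\<exists>q\<in>H. \<bar>q - t\<bar> < e" if "e > 0" for e proof -
        have "max 0 (t - e) < min T (t + e)" using t T that by auto
        from Rats_dense_in_real[OF this] obtain q where "q \<in> \<rat>" "max 0 (t - e) < q" "q < min T (t + e)" by blast
        then show ?thesis by (intro bexI[of _ q]) (auto simp: H_def abs_if)
      qed
      then have "\<exists>q\<in>H. \<bar>q - t\<bar> < 1 / real (Suc n)" for n by simp
      then obtain q where q: "\<And>n. q n \<in> H" "\<And>n. \<bar>q n - t\<bar> < 1 / real (Suc n)" by metis
      have qt: "q \<longlonglongrightarrow> t" using q(2) by (intro tendsto_1_over_SucI) (auto intro: less_imp_le)
      have "(\<lambda>n. u (x, q n) - u (x, 0)) \<longlonglongrightarrow> u (x, t) - u (x, 0)"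
        by (intro tendsto_intros continuous_on_tendsto_compose[OF uxc qt])
          (use q(1) t in \<open>auto intro!: always_eventually simp: H_def less_imp_le\<close>)
      moreover have "(\<lambda>n. \<Phi> (q n)) \<longlonglongrightarrow> \<Phi> t" by (rule isCont_tendsto_compose[OF \<Phi>c qt])
      ultimately show ?thesis using rat[OF q(1)] LIMSEQ_unique by auto
    qed
    then show ?case using elim(2) by (simp add: \<Phi>_def)
  qed
qed

text \<open>For almost every \<open>x\<close> the function is the primitive of its time derivative,
  so its square is given by \<open>square_of_primitive\<close>; integrating over \<open>x\<close>
  and applying Fubini finishes the proof.\<close>

lemma energy_identity:
  assumes T: "T > 0" and u: "has_weak_dt \<Omega> T u w" and uc: "continuous_on (closure (cylinder \<Omega> T)) u"
    and w: "L2_fun (lebesgue_on (cylinder \<Omega> T)) w" and u0: "AE x in NN. u (x, 0) = 0"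
    and t: "t \<in> {0..T}"
  shows "(\<integral>x. (u (x, t))^2 \<partial>NN)
      = 2 * (\<integral>s. indicator {..t} s * (\<integral>x. w (x, s) * u (x, s) \<partial>NN) \<partial>lebesgue_on {0<..<T})"
proof -
  let ?S = "\<lambda>x. \<integral>s. indicator {..t} s * (w (x, s) * u (x, s)) \<partial>lebesgue_on {0<..<T}"
  let ?Q = "cylinder \<Omega> T" and ?LQ = "lebesgue_on (cylinder \<Omega> T)" and ?I = "{0<..<T}"
  have Q: "?Q \<in> sets borel" using open_dom by simp
  have I: "?I \<in> sets borel" by simp
  have fin: "finite_measure ?LQ" by (rule finite_measure_bounded_set[OF Q cylinder_bounded[OF bounded_dom]])
  have iw: "integrable ?LQ w" by (rule L2_integrable[OF fin w])
  obtain w' where w': "w' \<in> borel_measurable borel" "\<And>z. z \<notin> ?Q \<Longrightarrow> w' z = 0" "AE z in ?LQ. w z = w' z"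
    by (rule borel_rep[OF borel_measurable_integrable[OF iw] Q]) (rule that)
  note um = continuous_closure_cylinder(1)[OF T uc]
  obtain B where B: "\<And>z. z \<in> closure ?Q \<Longrightarrow> norm (u z) \<le> B" using continuous_closure_cylinder(2)[OF T uc] by blast
  have iwu: "integrable ?LQ (\<lambda>z. indicator {..t} (snd z) * (w z * u z))" proof -
    have m: "(\<lambda>z::'a \<times> real. indicator {..t} (snd z) :: real) \<in> borel_measurable borel"
      unfolding borel_prod[symmetric] by measurable
    have "\<bar>indicator {..t} (snd z) * u z\<bar> \<le> \<bar>B\<bar>" if "z \<in> ?Q" for z
      using B[of z] that closure_subset[of ?Q] by (fastforce split: split_indicator)
    then show ?thesis using integrable_bounded_scaleR[OF iw borel_measurable_times[OF lebesgue_onI[OF m] um], of "\<bar>B\<bar>"]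
      by (simp add: mult_ac)
  qed
  have "AE x in NN. integrable lborel (\<lambda>s. w' (x, s)) \<and>
    (\<forall>t\<in>{0..T}. u (x, t) - u (x, 0) = (\<integral>s. indicator {..t} s * w' (x, s) \<partial>lborel))"
    by (rule weak_dt_pointwise[OF T u uc iw w'(1) _ w'(3)]) (rule w'(2))
  moreover have "AE x in NN. AE s in lebesgue_on ?I. w (x, s) = w' (x, s)"
    using w'(3) unfolding cylinder_def by (intro AE_lebesgue_on_pair(1)) auto
  ultimately have sq: "AE x in NN. (u (x, t))^2 = 2 * ?S x" using u0 proof eventually_elim
    case (elim x)
    have [measurable]: "(\<lambda>s. w' (x, s)) \<in> borel_measurable borel" using elim by auto
    \<comment> \<open>Cut off at \<open>t\<close>, so that the total integral of \<open>f\<close> is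
      the value at time \<open>t\<close>, the initial value being 0. On the support of
      \<open>f\<close> the primitive of \<open>f\<close> equals \<open>u\<close>.\<close>
    define f where "f s = indicator {..t} s * w' (x, s)" for s
    have f: "integrable lborel f"
      unfolding f_def using elim(1) integrable_real_mult_indicator[of "{..t}" lborel "\<lambda>s. w' (x, s)"] by (simp add: mult.commute)
    have [measurable]: "f \<in> borel_measurable borel" using f by auto
    have ut: "u (x, s) = (\<integral>r. indicator {..s} r * w' (x, r) \<partial>lborel)" if "s \<in> {0..T}" for s
      using elim that by simp
    have F: "f s * (\<integral>r. indicator {..s} r * f r \<partial>lborel) = f s * u (x, s)" for s
    proof (cases "s \<in> {0<..<T} \<and> s \<le> t")
      case True
      have "(\<integral>r. indicator {..s} r * f r \<partial>lborel) = (\<integral>r. indicator {..s} r * w' (x, r) \<partial>lborel)"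
        using True by (intro Bochner_Integration.integral_cong) (auto simp: f_def split: split_indicator)
      then show ?thesis using True ut[of s] by simp
    next
      case False
      then have "f s = 0" using w'(2)[of "(x, s)"] by (auto simp: f_def cylinder_def split: split_indicator)
      then show ?thesis by simp
    qed
    have "integral\<^sup>L lborel f = u (x, t)" using ut[OF t] by (simp add: f_def[abs_def])
    then have "(u (x, t))^2 = 2 * (\<integral>s. f s * u (x, s) \<partial>lborel)" using square_of_primitive(2)[OF f] F by simp
    also have "(\<integral>s. f s * u (x, s) \<partial>lborel) = ?S x" proof (rule borel_rep_integral(2)[OF I, symmetric])
      show "(\<lambda>s. f s * u (x, s)) \<in> borel_measurable borel" proof -
        have "integrable lborel (\<lambda>s. f s * u (x, s))" using square_of_primitive(1)[OF f] by (simp add: F)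
        then show ?thesis by auto
      qed
      show "f s * u (x, s) = 0" if "s \<notin> ?I" for s using that w'(2)[of "(x, s)"] by (auto simp: f_def cylinder_def)
      show "AE s in lebesgue_on ?I. indicator {..t} s * (w (x, s) * u (x, s)) = f s * u (x, s)"
        using elim(2) by eventually_elim (simp add: f_def)
    qed
    finally show ?case .
  qed
  have "(\<integral>x. (u (x, t))^2 \<partial>NN) = (\<integral>x. 2 * ?S x \<partial>NN)" proof (rule integral_cong_AE[OF _ _ sq])
    have "(\<lambda>x. u (x, t)) \<in> borel_measurable NN" by (rule continuous_closure_cylinder(3)[OF T uc t])
    then show "(\<lambda>x. (u (x, t))^2) \<in> borel_measurable NN" by auto
    show "(\<lambda>x. 2 * ?S x) \<in> borel_measurable NN"
      using lebesgue_on_Fubini(5)[OF dom_sets(1) I iwu[unfolded cylinder_def]] by auto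
  qed
  also have "\<dots> = 2 * (\<integral>x. ?S x \<partial>NN)" by simp
  also have "(\<integral>x. ?S x \<partial>NN)
      = (\<integral>s. (\<integral>x. indicator {..t} s * (w (x, s) * u (x, s)) \<partial>NN) \<partial>lebesgue_on ?I)"
    using lebesgue_on_Fubini(3,6)[OF dom_sets(1) I iwu[unfolded cylinder_def]] by simp
  finally show ?thesis by simp
qed

text \<open>Test with \<sigma>^2 times a nonnegative function of time: the gradient of \<sigma>^2 is
  2 \<sigma> grad \<sigma>, which cancels the 1/2, and the arbitrary time factor localises to almost
  every time. The null set still depends on \<sigma>; it is made common by a countable family dense
  with respect to uniform convergence of function and gradient.\<close>

lemma c_minus_half_div_AE:
  assumes b: "in_L2 (cylinder \<Omega> T) b" and c: "in_L2 (cylinder \<Omega> T) c"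
    and div: "c_minus_half_div_ge \<Omega> T b c l"
  shows "AE t in lebesgue_on {0<..<T}. \<forall>\<sigma>. test_function \<Omega> \<sigma> \<longrightarrow>
      l * (\<integral>x. \<sigma> x * \<sigma> x \<partial>NN)
        \<le> (\<integral>x. c (x, t) * (\<sigma> x * \<sigma> x) \<partial>NN) + (\<integral>x. b (x, t) \<bullet> (\<sigma> x *\<^sub>R grad \<sigma> x) \<partial>NN)"
proof -
  let ?I = "{0<..<T}" and ?LI = "lebesgue_on ({0<..<T})" and ?Q = "\<Omega> \<times> {0<..<T}" and ?LQ = "lebesgue_on (\<Omega> \<times> {0<..<T})"
  have I: "?I \<in> sets borel" by simp
  have Q: "?Q \<in> sets borel" by (intro borel_Times) auto
  have fin: "finite_measure ?LQ"
    using finite_measure_bounded_set[OF Q] cylinder_bounded[OF bounded_dom, of T] by (simp add: cylinder_def)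
  have Lb: "L2_fun ?LQ b" "L2_fun ?LQ c" using b c by (simp_all add: in_L2_iff cylinder_def)
  have ib: "integrable ?LQ b" "integrable ?LQ c" using Lb L2_integrable[OF fin] by auto
  have one: "AE t in ?LI. 0 \<le> (\<integral>x. (c (x, t) - l) * (\<sigma> x * \<sigma> x) + b (x, t) \<bullet> (\<sigma> x *\<^sub>R grad \<sigma> x) \<partial>NN)"
    if \<sigma>: "test_function \<Omega> \<sigma>" for \<sigma>
  proof -
    have sm: "smooth \<sigma>" by (rule test_function_smooth[OF \<sigma>])
    obtain B where B: "\<And>x. \<bar>\<sigma> x\<bar> \<le> B" "\<And>x. norm (grad \<sigma> x) \<le> B"
      by (rule test_function_bounded[OF \<sigma>]) (rule that)
    define k where "k z = (c z - l) * (\<sigma> (fst z) * \<sigma> (fst z)) + b z \<bullet> (\<sigma> (fst z) *\<^sub>R grad \<sigma> (fst z))" for z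
    have m: "(\<lambda>z::'a \<times> real. \<sigma> (fst z)) \<in> borel_measurable ?LQ"
        "(\<lambda>z::'a \<times> real. grad \<sigma> (fst z)) \<in> borel_measurable ?LQ"
      by (intro lebesgue_on_measurable_fst dom_sets I lebesgue_onI smooth_measurable smooth_grad_borel_measurable sm)+
    have B0: "B \<ge> 0" using B(1)[of 0] by linarith
    have b1: "\<bar>\<sigma> x * \<sigma> x\<bar> \<le> B * B" for x unfolding abs_mult by (rule mult_mono[OF B(1) B(1) B0]) simp
    have b2: "norm (\<sigma> x *\<^sub>R grad \<sigma> x) \<le> B * B" for x using B(1)[of x] B(2)[of x] B0 by (simp add: mult_mono)
    have ik: "integrable ?LQ k" proof (rule Bochner_Integration.integrable_bound)
      show "integrable ?LQ (\<lambda>z. (\<bar>c z - l\<bar> + norm (b z)) * (B * B))"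
        using ib fin by (intro integrable_mult_left Bochner_Integration.integrable_add integrable_norm integrable_abs
            Bochner_Integration.integrable_diff finite_measure.integrable_const)
      show "k \<in> borel_measurable ?LQ" unfolding k_def[abs_def] using m ib by auto
      show "AE z in ?LQ. norm (k z) \<le> norm ((\<bar>c z - l\<bar> + norm (b z)) * (B * B))" proof (rule AE_I2)
        fix z
        have "norm (k z) \<le> \<bar>c z - l\<bar> * \<bar>\<sigma> (fst z) * \<sigma> (fst z)\<bar> + norm (b z) * norm (\<sigma> (fst z) *\<^sub>R grad \<sigma> (fst z))"
          unfolding k_def using Cauchy_Schwarz_ineq2[of "b z" "\<sigma> (fst z) *\<^sub>R grad \<sigma> (fst z)"]
            abs_triangle_ineq[of "(c z - l) * (\<sigma> (fst z) * \<sigma> (fst z))" "b z \<bullet> (\<sigma> (fst z) *\<^sub>R grad \<sigma> (fst z))"]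
          by (simp add: abs_mult)
        also have "\<dots> \<le> \<bar>c z - l\<bar> * (B * B) + norm (b z) * (B * B)" by (intro add_mono mult_left_mono b1 b2) auto
        also have "\<dots> = (\<bar>c z - l\<bar> + norm (b z)) * (B * B)" by (simp add: distrib_right)
        finally show "norm (k z) \<le> norm ((\<bar>c z - l\<bar> + norm (b z)) * (B * B))" using B0 by simp
      qed
    qed
    have "AE t in ?LI. 0 \<le> (\<integral>x. k (x, t) \<partial>NN)" proof (rule fundamental_lemma_nonneg_lebesgue_on)
      show "integrable ?LI (\<lambda>t. \<integral>x. k (x, t) \<partial>NN)" by (rule lebesgue_on_Fubini(2)[OF dom_sets(1) I ik])
      fix \<rho> :: "real \<Rightarrow> real" assume \<rho>: "test_function ?I \<rho>" "\<And>t. 0 \<le> \<rho> t"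
      define \<phi> where "\<phi> z = (\<sigma> (fst z) * \<sigma> (fst z)) * \<rho> (snd z)" for z :: "'a \<times> real"
      let ?r = "\<lambda>z. c z * \<phi> z + 1 / 2 * (b z \<bullet> grad (\<lambda>y. \<phi> (y, snd z)) (fst z))"
      have \<phi>: "test_function (cylinder \<Omega> T) \<phi>"
        unfolding \<phi>_def[abs_def] cylinder_def by (rule test_function_product[OF test_function_mult[OF \<sigma> sm] \<rho>(1)])
      have \<phi>0: "\<forall>z. 0 \<le> \<phi> z" using \<rho>(2) by (simp add: \<phi>_def)
      have gr: "grad (\<lambda>y. \<phi> (y, t)) x = (2 * \<rho> t) *\<^sub>R (\<sigma> x *\<^sub>R grad \<sigma> x)" for x t
      proof (rule grad_eq)
        have "(\<sigma> has_derivative (\<lambda>h. h \<bullet> grad \<sigma> x)) (at x)"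
          using GDERIV_grad(1)[OF smooth_differentiable[OF sm]] by (simp add: gderiv_def)
        then show "GDERIV (\<lambda>y. \<phi> (y, t)) x :> (2 * \<rho> t) *\<^sub>R (\<sigma> x *\<^sub>R grad \<sigma> x)"
          unfolding gderiv_def \<phi>_def by (auto intro!: derivative_eq_intros simp: algebra_simps)
      qed
      have ineq: "l * (\<integral>z. \<phi> z \<partial>?LQ) \<le> (\<integral>z. ?r z \<partial>?LQ)"
        using div \<phi> \<phi>0 unfolding c_minus_half_div_ge_def cylinder_def by blast
      have eq: "\<rho> (snd z) * k z = (?r z) - l * \<phi> z" for z by (simp only: gr) (simp add: k_def \<phi>_def algebra_simps)
      obtain R where R: "\<And>t. \<bar>\<rho> t\<bar> \<le> R" by (rule test_function_bounded[OF \<rho>(1)]) (rule that)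
      have mr: "(\<lambda>z::'a \<times> real. \<rho> (snd z)) \<in> borel_measurable borel"
        using smooth_measurable[OF test_function_smooth[OF \<rho>(1)]] unfolding borel_prod[symmetric] by measurable
      have i\<rho>k: "integrable ?LQ (\<lambda>z. \<rho> (snd z) * k z)"
        using integrable_bounded_scaleR[OF ik lebesgue_onI[OF mr], of R] R by simp
      have i\<phi>: "integrable ?LQ \<phi>" proof -
        obtain P where "\<And>z. \<bar>\<phi> z\<bar> \<le> P" by (rule test_function_bounded[OF \<phi>]) (rule that)
        then show ?thesis
          using integrable_bounded_set[OF Q _ lebesgue_onI[OF smooth_measurable[OF test_function_smooth[OF \<phi>]]], of P]
            cylinder_bounded[OF bounded_dom, of T] by (simp add: cylinder_def)
      qed
      have "0 \<le> (\<integral>z. ?r z \<partial>?LQ) - l * (\<integral>z. \<phi> z \<partial>?LQ)" using ineq by simp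
      also have "\<dots> = (\<integral>z. \<rho> (snd z) * k z \<partial>?LQ)" proof -
        have "(\<lambda>z. ?r z) = (\<lambda>z. \<rho> (snd z) * k z + l * \<phi> z)" by (simp add: eq)
        then show ?thesis using i\<rho>k i\<phi> by simp
      qed
      also have "\<dots> = (\<integral>t. (\<integral>x. \<rho> t * k (x, t) \<partial>NN) \<partial>?LI)"
        using lebesgue_on_Fubini(3)[OF dom_sets(1) I i\<rho>k] by simp
      finally show "0 \<le> (\<integral>t. \<rho> t * (\<integral>x. k (x, t) \<partial>NN) \<partial>?LI)" by simp
    qed auto
    then show ?thesis by (simp add: k_def)
  qed
  \<comment> \<open>Density is used for the pairs of function and gradient, since both enter the
    inequality.\<close>
  obtain D where D: "D \<subseteq> Collect (test_function \<Omega>)" "countable D"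
    "\<And>\<sigma> \<epsilon>. \<sigma> \<in> Collect (test_function \<Omega>) \<Longrightarrow> \<epsilon> > 0 \<Longrightarrow> \<exists>d\<in>D. \<forall>x\<in>closure \<Omega>. norm ((\<sigma> x, grad \<sigma> x) - (d x, grad d x)) < \<epsilon>"
  proof (rule countable_uniform_dense[of "closure \<Omega>" "Collect (test_function \<Omega>)" "\<lambda>\<sigma> x. (\<sigma> x, grad \<sigma> x)"])
    show "compact (closure \<Omega>)" using bounded_dom by simp
    show "continuous_on (closure \<Omega>) (\<lambda>x. (\<sigma> x, grad \<sigma> x))" if "\<sigma> \<in> Collect (test_function \<Omega>)" for \<sigma>
      using that test_function_smooth by (intro continuous_on_Pair smooth_continuous smooth_grad_continuous) auto
  qed (rule that)
  have "AE t in ?LI. \<forall>\<sigma>\<in>D. 0 \<le> (\<integral>x. (c (x, t) - l) * (\<sigma> x * \<sigma> x) + b (x, t) \<bullet> (\<sigma> x *\<^sub>R grad \<sigma> x) \<partial>NN)"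
    using D(1) one by (subst AE_ball_countable[OF D(2)]) auto
  with L2_section[OF b] L2_section[OF c] show ?thesis proof eventually_elim
    case (elim t)
    have Lcl: "L2_fun NN (\<lambda>x. c (x, t) - l)" by (intro L2_diff elim L2_bounded[OF dom_finite, where B="\<bar>l\<bar>"]) auto
    show ?case proof (intro allI impI)
      fix \<sigma> assume \<sigma>: "test_function \<Omega> \<sigma>"
      let ?F = "\<lambda>\<sigma>. (\<integral>x. (c (x, t) - l) * (\<sigma> x * \<sigma> x) \<partial>NN) + (\<integral>x. b (x, t) \<bullet> (\<sigma> x *\<^sub>R grad \<sigma> x) \<partial>NN)"

      obtain B where B: "\<And>x. \<bar>\<sigma> x\<bar> \<le> B" "\<And>x. norm (grad \<sigma> x) \<le> B"
        by (rule test_function_bounded[OF \<sigma>]) (rule that)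
      have B0: "B \<ge> 0" using B(1)[of 0] by linarith
      have "\<exists>d\<in>D. \<forall>x\<in>closure \<Omega>. norm ((\<sigma> x, grad \<sigma> x) - (d x, grad d x)) < 1 / real (Suc n)" for n
        using D(3)[of \<sigma> "1 / real (Suc n)"] \<sigma> by simp
      then obtain d where d: "\<And>n. d n \<in> D" "\<And>n x. x \<in> closure \<Omega> \<Longrightarrow> norm ((\<sigma> x, grad \<sigma> x) - (d n x, grad (d n) x)) < 1 / real (Suc n)"
        by metis
      have dt: "test_function \<Omega> (d n)" for n using d(1) D(1) by blast
      have cl: "\<bar>d n x - \<sigma> x\<bar> \<le> 1 / real (Suc n)" "norm (grad (d n) x - grad \<sigma> x) \<le> 1 / real (Suc n)" if "x \<in> \<Omega>" for n x
        using d(2)[of x n] that closure_subset[of \<Omega>] norm_fst_le[of "\<sigma> x - d n x" "grad \<sigma> x - grad (d n) x"]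
          norm_snd_le[of "grad \<sigma> x - grad (d n) x" "\<sigma> x - d n x"] by (auto simp: norm_minus_commute abs_minus_commute)
      have n1: "1 / real (Suc n) \<le> 1" for n by simp
      have bd: "\<bar>d n x\<bar> \<le> B + 1" "norm (grad (d n) x) \<le> B + 1" if "x \<in> \<Omega>" for n x proof -
        have "\<bar>d n x - \<sigma> x\<bar> \<le> 1" "norm (grad (d n) x - grad \<sigma> x) \<le> 1"
          by (rule order_trans[OF cl(1)[OF that] n1], rule order_trans[OF cl(2)[OF that] n1])
        then show "\<bar>d n x\<bar> \<le> B + 1" "norm (grad (d n) x) \<le> B + 1"
          using B(1)[of x] B(2)[of x] norm_triangle_ineq[of "grad (d n) x - grad \<sigma> x" "grad \<sigma> x"] by auto
      qed
      have pl: "(\<lambda>n. d n x) \<longlonglongrightarrow> \<sigma> x" "(\<lambda>n. grad (d n) x) \<longlonglongrightarrow> grad \<sigma> x" if "x \<in> \<Omega>" for x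
      proof -
        show "(\<lambda>n. d n x) \<longlonglongrightarrow> \<sigma> x" "(\<lambda>n. grad (d n) x) \<longlonglongrightarrow> grad \<sigma> x"
          using cl[OF that] by (auto intro!: tendsto_1_over_SucI)
      qed
      have bd2: "norm (d n x * d n x) \<le> (B + 1) * (B + 1)" "norm (d n x *\<^sub>R grad (d n) x) \<le> (B + 1) * (B + 1)"
        if "x \<in> \<Omega>" for n x
      proof -
        show "norm (d n x * d n x) \<le> (B + 1) * (B + 1)"
          unfolding real_norm_def abs_mult by (rule mult_mono[OF bd(1)[OF that] bd(1)[OF that]]) (use B0 in simp_all)
        show "norm (d n x *\<^sub>R grad (d n) x) \<le> (B + 1) * (B + 1)"
          unfolding norm_scaleR by (rule mult_mono[OF bd(1)[OF that] bd(2)[OF that]]) (use B0 in simp_all)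
      qed
      note ms = test_function_L2(1)[OF dt, THEN L2_measurable] test_function_L2(2)[OF dt, THEN L2_measurable]
        test_function_L2(1)[OF \<sigma>, THEN L2_measurable] test_function_L2(2)[OF \<sigma>, THEN L2_measurable]
      have L1: "L2_lim NN (\<lambda>n x. d n x * d n x) (\<lambda>x. \<sigma> x * \<sigma> x)"
        by (rule L2_lim_dominated_bounded[OF dom_finite, where B="(B + 1) * (B + 1)"])
          (use ms bd2(1) pl in \<open>auto intro!: AE_I2 tendsto_mult\<close>)
      have L2: "L2_lim NN (\<lambda>n x. d n x *\<^sub>R grad (d n) x) (\<lambda>x. \<sigma> x *\<^sub>R grad \<sigma> x)"
        by (rule L2_lim_dominated_bounded[OF dom_finite, where B="(B + 1) * (B + 1)"])
          (use ms bd2(2) pl in \<open>auto intro!: AE_I2 tendsto_scaleR borel_measurable_scaleR\<close>)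
      have LL: "L2_fun NN (\<lambda>x. d n x * d n x)" "L2_fun NN (\<lambda>x. \<sigma> x * \<sigma> x)" "L2_fun NN (\<lambda>x. d n x *\<^sub>R grad (d n) x)"
        "L2_fun NN (\<lambda>x. \<sigma> x *\<^sub>R grad \<sigma> x)" for n using L1 L2 by (auto simp: L2_lim_def)
      have "0 \<le> ?F \<sigma>" proof (rule LIMSEQ_le_const)
        show "(\<lambda>n. ?F (d n)) \<longlonglongrightarrow> ?F \<sigma>"
          by (intro tendsto_add L2_lim_mult L2_lim_inner L2_lim_const L1 L2 Lcl elim)
        have "0 \<le> ?F (d n)" for n
          using elim(3) d(1)[of n] L2_mult_integrable[OF Lcl LL(1)] L2_inner_integrable[OF elim(1) LL(3)] by auto
        then show "\<exists>N. \<forall>n\<ge>N. 0 \<le> ?F (d n)" by blast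
      qed
      moreover have "(\<integral>x. (c (x, t) - l) * (\<sigma> x * \<sigma> x) \<partial>NN) = (\<integral>x. c (x, t) * (\<sigma> x * \<sigma> x) \<partial>NN) - l * (\<integral>x. \<sigma> x * \<sigma> x \<partial>NN)"
      proof -
        have "integrable NN (\<lambda>x. \<sigma> x * \<sigma> x)" by (rule L2_integrable[OF dom_finite LL(2)])
        then show ?thesis using L2_mult_integrable[OF elim(2) LL(2)] by (simp add: left_diff_distrib)
      qed
      ultimately show "l * (\<integral>x. \<sigma> x * \<sigma> x \<partial>NN)
        \<le> (\<integral>x. c (x, t) * (\<sigma> x * \<sigma> x) \<partial>NN) + (\<integral>x. b (x, t) \<bullet> (\<sigma> x *\<^sub>R grad \<sigma> x) \<partial>NN)" by simp
    qed
  qed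
qed

end

lemma test_function_frechet_derivative:
  assumes "test_function S \<phi>"
  shows "test_function S (\<lambda>x. frechet_derivative \<phi> (at x) h)"
proof -
  from assms obtain K where "smooth \<phi>" "compact K" "K \<subseteq> S" "\<And>x h. x \<notin> K \<Longrightarrow> frechet_derivative \<phi> (at x) h = 0"
    by (rule test_functionE) (rule that)
  then show ?thesis by (intro test_functionI[of _ K] smooth_frechet_derivative) auto
qed

subsection \<open>Uniqueness\<close>

lemma has_weak_dt_linear:
  assumes "open \<Omega>" and u: "has_weak_dt \<Omega> T u w" and v: "has_weak_dt \<Omega> T v w'"
  shows "has_weak_dt \<Omega> T (\<lambda>z. a * u z + b * v z) (\<lambda>z. a * w z + b * w' z)"
proof -
  let ?Q = "cylinder \<Omega> T" and ?LQ = "lebesgue_on (cylinder \<Omega> T)"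
  have Q: "open ?Q" by (rule cylinder_open[OF assms(1)])
  have li: "locally_integrable ?Q u" "locally_integrable ?Q w" "locally_integrable ?Q v" "locally_integrable ?Q w'"
    using u v by (auto simp: has_weak_dt_def)
  have lin: "locally_integrable ?Q (\<lambda>z. a * f z + b * g z)" if "locally_integrable ?Q f" "locally_integrable ?Q g"
    for f g :: "'a \<times> real \<Rightarrow> real" using that by (auto simp: locally_integrable_def)
  have "(\<integral>z. (a * u z + b * v z) * deriv (\<lambda>s. \<phi> (fst z, s)) (snd z) \<partial>?LQ)
      = - (\<integral>z. (a * w z + b * w' z) * \<phi> z \<partial>?LQ)" if \<phi>: "test_function ?Q \<phi>" for \<phi>
  proof -
    have sm: "smooth \<phi>" by (rule test_function_smooth[OF \<phi>])
    define D where "D z = deriv (\<lambda>s. \<phi> (fst z, s)) (snd z)" for z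
    have D: "test_function ?Q D"
      using test_function_frechet_derivative[OF \<phi>, of "(0, 1)"] by (simp add: D_def[abs_def] deriv_section(2)[OF sm])
    have i: "integrable ?LQ (\<lambda>z. u z * D z)" "integrable ?LQ (\<lambda>z. v z * D z)"
      "integrable ?LQ (\<lambda>z. w z * \<phi> z)" "integrable ?LQ (\<lambda>z. w' z * \<phi> z)"
      using test_function_locally_integrable[OF D li(1) Q] test_function_locally_integrable[OF D li(3) Q]
        test_function_locally_integrable[OF \<phi> li(2) Q] test_function_locally_integrable[OF \<phi> li(4) Q]
      by (simp_all add: mult.commute)
    have "(\<integral>z. u z * D z \<partial>?LQ) = - (\<integral>z. w z * \<phi> z \<partial>?LQ)"
      "(\<integral>z. v z * D z \<partial>?LQ) = - (\<integral>z. w' z * \<phi> z \<partial>?LQ)"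
      using u v \<phi> unfolding has_weak_dt_def D_def by auto
    then have "(\<integral>z. a * (u z * D z) + b * (v z * D z) \<partial>?LQ) = - (\<integral>z. a * (w z * \<phi> z) + b * (w' z * \<phi> z) \<partial>?LQ)"
      using i by simp
    then show ?thesis by (simp add: D_def algebra_simps)
  qed
  then show ?thesis using li lin by (simp add: has_weak_dt_def)
qed

context bounded_domain
begin

text \<open>\<Phi> is the residual of the equation at a fixed time; collecting the four integrals
  into one lets inequalities be added, compared and passed to limits as a single L2 pairing.\<close>

lemma variational_inequality_iff:
  assumes a: "L2_fun NN a" and b: "L2_fun NN b" and c: "L2_fun NN c"
    and f: "L2_fun NN f"
    and G: "L2_fun NN G" "AE x in NN. norm (G x) \<le> M"
    and u: "L2_fun NN u" "AE x in NN. \<bar>u x\<bar> \<le> B" and v: "L2_fun NN v"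
  defines "\<Phi> \<equiv> \<lambda>x. a x + b x \<bullet> G x + c x * u x - f x"
  shows "L2_fun NN \<Phi>"
    and "(\<integral>x. a x * (v x - u x) \<partial>NN) + (\<integral>x. (b x \<bullet> G x) * (v x - u x) \<partial>NN)
       + (\<integral>x. c x * u x * (v x - u x) \<partial>NN) - (\<integral>x. f x * (v x - u x) \<partial>NN)
       = (\<integral>x. \<Phi> x * (v x - u x) \<partial>NN)"
proof -
  have bG: "L2_fun NN (\<lambda>x. b x \<bullet> G x)" by (rule L2_inner_bounded[OF b L2_measurable[OF G(1)] G(2)])
  have cu: "L2_fun NN (\<lambda>x. c x * u x)" using L2_bounded_mult[OF c L2_measurable[OF u(1)] u(2)] by (simp add: mult.commute)
  show "L2_fun NN \<Phi>" unfolding \<Phi>_def by (intro L2_diff L2_add a bG cu f)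
  have d: "L2_fun NN (\<lambda>x. v x - u x)" by (intro L2_diff v u)
  note i = L2_mult_integrable[OF a d] L2_mult_integrable[OF bG d] L2_mult_integrable[OF cu d] L2_mult_integrable[OF f d]
  show "(\<integral>x. a x * (v x - u x) \<partial>NN) + (\<integral>x. (b x \<bullet> G x) * (v x - u x) \<partial>NN)
       + (\<integral>x. c x * u x * (v x - u x) \<partial>NN) - (\<integral>x. f x * (v x - u x) \<partial>NN)
       = (\<integral>x. \<Phi> x * (v x - u x) \<partial>NN)"
    unfolding \<Phi>_def left_diff_distrib[of _ "f _"] distrib_right using i by simp
qed

lemma weak_dt_section:
  assumes w: "has_weak_dt \<Omega> T u w"
  shows "AE t in lebesgue_on {0<..<T}. AE x in NN. weak_dt \<Omega> T u (x, t) = w (x, t)"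
proof -
  have "has_weak_dt \<Omega> T u (weak_dt \<Omega> T u)" unfolding weak_dt_def by (rule someI[of "has_weak_dt \<Omega> T u", OF w])
  from has_weak_dt_unique[OF open_dom this w] show ?thesis unfolding cylinder_def by (intro AE_lebesgue_on_pair(2)) auto
qed

lemma solution_unique:
  assumes T: "T > 0"
    and b: "in_L2 (cylinder \<Omega> T) b" and c: "in_L2 (cylinder \<Omega> T) c" and f: "in_L2 (cylinder \<Omega> T) f"
    and div: "c_minus_half_div_ge \<Omega> T b c l"
    and gM: "\<And>t. t \<in> {0..T} \<Longrightarrow> AE x in NN. g (x, t) \<le> M"
    and u1: "u1 \<in> solution_class \<Omega> T" "is_solution \<Omega> T b c g f u0 u1"
    and u2: "u2 \<in> solution_class \<Omega> T" "is_solution \<Omega> T b c g f u0 u2"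
    and z: "z \<in> closure (cylinder \<Omega> T)"
  shows "u1 z = u2 z"
proof -
  let ?Q = "cylinder \<Omega> T" and ?LQ = "lebesgue_on (cylinder \<Omega> T)" and ?I = "{0<..<T}" and ?LI = "lebesgue_on ({0<..<T})"
  have Q: "?Q \<in> sets borel" using open_dom by simp
  have I: "?I \<in> sets borel" by simp
  have cl: "closure ?Q = closure \<Omega> \<times> {0..T}" using T by (simp add: cylinder_def closure_Times)
  obtain w1 where w1: "has_weak_dt \<Omega> T u1 w1" "in_L2 ?Q w1" using u1(1) unfolding solution_class_def by blast
  obtain w2 where w2: "has_weak_dt \<Omega> T u2 w2" "in_L2 ?Q w2" using u2(1) unfolding solution_class_def by blast
  have c1: "continuous_on (closure ?Q) u1" and c2: "continuous_on (closure ?Q) u2"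
    using u1(1) u2(1) by (simp_all add: solution_class_def)
  define W where "W z = u1 z - u2 z" for z
  define w where "w z = w1 z - w2 z" for z
  have Ww: "has_weak_dt \<Omega> T W w"
    using has_weak_dt_linear[OF open_dom w1(1) w2(1), of 1 "-1"] by (simp add: W_def[abs_def] w_def[abs_def])
  have Wc: "continuous_on (closure ?Q) W" unfolding W_def by (intro continuous_intros c1 c2)
  have Lw: "L2_fun ?LQ w" unfolding w_def using w1(2) w2(2) by (intro L2_diff) (simp_all add: in_L2_iff)
  have W0: "AE x in NN. W (x, 0) = 0" proof -
    have "AE x in NN. u1 (x, 0) = u0 x" "AE x in NN. u2 (x, 0) = u0 x" using u1(2) u2(2) by (simp_all add: is_solution_def)
    then show ?thesis by eventually_elim (simp add: W_def)
  qed
  obtain B1 B2 where B12: "\<And>z. z \<in> closure ?Q \<Longrightarrow> norm (u1 z) \<le> B1" "\<And>z. z \<in> closure ?Q \<Longrightarrow> norm (u2 z) \<le> B2"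
    using continuous_closure_cylinder(2)[OF T c1] continuous_closure_cylinder(2)[OF T c2] by blast
  define B where "B = B1 + B2"
  have WB: "\<bar>W z\<bar> \<le> B" if "z \<in> closure ?Q" for z using B12[OF that] by (simp add: W_def B_def abs_le_iff)
  note sec = continuous_closure_cylinder(3)[OF T]
  define k where "k t = (\<integral>x. w (x, t) * W (x, t) \<partial>NN)" for t
  define y where "y t = (\<integral>x. (W (x, t))^2 \<partial>NN)" for t
  have I0: "AE t in ?LI. t \<in> ?I" by (rule AE_I2) simp
  have S1: "AE t in ?LI. (\<lambda>x. u1 (x, t)) \<in> constraint_set \<Omega> (\<lambda>x. g (x, t))"
    "AE t in ?LI. (\<lambda>x. u2 (x, t)) \<in> constraint_set \<Omega> (\<lambda>x. g (x, t))"
    using u1(2) u2(2) by (simp_all add: is_solution_def)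
  let ?V = "\<lambda>u t. \<forall>v\<in>constraint_set \<Omega> (\<lambda>x. g (x, t)). (\<integral>x. weak_dt \<Omega> T u (x, t) * (v x - u (x, t)) \<partial>NN)
    + (\<integral>x. (b (x, t) \<bullet> weak_grad \<Omega> (\<lambda>y. u (y, t)) x) * (v x - u (x, t)) \<partial>NN)
    + (\<integral>x. c (x, t) * u (x, t) * (v x - u (x, t)) \<partial>NN) \<ge> (\<integral>x. f (x, t) * (v x - u (x, t)) \<partial>NN)"
  have V1: "AE t in ?LI. ?V u t" if "is_solution \<Omega> T b c g f u0 u" for u using that by (simp add: is_solution_def)
  have key: "AE t in ?LI. k t \<le> \<bar>l\<bar> * y t"
    using I0 S1 V1[OF u1(2)] V1[OF u2(2)] weak_dt_section[OF w1(1)] weak_dt_section[OF w2(1)] L2_section[OF w1(2)] L2_section[OF w2(2)]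
      L2_section[OF b] L2_section[OF c] L2_section[OF f] c_minus_half_div_AE[OF b c div]
  proof eventually_elim
    case (elim t)
    have tT: "t \<in> {0..T}" using elim(1) by auto
    have clx: "(x, t) \<in> closure ?Q" if "x \<in> \<Omega>" for x using that tT cl closure_subset[of \<Omega>] by auto
    let ?G = "\<lambda>v. weak_grad \<Omega> (\<lambda>x. v (x, t))" and ?K = "constraint_set \<Omega> (\<lambda>x. g (x, t))"
    define P where "P v x = weak_dt \<Omega> T v (x, t) + b (x, t) \<bullet> ?G v x + c (x, t) * v (x, t) - f (x, t)" for v x
    have H: "H10_grad (\<lambda>x. v (x, t)) (?G v)" "AE x in NN. norm (?G v x) \<le> M" if "(\<lambda>x. v (x, t)) \<in> ?K" for v
    proof -
      show "H10_grad (\<lambda>x. v (x, t)) (?G v)" using that in_H10_H10_grad unfolding constraint_set_def by blast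
      have "AE x in NN. norm (?G v x) \<le> g (x, t)" using that unfolding constraint_set_def by blast
      then show "AE x in NN. norm (?G v x) \<le> M" using gM[OF tT] by eventually_elim simp
    qed
    note H1 = H[OF elim(2)] and H2 = H[OF elim(3)]
    note L = H10_grad_L2[OF H1(1)] H10_grad_L2[OF H2(1)]
    have P: "L2_fun NN (P v)" "0 \<le> (\<integral>x. P v x * (v' (x, t) - v (x, t)) \<partial>NN)"
      if v: "(\<lambda>x. v (x, t)) \<in> ?K" "(\<lambda>x. v' (x, t)) \<in> ?K" and w': "L2_fun NN (\<lambda>x. w' (x, t))" "AE x in NN. weak_dt \<Omega> T v (x, t) = w' (x, t)"
        and vB: "\<And>z. z \<in> closure ?Q \<Longrightarrow> norm (v z) \<le> B'" and vi: "?V v t" for v v' w' B'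
    proof -
      have a: "L2_fun NN (\<lambda>x. weak_dt \<Omega> T v (x, t))" by (rule AE_eq_L2_fun[OF w']) simp
      have b: "AE x in NN. \<bar>v (x, t)\<bar> \<le> B'" using vB[OF clx] by (intro AE_I2) simp
      note Hv = H[OF v(1)] H(1)[OF v(2)]
      note iff = variational_inequality_iff[OF a elim(10-12) H10_grad_L2(2)[OF Hv(1)] Hv(2) H10_grad_L2(1)[OF Hv(1)] b H10_grad_L2(1)[OF Hv(3)]]
      show "L2_fun NN (P v)" unfolding P_def[abs_def] by (rule iff(1))
      show "0 \<le> (\<integral>x. P v x * (v' (x, t) - v (x, t)) \<partial>NN)" unfolding P_def iff(2)[symmetric] using bspec[OF vi v(2)] by simp
    qed
    note P1 = P[OF elim(2,3,8,6) B12(1) elim(4)] and P2 = P[OF elim(3,2,9,7) B12(2) elim(5)]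
    define G where "G x = ?G u1 x - ?G u2 x" for x
    have WG: "H10_grad (\<lambda>x. W (x, t)) G"
      using H10_grad_linear[OF H1(1) H2(1), of 1 "-1"] by (simp add: W_def G_def[abs_def])
    have GM: "AE x in NN. norm (G x) \<le> 2 * M" using H1(2) H2(2) proof eventually_elim
      case (elim x)
      then show ?case using norm_triangle_ineq4[of "?G u1 x" "?G u2 x"] by (simp add: G_def)
    qed
    have WBt: "AE x in NN. \<bar>W (x, t)\<bar> \<le> B" using WB[OF clx] by (intro AE_I2) simp
    have LW: "L2_fun NN (\<lambda>x. W (x, t))" "L2_fun NN G" using H10_grad_L2[OF WG] by auto
    have LWW: "L2_fun NN (\<lambda>x. W (x, t) * W (x, t))" using L2_bounded_mult[OF LW(1) L2_measurable[OF LW(1)] WBt] by simp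
    have LWG: "L2_fun NN (\<lambda>x. W (x, t) *\<^sub>R G x)" by (rule L2_bounded_mult[OF LW(2) L2_measurable[OF LW(1)] WBt])
    have Lwt: "L2_fun NN (\<lambda>x. w (x, t))" unfolding w_def by (intro L2_diff elim)
    note ii = L2_mult_integrable[OF Lwt LW(1)] L2_mult_integrable[OF elim(11) LWW] L2_inner_integrable[OF elim(10) LWG]
    \<comment> \<open>The two inequalities, each tested with the other solution, add up to minus the
      quadratic form of the difference \<open>W\<close>; the source term \<open>f\<close>
      cancels.\<close>
    have "k t + (\<integral>x. c (x, t) * (W (x, t) * W (x, t)) \<partial>NN) + (\<integral>x. b (x, t) \<bullet> (W (x, t) *\<^sub>R G x) \<partial>NN)
        = (\<integral>x. w (x, t) * W (x, t) + c (x, t) * (W (x, t) * W (x, t)) + b (x, t) \<bullet> (W (x, t) *\<^sub>R G x) \<partial>NN)"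
      using ii by (simp add: k_def)
    also have "\<dots> = (\<integral>x. - (P u1 x * (u2 (x, t) - u1 (x, t)) + P u2 x * (u1 (x, t) - u2 (x, t))) \<partial>NN)"
    proof (rule integral_cong_AE)
      show "(\<lambda>x. w (x, t) * W (x, t) + c (x, t) * (W (x, t) * W (x, t)) + b (x, t) \<bullet> (W (x, t) *\<^sub>R G x)) \<in> borel_measurable NN"
        using ii by (intro borel_measurable_add) auto
      show "(\<lambda>x. - (P u1 x * (u2 (x, t) - u1 (x, t)) + P u2 x * (u1 (x, t) - u2 (x, t)))) \<in> borel_measurable NN"
        using P1(1) P2(1) L by (auto simp: L2_fun_def)
      show "AE x in NN. w (x, t) * W (x, t) + c (x, t) * (W (x, t) * W (x, t)) + b (x, t) \<bullet> (W (x, t) *\<^sub>R G x)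
          = - (P u1 x * (u2 (x, t) - u1 (x, t)) + P u2 x * (u1 (x, t) - u2 (x, t)))" using elim(6,7)
      by eventually_elim (simp add: P_def w_def W_def G_def inner_diff_right algebra_simps)
    qed
    also have "\<dots> = - ((\<integral>x. P u1 x * (u2 (x, t) - u1 (x, t)) \<partial>NN) + (\<integral>x. P u2 x * (u1 (x, t) - u2 (x, t)) \<partial>NN))"
    proof -
      have "integrable NN (\<lambda>x. P u1 x * (u2 (x, t) - u1 (x, t)))" "integrable NN (\<lambda>x. P u2 x * (u1 (x, t) - u2 (x, t)))"
        using L2_mult_integrable[OF P1(1) L2_diff[OF L(3,1)]] L2_mult_integrable[OF P2(1) L2_diff[OF L(1,3)]] by blast+
      then show ?thesis by simp
    qed
    also have "\<dots> \<le> 0" using P1(2) P2(2) by simp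
    finally have "k t \<le> - ((\<integral>x. c (x, t) * (W (x, t) * W (x, t)) \<partial>NN) + (\<integral>x. b (x, t) \<bullet> (W (x, t) *\<^sub>R G x) \<partial>NN))" by simp
    \<comment> \<open>The condition on c - 1/2 div b, extended to the bounded function
      \<open>W\<close> with bounded gradient, absorbs the convection and zero order terms.\<close>
    also have "\<dots> \<le> - (l * (\<integral>x. W (x, t) * W (x, t) \<partial>NN))"
      using weighted_sin_inequality[OF elim(10,11) _ WG GM WBt, of l] elim(13) by simp
    also have "\<dots> = - l * y t" by (simp add: y_def power2_eq_square)
    also have "\<dots> \<le> \<bar>l\<bar> * y t" by (intro mult_right_mono) (auto simp: y_def)
    finally show ?case .
  qed
  note Wm = continuous_closure_cylinder(1)[OF T Wc]
  have WBQ: "AE z in ?LQ. norm (W z) \<le> B" using WB closure_subset[of ?Q] by (intro AE_I2) auto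
  have fin: "finite_measure ?LQ" by (rule finite_measure_bounded_set[OF Q cylinder_bounded[OF bounded_dom]])
  have LWQ: "L2_fun ?LQ W" by (rule L2_bounded[OF fin Wm WBQ])
  have iy: "integrable ?LI y"
    unfolding y_def[abs_def] using LWQ by (intro lebesgue_on_Fubini(2)) (auto simp: L2_fun_def cylinder_def)
  have ik: "integrable ?LI k"
    unfolding k_def[abs_def] using L2_mult_integrable[OF Lw LWQ] by (intro lebesgue_on_Fubini(2)) (auto simp: cylinder_def)
  interpret N: finite_measure NN by (rule dom_finite)
  have y_bound: "0 \<le> y t \<and> y t \<le> B^2 * measure NN (space NN)" if t: "t \<in> {0..T}" for t proof -
    have "y t \<le> (\<integral>x. B^2 \<partial>NN)" unfolding y_def proof (rule integral_mono_AE')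
      show "AE x in NN. (W (x, t))^2 \<le> B^2"
        using WB cl t closure_subset[of \<Omega>] power_mono[of "\<bar>W (_, t)\<bar>" B 2] by (intro AE_I2) auto
    qed auto
    then show ?thesis by (simp add: y_def mult.commute)
  qed
  \<comment> \<open>The factor 2 in the Gronwall constant comes from the energy identity.\<close>
  have y0: "y t = 0" if t: "t \<in> {0..T}" for t proof (rule gronwall_zero[where K="2 * \<bar>l\<bar>", OF _ y_bound iy _ t])
    show "y s \<le> 2 * \<bar>l\<bar> * (\<integral>r. indicator {..s} r * y r \<partial>?LI)" if s: "s \<in> {0..T}" for s proof -
      have "y s = 2 * (\<integral>r. indicator {..s} r * k r \<partial>?LI)"
        unfolding y_def k_def by (rule energy_identity[OF T Ww Wc Lw W0 s])
      also have "\<dots> \<le> 2 * (\<integral>r. \<bar>l\<bar> * (indicator {..s} r * y r) \<partial>?LI)"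
      proof (intro mult_left_mono integral_mono_AE)
        show "integrable ?LI (\<lambda>r. indicator {..s} r * k r)" by (rule integrable_indicator_lebesgue_on[OF ik]) simp
        show "integrable ?LI (\<lambda>r. \<bar>l\<bar> * (indicator {..s} r * y r))"
          using integrable_indicator_lebesgue_on[OF iy, of "{..s}"] by simp
        show "AE r in ?LI. indicator {..s} r * k r \<le> \<bar>l\<bar> * (indicator {..s} r * y r)"
          using key by eventually_elim (auto split: split_indicator)
      qed simp
      finally show ?thesis by simp
    qed
  qed simp
  \<comment> \<open>At each time \<open>W\<close> vanishes almost everywhere in
    \<open>\<Omega>\<close>, hence everywhere in \<open>\<Omega>\<close> by continuity; the boundary
    of the cylinder follows by closure.\<close>
  have Wz: "W p = 0" if p: "p \<in> ?Q" for p proof (rule ccontr)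
    assume np: "W p \<noteq> 0"
    obtain x t where xt: "p = (x, t)" "x \<in> \<Omega>" "t \<in> ?I" using p by (auto simp: cylinder_def)
    have tT: "t \<in> {0..T}" using xt by auto
    have "continuous_on \<Omega> (\<lambda>x. W (x, t))"
      by (rule continuous_on_compose2[OF Wc]) (use tT closure_subset[of \<Omega>] cl in \<open>auto intro!: continuous_intros\<close>)
    then have "isCont (\<lambda>x. W (x, t)) x" using xt(2) open_dom by (simp add: continuous_on_eq_continuous_at)
    then have "eventually (\<lambda>x. W (x, t) \<noteq> 0) (nhds x)"
      using np xt(1) tendsto_at_iff_tendsto_nhds[of "\<lambda>x. W (x, t)" x]
      by (intro tendsto_imp_eventually_ne[of "\<lambda>x. W (x, t)" "W (x, t)"]) (simp_all add: isCont_def)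
    moreover have "eventually (\<lambda>x. x \<in> \<Omega>) (nhds x)" using xt(2) open_dom by (rule eventually_nhds_in_open[rotated])
    ultimately have "eventually (\<lambda>x. W (x, t) \<noteq> 0 \<and> x \<in> \<Omega>) (nhds x)" by (rule eventually_conj)
    then obtain e where e: "e > 0" "\<And>x'. dist x' x < e \<Longrightarrow> W (x', t) \<noteq> 0 \<and> x' \<in> \<Omega>"
      unfolding eventually_nhds_metric by blast
    have "L2_fun NN (\<lambda>x. W (x, t))" proof (rule L2_bounded[OF dom_finite sec[OF Wc tT]])
      show "AE x in NN. norm (W (x, t)) \<le> B" by (rule AE_I2) (use WB cl tT closure_subset[of \<Omega>] in auto)
    qed
    then have "integrable NN (\<lambda>x. (W (x, t))^2)" by (simp add: L2_fun_def)
    then have "AE x in NN. (W (x, t))^2 = 0" using y0[OF tT] unfolding y_def by (subst (asm) integral_nonneg_eq_0_iff_AE) auto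
    then have ae: "AE x in lborel. x \<in> \<Omega> \<longrightarrow> (W (x, t))^2 = 0" by (simp add: AE_lebesgue_on_iff)
    obtain x' where "x' \<in> ball x e" "x' \<in> \<Omega> \<longrightarrow> (W (x', t))^2 = 0" by (rule AE_lborel_dense[OF ae e(1)])
    then show False using e(2)[of x'] by (simp add: dist_commute)
  qed
  have "W z = 0" by (rule continuous_constant_on_closure[OF Wc Wz z])
  then show ?thesis by (simp add: W_def)
qed

end

subsection \<open>The discrete problem\<close>

lemma young_ineq: "a * b \<le> r * a^2 + b^2 / (4 * r)" if "r > 0" for a b r :: real
proof -
  have "0 \<le> (2 * r * a - b)^2 / (4 * r)" using that by simp
  also have "\<dots> = r * a^2 + b^2 / (4 * r) - a * b" using that by (simp add: power2_eq_square field_simps)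
  finally show ?thesis by simp
qed

text \<open>\<open>C\<close> is the Lipschitz constant of \<open>g\<close> in time, \<open>m\<close>
  and \<open>M\<close> its bounds at every time, and \<open>V0\<close> stands for the Lipschitz
  representative of the initial value.\<close>

locale evolution = lipschitz_domain \<Omega> for \<Omega> :: "'a::euclidean_space set" +
  fixes T m C M :: real and b :: "'a \<times> real \<Rightarrow> 'a" and c f g :: "'a \<times> real \<Rightarrow> real" and V0 :: "'a \<Rightarrow> real"
  assumes T: "T > 0" and m: "m > 0" and C: "C \<ge> 0" and M: "M \<ge> 0"
    and Lb: "in_L2 (cylinder \<Omega> T) b" and Lc: "in_L2 (cylinder \<Omega> T) c" and Lf: "in_L2 (cylinder \<Omega> T) f"
    and g_bounds: "\<And>t. t \<in> {0..T} \<Longrightarrow> AE x in lebesgue_on \<Omega>. m \<le> g (x, t) \<and> g (x, t) \<le> M"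
    and g_lip: "\<And>s t. s \<in> {0..T} \<Longrightarrow> t \<in> {0..T} \<Longrightarrow> AE x in lebesgue_on \<Omega>. \<bar>g (x, t) - g (x, s)\<bar> \<le> C * \<bar>t - s\<bar>"
    and V0: "V0 \<in> Kset M (\<lambda>x. g (x, 0))"
begin

abbreviation "TT \<equiv> lebesgue_on {0<..<T}"
abbreviation "QQ \<equiv> lebesgue_on (\<Omega> \<times> {0<..<T})"
abbreviation "K t \<equiv> Kset M (\<lambda>x. g (x, t))"

lemma Q_sets [simp]: "\<Omega> \<times> {0<..<T} \<in> sets borel" "{0<..<T} \<in> sets (borel :: real measure)"
  by (intro borel_Times) auto

lemmas QF = dom_sets(1) Q_sets(2)

lemma Q_bounded: "bounded (\<Omega> \<times> {0<..<T})"
  using cylinder_bounded[OF bounded_dom, of T] by (simp add: cylinder_def)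

lemma Q_finite: "finite_measure QQ"
  by (rule finite_measure_bounded_set[OF Q_sets(1) Q_bounded])

lemma LQ: "L2_fun QQ b" "L2_fun QQ c" "L2_fun QQ f"
  using Lb Lc Lf by (simp_all add: in_L2_iff cylinder_def)

lemma K_lip0: "V \<in> K t \<Longrightarrow> V \<in> lip0 M" by (simp add: Kset_def)

text \<open>One sup bound for all of \<open>lip0 M\<close>, fixed once so that later constants do
  not depend on the step number or the mesh.\<close>

definition B where "B = (SOME B. B \<ge> 0 \<and> (\<forall>V x. V \<in> lip0 M \<longrightarrow> \<bar>V x\<bar> \<le> B))"

lemma B: "B \<ge> 0" "V \<in> lip0 M \<Longrightarrow> \<bar>V x\<bar> \<le> B"
proof -
  have "\<exists>B. B \<ge> 0 \<and> (\<forall>V x. V \<in> lip0 M \<longrightarrow> \<bar>V x\<bar> \<le> B)"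
    by (rule lip0_bounded[of M]) blast
  from someI_ex[OF this] show "B \<ge> 0" "V \<in> lip0 M \<Longrightarrow> \<bar>V x\<bar> \<le> B" unfolding B_def by blast+
qed

lemma gM: "t \<in> {0..T} \<Longrightarrow> AE x in NN. g (x, t) \<le> M"
  using g_bounds by (auto elim: eventually_mono)

lemma K_grad:
  assumes "V \<in> K t" "t \<in> {0..T}"
  shows "H10_grad V (weak_grad \<Omega> V)" "AE x in NN. norm (weak_grad \<Omega> V x) \<le> g (x, t)"
    "AE x in NN. norm (weak_grad \<Omega> V x) \<le> M"
proof -
  show "H10_grad V (weak_grad \<Omega> V)" and 1: "AE x in NN. norm (weak_grad \<Omega> V x) \<le> g (x, t)"
    using assms(1) in_H10_H10_grad by (auto simp: Kset_def constraint_set_def)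
  show "AE x in NN. norm (weak_grad \<Omega> V x) \<le> M" using 1 gM[OF assms(2)] by eventually_elim simp
qed

text \<open>Since \<open>g \<ge> m\<close>, this factor compensates the variation of \<open>g\<close> between the times \<open>s\<close> and \<open>t\<close>.\<close>

definition sc :: "real \<Rightarrow> real \<Rightarrow> real" where "sc s t = max 0 (1 - C / m * \<bar>t - s\<bar>)"

lemma sc_bounds: "0 \<le> sc s t" "sc s t \<le> 1" "1 - sc s t \<le> C / m * \<bar>t - s\<bar>"
  using C m by (auto simp: sc_def)

lemma K_scale:
  assumes V: "V \<in> K s" and st: "s \<in> {0..T}" "t \<in> {0..T}"
  shows "(\<lambda>x. sc s t * V x) \<in> K t"
proof -
  note G = K_grad[OF V st(1)]
  have "AE x in NN. norm (sc s t *\<^sub>R weak_grad \<Omega> V x) \<le> g (x, t)"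
    using G(2) g_bounds[OF st(1)] g_bounds[OF st(2)] g_lip[OF st]
  proof eventually_elim
    case (elim x)
    have 1: "norm (sc s t *\<^sub>R weak_grad \<Omega> V x) \<le> sc s t * g (x, s)"
      using elim(1) sc_bounds(1)[of s t] by (simp add: mult_left_mono)
    show ?case proof (cases "1 - C / m * \<bar>t - s\<bar> \<le> 0")
      case True
      then show ?thesis using elim m by (simp add: sc_def)
    next
      case False
      \<comment> \<open>The room gained by the scaling is a multiple of \<open>g (x, s)\<close>; the
        lower bound \<open>m\<close> makes it at least as large as any decrease of \<open>g\<close>
        between the two times.\<close>
      have "C * \<bar>t - s\<bar> \<le> C / m * \<bar>t - s\<bar> * g (x, s)"
        using mult_left_mono[of m "g (x, s)" "C / m * \<bar>t - s\<bar>"] elim(2) C m by simp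
      then have "sc s t * g (x, s) \<le> g (x, s) - C * \<bar>t - s\<bar>" using False by (simp add: sc_def left_diff_distrib)
      then show ?thesis using 1 elim(4) by (simp add: abs_le_iff)
    qed
  qed
  then have "(\<lambda>x. sc s t * V x) \<in> constraint_set \<Omega> (\<lambda>x. g (x, t))"
    unfolding constraint_set_iff using H10_grad_linear[OF G(1) G(1), of "sc s t" 0] by auto
  moreover have "(\<lambda>x. sc s t * V x) \<in> lip0 M" proof (rule lip0I[OF M])
    show "\<bar>sc s t * V x - sc s t * V y\<bar> \<le> M * norm (x - y)" for x y proof -
      have "sc s t * \<bar>V x - V y\<bar> \<le> 1 * (M * norm (x - y))"
        using lip0_le[OF K_lip0[OF V]] sc_bounds[of s t] by (intro mult_mono) auto
      then show ?thesis using sc_bounds[of s t] by (simp add: abs_mult flip: right_diff_distrib)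
    qed
  qed (use V in \<open>simp add: Kset_def lip0_def\<close>)
  ultimately show ?thesis by (simp add: Kset_def)
qed

text \<open>Only \<open>U\<close> is frozen; \<open>f\<close>, \<open>b\<close> and \<open>c\<close>
  keep their dependence on time.\<close>

definition src :: "('a \<Rightarrow> real) \<Rightarrow> 'a \<times> real \<Rightarrow> real" where
  "src U z = f z - b z \<bullet> weak_grad \<Omega> U (fst z) - c z * U (fst z)"

text \<open>A common integrable bound for the squares of all sources, independent of the iterate: 3
  from the square of a sum of three terms, \<open>M\<close> for the gradient, \<open>B\<close> for
  the values.\<close>

definition \<Psi> :: "'a \<times> real \<Rightarrow> real" where
  "\<Psi> z = 3 * ((f z)^2 + M^2 * (norm (b z))^2 + B^2 * (c z)^2)"

lemma \<Psi>_integrable: "integrable QQ \<Psi>" "\<Psi> z \<ge> 0"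
  using LQ by (auto simp: \<Psi>_def[abs_def] L2_fun_def)

lemma lip0_fst_measurable:
  "V \<in> lip0 M' \<Longrightarrow> (\<lambda>z. V (fst z)) \<in> borel_measurable (lebesgue_on (\<Omega> \<times> {0<..<T}))"
  by (intro lebesgue_on_measurable_fst dom_sets Q_sets lebesgue_onI lip0_measurable)

lemma src_L2:
  assumes U: "U \<in> K s" "s \<in> {0..T}"
  shows "L2_fun QQ (src U)" "AE z in QQ. (src U z)^2 \<le> \<Psi> z"
proof -
  note G = K_grad[OF U]
  have UB: "AE z in QQ. \<bar>U (fst z)\<bar> \<le> B" using B(2)[OF K_lip0[OF U(1)]] by simp
  have GM: "AE z in QQ. norm (weak_grad \<Omega> U (fst z)) \<le> M" by (rule AE_lebesgue_on_fst[OF QF G(3)])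
  have Gm: "(\<lambda>z. weak_grad \<Omega> U (fst z)) \<in> borel_measurable QQ"
    by (rule lebesgue_on_measurable_fst[OF QF L2_measurable[OF H10_grad_L2(2)[OF G(1)]]])
  have "L2_fun QQ (\<lambda>z. U (fst z) *\<^sub>R c z)" by (rule L2_bounded_mult[OF LQ(2) lip0_fst_measurable[OF K_lip0[OF U(1)]] UB])
  then show "L2_fun QQ (src U)" unfolding src_def[abs_def] using L2_inner_bounded[OF LQ(1) Gm GM] LQ(3)
    by (intro L2_diff) (auto simp: mult.commute)
  show "AE z in QQ. (src U z)^2 \<le> \<Psi> z" using UB GM proof eventually_elim
    case (elim z)
    have "(p - q - r)^2 \<le> 3 * (p^2 + q^2 + r^2)" for p q r :: real proof -
      have "0 \<le> (p + q)^2 + (p + r)^2 + (q - r)^2" by simp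
      then show ?thesis by (simp add: power2_eq_square algebra_simps)
    qed
    then have "(src U z)^2 \<le> 3 * ((f z)^2 + (b z \<bullet> weak_grad \<Omega> U (fst z))^2 + (c z * U (fst z))^2)"
      by (simp add: src_def)
    also have "(b z \<bullet> weak_grad \<Omega> U (fst z))^2 \<le> M^2 * (norm (b z))^2" proof -
      have "\<bar>b z \<bullet> weak_grad \<Omega> U (fst z)\<bar> \<le> M * norm (b z)"
        using Cauchy_Schwarz_ineq2[of "b z" "weak_grad \<Omega> U (fst z)"] mult_left_mono[OF elim(2), of "norm (b z)"] by (simp add: mult.commute)
      from power_mono[OF this, of 2] show ?thesis by (simp add: power_mult_distrib)
    qed
    also have "(c z * U (fst z))^2 \<le> B^2 * (c z)^2"
      using power_mono[OF elim(1), of 2] by (simp add: power_mult_distrib mult.commute mult_left_mono)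
    finally show ?case by (simp add: \<Psi>_def)
  qed
qed

text \<open>An Euler step multiplied by the step length: the constraint and the test functions
  belong to the new time \<open>t\<close>, while the source uses the old iterate \<open>U\<close>
  and is integrated over the cell \<open>J\<close>.\<close>

definition el_ineq :: "real \<Rightarrow> real set \<Rightarrow> ('a \<Rightarrow> real) \<Rightarrow> ('a \<Rightarrow> real) \<Rightarrow> bool" where
  "el_ineq t J U U' \<longleftrightarrow> (\<forall>V\<in>K t. (\<integral>x. (U' x - U x) * (V x - U' x) \<partial>NN)
     \<ge> (\<integral>z. indicator J (snd z) * src U z * (V (fst z) - U' (fst z)) \<partial>QQ))"

lemma indicator_snd_measurable:
  "J \<in> sets borel \<Longrightarrow> (\<lambda>z. indicator J (snd z) :: real) \<in> borel_measurable (lebesgue_on (S :: ('a \<times> real) set))"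
  by (rule lebesgue_onI) (simp flip: borel_prod)

lemma step_exists:
  assumes U: "U \<in> K s" and st: "s \<in> {0..T}" "t \<in> {0..T}" and J: "J \<in> sets borel"
  shows "\<exists>U'\<in>K t. el_ineq t J U U'"
proof -
  have L: "L2_fun QQ (\<lambda>z. indicator J (snd z) *\<^sub>R src U z)"
    by (rule L2_bounded_mult[OF src_L2(1)[OF U st(1)] indicator_snd_measurable[OF J], of 1]) (auto split: split_indicator)
  have "integrable QQ (\<lambda>z. indicator J (snd z) * src U z)" using L2_integrable[OF Q_finite L] by simp
  then obtain U' where "U' \<in> K t" "\<And>V. V \<in> K t \<Longrightarrow> (\<integral>x. (U' x - U x) * (V x - U' x) \<partial>NN)
      \<ge> (\<integral>z. (indicator J (snd z) * src U z) * (V (fst z) - U' (fst z)) \<partial>QQ)"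
    by (rule Kset_minimizer[OF Q_sets(2) _ K_lip0[OF U] _ gM[OF st(2)]]) (use K_scale[OF U st] in blast, rule that)
  then show ?thesis unfolding el_ineq_def by blast
qed

text \<open>Entries beyond index \<open>N\<close> are unconstrained. The cells are half-open, so
  that each time in [0, T) belongs to exactly one of them.\<close>

definition is_scheme :: "nat \<Rightarrow> (nat \<Rightarrow> 'a \<Rightarrow> real) \<Rightarrow> bool" where
  "is_scheme N U \<longleftrightarrow> U 0 = V0 \<and> (\<forall>k\<le>N. U k \<in> K (real k * (T / real N))) \<and>
     (\<forall>k<N. el_ineq (real (Suc k) * (T / real N)) {real k * (T / real N)..<real (Suc k) * (T / real N)} (U k) (U (Suc k)))"

lemma grid_in:
  assumes "N > 0" "k \<le> N"
  shows "real k * (T / real N) \<in> {0..T}"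
proof -
  have "real k * T \<le> real N * T" using assms T by (intro mult_right_mono) auto
  then show ?thesis using assms T by (simp add: field_simps)
qed

lemma scheme_exists:
  assumes N: "N > 0"
  shows "\<exists>U. is_scheme N U"
proof -
  let ?t = "\<lambda>k. real k * (T / real N)"
  let ?P = "\<lambda>k U. (k = 0 \<longrightarrow> U = V0) \<and> (k \<le> N \<longrightarrow> U \<in> K (?t k))"
  let ?R = "\<lambda>k U U'. k < N \<longrightarrow> el_ineq (?t (Suc k)) {?t k..<?t (Suc k)} U U'"
  have "\<exists>U. \<forall>k. ?P k (U k) \<and> ?R k (U k) (U (Suc k))" proof (rule dependent_nat_choice)
    show "\<exists>U. ?P 0 U" using V0 by simp
    fix U k assume U: "?P k U"
    show "\<exists>U'. ?P (Suc k) U' \<and> ?R k U U'" proof (cases "k < N")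
      case True
      then have "U \<in> K (?t k)" using U by simp
      from step_exists[OF this grid_in[OF N] grid_in[OF N], of "Suc k" "{?t k..<?t (Suc k)}"] True
      show ?thesis by auto
    qed auto
  qed
  then show ?thesis unfolding is_scheme_def by auto
qed

lemma bounded_product_integral:
  fixes h :: "'a \<Rightarrow> real" and \<alpha> :: "real \<Rightarrow> real"
  assumes h: "h \<in> borel_measurable NN" "\<And>x. x \<in> \<Omega> \<Longrightarrow> \<bar>h x\<bar> \<le> H" and \<alpha>: "\<alpha> \<in> borel_measurable borel" "\<And>t. \<bar>\<alpha> t\<bar> \<le> A"
  shows "integrable QQ (\<lambda>z. \<alpha> (snd z) * h (fst z))"
    and "(\<integral>z. \<alpha> (snd z) * h (fst z) \<partial>QQ) = integral\<^sup>L TT \<alpha> * integral\<^sup>L NN h"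
proof -
  have "(\<lambda>z::'a \<times> real. \<alpha> (snd z)) \<in> borel_measurable borel" using \<alpha>(1) by (simp flip: borel_prod)
  then have m: "(\<lambda>z. \<alpha> (snd z) * h (fst z)) \<in> borel_measurable QQ"
    by (intro borel_measurable_times lebesgue_onI lebesgue_on_measurable_fst h dom_sets Q_sets)
  show i: "integrable QQ (\<lambda>z. \<alpha> (snd z) * h (fst z))"
  proof (rule integrable_bounded_set[OF Q_sets(1) Q_bounded m, of "A * H"])
    have "A \<ge> 0" using \<alpha>(2)[of 0] by linarith
    then show "AE z in QQ. norm (\<alpha> (snd z) * h (fst z)) \<le> A * H"
      using h(2) \<alpha>(2) by (intro AE_I2) (auto simp: abs_mult intro!: mult_mono)
  qed
  show "(\<integral>z. \<alpha> (snd z) * h (fst z) \<partial>QQ) = integral\<^sup>L TT \<alpha> * integral\<^sup>L NN h"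
    using lebesgue_on_Fubini(3)[OF QF i] by simp
qed

lemma cell_measure:
  assumes "0 \<le> s" "s < t" "t \<le> T"
  shows "integral\<^sup>L TT (indicator {s..<t} :: real \<Rightarrow> real) = t - s"
proof -
  have "integral\<^sup>L TT (indicator {s..<t} :: real \<Rightarrow> real) = (\<integral>r. indicator {0<..<T} r * indicator {s..<t} r \<partial>lborel)"
    by (rule borel_rep_integral(2)) (auto intro!: AE_I2)
  also have "\<dots> = (\<integral>r. (indicator {s..<t} r :: real) \<partial>lborel)" proof (rule integral_cong_AE)
    have "AE r in lborel. r \<noteq> (0::real)" by (rule AE_lborel_singleton)
    then show "AE r in lborel. indicator {0<..<T} r * indicator {s..<t} r = (indicator {s..<t} r :: real)"
      by eventually_elim (use assms in \<open>auto split: split_indicator\<close>)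
  qed auto
  also have "\<dots> = t - s" using assms by simp
  finally show ?thesis .
qed

definition "\<beta> = B^2 * measure NN \<Omega>"

text \<open>The natural test function, the old iterate, may be inadmissible at the new time, so its
  rescaling by \<open>sc s t\<close> is used. The error is \<open>e\<close> times the old iterate
  with \<open>e\<close> of the order of the step length, and Young's inequality absorbs half of the
  squared increment. The result is of the order of the step length times an amount that can be
  summed over the steps.\<close>

lemma step_energy:
  assumes U: "U \<in> K s" and U': "U' \<in> K t" and st: "0 \<le> s" "s < t" "t \<le> T"
    and EL: "el_ineq t {s..<t} U U'"
  shows "(\<integral>x. (U' x - U x)^2 \<partial>NN) \<le> (t - s) * (3 * (\<integral>z. indicator {s..<t} (snd z) * \<Psi> z \<partial>QQ) + 3 * (C / m)^2 * (t - s) * \<beta>)"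
proof -
  interpret N: finite_measure NN by (rule dom_finite)
  define \<tau> where "\<tau> = t - s"
  have \<tau>: "\<tau> > 0" using st by (simp add: \<tau>_def)
  define e where "e = 1 - sc s t"
  have e: "0 \<le> e" "e \<le> C / m * \<tau>" using sc_bounds[of s t] st by (auto simp: e_def \<tau>_def)
  have sT: "s \<in> {0..T}" "t \<in> {0..T}" using st by auto
  define D where "D x = U' x - U x" for x
  let ?i = "\<lambda>z::'a \<times> real. indicator {s..<t} (snd z) :: real"
  have Ub: "\<bar>U x\<bar> \<le> B" "\<bar>U' x\<bar> \<le> B" for x using B(2) K_lip0 U U' by auto
  have Db: "\<bar>D x\<bar> \<le> 2 * B" for x using Ub[of x] by (simp add: D_def abs_le_iff)
  have LU: "L2_fun NN U" "L2_fun NN D" using lip0_L2[OF K_lip0[OF U]] L2_diff[OF lip0_L2[OF K_lip0[OF U']] lip0_L2[OF K_lip0[OF U]]] by (simp_all add: D_def[abs_def])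
  have i: "integrable NN (\<lambda>x. (D x)^2)" "integrable NN (\<lambda>x. (U x)^2)" "integrable NN (\<lambda>x. D x * U x)"
    using LU L2_mult_integrable[OF LU(2,1)] by (auto simp: L2_fun_def)
  have pm: "integrable QQ (\<lambda>z. ?i z * (h (fst z))^2)" "(\<integral>z. ?i z * (h (fst z))^2 \<partial>QQ) = \<tau> * (\<integral>x. (h x)^2 \<partial>NN)"
    if "h \<in> borel_measurable NN" "\<And>x. \<bar>h x\<bar> \<le> H" for h :: "'a \<Rightarrow> real" and H
  proof -
    have "(\<lambda>x. (h x)^2) \<in> borel_measurable NN" using that(1) by simp
    moreover have "\<bar>(h x)^2\<bar> \<le> H^2" for x using power_mono[OF that(2)[of x], of 2] by simp
    moreover have "(indicator {s..<t} :: real \<Rightarrow> real) \<in> borel_measurable borel" by simp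
    moreover have "\<bar>indicator {s..<t} r :: real\<bar> \<le> 1" for r by (simp split: split_indicator)
    ultimately show "integrable QQ (\<lambda>z. ?i z * (h (fst z))^2)" "(\<integral>z. ?i z * (h (fst z))^2 \<partial>QQ) = \<tau> * (\<integral>x. (h x)^2 \<partial>NN)"
      using bounded_product_integral[of "\<lambda>x. (h x)^2" "H^2" "indicator {s..<t}" 1] cell_measure[OF st] by (auto simp: \<tau>_def)
  qed
  note pD = pm[OF L2_measurable[OF LU(2)] Db] and pU = pm[OF L2_measurable[OF LU(1)] Ub(1)]
  have LS: "L2_fun QQ (src U)" by (rule src_L2(1)[OF U sT(1)])
  have LDQ: "L2_fun QQ (\<lambda>z. ?i z * (D (fst z) + e * U (fst z)))" proof (rule L2_bounded[OF Q_finite])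
    show "(\<lambda>z. ?i z * (D (fst z) + e * U (fst z))) \<in> borel_measurable QQ"
      unfolding D_def using lip0_fst_measurable[OF K_lip0[OF U]] lip0_fst_measurable[OF K_lip0[OF U']] indicator_snd_measurable[of "{s..<t}"] by auto
    show "AE z in QQ. norm (?i z * (D (fst z) + e * U (fst z))) \<le> 2 * B + e * B" proof (rule AE_I2)
      fix z :: "'a \<times> real"
      have "\<bar>D (fst z) + e * U (fst z)\<bar> \<le> 2 * B + e * B"
        using Db[of "fst z"] mult_left_mono[OF Ub(1)[of "fst z"] e(1)] abs_triangle_ineq[of "D (fst z)" "e * U (fst z)"] e(1) by (simp add: abs_mult)
      then show "norm (?i z * (D (fst z) + e * U (fst z))) \<le> 2 * B + e * B" using B(1) e(1) by (simp split: split_indicator)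
    qed
  qed
  have i\<Psi>: "integrable QQ (\<lambda>z. ?i z * \<Psi> z)"
    using integrable_bounded_scaleR[OF \<Psi>_integrable(1) indicator_snd_measurable[of "{s..<t}"], of 1] by (simp split: split_indicator)
  have "(\<integral>z. ?i z * src U z * (sc s t * U (fst z) - U' (fst z)) \<partial>QQ) \<le> (\<integral>x. D x * (sc s t * U x - U' x) \<partial>NN)"
    using bspec[OF EL[unfolded el_ineq_def] K_scale[OF U sT]] by (simp add: D_def)
  moreover have "(\<integral>x. D x * (sc s t * U x - U' x) \<partial>NN) = - ((\<integral>x. (D x)^2 \<partial>NN) + e * (\<integral>x. D x * U x \<partial>NN))"
  proof -
    have "(\<lambda>x. D x * (sc s t * U x - U' x)) = (\<lambda>x. - ((D x)^2 + e * (D x * U x)))"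
      by (auto simp: D_def e_def power2_eq_square algebra_simps)
    then show ?thesis using i by simp
  qed
  moreover have "(\<integral>z. ?i z * src U z * (sc s t * U (fst z) - U' (fst z)) \<partial>QQ) = - (\<integral>z. src U z * (?i z * (D (fst z) + e * U (fst z))) \<partial>QQ)"
  proof -
    have "(\<lambda>z. ?i z * src U z * (sc s t * U (fst z) - U' (fst z))) = (\<lambda>z. - (src U z * (?i z * (D (fst z) + e * U (fst z)))))"
      by (auto simp: D_def e_def algebra_simps)
    then show ?thesis by simp
  qed
  ultimately have main: "(\<integral>x. (D x)^2 \<partial>NN) \<le> - e * (\<integral>x. D x * U x \<partial>NN) + (\<integral>z. src U z * (?i z * (D (fst z) + e * U (fst z))) \<partial>QQ)"
    by simp
  have A: "- e * (\<integral>x. D x * U x \<partial>NN) \<le> (\<integral>x. (D x)^2 \<partial>NN) / 4 + e^2 * (\<integral>x. (U x)^2 \<partial>NN)"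
  proof -
    have "- e * (\<integral>x. D x * U x \<partial>NN) = (\<integral>x. (- e * U x) * D x \<partial>NN)"
      by (simp add: mult.commute mult.left_commute)
    also have "\<dots> \<le> (\<integral>x. e^2 * (U x)^2 + (D x)^2 / 4 \<partial>NN)" proof (rule integral_mono)
      show "integrable NN (\<lambda>x. (- e * U x) * D x)" using i(3) by (simp add: mult.commute mult.left_commute)
      show "integrable NN (\<lambda>x. e^2 * (U x)^2 + (D x)^2 / 4)" using i by simp
      show "(- e * U x) * D x \<le> e^2 * (U x)^2 + (D x)^2 / 4" for x
        using young_ineq[of 1 "- e * U x" "D x"] by (simp add: power_mult_distrib)
    qed
    also have "\<dots> = e^2 * (\<integral>x. (U x)^2 \<partial>NN) + (\<integral>x. (D x)^2 \<partial>NN) / 4" using i by simp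
    finally show ?thesis by simp
  qed
  have Bb: "(\<integral>z. src U z * (?i z * (D (fst z) + e * U (fst z))) \<partial>QQ)
      \<le> 3 / 2 * \<tau> * (\<integral>z. ?i z * \<Psi> z \<partial>QQ) + (\<integral>x. (D x)^2 \<partial>NN) / 4 + e^2 * (\<integral>x. (U x)^2 \<partial>NN) / 2"
  proof -
    \<comment> \<open>Young's inequality with weight \<tau> for the increment and \<tau>/2 for the
      rescaling error. Together with the quarter from \<open>A\<close>, half of the squared
      increment remains on the right; doubling turns the coefficients 3/2 into 3.\<close>
    have "(\<integral>z. src U z * (?i z * (D (fst z) + e * U (fst z))) \<partial>QQ)
        \<le> (\<integral>z. 3 / 2 * \<tau> * (?i z * \<Psi> z) + 1 / (4 * \<tau>) * (?i z * (D (fst z))^2) + e^2 / (2 * \<tau>) * (?i z * (U (fst z))^2) \<partial>QQ)"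
    proof (rule integral_mono_AE)
      show "integrable QQ (\<lambda>z. src U z * (?i z * (D (fst z) + e * U (fst z))))" by (rule L2_mult_integrable[OF LS LDQ])
      show "integrable QQ (\<lambda>z. 3 / 2 * \<tau> * (?i z * \<Psi> z) + 1 / (4 * \<tau>) * (?i z * (D (fst z))^2) + e^2 / (2 * \<tau>) * (?i z * (U (fst z))^2))"
        using i\<Psi> pD(1) pU(1) by (intro Bochner_Integration.integrable_add integrable_mult_right)
      show "AE z in QQ. src U z * (?i z * (D (fst z) + e * U (fst z)))
          \<le> 3 / 2 * \<tau> * (?i z * \<Psi> z) + 1 / (4 * \<tau>) * (?i z * (D (fst z))^2) + e^2 / (2 * \<tau>) * (?i z * (U (fst z))^2)"
        using src_L2(2)[OF U sT(1)]
      proof eventually_elim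
        case (elim z)
        have 1: "src U z * D (fst z) \<le> \<tau> * (src U z)^2 + 1 / (4 * \<tau>) * (D (fst z))^2"
          using young_ineq[OF \<tau>, of "src U z" "D (fst z)"] by simp
        have 2: "src U z * (e * U (fst z)) \<le> \<tau> / 2 * (src U z)^2 + e^2 / (2 * \<tau>) * (U (fst z))^2"
          using young_ineq[of "\<tau> / 2" "src U z" "e * U (fst z)"] \<tau> by (simp add: power_mult_distrib)
        have 3: "\<tau> * (src U z)^2 \<le> \<tau> * \<Psi> z" using elim \<tau> by (intro mult_left_mono) auto
        show ?case proof (cases "snd z \<in> {s..<t}")
          case True
          then show ?thesis using 1 2 3 by (simp add: distrib_left)
        qed simp
      qed
    qed
    also have "\<dots> = 3 / 2 * \<tau> * (\<integral>z. ?i z * \<Psi> z \<partial>QQ) + 1 / (4 * \<tau>) * (\<integral>z. ?i z * (D (fst z))^2 \<partial>QQ) + e^2 / (2 * \<tau>) * (\<integral>z. ?i z * (U (fst z))^2 \<partial>QQ)"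
      using i\<Psi> pD(1) pU(1) by simp
    also have "\<dots> = 3 / 2 * \<tau> * (\<integral>z. ?i z * \<Psi> z \<partial>QQ) + (\<integral>x. (D x)^2 \<partial>NN) / 4 + e^2 * (\<integral>x. (U x)^2 \<partial>NN) / 2"
      unfolding pD(2) pU(2) using \<tau> by simp
    finally show ?thesis .
  qed
  have Ui: "e^2 * (\<integral>x. (U x)^2 \<partial>NN) \<le> (C / m)^2 * \<tau>^2 * \<beta>" proof (rule mult_mono)
    show "e^2 \<le> (C / m)^2 * \<tau>^2" using power_mono[OF e(2,1), of 2] by (simp add: power_mult_distrib power_divide)
    have "(\<integral>x. (U x)^2 \<partial>NN) \<le> (\<integral>x. B^2 \<partial>NN)"
      using i(2) Ub power_mono[of "\<bar>U _\<bar>" B 2] by (intro integral_mono) auto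
    then show "(\<integral>x. (U x)^2 \<partial>NN) \<le> \<beta>" by (simp add: \<beta>_def mult.commute)
  qed auto
  have "(\<integral>x. (D x)^2 \<partial>NN) \<le> 3 * \<tau> * (\<integral>z. ?i z * \<Psi> z \<partial>QQ) + 3 * (e^2 * (\<integral>x. (U x)^2 \<partial>NN))"
    using main A Bb by (simp add: field_simps)
  also have "\<dots> \<le> 3 * \<tau> * (\<integral>z. ?i z * \<Psi> z \<partial>QQ) + 3 * ((C / m)^2 * \<tau>^2 * \<beta>)" using Ui by simp
  also have "\<dots> = \<tau> * (3 * (\<integral>z. ?i z * \<Psi> z \<partial>QQ) + 3 * (C / m)^2 * \<tau> * \<beta>)"
    by (simp add: power2_eq_square algebra_simps)
  finally show ?thesis by (simp add: D_def \<tau>_def)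
qed

text \<open>What the single-step bounds add up to: the cells exhaust the interval, which turns the
  cell integrals of \<Psi> into the full integral, and the step lengths add up to
  \<open>T\<close>.\<close>

definition "EE = 3 * integral\<^sup>L QQ \<Psi> + 3 * (C / m)^2 * T * \<beta>"

lemma EE: "EE \<ge> 0"
  unfolding EE_def \<beta>_def using T \<Psi>_integrable(2) by (simp add: integral_nonneg_AE)

definition cell :: "nat \<Rightarrow> nat \<Rightarrow> real set" where
  "cell N k = {real k * (T / real N)..<real (Suc k) * (T / real N)}"

definition idx :: "nat \<Rightarrow> real \<Rightarrow> nat" where "idx N s = nat \<lfloor>s / (T / real N)\<rfloor>"

lemma idx_cell:
  assumes "N > 0" "0 \<le> s" "s < T"
  shows "idx N s < N" "s \<in> cell N k \<longleftrightarrow> k = idx N s"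
proof -
  have \<tau>: "T / real N > 0" using T assms by simp
  define y where "y = s / (T / real N)"
  have y: "y \<ge> 0" "y < real N" using assms T \<tau> by (auto simp: y_def field_simps)
  have i: "idx N s = nat \<lfloor>y\<rfloor>" by (simp add: idx_def y_def)
  show "idx N s < N" using y unfolding i by linarith
  have sy: "s = y * (T / real N)" using assms(1) T by (simp add: y_def)
  have "s \<in> cell N k \<longleftrightarrow> real k \<le> y \<and> y < real (Suc k)"
    unfolding cell_def sy atLeastLessThan_iff mult_le_cancel_right_pos[OF \<tau>] mult_less_cancel_right_pos[OF \<tau>] ..
  also have "\<dots> \<longleftrightarrow> k = idx N s" using y(1) unfolding i by linarith
  finally show "s \<in> cell N k \<longleftrightarrow> k = idx N s" .
qed

lemma step_sum:
  fixes \<Phi> :: "nat \<Rightarrow> 'b::real_vector"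
  assumes "N > 0" "0 \<le> s" "s < T"
  shows "\<Phi> (idx N s) = (\<Sum>k<N. indicator (cell N k) s *\<^sub>R \<Phi> k)"
proof -
  have "(\<Sum>k<N. indicator (cell N k) s *\<^sub>R \<Phi> k) = (\<Sum>k<N. if k = idx N s then \<Phi> k else 0)"
    using idx_cell(2)[OF assms] by (intro sum.cong) (auto split: split_indicator)
  also have "\<dots> = \<Phi> (idx N s)" using idx_cell(1)[OF assms] by simp
  finally show ?thesis by simp
qed

lemma scheme_energy:
  assumes S: "is_scheme N U" and N: "N > 0"
  shows "(\<Sum>k<N. \<integral>x. (U (Suc k) x - U k x)^2 \<partial>NN) \<le> T / real N * EE"
proof -
  define \<tau> where "\<tau> = T / real N"
  have \<tau>: "\<tau> > 0" using T N by (simp add: \<tau>_def)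
  have i\<Psi>: "integrable QQ (\<lambda>z. indicator (cell N k) (snd z) * \<Psi> z)" for k
    using integrable_bounded_scaleR[OF \<Psi>_integrable(1) indicator_snd_measurable[of "cell N k"], of 1]
    by (simp add: cell_def split: split_indicator)
  have "(\<Sum>k<N. \<integral>x. (U (Suc k) x - U k x)^2 \<partial>NN)
      \<le> (\<Sum>k<N. \<tau> * (3 * (\<integral>z. indicator (cell N k) (snd z) * \<Psi> z \<partial>QQ) + 3 * (C / m)^2 * \<tau> * \<beta>))"
  proof (rule sum_mono)
    fix k assume "k \<in> {..<N}"
    then have k: "k < N" by simp
    have t: "real (Suc k) * \<tau> - real k * \<tau> = \<tau>" by (simp add: algebra_simps)
    have "(\<integral>x. (U (Suc k) x - U k x)^2 \<partial>NN) \<le> (real (Suc k) * \<tau> - real k * \<tau>) * (3 * (\<integral>z. indicator {real k * \<tau>..<real (Suc k) * \<tau>} (snd z) * \<Psi> z \<partial>QQ)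
      + 3 * (C / m)^2 * (real (Suc k) * \<tau> - real k * \<tau>) * \<beta>)"
    proof (rule step_energy)
      show "U k \<in> K (real k * \<tau>)" "U (Suc k) \<in> K (real (Suc k) * \<tau>)"
        using S k unfolding is_scheme_def \<tau>_def by (auto simp del: of_nat_Suc)
      show "el_ineq (real (Suc k) * \<tau>) {real k * \<tau>..<real (Suc k) * \<tau>} (U k) (U (Suc k))"
        using S k unfolding is_scheme_def \<tau>_def by blast
      show "0 \<le> real k * \<tau>" "real k * \<tau> < real (Suc k) * \<tau>" using \<tau> by (auto intro: mult_strict_right_mono)
      show "real (Suc k) * \<tau> \<le> T" using grid_in[OF N, of "Suc k"] k by (simp add: \<tau>_def del: of_nat_Suc)
    qed
    then show "(\<integral>x. (U (Suc k) x - U k x)^2 \<partial>NN) \<le> \<tau> * (3 * (\<integral>z. indicator (cell N k) (snd z) * \<Psi> z \<partial>QQ) + 3 * (C / m)^2 * \<tau> * \<beta>)"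
      unfolding t by (simp add: cell_def \<tau>_def)
  qed
  also have "\<dots> = \<tau> * (3 * (\<Sum>k<N. \<integral>z. indicator (cell N k) (snd z) * \<Psi> z \<partial>QQ) + 3 * (C / m)^2 * (real N * \<tau>) * \<beta>)"
    by (simp add: sum_distrib_left[symmetric] sum.distrib algebra_simps)
  also have "(\<Sum>k<N. \<integral>z. indicator (cell N k) (snd z) * \<Psi> z \<partial>QQ) = integral\<^sup>L QQ \<Psi>" proof -
    have "(\<Sum>k<N. \<integral>z. indicator (cell N k) (snd z) * \<Psi> z \<partial>QQ) = (\<integral>z. (\<Sum>k<N. indicator (cell N k) (snd z) * \<Psi> z) \<partial>QQ)"
      using i\<Psi> by (intro Bochner_Integration.integral_sum[symmetric]) auto
    also have "\<dots> = integral\<^sup>L QQ \<Psi>" proof (rule Bochner_Integration.integral_cong[OF refl])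
      fix z assume "z \<in> space QQ"
      then have "0 \<le> snd z" "snd z < T" by auto
      from step_sum[OF N this, of "\<lambda>k. \<Psi> z"] show "(\<Sum>k<N. indicator (cell N k) (snd z) * \<Psi> z) = \<Psi> z" by simp
    qed
    finally show ?thesis .
  qed
  also have "real N * \<tau> = T" using N by (simp add: \<tau>_def)
  finally show ?thesis by (simp add: EE_def \<tau>_def)
qed

end

section \<open>Interpolation in time and compactness\<close>

context evolution
begin

text \<open>The fraction of the cell \<open>k\<close> that has elapsed at time \<open>t\<close>: 0
  before the cell, 1 after it.\<close>

definition cl :: "nat \<Rightarrow> nat \<Rightarrow> real \<Rightarrow> real" where "cl N k t = max 0 (min 1 (t * (real N / T) - real k))"

text \<open>The piecewise linear interpolant of \<open>a 0, \<dots>, a N\<close> on the grid of \<open>[0, T]\<close>; written as a sum of ramps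
  it is monotone in time term by term.\<close>

definition itp :: "nat \<Rightarrow> (nat \<Rightarrow> real) \<Rightarrow> real \<Rightarrow> real" where
  "itp N a t = a 0 + (\<Sum>k<N. cl N k t * (a (Suc k) - a k))"

lemma cell_iff: "N > 0 \<Longrightarrow> t \<in> cell N k \<longleftrightarrow> real k \<le> t * (real N / T) \<and> t * (real N / T) < real k + 1"
  using T unfolding cell_def by (simp add: field_simps)

lemma itp_cell:
  assumes j: "j < N" "real j \<le> t * (real N / T)" "t * (real N / T) \<le> real j + 1"
  shows "itp N a t = a j + (t * (real N / T) - real j) * (a (Suc j) - a j)"
proof -
  have "(\<Sum>k<N. cl N k t * (a (Suc k) - a k)) = (\<Sum>k<Suc j. cl N k t * (a (Suc k) - a k))"
    using j by (intro sum.mono_neutral_right) (auto simp: cl_def)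
  also have "\<dots> = (\<Sum>k<j. a (Suc k) - a k) + cl N j t * (a (Suc j) - a j)" proof -
    have "cl N k t = 1" if "k < j" for k proof -
      have "real k + 1 \<le> real j" using that by simp
      then show ?thesis using j by (simp add: cl_def)
    qed
    then show ?thesis by simp
  qed
  also have "(\<Sum>k<j. a (Suc k) - a k) = a j - a 0" by (rule sum_lessThan_telescope)
  also have "cl N j t = t * (real N / T) - real j" using j by (simp add: cl_def)
  finally show ?thesis by (simp add: itp_def)
qed

lemma cell_obtain:
  assumes "N > 0" "t \<in> {0..T}"
  obtains j where "j < N" "real j \<le> t * (real N / T)" "t * (real N / T) \<le> real j + 1"
proof (cases "t < T")
  case True
  show ?thesis using that[of "idx N t"] idx_cell[OF assms(1), of t] True assms cell_iff[OF assms(1), of t "idx N t"] by auto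
next
  case False
  then have "t * (real N / T) = real N" using assms T by auto
  moreover have "real (N - 1) = real N - 1" using assms by (simp add: of_nat_diff)
  ultimately show ?thesis using that[of "N - 1"] assms by simp
qed

lemma sum_cl:
  assumes "N > 0" "t \<in> {0..T}"
  shows "(\<Sum>k<N. cl N k t) = t * (real N / T)"
proof -
  obtain j where "j < N" "real j \<le> t * (real N / T)" "t * (real N / T) \<le> real j + 1" by (rule cell_obtain[OF assms])
  from itp_cell[OF this, of real] show ?thesis by (simp add: itp_def)
qed

lemma itp_grid:
  assumes "j \<le> N" "N > 0"
  shows "itp N a (real j * (T / real N)) = a j"
proof (cases "j < N")
  case True
  then show ?thesis using itp_cell[OF True, of "real j * (T / real N)" a] T by simp
next
  case False
  then have j: "j = Suc (N - 1)" "real (N - 1) = real N - 1" using assms by auto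
  have "real j * (T / real N) * (real N / T) = real j" using T assms by simp
  then show ?thesis using itp_cell[of "N - 1" N "real j * (T / real N)" a] assms j T by simp
qed

lemma cl_mono: "s \<le> t \<Longrightarrow> cl N k s \<le> cl N k t"
proof -
  assume "s \<le> t"
  then have "s * (real N / T) \<le> t * (real N / T)" using T by (intro mult_right_mono) auto
  then show ?thesis by (simp add: cl_def)
qed

lemma is_scheme_K: "is_scheme N U \<Longrightarrow> k \<le> N \<Longrightarrow> U k \<in> K (real k * (T / real N))"
  by (simp add: is_scheme_def)

lemma is_scheme_lip0: "is_scheme N U \<Longrightarrow> k \<le> N \<Longrightarrow> U k \<in> lip0 M"
  using K_lip0 is_scheme_K by blast

lemma itp_lip0:
  assumes S: "is_scheme N U" and N: "N > 0" and t: "t \<in> {0..T}"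
  shows "(\<lambda>x. itp N (\<lambda>k. U k x) t) \<in> lip0 M"
proof -
  obtain j where j: "j < N" "real j \<le> t * (real N / T)" "t * (real N / T) \<le> real j + 1" by (rule cell_obtain[OF N t])
  define \<theta> where "\<theta> = t * (real N / T) - real j"
  have th: "0 \<le> \<theta>" "\<theta> \<le> 1" using j by (auto simp: \<theta>_def)
  have "(\<lambda>x. (1 - \<theta>) * U j x + \<theta> * U (Suc j) x) \<in> lip0 ((\<bar>1 - \<theta>\<bar> + \<bar>\<theta>\<bar>) * M)"
    using is_scheme_lip0[OF S] j(1) by (intro lip0_linear) auto
  then show ?thesis unfolding itp_cell[OF j] \<theta>_def[symmetric] using th by (simp add: algebra_simps)
qed

text \<open>The increments of the ramps lie in [0, 1] and add up to (t - s) N / T. Cauchy-Schwarz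
  with these weights leaves that factor times the sum of squared steps, which is at most
  \<open>T / N * EE\<close>; the mesh cancels and the bound is uniform in \<open>N\<close>.\<close>

lemma itp_Hoelder:
  assumes S: "is_scheme N U" and N: "N > 0" and st: "s \<in> {0..T}" "t \<in> {0..T}" "s \<le> t"
  shows "(\<integral>x. (itp N (\<lambda>k. U k x) t - itp N (\<lambda>k. U k x) s)^2 \<partial>NN) \<le> (t - s) * EE"
proof -
  define \<alpha> where "\<alpha> k = cl N k t - cl N k s" for k
  define d where "d k x = U (Suc k) x - U k x" for k x
  have \<alpha>: "0 \<le> \<alpha> k" "\<alpha> k \<le> 1" for k using cl_mono[OF st(3)] by (auto simp: \<alpha>_def cl_def)
  have \<alpha>s: "(\<Sum>k<N. \<alpha> k) = (t - s) * (real N / T)"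
    by (simp add: \<alpha>_def sum_subtractf sum_cl[OF N st(1)] sum_cl[OF N st(2)] left_diff_distrib diff_divide_distrib)
  have Ld: "L2_fun NN (d k)" if "k < N" for k unfolding d_def using that by (intro L2_diff lip0_L2[OF is_scheme_lip0[OF S]]) auto
  have id: "integrable NN (\<lambda>x. (t - s) * (real N / T) * (\<Sum>k<N. (d k x)^2))"
    using Ld by (intro integrable_mult_right Bochner_Integration.integrable_sum) (auto simp: L2_fun_def)
  have le: "(itp N (\<lambda>k. U k x) t - itp N (\<lambda>k. U k x) s)^2 \<le> (t - s) * (real N / T) * (\<Sum>k<N. (d k x)^2)" for x
  proof -
    have "itp N (\<lambda>k. U k x) t - itp N (\<lambda>k. U k x) s = (\<Sum>k<N. sqrt (\<alpha> k) * (sqrt (\<alpha> k) * d k x))"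
      by (simp add: itp_def sum_subtractf[symmetric] \<alpha>_def d_def left_diff_distrib[symmetric] \<alpha> flip: mult.assoc)
        (simp add: cl_mono[OF st(3)])
    also have "\<dots>^2 \<le> (\<Sum>k<N. (sqrt (\<alpha> k))^2) * (\<Sum>k<N. (sqrt (\<alpha> k) * d k x)^2)"
      by (rule Cauchy_Schwarz_ineq_sum)
    also have "\<dots> \<le> (\<Sum>k<N. (sqrt (\<alpha> k))^2) * (\<Sum>k<N. (d k x)^2)"
      using \<alpha> by (intro mult_left_mono sum_mono sum_nonneg) (auto simp: power_mult_distrib mult_left_le_one_le)
    also have "(\<Sum>k<N. (sqrt (\<alpha> k))^2) = (t - s) * (real N / T)" using \<alpha>(1) \<alpha>s by simp
    finally show ?thesis .
  qed
  have "(\<integral>x. (itp N (\<lambda>k. U k x) t - itp N (\<lambda>k. U k x) s)^2 \<partial>NN) \<le> (\<integral>x. (t - s) * (real N / T) * (\<Sum>k<N. (d k x)^2) \<partial>NN)"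
  proof (rule integral_mono)
    have "L2_fun NN (\<lambda>x. itp N (\<lambda>k. U k x) t - itp N (\<lambda>k. U k x) s)"
      by (intro L2_diff lip0_L2[OF itp_lip0[OF S N]] st)
    then show "integrable NN (\<lambda>x. (itp N (\<lambda>k. U k x) t - itp N (\<lambda>k. U k x) s)^2)" by (simp add: L2_fun_def)
  qed (use id le in auto)
  also have "\<dots> = (t - s) * (real N / T) * (\<Sum>k<N. \<integral>x. (d k x)^2 \<partial>NN)"
    using Ld by (subst integral_mult_right_zero, subst Bochner_Integration.integral_sum) (auto simp: L2_fun_def)
  also have "\<dots> \<le> (t - s) * (real N / T) * (T / real N * EE)"
    using scheme_energy[OF S N] T st unfolding d_def by (intro mult_left_mono) auto
  also have "\<dots> = (t - s) * EE" using N T by simp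
  finally show ?thesis .
qed

text \<open>Continuity in time in L2 plus the spatial Lipschitz bound, which is \<open>2 * M\<close>
  for a difference, gives a modulus of continuity uniform in the point, the mesh and the
  scheme.\<close>

lemma itp_equicontinuous:
  assumes "\<epsilon> > 0"
  obtains \<delta> where "\<delta> > 0" "\<And>N U s t x. is_scheme N U \<Longrightarrow> N > 0 \<Longrightarrow> s \<in> {0..T} \<Longrightarrow> t \<in> {0..T} \<Longrightarrow> \<bar>t - s\<bar> < \<delta>
    \<Longrightarrow> \<bar>itp N (\<lambda>k. U k x) t - itp N (\<lambda>k. U k x) s\<bar> < \<epsilon>"
proof -
  obtain \<eta> where \<eta>: "\<eta> > 0" "\<And>V x. V \<in> lip0 (2 * M) \<Longrightarrow> (\<integral>x. (V x)^2 \<partial>NN) < \<eta> \<Longrightarrow> \<bar>V x\<bar> < \<epsilon>"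
    by (rule lip0_L2_small[OF assms]) (rule that)
  define \<delta> where "\<delta> = \<eta> / (EE + 1)"
  have \<delta>: "\<delta> > 0" using \<eta> EE by (simp add: \<delta>_def)
  have main: "\<bar>itp N (\<lambda>k. U k x) t - itp N (\<lambda>k. U k x) s\<bar> < \<epsilon>"
    if S: "is_scheme N U" and N: "N > 0" and st: "s \<in> {0..T}" "t \<in> {0..T}" "s \<le> t" "t - s < \<delta>" for N U s t x
  proof (rule \<eta>(2))
    show "(\<lambda>x. itp N (\<lambda>k. U k x) t - itp N (\<lambda>k. U k x) s) \<in> lip0 (2 * M)"
      using lip0_linear[OF itp_lip0[OF S N st(2)] itp_lip0[OF S N st(1)], of 1 "-1"] by simp
    have "(t - s) * EE \<le> \<delta> * EE" using st EE by (intro mult_right_mono) auto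
    also have "\<dots> < \<delta> * (EE + 1)" using \<delta> by simp
    also have "\<dots> = \<eta>" using EE by (simp add: \<delta>_def)
    finally show "(\<integral>x. (itp N (\<lambda>k. U k x) t - itp N (\<lambda>k. U k x) s)^2 \<partial>NN) < \<eta>"
      using itp_Hoelder[OF S N st(1-3)] by simp
  qed
  show ?thesis proof (rule that[OF \<delta>])
    fix N U s t x assume a: "is_scheme N U" "N > 0" "s \<in> {0..T}" "t \<in> {0..T}" "\<bar>t - s\<bar> < \<delta>"
    then show "\<bar>itp N (\<lambda>k. U k x) t - itp N (\<lambda>k. U k x) s\<bar> < \<epsilon>"
      using main[of N U s t x] main[of N U t s x] by (cases "s \<le> t") (auto simp: abs_minus_commute)
  qed
qed

text \<open>Arzela-Ascoli on the closed cylinder: equicontinuity in space is the Lipschitz bound, in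
  time \<open>itp_equicontinuous\<close>, each contributing half of the tolerance.\<close>

lemma itp_limit:
  assumes S: "\<And>n. is_scheme (Suc n) (U n)"
  obtains u :: "'a \<times> real \<Rightarrow> real" and r :: "nat \<Rightarrow> nat" where "strict_mono r" "continuous_on (closure \<Omega> \<times> {0..T}) u"
    "\<And>t. t \<in> {0..T} \<Longrightarrow> (\<lambda>x. u (x, t)) \<in> lip0 M" "\<And>x. u (x, 0) = V0 x"
    "\<And>\<epsilon>. \<epsilon> > 0 \<Longrightarrow> \<exists>n0. \<forall>n\<ge>n0. \<forall>x. \<forall>t\<in>{0..T}. \<bar>itp (Suc (r n)) (\<lambda>k. U (r n) k x) t - u (x, t)\<bar> < \<epsilon>"
proof -
  define F where "F n z = itp (Suc n) (\<lambda>k. U n k (fst z)) (snd z)" for n and z :: "'a \<times> real"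
  have Fl: "(\<lambda>x. F n (x, t)) \<in> lip0 M" if "t \<in> {0..T}" for n t using itp_lip0[OF S _ that] by (simp add: F_def)
  have "compact (closure \<Omega> \<times> {0..T})" using bounded_dom by (intro compact_Times) auto
  then obtain g r where g: "continuous_on (closure \<Omega> \<times> {0..T}) g" "strict_mono (r :: nat \<Rightarrow> nat)"
    "\<And>e. 0 < e \<Longrightarrow> \<exists>N. \<forall>n z. n \<ge> N \<and> z \<in> closure \<Omega> \<times> {0..T} \<longrightarrow> norm (F (r n) z - g z) < e"
  proof (rule Arzela_Ascoli[of "closure \<Omega> \<times> {0..T}" F B])
    show "norm (F n z) \<le> B" if "z \<in> closure \<Omega> \<times> {0..T}" for n z
      using B(2)[OF Fl[of "snd z"], of n "fst z"] that by auto
    fix z :: "'a \<times> real" and e :: real assume z: "z \<in> closure \<Omega> \<times> {0..T}" and e: "e > 0"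
    obtain \<delta> where \<delta>: "\<delta> > 0" "\<And>N U s t x. is_scheme N U \<Longrightarrow> N > 0 \<Longrightarrow> s \<in> {0..T} \<Longrightarrow> t \<in> {0..T} \<Longrightarrow> \<bar>t - s\<bar> < \<delta>
      \<Longrightarrow> \<bar>itp N (\<lambda>k. U k x) t - itp N (\<lambda>k. U k x) s\<bar> < e / 2" by (rule itp_equicontinuous[of "e / 2"]) (use e in simp, rule that)
    show "\<exists>d>0. \<forall>n y. y \<in> closure \<Omega> \<times> {0..T} \<and> norm (z - y) < d \<longrightarrow> norm (F n z - F n y) < e"
    proof (intro exI[of _ "min \<delta> (e / (2 * (M + 1)))"] conjI allI impI)
      show "0 < min \<delta> (e / (2 * (M + 1)))" using \<delta> e M by simp
      fix n y assume y: "y \<in> closure \<Omega> \<times> {0..T} \<and> norm (z - y) < min \<delta> (e / (2 * (M + 1)))"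
      have n: "norm (fst z - fst y) \<le> norm (z - y)" "\<bar>snd z - snd y\<bar> \<le> norm (z - y)"
        using norm_fst_le[of "fst z - fst y" "snd z - snd y"] norm_snd_le[of "snd z - snd y" "fst z - fst y"]
        by (auto simp: minus_prod_def)
      have zy: "snd z \<in> {0..T}" "snd y \<in> {0..T}" using z y by auto
      have 1: "\<bar>F n z - F n (fst z, snd y)\<bar> < e / 2"
        using \<delta>(2)[OF S, of n "snd y" "snd z" "fst z"] zy n y by (simp add: F_def)
      have "\<bar>F n (fst z, snd y) - F n y\<bar> \<le> M * norm (fst z - fst y)"
        using lip0_le[OF Fl[OF zy(2)], of n "fst z" "fst y"] by simp
      also have "\<dots> \<le> (M + 1) * norm (z - y)" using n(1) M by (intro mult_mono) auto
      also have "\<dots> < (M + 1) * (e / (2 * (M + 1)))" using y M by (intro mult_strict_left_mono) auto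
      also have "\<dots> = e / 2" using M by (simp add: divide_simps)
      finally have "\<bar>F n (fst z, snd y) - F n y\<bar> < e / 2" .
      then show "norm (F n z - F n y) < e" using 1 unfolding real_norm_def by linarith
    qed
  qed (rule that)
  \<comment> \<open>Extended by 0 outside \<open>\<Omega>\<close>, where all interpolants vanish, so
    that convergence is uniform over the whole space and each time section lies in
    \<open>lip0 M\<close>.\<close>
  define u where "u z = (if fst z \<in> \<Omega> then g z else 0)" for z
  have lim: "\<exists>n0. \<forall>n\<ge>n0. \<forall>x. \<forall>t\<in>{0..T}. \<bar>F (r n) (x, t) - u (x, t)\<bar> < \<epsilon>" if \<epsilon>: "\<epsilon> > 0" for \<epsilon>
  proof -
    obtain n0 where n0: "\<And>n z. n \<ge> n0 \<Longrightarrow> z \<in> closure \<Omega> \<times> {0..T} \<Longrightarrow> norm (F (r n) z - g z) < \<epsilon>"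
      using g(3)[OF \<epsilon>] by blast
    have "\<bar>F (r n) (x, t) - u (x, t)\<bar> < \<epsilon>" if "n \<ge> n0" "t \<in> {0..T}" for n x t
    proof (cases "x \<in> \<Omega>")
      case True
      then show ?thesis using n0[OF that(1), of "(x, t)"] closure_subset[of \<Omega>] that by (auto simp: u_def)
    next
      case False
      then show ?thesis using Fl[OF that(2), of "r n"] \<epsilon> by (simp add: u_def lip0_def)
    qed
    then show ?thesis by blast
  qed
  have pt: "(\<lambda>n. F (r n) (x, t)) \<longlonglongrightarrow> u (x, t)" if "t \<in> {0..T}" for x t
    using lim that by (force intro!: LIMSEQ_I)
  have ul: "(\<lambda>x. u (x, t)) \<in> lip0 M" if t: "t \<in> {0..T}" for t proof (rule lip0I[OF M])
    fix x y
    have "(\<lambda>n. \<bar>F (r n) (x, t) - F (r n) (y, t)\<bar>) \<longlonglongrightarrow> \<bar>u (x, t) - u (y, t)\<bar>"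
      by (intro tendsto_intros pt t)
    then show "\<bar>u (x, t) - u (y, t)\<bar> \<le> M * norm (x - y)" by (rule LIMSEQ_le_const2) (use lip0_le[OF Fl[OF t]] in auto)
  qed (simp add: u_def)
  show ?thesis proof (rule that[OF g(2) _ ul])
    show "continuous_on (closure \<Omega> \<times> {0..T}) u" proof (rule continuous_on_eq[OF g(1)])
      fix z assume z: "z \<in> closure \<Omega> \<times> {0..T}"
      show "g z = u z" proof (rule LIMSEQ_unique)
        show "(\<lambda>n. F (r n) z) \<longlonglongrightarrow> g z" using g(3) z by (force intro!: LIMSEQ_I)
        show "(\<lambda>n. F (r n) z) \<longlonglongrightarrow> u z" using pt[of "snd z" "fst z"] z by auto
      qed
    qed
    show "u (x, 0) = V0 x" for x proof (rule LIMSEQ_unique[OF pt])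
      have "F n (x, 0) = V0 x" for n using itp_grid[of 0 "Suc n" "\<lambda>k. U n k x"] S[of n] by (simp add: F_def is_scheme_def)
      then show "(\<lambda>n. F (r n) (x, 0)) \<longlonglongrightarrow> V0 x" by simp
    qed (use T in auto)
    show "\<exists>n0. \<forall>n\<ge>n0. \<forall>x. \<forall>t\<in>{0..T}. \<bar>itp (Suc (r n)) (\<lambda>k. U (r n) k x) t - u (x, t)\<bar> < \<epsilon>" if "\<epsilon> > 0" for \<epsilon>
      using lim[OF that] by (simp add: F_def)
  qed auto
qed

text \<open>The fundamental theorem of calculus for the product of interpolant and test function; it
  is continuous, and the derivative may fail at the finitely many grid points.\<close>

lemma itp_by_parts:
  fixes \<psi> \<psi>' :: "real \<Rightarrow> real"
  assumes N: "N > 0" and d: "\<And>t. (\<psi> has_real_derivative \<psi>' t) (at t)" and z: "\<psi> 0 = 0" "\<psi> T = 0"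
  shows "((\<lambda>t. itp N a t * \<psi>' t + (\<Sum>k<N. indicator (cell N k) t * ((a (Suc k) - a k) / (T / real N))) * \<psi> t) has_integral 0) {0<..<T}"
proof -
  let ?S = "(\<lambda>k. real k * (T / real N)) ` {..N}"
  let ?w = "\<lambda>t. \<Sum>k<N. indicator (cell N k) t * ((a (Suc k) - a k) / (T / real N))"
  have dcl: "(cl N k has_real_derivative indicator (cell N k) t * (real N / T)) (at t)" if t: "t \<notin> ?S" and k: "k < N" for k t
  proof -
    let ?y = "\<lambda>s. s * (real N / T)"
    have o: "open {s. ?y s < c}" "open {s. ?y s > c}" for c :: real by (intro open_Collect_less continuous_intros)+
    have ne: "?y t \<noteq> real j" if "j \<le> N" for j proof
      assume "?y t = real j"
      then have "t = real j * (T / real N)" using T N by (simp add: field_simps)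
      then show False using t that by blast
    qed
    consider "?y t < real k" | "real k < ?y t" "?y t < real k + 1" | "real k + 1 < ?y t"
      using ne[of k] ne[of "Suc k"] k by fastforce
    then show ?thesis proof cases
      case 1
      then have "indicator (cell N k) t = (0::real)" using cell_iff[OF N, of t k] by simp
      moreover have "(cl N k has_real_derivative 0) (at t)"
        by (rule has_field_derivative_transform_within_open[OF DERIV_const[of 0] o(1)[of "real k"]]) (use 1 in \<open>auto simp: cl_def\<close>)
      ultimately show ?thesis by simp
    next
      case 2
      then have "indicator (cell N k) t = (1::real)" using cell_iff[OF N, of t k] by simp
      moreover have "((\<lambda>s. ?y s - real k) has_real_derivative real N / T) (at t)" using T by (auto intro!: derivative_eq_intros)
      then have "(cl N k has_real_derivative real N / T) (at t)"
        by (rule has_field_derivative_transform_within_open[OF _ open_Int[OF o(2)[of "real k"] o(1)[of "real k + 1"]]])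
          (use 2 in \<open>auto simp: cl_def\<close>)
      ultimately show ?thesis by simp
    next
      case 3
      then have "indicator (cell N k) t = (0::real)" using cell_iff[OF N, of t k] by simp
      moreover have "(cl N k has_real_derivative 0) (at t)"
        by (rule has_field_derivative_transform_within_open[OF DERIV_const[of 1] o(2)[of "real k + 1"]]) (use 3 in \<open>auto simp: cl_def\<close>)
      ultimately show ?thesis by simp
    qed
  qed
  have "((\<lambda>t. itp N a t * \<psi>' t + ?w t * \<psi> t) has_integral (itp N a T * \<psi> T - itp N a 0 * \<psi> 0)) {0..T}"
  proof (rule fundamental_theorem_of_calculus_interior_strong)
    show "continuous_on {0..T} (\<lambda>t. itp N a t * \<psi> t)"
      unfolding itp_def[abs_def] cl_def using DERIV_continuous_on[of "{0..T}" \<psi> \<psi>'] has_field_derivative_at_within[OF d]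
      by (intro continuous_intros) auto
    fix t assume t: "t \<in> {0<..<T} - ?S"
    have "(itp N a has_real_derivative (\<Sum>k<N. indicator (cell N k) t * (real N / T) * (a (Suc k) - a k))) (at t)"
      unfolding itp_def[abs_def] using t by (auto intro!: derivative_eq_intros DERIV_sum dcl)
    also have "(\<Sum>k<N. indicator (cell N k) t * (real N / T) * (a (Suc k) - a k)) = ?w t" using T by (intro sum.cong) auto
    finally show "((\<lambda>t. itp N a t * \<psi> t) has_vector_derivative itp N a t * \<psi>' t + ?w t * \<psi> t) (at t)"
      using DERIV_mult[OF _ d, of "itp N a" "?w t" t] by (simp add: has_real_derivative_iff_has_vector_derivative add.commute mult.commute)
  qed (use T in auto)
  then show ?thesis using z by (simp add: has_integral_Icc_iff_Ioo)
qed

end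

lemma L2_fst_snd:
  fixes f :: "'x \<Rightarrow> 'b::euclidean_space \<times> 'c::euclidean_space"
  assumes "L2_fun M f"
  shows "L2_fun M (\<lambda>z. fst (f z))" "L2_fun M (\<lambda>z. snd (f z))"
proof -
  have m: "f \<in> borel_measurable M" and i: "integrable M (\<lambda>z. (norm (f z))^2)" using assms by (auto simp: L2_fun_def)
  have c: "continuous_on UNIV (fst :: 'b \<times> 'c \<Rightarrow> 'b)" "continuous_on UNIV (snd :: 'b \<times> 'c \<Rightarrow> 'c)"
    by (intro continuous_intros)+
  have "norm (fst (f z)) \<le> norm (f z)" "norm (snd (f z)) \<le> norm (f z)" for z
    using norm_fst_le[of "fst (f z)" "snd (f z)"] norm_snd_le[of "snd (f z)" "fst (f z)"] by auto
  then show "L2_fun M (\<lambda>z. fst (f z))" "L2_fun M (\<lambda>z. snd (f z))"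
    by (auto intro!: L2_bound[OF _ i] power_mono AE_I2 measurable_compose[OF m] borel_measurable_continuous_onI c)
qed

lemma L2_fun_Pair: "L2_fun M f \<Longrightarrow> L2_fun M g \<Longrightarrow> L2_fun M (\<lambda>x. (f x, g x))"
  by (auto simp: L2_fun_def norm_Pair intro!: borel_measurable_Pair)

subsection \<open>Passage to the limit\<close>

lemma midhull_property:
  assumes "midhull X n f" "\<And>k. n \<le> k \<Longrightarrow> P (X k)" "\<And>f g. P f \<Longrightarrow> P g \<Longrightarrow> P (\<lambda>x. (1/2) *\<^sub>R (f x + g x))"
  shows "P f"
  using assms(1) by induction (use assms in auto)

text \<open>A lower bound for a linear functional is stable under midpoints, and the hull from index
  \<open>n\<close> on uses only the tail, where the bound holds up to \<epsilon>. So inequalities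
  pass to the limit as they would under weak convergence.\<close>

lemma L2_midhull_inner_ge:
  fixes X :: "nat \<Rightarrow> 'x \<Rightarrow> 'b::euclidean_space"
  assumes L: "\<And>n. L2_fun M (X n)" and F: "\<And>n. midhull X n (F n)" and lim: "L2_lim M F x" and Z: "L2_fun M Z"
    and ev: "\<And>\<epsilon>. \<epsilon> > 0 \<Longrightarrow> \<exists>n0. \<forall>n\<ge>n0. \<kappa> - \<epsilon> \<le> (\<integral>z. X n z \<bullet> Z z \<partial>M)"
  shows "\<kappa> \<le> (\<integral>z. x z \<bullet> Z z \<partial>M)"
proof (rule field_le_epsilon)
  fix \<epsilon> :: real assume "\<epsilon> > 0"
  from ev[OF this] obtain n0 where n0: "\<And>n. n \<ge> n0 \<Longrightarrow> \<kappa> - \<epsilon> \<le> (\<integral>z. X n z \<bullet> Z z \<partial>M)" by blast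
  have "\<kappa> - \<epsilon> \<le> (\<integral>z. F n z \<bullet> Z z \<partial>M)" if n: "n \<ge> n0" for n proof -
    have "L2_fun M (F n) \<and> \<kappa> - \<epsilon> \<le> (\<integral>z. F n z \<bullet> Z z \<partial>M)"
    proof (rule midhull_property[OF F[of n]])
      show "L2_fun M (X k) \<and> \<kappa> - \<epsilon> \<le> (\<integral>z. X k z \<bullet> Z z \<partial>M)" if "n \<le> k" for k
        using L n0 that n by simp
      fix f g assume fg: "L2_fun M f \<and> \<kappa> - \<epsilon> \<le> (\<integral>z. f z \<bullet> Z z \<partial>M)" "L2_fun M g \<and> \<kappa> - \<epsilon> \<le> (\<integral>z. g z \<bullet> Z z \<partial>M)"
      then have "(\<integral>z. ((1/2) *\<^sub>R (f z + g z)) \<bullet> Z z \<partial>M) = 1 / 2 * ((\<integral>z. f z \<bullet> Z z \<partial>M) + (\<integral>z. g z \<bullet> Z z \<partial>M))"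
        using L2_inner_integrable[OF _ Z] by (simp add: inner_add_left)
      then show "L2_fun M (\<lambda>x. (1/2) *\<^sub>R (f x + g x)) \<and> \<kappa> - \<epsilon> \<le> (\<integral>z. ((1/2) *\<^sub>R (f z + g z)) \<bullet> Z z \<partial>M)"
        using fg L2_scaleR[OF L2_add, of M f g "1/2"] by auto
    qed
    then show ?thesis ..
  qed
  then have "\<kappa> - \<epsilon> \<le> (\<integral>z. x z \<bullet> Z z \<partial>M)"
    by (intro LIMSEQ_le_const[OF L2_lim_inner[OF lim L2_lim_const[OF Z]]]) blast
  then show "\<kappa> \<le> (\<integral>z. x z \<bullet> Z z \<partial>M) + \<epsilon>" by simp
qed

lemma L2_midhull_inner_lim:
  fixes X :: "nat \<Rightarrow> 'x \<Rightarrow> 'b::euclidean_space"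
  assumes L: "\<And>n. L2_fun M (X n)" and F: "\<And>n. midhull X n (F n)" and lim: "L2_lim M F x" and Z: "L2_fun M Z"
    and ev: "(\<lambda>n. \<integral>z. X n z \<bullet> Z z \<partial>M) \<longlonglongrightarrow> \<kappa>"
  shows "(\<integral>z. x z \<bullet> Z z \<partial>M) = \<kappa>"
proof (rule antisym)
  have ev': "\<exists>n0. \<forall>n\<ge>n0. \<bar>(\<integral>z. X n z \<bullet> Z z \<partial>M) - \<kappa>\<bar> < \<epsilon>" if "\<epsilon> > 0" for \<epsilon>
    using LIMSEQ_D[OF ev that] by simp
  show "\<kappa> \<le> (\<integral>z. x z \<bullet> Z z \<partial>M)" by (rule L2_midhull_inner_ge[OF L F lim Z]) (use ev' in force)
  \<comment> \<open>The opposite inequality is the same statement for minus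
    \<open>Z\<close>.\<close>
  have "- \<kappa> \<le> (\<integral>z. x z \<bullet> (- 1 *\<^sub>R Z z) \<partial>M)"
    by (rule L2_midhull_inner_ge[OF L F lim L2_scaleR[OF Z]]) (use ev' in force)
  then show "(\<integral>z. x z \<bullet> Z z \<partial>M) \<le> \<kappa>" by simp
qed

section \<open>Functions that are piecewise constant in time\<close>

context evolution
begin

lemma Q_test: "test_function (\<Omega> \<times> {0<..<T}) \<psi> \<Longrightarrow> L2_fun QQ \<psi>"
proof -
  interpret Q: bounded_domain "\<Omega> \<times> {0<..<T}" using Q_bounded open_dom by unfold_locales (auto intro: open_Times)
  show "test_function (\<Omega> \<times> {0<..<T}) \<psi> \<Longrightarrow> L2_fun QQ \<psi>" by (rule Q.test_function_L2(1))
qed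

text \<open>Written as a sum over cells, so that measurability and integrals reduce to products of a
  function of space and a function of time.\<close>

definition pw :: "nat \<Rightarrow> (nat \<Rightarrow> 'a \<Rightarrow> 'c::real_vector) \<Rightarrow> 'a \<times> real \<Rightarrow> 'c" where
  "pw N \<Phi> z = (\<Sum>k<N. indicator (cell N k) (snd z) *\<^sub>R \<Phi> k (fst z))"

lemma pw_eq: "N > 0 \<Longrightarrow> 0 \<le> t \<Longrightarrow> t < T \<Longrightarrow> pw N \<Phi> (x, t) = \<Phi> (idx N t) x"
  unfolding pw_def using step_sum[of N t "\<lambda>k. \<Phi> k x"] by simp

lemma cell_borel [simp]: "cell N k \<in> sets borel" by (simp add: cell_def)

lemma pw_measurable:
  fixes \<Phi> :: "nat \<Rightarrow> 'a \<Rightarrow> 'c::euclidean_space"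
  assumes "\<And>k. k < N \<Longrightarrow> \<Phi> k \<in> borel_measurable NN"
  shows "pw N \<Phi> \<in> borel_measurable QQ"
  unfolding pw_def[abs_def]
  by (intro borel_measurable_sum borel_measurable_scaleR indicator_snd_measurable lebesgue_on_measurable_fst assms dom_sets Q_sets cell_borel) auto

lemma pw_AE:
  assumes N: "N > 0" and P: "\<And>k. k < N \<Longrightarrow> AE z in QQ. P k z"
  shows "AE z in QQ. P (idx N (snd z)) z"
proof -
  have "AE z in QQ. \<forall>k\<in>{..<N}. P k z" by (rule AE_finite_allI) (use P in auto)
  moreover have "AE z in QQ. z \<in> \<Omega> \<times> {0<..<T}" by (rule AE_I2) simp
  ultimately show ?thesis by eventually_elim (use idx_cell(1)[OF N] in auto)
qed

lemma cell_integral: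
  assumes N: "N > 0" and k: "k < N"
  shows "integral\<^sup>L TT (indicator (cell N k) :: real \<Rightarrow> real) = T / real N"
  unfolding cell_def using cell_measure[of "real k * (T / real N)" "real (Suc k) * (T / real N)"]
    grid_in[OF N, of "Suc k"] grid_in[OF N, of k] k N T by (simp add: add_divide_distrib distrib_right)

lemma pw_integral:
  fixes h :: "nat \<Rightarrow> 'a \<Rightarrow> real"
  assumes N: "N > 0" and h: "\<And>k. k < N \<Longrightarrow> h k \<in> borel_measurable NN" "\<And>k x. k < N \<Longrightarrow> \<bar>h k x\<bar> \<le> H"
  shows "integrable QQ (pw N h)" "integral\<^sup>L QQ (pw N h) = T / real N * (\<Sum>k<N. integral\<^sup>L NN (h k))"
proof -
  have 1: "integrable QQ (\<lambda>z. indicator (cell N k) (snd z) * h k (fst z))"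
    "(\<integral>z. indicator (cell N k) (snd z) * h k (fst z) \<partial>QQ) = T / real N * integral\<^sup>L NN (h k)" if k: "k < N" for k
  proof -
    note cell_integral[OF N k]
    then show "integrable QQ (\<lambda>z. indicator (cell N k) (snd z) * h k (fst z))"
      "(\<integral>z. indicator (cell N k) (snd z) * h k (fst z) \<partial>QQ) = T / real N * integral\<^sup>L NN (h k)"
      using bounded_product_integral[of "h k" H "indicator (cell N k)" 1, OF h(1)[OF k] _ borel_measurable_indicator[OF cell_borel]] h(2)[OF k] by (auto split: split_indicator)
  qed
  then show "integrable QQ (pw N h)" unfolding pw_def[abs_def] by (intro Bochner_Integration.integrable_sum) auto
  show "integral\<^sup>L QQ (pw N h) = T / real N * (\<Sum>k<N. integral\<^sup>L NN (h k))"
    unfolding pw_def[abs_def] real_scaleR_def sum_distrib_left by (subst Bochner_Integration.integral_sum) (use 1 in auto)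
qed

end

text \<open>The schemes along the subsequence extracted by Arzela-Ascoli; hence the number of cells
  \<open>N n\<close> need not be consecutive.\<close>

locale evolution_limit = evolution +
  fixes U :: "nat \<Rightarrow> nat \<Rightarrow> 'a \<Rightarrow> real" and N :: "nat \<Rightarrow> nat" and u :: "'a \<times> real \<Rightarrow> real"
  assumes N: "\<And>n. N n > 0" and S: "\<And>n. is_scheme (N n) (U n)" and mesh: "(\<lambda>n. T / real (N n)) \<longlonglongrightarrow> 0"
    and u_cont: "continuous_on (closure \<Omega> \<times> {0..T}) u" and u_lip0: "\<And>t. t \<in> {0..T} \<Longrightarrow> (\<lambda>x. u (x, t)) \<in> lip0 M"
    and u_init: "\<And>x. u (x, 0) = V0 x"
    and u_lim: "\<And>\<epsilon>. \<epsilon> > 0 \<Longrightarrow> \<exists>n0. \<forall>n\<ge>n0. \<forall>x. \<forall>t\<in>{0..T}. \<bar>itp (N n) (\<lambda>k. U n k x) t - u (x, t)\<bar> < \<epsilon>"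
begin

text \<open>At a grid point the interpolant equals the iterate, and both ends of the cell of
  \<open>s\<close> are within one mesh width of \<open>s\<close>; equicontinuity then compares with
  the value at \<open>s\<close>.\<close>

lemma step_limit:
  assumes \<epsilon>: "\<epsilon> > 0"
  obtains n0 where "\<And>n s x. n \<ge> n0 \<Longrightarrow> s \<in> {0<..<T} \<Longrightarrow> \<bar>U n (idx (N n) s) x - u (x, s)\<bar> < \<epsilon>"
    "\<And>n s x. n \<ge> n0 \<Longrightarrow> s \<in> {0<..<T} \<Longrightarrow> \<bar>U n (Suc (idx (N n) s)) x - u (x, s)\<bar> < \<epsilon>"
    "\<And>n s. n \<ge> n0 \<Longrightarrow> s \<in> {0<..<T} \<Longrightarrow> \<bar>real (idx (N n) s) * (T / real (N n)) - s\<bar> < \<epsilon>"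
    "\<And>n s. n \<ge> n0 \<Longrightarrow> s \<in> {0<..<T} \<Longrightarrow> \<bar>real (Suc (idx (N n) s)) * (T / real (N n)) - s\<bar> < \<epsilon>"
proof -
  obtain \<delta> where \<delta>: "\<delta> > 0" "\<And>N U s t x. is_scheme N U \<Longrightarrow> N > 0 \<Longrightarrow> s \<in> {0..T} \<Longrightarrow> t \<in> {0..T} \<Longrightarrow> \<bar>t - s\<bar> < \<delta>
    \<Longrightarrow> \<bar>itp N (\<lambda>k. U k x) t - itp N (\<lambda>k. U k x) s\<bar> < \<epsilon> / 2"
    by (rule itp_equicontinuous[of "\<epsilon> / 2"]) (use \<epsilon> in simp, rule that)
  obtain n1 where n1: "\<And>n x t. n \<ge> n1 \<Longrightarrow> t \<in> {0..T} \<Longrightarrow> \<bar>itp (N n) (\<lambda>k. U n k x) t - u (x, t)\<bar> < \<epsilon> / 2"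
    using u_lim[OF half_gt_zero[OF \<epsilon>]] by blast
  obtain n2 where n2: "\<And>n. n \<ge> n2 \<Longrightarrow> T / real (N n) < min \<delta> \<epsilon>"
    using order_tendstoD(2)[OF mesh, of "min \<delta> \<epsilon>"] \<delta>(1) \<epsilon> by (auto simp: eventually_sequentially)
  have near: "\<bar>real j * (T / real (N n)) - s\<bar> < min \<delta> \<epsilon> \<and> \<bar>U n j x - u (x, s)\<bar> < \<epsilon>"
    if n: "n \<ge> max n1 n2" and s: "s \<in> {0<..<T}" and j: "j = idx (N n) s \<or> j = Suc (idx (N n) s)" for n s x j
  proof -
    have ix: "idx (N n) s < N n" "s \<in> cell (N n) (idx (N n) s)" using idx_cell[OF N, of s] s by auto
    have jn: "j \<le> N n" using j ix(1) by auto
    have "\<bar>real j * (T / real (N n)) - s\<bar> \<le> T / real (N n)"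
      using j ix(2) by (auto simp: cell_def distrib_right add_divide_distrib)
    then have 1: "\<bar>real j * (T / real (N n)) - s\<bar> < min \<delta> \<epsilon>" using n2[of n] n by simp
    have "\<bar>itp (N n) (\<lambda>k. U n k x) (real j * (T / real (N n))) - itp (N n) (\<lambda>k. U n k x) s\<bar> < \<epsilon> / 2"
      using 1 s by (intro \<delta>(2)[OF S N] grid_in[OF N jn]) auto
    moreover have "\<bar>itp (N n) (\<lambda>k. U n k x) s - u (x, s)\<bar> < \<epsilon> / 2" using n1[of n s x] n s by simp
    ultimately show ?thesis using 1 unfolding itp_grid[OF jn N] by linarith
  qed
  show ?thesis by (rule that[of "max n1 n2"]) (use near in \<open>auto simp del: of_nat_Suc\<close>)
qed

lemma step_tendsto:
  assumes s: "s \<in> {0<..<T}"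
  shows "(\<lambda>n. U n (idx (N n) s) x) \<longlonglongrightarrow> u (x, s)" "(\<lambda>n. U n (Suc (idx (N n) s)) x) \<longlonglongrightarrow> u (x, s)"
    "(\<lambda>n. real (Suc (idx (N n) s)) * (T / real (N n))) \<longlonglongrightarrow> s"
proof -
  have "\<exists>n0. \<forall>n\<ge>n0. norm (U n (idx (N n) s) x - u (x, s)) < e \<and> norm (U n (Suc (idx (N n) s)) x - u (x, s)) < e \<and>
    norm (real (Suc (idx (N n) s)) * (T / real (N n)) - s) < e" if e: "e > 0" for e
  proof (rule step_limit[OF e])
    fix n0 assume "\<And>n s x. n \<ge> n0 \<Longrightarrow> s \<in> {0<..<T} \<Longrightarrow> \<bar>U n (idx (N n) s) x - u (x, s)\<bar> < e"
    "\<And>n s x. n \<ge> n0 \<Longrightarrow> s \<in> {0<..<T} \<Longrightarrow> \<bar>U n (Suc (idx (N n) s)) x - u (x, s)\<bar> < e"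
    "\<And>n s. n \<ge> n0 \<Longrightarrow> s \<in> {0<..<T} \<Longrightarrow> \<bar>real (Suc (idx (N n) s)) * (T / real (N n)) - s\<bar> < e"
    then show ?thesis unfolding real_norm_def using s by blast
  qed
  then show "(\<lambda>n. U n (idx (N n) s) x) \<longlonglongrightarrow> u (x, s)" "(\<lambda>n. U n (Suc (idx (N n) s)) x) \<longlonglongrightarrow> u (x, s)"
    "(\<lambda>n. real (Suc (idx (N n) s)) * (T / real (N n))) \<longlonglongrightarrow> s" by (force intro!: LIMSEQ_I)+
qed

lemma u_measurable: "u \<in> borel_measurable QQ"
proof (rule continuous_imp_measurable_on_sets_lebesgue)
  show "continuous_on (\<Omega> \<times> {0<..<T}) u"
    by (rule continuous_on_subset[OF u_cont]) (use closure_subset[of \<Omega>] in auto)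
qed (use Q_sets(1) in auto)

lemma u_bound: "t \<in> {0..T} \<Longrightarrow> \<bar>u (x, t)\<bar> \<le> B"
  using B(2)[OF u_lip0] .

definition dU where "dU n k x = (U n (Suc k) x - U n k x) / (T / real (N n))"

definition X :: "nat \<Rightarrow> 'a \<times> real \<Rightarrow> real \<times> 'a" where
  "X n = pw (N n) (\<lambda>k x. (dU n k x, weak_grad \<Omega> (U n k) x))"

lemma X_eq: "0 \<le> t \<Longrightarrow> t < T \<Longrightarrow> X n (x, t) = (dU n (idx (N n) t) x, weak_grad \<Omega> (U n (idx (N n) t)) x)"
  by (simp add: X_def pw_eq N)

lemma U_grad:
  assumes "k \<le> N n"
  shows "H10_grad (U n k) (weak_grad \<Omega> (U n k))" "AE x in NN. norm (weak_grad \<Omega> (U n k) x) \<le> g (x, real k * (T / real (N n)))"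
    "AE x in NN. norm (weak_grad \<Omega> (U n k) x) \<le> M" using K_grad[OF is_scheme_K[OF S assms] grid_in[OF N assms]] .

lemma dU_props:
  assumes "k < N n"
  shows "dU n k \<in> borel_measurable NN" "\<bar>dU n k x\<bar> \<le> 2 * B / (T / real (N n))"
proof -
  note l = is_scheme_lip0[OF S, of k n] is_scheme_lip0[OF S, of "Suc k" n]
  show "dU n k \<in> borel_measurable NN" unfolding dU_def[abs_def]
    using lip0_measurable[OF l(1)] lip0_measurable[OF l(2)] assms by (intro lebesgue_onI) auto
  have "\<bar>U n (Suc k) x - U n k x\<bar> \<le> 2 * B" using B(2)[OF l(1), of x] B(2)[OF l(2), of x] assms by simp
  then show "\<bar>dU n k x\<bar> \<le> 2 * B / (T / real (N n))" unfolding dU_def using T by (simp add: abs_mult divide_right_mono mult_right_mono)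
qed

text \<open>The first component contributes the sum of squared steps divided by the step length,
  which the scheme energy bounds by \<open>EE\<close>; the second is bounded by
  \<open>M\<close>.\<close>

lemma X_L2: "L2_fun QQ (X n)" "(\<integral>z. (norm (X n z))^2 \<partial>QQ) \<le> EE + M^2 * measure QQ (\<Omega> \<times> {0<..<T})"
proof -
  interpret Q: finite_measure QQ by (rule Q_finite)
  have Xm: "X n \<in> borel_measurable QQ" unfolding X_def using dU_props(1) L2_measurable[OF H10_grad_L2(2)[OF U_grad(1)]]
    by (intro pw_measurable borel_measurable_Pair) auto
  have GM: "AE z in QQ. norm (weak_grad \<Omega> (U n (idx (N n) (snd z))) (fst z)) \<le> M"
    by (rule pw_AE[OF N, where P = "\<lambda>k z. norm (weak_grad \<Omega> (U n k) (fst z)) \<le> M"])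
      (intro AE_lebesgue_on_fst dom_sets Q_sets U_grad(3) less_imp_le)
  have sp: "AE z in QQ. z \<in> \<Omega> \<times> {0<..<T}" by (rule AE_I2) simp
  have h: "\<bar>(dU n k x)^2\<bar> \<le> (2 * B / (T / real (N n)))^2" if "k < N n" for k x
    using power_mono[OF dU_props(2)[OF that, of x], of 2] by simp
  note pwi = pw_integral[OF N, of n "\<lambda>k x. (dU n k x)^2", OF borel_measurable_power[OF dU_props(1)] h]
  let ?h = "\<lambda>z. pw (N n) (\<lambda>k x. (dU n k x)^2) z + M^2"
  have ih: "integrable QQ ?h" using pwi(1) by simp
  have le: "AE z in QQ. (norm (X n z))^2 \<le> ?h z" using GM sp proof eventually_elim
    case (elim z)
    obtain x t where z: "z = (x, t)" by force
    show ?case using elim power_mono[OF elim(1), of 2] by (simp add: z X_eq pw_eq N norm_Pair)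
  qed
  show L: "L2_fun QQ (X n)" by (rule L2_bound[OF Xm ih le])
  have "(\<integral>z. (norm (X n z))^2 \<partial>QQ) \<le> integral\<^sup>L QQ ?h"
    by (rule integral_mono_AE[OF _ ih le]) (use L in \<open>simp add: L2_fun_def\<close>)
  also have "\<dots> = integral\<^sup>L QQ (pw (N n) (\<lambda>k x. (dU n k x)^2)) + M^2 * measure QQ (\<Omega> \<times> {0<..<T})"
    using pwi(1) by (simp add: mult.commute)
  also have "integral\<^sup>L QQ (pw (N n) (\<lambda>k x. (dU n k x)^2)) = T / real (N n) * (\<Sum>k<N n. (\<integral>x. (U n (Suc k) x - U n k x)^2 \<partial>NN) / (T / real (N n))^2)"
  proof -
    have "integral\<^sup>L QQ (pw (N n) (\<lambda>k x. (dU n k x)^2)) = T / real (N n) * (\<Sum>k<N n. \<integral>x. (dU n k x)^2 \<partial>NN)"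
      by (rule pwi(2)) assumption+
    then show ?thesis by (simp only: dU_def power_divide integral_divide_zero)
  qed
  also have "\<dots> = (\<Sum>k<N n. \<integral>x. (U n (Suc k) x - U n k x)^2 \<partial>NN) / (T / real (N n))" proof -
    have "p * (q / p^2) = q / p" for p q :: real by (simp add: power2_eq_square)
    then show ?thesis unfolding sum_divide_distrib[symmetric] .
  qed
  also have "\<dots> \<le> T / real (N n) * EE / (T / real (N n))"
    using scheme_energy[OF S N, of n] T N by (intro divide_right_mono) auto
  also have "\<dots> = EE" using T N[of n] by simp
  finally show "(\<integral>z. (norm (X n z))^2 \<partial>QQ) \<le> EE + M^2 * measure QQ (\<Omega> \<times> {0<..<T})" by simp
qed

text \<open>On almost every vertical line this is \<open>itp_by_parts\<close>; Fubini assembles the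
  lines.\<close>

lemma scheme_by_parts:
  assumes \<phi>: "test_function (\<Omega> \<times> {0<..<T}) \<phi>"
  shows "(\<integral>z. itp (N n) (\<lambda>k. U n k (fst z)) (snd z) * frechet_derivative \<phi> (at z) (0, 1) \<partial>QQ) = - (\<integral>z. fst (X n z) * \<phi> z \<partial>QQ)"
    "(\<lambda>z. itp (N n) (\<lambda>k. U n k (fst z)) (snd z)) \<in> borel_measurable QQ"
proof -
  let ?i = "\<lambda>z. itp (N n) (\<lambda>k. U n k (fst z)) (snd z)" and ?D = "\<lambda>z. frechet_derivative \<phi> (at z) (0, 1)"
  note \<phi>' = test_function_frechet_derivative[OF \<phi>, of "(0, 1)"]
  obtain K where K: "smooth \<phi>" "K \<subseteq> \<Omega> \<times> {0<..<T}" "\<And>x. x \<notin> K \<Longrightarrow> \<phi> x = 0"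
    using \<phi> by (rule test_functionE) (rule that)
  have clm: "(\<lambda>z::'a \<times> real. cl (N n) k (snd z)) \<in> borel_measurable QQ" for k
    unfolding cl_def by (intro lebesgue_onI borel_measurable_continuous_onI continuous_intros)
  show im: "?i \<in> borel_measurable QQ" unfolding itp_def using lip0_fst_measurable[OF is_scheme_lip0[OF S, of _ n]] clm
    by (intro borel_measurable_add borel_measurable_sum borel_measurable_times borel_measurable_diff) auto
  have Li: "L2_fun QQ ?i" proof (rule L2_bounded[OF Q_finite im])
    show "AE z in QQ. norm (?i z) \<le> B" using B(2)[OF itp_lip0[OF S N]] by (intro AE_I2) auto
  qed
  have LX: "L2_fun QQ (\<lambda>z. fst (X n z))" by (rule L2_fst_snd(1)[OF X_L2(1)])
  have i: "integrable QQ (\<lambda>z. ?i z * ?D z)" "integrable QQ (\<lambda>z. fst (X n z) * \<phi> z)"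
    using L2_mult_integrable[OF Li Q_test[OF \<phi>']] L2_mult_integrable[OF LX Q_test[OF \<phi>]] .
  let ?h = "\<lambda>z. ?i z * ?D z + fst (X n z) * \<phi> z"
  have ih: "integrable QQ ?h" using i by simp
  have "AE x in NN. (\<integral>t. ?h (x, t) \<partial>TT) = 0" using lebesgue_on_Fubini(4)[OF QF ih] proof eventually_elim
    case (elim x)
    have "((\<lambda>t. itp (N n) (\<lambda>k. U n k x) t * ?D (x, t) +
        (\<Sum>k<N n. indicator (cell (N n) k) t * ((U n (Suc k) x - U n k x) / (T / real (N n)))) * \<phi> (x, t)) has_integral 0) {0<..<T}"
    proof (rule itp_by_parts[OF N])
      show "((\<lambda>t. \<phi> (x, t)) has_real_derivative ?D (x, t)) (at t)" for t by (rule deriv_section(1)[OF K(1)])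
      show "\<phi> (x, 0) = 0" "\<phi> (x, T) = 0" using subsetD[OF K(2), of "(x, 0)"] subsetD[OF K(2), of "(x, T)"] K(3)[of "(x, 0)"] K(3)[of "(x, T)"] by auto
    qed
    then have "((\<lambda>t. ?h (x, t)) has_integral 0) {0<..<T}" by (simp add: X_def pw_def fst_sum dU_def)
    then show ?case using has_integral_unique[OF _ has_integral_integral_lebesgue_on[OF elim]] by simp
  qed
  then have "(\<integral>x. (\<integral>t. ?h (x, t) \<partial>TT) \<partial>NN) = (\<integral>x. 0 \<partial>NN)"
    using lebesgue_on_Fubini(5)[OF QF ih] by (intro integral_cong_AE) auto
  then have "integral\<^sup>L QQ ?h = 0" using lebesgue_on_Fubini(6)[OF QF ih] by simp
  then show "(\<integral>z. ?i z * ?D z \<partial>QQ) = - (\<integral>z. fst (X n z) * \<phi> z \<partial>QQ)" using i by simp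
qed

end

section \<open>Identification of the limit of the combinations\<close>

context evolution_limit
begin

lemma itp_L2_lim: "L2_lim QQ (\<lambda>n z. itp (N n) (\<lambda>k. U n k (fst z)) (snd z)) u"
proof (rule L2_lim_dominated_bounded[OF Q_finite scheme_by_parts(2)[OF test_function_zero] u_measurable])
  show "AE z in QQ. norm (itp (N n) (\<lambda>k. U n k (fst z)) (snd z)) \<le> B" for n
    using B(2)[OF itp_lip0[OF S N]] by (intro AE_I2) auto
  show "AE z in QQ. (\<lambda>n. itp (N n) (\<lambda>k. U n k (fst z)) (snd z)) \<longlonglongrightarrow> u z"
    using u_lim by (intro AE_I2 LIMSEQ_I) force
qed

lemma snd_measurable: "continuous_on UNIV \<psi> \<Longrightarrow> (\<lambda>z::'a \<times> real. \<psi> (snd z) :: real) \<in> borel_measurable QQ"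
  by (rule lebesgue_onI, rule borel_measurable_continuous_onI, rule continuous_on_compose2[of UNIV \<psi> _ snd])
    (auto intro: continuous_intros)

lemma sc_continuous: "continuous_on UNIV (sc s)"
  unfolding sc_def[abs_def] by (intro continuous_intros)

lemma direction:
  assumes V: "V \<in> lip0 M"
  shows "(\<lambda>z. sc s (snd z) * V (fst z) - u z) \<in> borel_measurable QQ"
    and "AE z in QQ. \<bar>sc s (snd z) * V (fst z) - u z\<bar> \<le> 2 * B"
proof -
  show "(\<lambda>z. sc s (snd z) * V (fst z) - u z) \<in> borel_measurable QQ"
    using lip0_fst_measurable[OF V] u_measurable snd_measurable[OF sc_continuous]
    by (intro borel_measurable_diff borel_measurable_times) auto
  show "AE z in QQ. \<bar>sc s (snd z) * V (fst z) - u z\<bar> \<le> 2 * B" proof (rule AE_I2)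
    fix z assume "z \<in> space QQ"
    then have "\<bar>u z\<bar> \<le> B" using u_bound[of "snd z" "fst z"] by auto
    moreover have "\<bar>sc s (snd z) * V (fst z)\<bar> \<le> 1 * B"
      unfolding abs_mult using sc_bounds[of s "snd z"] B(2)[OF V] by (intro mult_mono) auto
    ultimately show "\<bar>sc s (snd z) * V (fst z) - u z\<bar> \<le> 2 * B" by linarith
  qed
qed

text \<open>\<open>F\<close> and \<open>Y\<close> stand for the combinations and the limit that the
  bound \<open>X_L2\<close> provides. The first component of \<open>Y\<close> turns out to be the
  time derivative of \<open>u\<close>, the second its spatial gradient.\<close>

context
  fixes F and Y :: "'a \<times> real \<Rightarrow> real \<times> 'a"
  assumes F: "\<And>n. midhull X n (F n)" and FY: "L2_lim QQ F Y" and FY_AE: "AE z in QQ. (\<lambda>n. F n z) \<longlonglongrightarrow> Y z"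
begin

lemma Y_L2: "L2_fun QQ Y" "L2_fun QQ (F n)"
  using FY by (auto simp: L2_lim_def)

lemma limit_dt:
  assumes \<phi>: "test_function (\<Omega> \<times> {0<..<T}) \<phi>"
  shows "(\<integral>z. u z * frechet_derivative \<phi> (at z) (0, 1) \<partial>QQ) = - (\<integral>z. fst (Y z) * \<phi> z \<partial>QQ)"
proof -
  have "(\<integral>z. Y z \<bullet> (\<phi> z, 0) \<partial>QQ) = - (\<integral>z. u z * frechet_derivative \<phi> (at z) (0, 1) \<partial>QQ)"
  proof (rule L2_midhull_inner_lim[OF X_L2(1) F FY])
    show "L2_fun QQ (\<lambda>z. (\<phi> z, 0 :: 'a))" by (rule L2_fun_Pair[OF Q_test[OF \<phi>]]) (simp add: L2_fun_def)
    have "(\<lambda>n. - (\<integral>z. itp (N n) (\<lambda>k. U n k (fst z)) (snd z) * frechet_derivative \<phi> (at z) (0, 1) \<partial>QQ))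
        \<longlonglongrightarrow> - (\<integral>z. u z * frechet_derivative \<phi> (at z) (0, 1) \<partial>QQ)"
      by (intro tendsto_minus L2_lim_mult itp_L2_lim L2_lim_const Q_test test_function_frechet_derivative[OF \<phi>])
    then show "(\<lambda>n. \<integral>z. X n z \<bullet> (\<phi> z, 0) \<partial>QQ) \<longlonglongrightarrow> - (\<integral>z. u z * frechet_derivative \<phi> (at z) (0, 1) \<partial>QQ)"
      unfolding scheme_by_parts(1)[OF \<phi>] by (simp add: inner_prod_def)
  qed
  then show ?thesis by (simp add: inner_prod_def)
qed

text \<open>At time \<open>t\<close> an iterate obeys the constraint of a nearby grid time, which
  exceeds that of time \<open>t\<close> by at most \<open>C\<close> times the distance; hence the
  slack \<epsilon>. Gradient bound and uniform closeness to \<open>u\<close> are both stable under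
  midpoints.\<close>

lemma hull_grad:
  assumes \<epsilon>: "\<epsilon> > 0"
  obtains n0 where "\<And>n t. n \<ge> n0 \<Longrightarrow> t \<in> {0<..<T} \<Longrightarrow> \<exists>v. H10_grad v (\<lambda>x. snd (F n (x, t))) \<and> (\<forall>x. \<bar>v x - u (x, t)\<bar> \<le> \<epsilon>) \<and>
    (AE x in NN. norm (snd (F n (x, t))) \<le> g (x, t) + \<epsilon>)"
proof -
  let ?P = "\<lambda>t f. \<exists>v. H10_grad v (\<lambda>x. snd (f (x, t))) \<and> (\<forall>x. \<bar>v x - u (x, t)\<bar> \<le> \<epsilon>) \<and> (AE x in NN. norm (snd (f (x, t))) \<le> g (x, t) + \<epsilon>)"
  define e where "e = \<epsilon> / (C + 1)"
  have e: "e > 0" "e \<le> \<epsilon>" "C * e \<le> \<epsilon>" using \<epsilon> C by (auto simp: e_def field_simps)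
  obtain n0 where n0: "\<And>n s x. n \<ge> n0 \<Longrightarrow> s \<in> {0<..<T} \<Longrightarrow> \<bar>U n (idx (N n) s) x - u (x, s)\<bar> < e"
    "\<And>n s. n \<ge> n0 \<Longrightarrow> s \<in> {0<..<T} \<Longrightarrow> \<bar>real (idx (N n) s) * (T / real (N n)) - s\<bar> < e"
    by (rule step_limit[OF e(1)]) (rule that)
  have PX: "?P t (X n)" if n: "n \<ge> n0" and t: "t \<in> {0<..<T}" for n t proof -
    define j where "j = idx (N n) t"
    have j: "j < N n" using idx_cell(1)[OF N, of t] t by (simp add: j_def)
    have Xe: "X n (x, t) = (dU n j x, weak_grad \<Omega> (U n j) x)" for x using t by (simp add: X_eq j_def)
    have s: "real j * (T / real (N n)) \<in> {0..T}" by (rule grid_in[OF N less_imp_le[OF j]])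
    have tT: "t \<in> {0..T}" using t by auto
    have "C * \<bar>t - real j * (T / real (N n))\<bar> \<le> C * e"
      using n0(2)[OF n t] C unfolding j_def[symmetric] by (intro mult_left_mono) auto
    then have Ce: "C * \<bar>t - real j * (T / real (N n))\<bar> \<le> \<epsilon>" using e(3) by simp
    have "AE x in NN. norm (weak_grad \<Omega> (U n j) x) \<le> g (x, t) + \<epsilon>"
      using U_grad(2)[OF less_imp_le[OF j]] g_lip[OF s tT] by eventually_elim (use Ce in linarith)
    moreover have "\<bar>U n j x - u (x, t)\<bar> \<le> \<epsilon>" for x using n0(1)[OF n t, of x] e(2) unfolding j_def by simp
    ultimately show ?thesis unfolding Xe snd_conv using U_grad(1)[OF less_imp_le[OF j]] by blast
  qed
  have mid: "?P t (\<lambda>x. (1/2) *\<^sub>R (f x + h x))" if P: "?P t f" "?P t h" for f h t proof -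
    obtain v w where v: "H10_grad v (\<lambda>x. snd (f (x, t)))" "\<And>x. \<bar>v x - u (x, t)\<bar> \<le> \<epsilon>" "AE x in NN. norm (snd (f (x, t))) \<le> g (x, t) + \<epsilon>"
      and w: "H10_grad w (\<lambda>x. snd (h (x, t)))" "\<And>x. \<bar>w x - u (x, t)\<bar> \<le> \<epsilon>" "AE x in NN. norm (snd (h (x, t))) \<le> g (x, t) + \<epsilon>"
      using P by blast
    have "H10_grad (\<lambda>x. 1 / 2 * v x + 1 / 2 * w x) (\<lambda>x. snd ((1/2) *\<^sub>R (f (x, t) + h (x, t))))"
      using H10_grad_linear[OF v(1) w(1), of "1/2" "1/2"] by (simp add: scaleR_add_right)
    moreover have "\<bar>1 / 2 * v x + 1 / 2 * w x - u (x, t)\<bar> \<le> \<epsilon>" for x using v(2)[of x] w(2)[of x] by (auto simp: abs_le_iff)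
    moreover have "AE x in NN. norm (snd ((1/2) *\<^sub>R (f (x, t) + h (x, t)))) \<le> g (x, t) + \<epsilon>" using v(3) w(3)
    proof eventually_elim
      case (elim x)
      then show ?case using norm_triangle_ineq[of "snd (f (x, t))" "snd (h (x, t))"] by simp
    qed
    ultimately show ?thesis by blast
  qed
  have "?P t (F n)" if "n \<ge> n0" "t \<in> {0<..<T}" for n t
    by (rule midhull_property[OF F[of n], of "?P t"]) (use PX that mid in \<open>force, blast\<close>)
  then show ?thesis by (rule that)
qed

text \<open>For almost every time the section of \<open>Y\<close> is an L2 limit of gradients of
  functions uniformly close to the section of \<open>u\<close>, so closedness of
  \<open>H10_grad\<close> applies; the constraint follows from pointwise convergence once the slack
  tends to 0.\<close>

lemma limit_grad:
  "AE t in TT. H10_grad (\<lambda>x. u (x, t)) (\<lambda>x. snd (Y (x, t))) \<and> (AE x in NN. norm (snd (Y (x, t))) \<le> g (x, t))"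
proof -
  interpret NF: finite_measure NN by (rule dom_finite)
  \<comment> \<open>The space-time L2 error is the time integral of the sectional errors, so a
    subsequence of these tends to 0 at almost every time.\<close>
  define y where "y n t = (\<integral>x. (norm (F n (x, t) - Y (x, t)))^2 \<partial>NN)" for n t
  have i: "integrable QQ (\<lambda>z. (norm (F n z - Y z))^2)" for n
    using L2_diff[OF Y_L2(2)[of n] Y_L2(1)] by (simp add: L2_fun_def)
  have y: "integrable TT (y n)" "integral\<^sup>L TT (y n) = (\<integral>z. (norm (F n z - Y z))^2 \<partial>QQ)" for n
    unfolding y_def using lebesgue_on_Fubini(2,3)[OF QF i] by auto
  have y0: "norm (y n t) = y n t" for n t by (simp add: y_def)
  have "(\<lambda>n. \<integral>t. norm (y n t) \<partial>TT) \<longlonglongrightarrow> 0"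
    unfolding y0 y(2) using FY by (simp add: L2_lim_def)
  from tendsto_L1_AE_subseq[of "TT" y, OF y(1) this]
  obtain r :: "nat \<Rightarrow> nat" where r: "strict_mono r" "AE t in TT. (\<lambda>n. y (r n) t) \<longlonglongrightarrow> 0" by blast
  have sec: "AE t in TT. L2_fun NN (\<lambda>x. h (x, t))" if "L2_fun QQ h" for h :: "'a \<times> real \<Rightarrow> real \<times> 'a"
    using L2_section[of T h] that by (simp add: in_L2_iff cylinder_def)
  have F2: "AE t in TT. \<forall>n. L2_fun NN (\<lambda>x. F n (x, t))" unfolding AE_all_countable using sec Y_L2(2) by blast
  have int: "AE t in TT. t \<in> {0<..<T}" by (rule AE_I2) simp
  show ?thesis using r(2) sec[OF Y_L2(1)] F2 AE_lebesgue_on_pair(2)[OF QF FY_AE] int proof eventually_elim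
    case (elim t)
    have tT: "t \<in> {0..T}" using elim(5) by auto
    have "H10_grad (\<lambda>x. u (x, t)) (\<lambda>x. snd (Y (x, t)))"
    proof (rule H10_grad_closed[OF lip0_L2[OF u_lip0[OF tT]] L2_fst_snd(2)[OF elim(2)]])
      fix \<epsilon> :: real assume \<epsilon>: "\<epsilon> > 0"
      define \<delta> where "\<delta> = sqrt (\<epsilon> / (measure NN \<Omega> + 1))"
      have mu: "0 < \<epsilon> / (\<mu> + 1)" "\<epsilon> / (\<mu> + 1) * \<mu> < \<epsilon>" if "\<mu> \<ge> 0" for \<mu> :: real
        using that \<epsilon> by (auto simp: field_simps)
      have \<delta>: "\<delta> > 0" "\<delta>^2 * measure NN \<Omega> < \<epsilon>"
        using mu[OF measure_nonneg[of NN \<Omega>]] by (simp_all add: \<delta>_def del: times_divide_eq_left)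
      obtain n0 where n0: "\<And>n t. n \<ge> n0 \<Longrightarrow> t \<in> {0<..<T} \<Longrightarrow> \<exists>v. H10_grad v (\<lambda>x. snd (F n (x, t))) \<and> (\<forall>x. \<bar>v x - u (x, t)\<bar> \<le> \<delta>) \<and>
          (AE x in NN. norm (snd (F n (x, t))) \<le> g (x, t) + \<delta>)" by (rule hull_grad[OF \<delta>(1)]) (rule that)
      obtain n1 where n1: "\<And>n. n \<ge> n1 \<Longrightarrow> y (r n) t < \<epsilon>"
        using order_tendstoD(2)[OF elim(1) \<epsilon>] by (auto simp: eventually_sequentially)
      define n where "n = max n0 n1"
      have "r n \<ge> n0" using seq_suble[OF r(1), of n] by (simp add: n_def)
      from n0[OF this elim(5)] obtain v where v: "H10_grad v (\<lambda>x. snd (F (r n) (x, t)))" "\<And>x. \<bar>v x - u (x, t)\<bar> \<le> \<delta>" by blast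
      have "(\<integral>x. (norm (v x - u (x, t)))^2 \<partial>NN) \<le> (\<integral>x. \<delta>^2 \<partial>NN)"
      proof (rule integral_mono)
        show "integrable NN (\<lambda>x. (norm (v x - u (x, t)))^2)"
          using L2_diff[OF H10_grad_L2(1)[OF v(1)] lip0_L2[OF u_lip0[OF tT]]] by (simp add: L2_fun_def)
        show "(norm (v x - u (x, t)))^2 \<le> \<delta>^2" for x using power_mono[OF v(2)[of x], of 2] by simp
      qed simp
      also have "\<dots> < \<epsilon>" using \<delta>(2) by (simp add: mult.commute)
      finally have 1: "(\<integral>x. (norm (v x - u (x, t)))^2 \<partial>NN) < \<epsilon>" .
      have LD: "L2_fun NN (\<lambda>x. F (r n) (x, t) - Y (x, t))" by (rule L2_diff) (use elim in auto)
      have "(\<integral>x. (norm (snd (F (r n) (x, t)) - snd (Y (x, t))))^2 \<partial>NN) \<le> y (r n) t" unfolding y_def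
      proof (rule integral_mono)
        show "integrable NN (\<lambda>x. (norm (snd (F (r n) (x, t)) - snd (Y (x, t))))^2)"
          using L2_fst_snd(2)[OF LD] by (simp add: L2_fun_def)
        show "integrable NN (\<lambda>x. (norm (F (r n) (x, t) - Y (x, t)))^2)" using LD by (simp add: L2_fun_def)
        show "(norm (snd (F (r n) (x, t)) - snd (Y (x, t))))^2 \<le> (norm (F (r n) (x, t) - Y (x, t)))^2" for x
          using norm_snd_le[of "snd (F (r n) (x, t) - Y (x, t))" "fst (F (r n) (x, t) - Y (x, t))"]
          unfolding prod.collapse unfolding snd_diff by (rule power_mono) simp
      qed
      also have "\<dots> < \<epsilon>" using n1[of n] by (simp add: n_def)
      finally show "\<exists>v' G'. H10_grad v' G' \<and> (\<integral>x. (norm (v' x - u (x, t)))^2 \<partial>NN) < \<epsilon> \<and>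
        (\<integral>x. (norm (G' x - snd (Y (x, t))))^2 \<partial>NN) < \<epsilon>" using v(1) 1 by blast
    qed
    moreover have "AE x in NN. norm (snd (Y (x, t))) \<le> g (x, t)" proof (rule AE_le_of_approx)
      fix \<epsilon> :: real assume \<epsilon>: "\<epsilon> > 0"
      obtain n0 where n0: "\<And>n t. n \<ge> n0 \<Longrightarrow> t \<in> {0<..<T} \<Longrightarrow> \<exists>v. H10_grad v (\<lambda>x. snd (F n (x, t))) \<and> (\<forall>x. \<bar>v x - u (x, t)\<bar> \<le> \<epsilon>) \<and>
          (AE x in NN. norm (snd (F n (x, t))) \<le> g (x, t) + \<epsilon>)" by (rule hull_grad[OF \<epsilon>]) (rule that)
      have "AE x in NN. \<forall>n. n \<ge> n0 \<longrightarrow> norm (snd (F n (x, t))) \<le> g (x, t) + \<epsilon>"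
        unfolding AE_all_countable using n0[OF _ elim(5)] by auto
      with elim(4) show "AE x in NN. norm (snd (Y (x, t))) \<le> g (x, t) + \<epsilon>" proof eventually_elim
        case (elim x)
        show ?case by (rule LIMSEQ_le_const2[OF tendsto_norm[OF tendsto_snd[OF elim(1)]]]) (use elim(2) in blast)
      qed
    qed
    ultimately show ?case ..
  qed
qed

text \<open>A fixed \<open>V\<close> is admissible at time \<open>s\<close> only; the factor
  \<open>sc s t\<close> makes it admissible at every time and so allows a weak formulation over the
  whole interval. The discrete inequalities hold for the piecewise constant direction
  \<open>\<Theta>'\<close>, which converges strongly to \<open>\<Theta>\<close>; the discrete
  residual is merely bounded in L2, and that is enough.\<close>

lemma limit_inequality:
  assumes V: "V \<in> K s" and s: "s \<in> {0..T}" and \<rho>: "test_function {0<..<T} \<rho>" "\<And>t. 0 \<le> \<rho> t"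
  defines "\<Theta> \<equiv> \<lambda>z. \<rho> (snd z) * (sc s (snd z) * V (fst z) - u z)"
  shows "L2_fun QQ \<Theta>"
    and "(\<integral>z. f z * \<Theta> z \<partial>QQ) - (\<integral>z. u z * (c z * \<Theta> z) \<partial>QQ) \<le> (\<integral>z. Y z \<bullet> (\<Theta> z, \<Theta> z *\<^sub>R b z) \<partial>QQ)"
proof -
  let ?J = "\<lambda>n. \<integral>z. X n z \<bullet> (\<Theta> z, \<Theta> z *\<^sub>R b z) \<partial>QQ"
  let ?\<kappa> = "(\<integral>z. f z * \<Theta> z \<partial>QQ) - (\<integral>z. u z * (c z * \<Theta> z) \<partial>QQ)"
  define \<tau> where "\<tau> n = T / real (N n)" for n
  \<comment> \<open>Evaluated at the right end of the cell, the time to which the step inequality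
    and the new iterate belong.\<close>
  define \<theta> where "\<theta> n k x = \<rho> (real (Suc k) * \<tau> n) * (sc s (real (Suc k) * \<tau> n) * V x - U n (Suc k) x)" for n k x
  define \<Theta>' where "\<Theta>' n = pw (N n) (\<theta> n)" for n
  define Sm where "Sm n z = (\<Sum>k<N n. indicator (cell (N n) k) (snd z) * src (U n k) z)" for n z
  \<comment> \<open>The residual of the discrete equation: difference quotient minus frozen
    source.\<close>
  define R where "R n z = fst (X n z) - Sm n z" for n z
  obtain r where r: "\<And>t. \<bar>\<rho> t\<bar> \<le> r" using \<rho>(1) by (rule test_function_bounded) (rule that)
  have r0: "r \<ge> 0" using r[of 0] by simp
  have \<tau>: "\<tau> n > 0" for n using T N by (simp add: \<tau>_def)
  have \<rho>c: "continuous_on UNIV \<rho>" by (rule smooth_continuous[OF test_function_smooth[OF \<rho>(1)]])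
  note scc = sc_continuous[of s]
  have Vl: "V \<in> lip0 M" by (rule K_lip0[OF V])
  have dB: "\<bar>\<rho> t * (sc s t * V x - w)\<bar> \<le> r * (2 * B)" if "\<bar>w\<bar> \<le> B" for t x w proof -
    have "\<bar>sc s t * V x\<bar> \<le> 1 * B" unfolding abs_mult using sc_bounds[of s t] B(2)[OF Vl] by (intro mult_mono) auto
    then have "\<bar>sc s t * V x - w\<bar> \<le> 2 * B" using that by linarith
    then show ?thesis unfolding abs_mult using r r0 by (intro mult_mono) auto
  qed
  have sp: "AE z in QQ. z \<in> \<Omega> \<times> {0<..<T}" by (rule AE_I2) simp
  have Ul: "U n (Suc k) \<in> lip0 M" if "k < N n" for n k using is_scheme_lip0[OF S, of "Suc k" n] that by simp
  have \<theta>B: "\<bar>\<theta> n k x\<bar> \<le> r * (2 * B)" if "k < N n" for n k x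
    unfolding \<theta>_def by (rule dB) (rule B(2)[OF Ul[OF that]])
  have \<theta>m: "\<theta> n k \<in> borel_measurable borel" if "k < N n" for n k
    unfolding \<theta>_def[abs_def] using lip0_measurable[OF Vl] lip0_measurable[OF Ul[OF that]] by simp
  have \<Theta>'m: "\<Theta>' n \<in> borel_measurable QQ" for n
    unfolding \<Theta>'_def by (intro pw_measurable lebesgue_onI \<theta>m)
  have \<Theta>'B: "AE z in QQ. norm (\<Theta>' n z) \<le> r * (2 * B)" for n
    using sp by eventually_elim (auto simp: \<Theta>'_def pw_eq N idx_cell(1) \<theta>B)
  have \<Theta>m: "\<Theta> \<in> borel_measurable QQ"
    unfolding \<Theta>_def by (intro borel_measurable_times snd_measurable[OF \<rho>c] direction(1)[OF Vl])
  have \<Theta>B: "AE z in QQ. norm (\<Theta> z) \<le> r * (2 * B)"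
    using sp by eventually_elim (use dB u_bound in \<open>auto simp: \<Theta>_def\<close>)
  show L\<Theta>: "L2_fun QQ \<Theta>" by (rule L2_bounded[OF Q_finite \<Theta>m \<Theta>B])
  have lim: "L2_lim QQ \<Theta>' \<Theta>" proof (rule L2_lim_dominated_bounded[OF Q_finite \<Theta>'m \<Theta>m \<Theta>'B])
    show "AE z in QQ. (\<lambda>n. \<Theta>' n z) \<longlonglongrightarrow> \<Theta> z" using sp proof eventually_elim
      case (elim z)
      then have z: "snd z \<in> {0<..<T}" by auto
      have "\<Theta>' n z = \<theta> n (idx (N n) (snd z)) (fst z)" for n
        using pw_eq[OF N, of "snd z" n "\<theta> n" "fst z"] z by (simp add: \<Theta>'_def)
      moreover have "(\<lambda>n. \<theta> n (idx (N n) (snd z)) (fst z)) \<longlonglongrightarrow> \<Theta> z"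
        unfolding \<theta>_def \<tau>_def \<Theta>_def
        using step_tendsto(2)[OF z, of "fst z"] continuous_on_tendsto_compose[OF \<rho>c step_tendsto(3)[OF z]]
          continuous_on_tendsto_compose[OF scc step_tendsto(3)[OF z]] by (intro tendsto_mult tendsto_diff tendsto_const) auto
      ultimately show ?case by simp
    qed
  qed
  have ubar: "L2_lim QQ (\<lambda>n. pw (N n) (U n)) u" proof (rule L2_lim_dominated_bounded[OF Q_finite _ u_measurable])
    have l: "U n k \<in> lip0 M" if "k < N n" for n k using is_scheme_lip0[OF S, of k n] that by simp
    show "pw (N n) (U n) \<in> borel_measurable QQ" for n by (intro pw_measurable lebesgue_onI lip0_measurable[OF l])
    show "AE z in QQ. norm (pw (N n) (U n) z) \<le> B" for n
      using sp by eventually_elim (auto simp: pw_eq N idx_cell(1) intro!: B(2)[OF l])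
    show "AE z in QQ. (\<lambda>n. pw (N n) (U n) z) \<longlonglongrightarrow> u z"
      using sp by eventually_elim (auto simp: pw_eq N step_tendsto(1))
  qed
  have srcL: "L2_fun QQ (src (U n k))" "AE z in QQ. (src (U n k) z)^2 \<le> \<Psi> z" if "k < N n" for n k
    using src_L2[OF is_scheme_K[OF S] grid_in[OF N]] that by auto
  have Sm_eq: "Sm n z = src (U n (idx (N n) (snd z))) z" if "z \<in> \<Omega> \<times> {0<..<T}" for n z
    using step_sum[OF N, of "snd z" "\<lambda>k. src (U n k) z" n] that by (auto simp: Sm_def)
  have Sm: "L2_fun QQ (Sm n)" "(\<integral>z. (Sm n z)^2 \<partial>QQ) \<le> integral\<^sup>L QQ \<Psi>" for n proof -
    have le: "AE z in QQ. (norm (Sm n z))^2 \<le> \<Psi> z" proof -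
      have "AE z in QQ. (src (U n (idx (N n) (snd z))) z)^2 \<le> \<Psi> z"
        by (rule pw_AE[OF N, where P = "\<lambda>k z. (src (U n k) z)^2 \<le> \<Psi> z"]) (rule srcL(2))
      with sp show ?thesis by eventually_elim (simp add: Sm_eq)
    qed
    have "Sm n \<in> borel_measurable QQ" unfolding Sm_def[abs_def]
      using L2_measurable[OF srcL(1)] by (intro borel_measurable_sum borel_measurable_times indicator_snd_measurable cell_borel) auto
    then show L: "L2_fun QQ (Sm n)" by (rule L2_bound[OF _ \<Psi>_integrable(1) le])
    show "(\<integral>z. (Sm n z)^2 \<partial>QQ) \<le> integral\<^sup>L QQ \<Psi>"
      using L le by (intro integral_mono_AE \<Psi>_integrable) (auto simp: L2_fun_def)
  qed
  define RB where "RB = 2 * (EE + M^2 * measure QQ (\<Omega> \<times> {0<..<T})) + 2 * integral\<^sup>L QQ \<Psi>"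
  note LX = L2_fst_snd(1)[OF X_L2(1)]
  have R: "L2_fun QQ (R n)" "(\<integral>z. (norm (R n z))^2 \<partial>QQ) \<le> RB" for n proof -
    show "L2_fun QQ (R n)" unfolding R_def[abs_def] by (rule L2_diff[OF LX Sm(1)])
    have "(\<integral>z. (norm (fst (X n z)))^2 \<partial>QQ) \<le> (\<integral>z. (norm (X n z))^2 \<partial>QQ)"
    proof (rule integral_mono)
      show "(norm (fst (X n z)))^2 \<le> (norm (X n z))^2" for z
        using norm_fst_le[of "fst (X n z)" "snd (X n z)"] by (intro power_mono) auto
    qed (use X_L2(1) LX in \<open>simp_all add: L2_fun_def\<close>)
    moreover have "(\<integral>z. (norm (fst (X n z) + (- 1) *\<^sub>R Sm n z))^2 \<partial>QQ)
        \<le> 2 * (\<integral>z. (norm (fst (X n z)))^2 \<partial>QQ) + 2 * (\<integral>z. (norm ((- 1) *\<^sub>R Sm n z))^2 \<partial>QQ)"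
      by (rule L2_integral_add_le[OF LX L2_scaleR[OF Sm(1)]])
    ultimately show "(\<integral>z. (norm (R n z))^2 \<partial>QQ) \<le> RB"
      using X_L2(2)[of n] Sm(2)[of n] unfolding RB_def R_def by simp
  qed
  have L\<Theta>': "L2_fun QQ (\<Theta>' n)" for n using lim by (simp add: L2_lim_def)
  \<comment> \<open>Each step inequality, multiplied by the nonnegative value of \<rho> at the right
    end of the cell, is summed over the cells.\<close>
  have discrete: "0 \<le> (\<integral>z. R n z * \<Theta>' n z \<partial>QQ)" for n proof -
    let ?i = "\<lambda>k z::'a \<times> real. indicator (cell (N n) k) (snd z) :: real"
    let ?q = "\<lambda>k z. ?i k z * (dU n k (fst z) * \<theta> n k (fst z))"
    let ?p = "\<lambda>k z. src (U n k) z * (?i k z * \<theta> n k (fst z))"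
    have q: "integrable QQ (?q k)" "integral\<^sup>L QQ (?q k) = \<tau> n * (\<integral>x. dU n k x * \<theta> n k x \<partial>NN)" if k: "k < N n" for k
    proof -
      have "\<bar>dU n k x * \<theta> n k x\<bar> \<le> 2 * B / (T / real (N n)) * (r * (2 * B))" for x
        unfolding abs_mult using dU_props(2)[OF k, of x] \<theta>B[OF k, of x] B(1) T by (intro mult_mono) auto
      moreover have "(\<lambda>x. dU n k x * \<theta> n k x) \<in> borel_measurable NN"
        using dU_props(1)[OF k] lebesgue_onI[OF \<theta>m[OF k]] by simp
      moreover note cell_integral[OF N k, folded \<tau>_def]
      ultimately show "integrable QQ (?q k)" "integral\<^sup>L QQ (?q k) = \<tau> n * (\<integral>x. dU n k x * \<theta> n k x \<partial>NN)"
        using bounded_product_integral[of "\<lambda>x. dU n k x * \<theta> n k x" _ "indicator (cell (N n) k)" 1]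
          borel_measurable_indicator[OF cell_borel[of "N n" k]] by (auto split: split_indicator)
    qed
    have p: "integrable QQ (?p k)" if k: "k < N n" for k proof (rule L2_mult_integrable[OF srcL(1)[OF k] L2_bounded[OF Q_finite]])
      show "(\<lambda>z. ?i k z * \<theta> n k (fst z)) \<in> borel_measurable QQ"
        by (intro borel_measurable_times indicator_snd_measurable cell_borel lebesgue_on_measurable_fst dom_sets Q_sets lebesgue_onI \<theta>m k)
      show "AE z in QQ. norm (?i k z * \<theta> n k (fst z)) \<le> r * (2 * B)"
        using \<theta>B[OF k] r0 B(1) by (intro AE_I2) (auto split: split_indicator)
    qed
    have le: "integral\<^sup>L QQ (?p k) \<le> integral\<^sup>L QQ (?q k)" if k: "k < N n" for k proof -
      let ?t = "real (Suc k) * \<tau> n"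
      have "el_ineq ?t (cell (N n) k) (U n k) (U n (Suc k))" using S[of n] k unfolding is_scheme_def cell_def \<tau>_def by blast
      moreover have "(\<lambda>x. sc s ?t * V x) \<in> K ?t"
        using K_scale[OF V s grid_in[OF N, of "Suc k" n]] k unfolding \<tau>_def by simp
      ultimately have el: "(\<integral>z. ?i k z * src (U n k) z * (sc s ?t * V (fst z) - U n (Suc k) (fst z)) \<partial>QQ)
          \<le> (\<integral>x. (U n (Suc k) x - U n k x) * (sc s ?t * V x - U n (Suc k) x) \<partial>NN)" unfolding el_ineq_def by (rule bspec)
      from el have "\<rho> ?t * (\<integral>z. ?i k z * src (U n k) z * (sc s ?t * V (fst z) - U n (Suc k) (fst z)) \<partial>QQ)
          \<le> \<rho> ?t * (\<integral>x. (U n (Suc k) x - U n k x) * (sc s ?t * V x - U n (Suc k) x) \<partial>NN)" by (rule mult_left_mono[OF _ \<rho>(2)])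
      moreover have "(\<lambda>z. \<rho> ?t * (?i k z * src (U n k) z * (sc s ?t * V (fst z) - U n (Suc k) (fst z)))) = ?p k"
        by (auto simp: \<theta>_def mult_ac)
      moreover have "\<tau> n * (dU n k x * \<theta> n k x) = \<rho> ?t * ((U n (Suc k) x - U n k x) * (sc s ?t * V x - U n (Suc k) x))" for x
        using \<tau>[of n] by (simp add: dU_def \<theta>_def \<tau>_def[symmetric])
      ultimately show ?thesis unfolding q(2)[OF k] by (simp flip: integral_mult_right_zero)
    qed
    have "(\<integral>z. R n z * \<Theta>' n z \<partial>QQ) = (\<integral>z. (\<Sum>k<N n. ?q k z - ?p k z) \<partial>QQ)"
    proof (rule Bochner_Integration.integral_cong[OF refl])
      fix z assume "z \<in> space QQ"
      then have z: "z \<in> \<Omega> \<times> {0<..<T}" "0 \<le> snd z" "snd z < T" by auto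
      have "R n z * \<Theta>' n z = (dU n (idx (N n) (snd z)) (fst z) - src (U n (idx (N n) (snd z))) z) * \<theta> n (idx (N n) (snd z)) (fst z)"
        using X_eq[of "snd z" n "fst z"] pw_eq[OF N, of "snd z" n "\<theta> n" "fst z"] z by (simp add: R_def Sm_eq \<Theta>'_def)
      also have "\<dots> = (\<Sum>k<N n. ?q k z - ?p k z)"
        using step_sum[OF N z(2,3), of "\<lambda>k. (dU n k (fst z) - src (U n k) z) * \<theta> n k (fst z)"]
        by (simp add: algebra_simps sum_subtractf)
      finally show "R n z * \<Theta>' n z = (\<Sum>k<N n. ?q k z - ?p k z)" .
    qed
    also have "\<dots> = (\<Sum>k<N n. integral\<^sup>L QQ (?q k) - integral\<^sup>L QQ (?p k))"
      using p q(1) by (subst Bochner_Integration.integral_sum) auto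
    also have "\<dots> \<ge> 0" using le by (intro sum_nonneg) auto
    finally show ?thesis .
  qed
  have Lc\<Theta>: "L2_fun QQ (\<lambda>z. c z * \<Theta> z)"
    using L2_bounded_mult[OF LQ(2) \<Theta>m, of "r * (2 * B)"] \<Theta>B by (simp add: mult.commute)
  have Lb\<Theta>: "L2_fun QQ (\<lambda>z. \<Theta> z *\<^sub>R b z)"
    using L2_bounded_mult[OF LQ(1) \<Theta>m, of "r * (2 * B)"] \<Theta>B by simp
  note LZ = L2_fun_Pair[OF L\<Theta> Lb\<Theta>]
  \<comment> \<open>A lower bound for the pairing of \<open>X n\<close> with the fixed direction
    that converges to \<kappa>; the last term is the Cauchy-Schwarz price for replacing
    \<open>\<Theta>'\<close> by \<open>\<Theta>\<close>.\<close>
  define lo where "lo n = (\<integral>z. f z * \<Theta> z \<partial>QQ) - (\<integral>z. pw (N n) (U n) z * (c z * \<Theta> z) \<partial>QQ)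
      - sqrt RB * sqrt (\<integral>z. (norm (\<Theta>' n z - \<Theta> z))^2 \<partial>QQ)" for n
  have "lo \<longlonglongrightarrow> ?\<kappa> - sqrt RB * sqrt 0" unfolding lo_def[abs_def] using lim
    by (intro tendsto_intros L2_lim_mult[OF ubar L2_lim_const[OF Lc\<Theta>]]) (simp add: L2_lim_def)
  then have lo: "lo \<longlonglongrightarrow> ?\<kappa>" by simp
  have low: "lo n \<le> ?J n" for n proof -
    note ig = L2_mult_integrable[OF R(1) L\<Theta>] L2_mult_integrable[OF LQ(3) L\<Theta>]
      L2_mult_integrable[OF _ Lc\<Theta>, of "pw (N n) (U n)"] L2_mult_integrable[OF R(1) L\<Theta>', of n n]
    have Lu: "L2_fun QQ (pw (N n) (U n))" using ubar by (simp add: L2_lim_def)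
    \<comment> \<open>Difference quotient and convection are linear in \<open>X n\<close> and stay
      in the pairing; the \<open>c\<close>-term contains the iterates themselves, which converge
      strongly, and goes to the other side.\<close>
    have "?J n = (\<integral>z. R n z * \<Theta> z + f z * \<Theta> z - pw (N n) (U n) z * (c z * \<Theta> z) \<partial>QQ)"
    proof (rule Bochner_Integration.integral_cong[OF refl])
      fix z assume "z \<in> space QQ"
      then have z: "z \<in> \<Omega> \<times> {0<..<T}" "0 \<le> snd z" "snd z < T" by auto
      show "X n z \<bullet> (\<Theta> z, \<Theta> z *\<^sub>R b z) = R n z * \<Theta> z + f z * \<Theta> z - pw (N n) (U n) z * (c z * \<Theta> z)"
        using X_eq[of "snd z" n "fst z"] pw_eq[OF N, of "snd z" n "U n" "fst z"] z
        by (simp add: inner_prod_def R_def Sm_eq src_def algebra_simps inner_commute)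
    qed
    also have "\<dots> = (\<integral>z. R n z * \<Theta> z \<partial>QQ) + (\<integral>z. f z * \<Theta> z \<partial>QQ) - (\<integral>z. pw (N n) (U n) z * (c z * \<Theta> z) \<partial>QQ)"
      using ig(1,2) ig(3)[OF Lu] by simp
    also have "(\<integral>z. R n z * \<Theta> z \<partial>QQ) = (\<integral>z. R n z * \<Theta>' n z \<partial>QQ) - (\<integral>z. R n z \<bullet> (\<Theta>' n z - \<Theta> z) \<partial>QQ)"
      using ig(1,4) by (simp add: right_diff_distrib)
    finally have 1: "?J n \<ge> (\<integral>z. f z * \<Theta> z \<partial>QQ) - (\<integral>z. pw (N n) (U n) z * (c z * \<Theta> z) \<partial>QQ)
        - \<bar>\<integral>z. R n z \<bullet> (\<Theta>' n z - \<Theta> z) \<partial>QQ\<bar>" using discrete[of n] by linarith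
    have "\<bar>\<integral>z. R n z \<bullet> (\<Theta>' n z - \<Theta> z) \<partial>QQ\<bar> \<le> sqrt (\<integral>z. (norm (R n z))^2 \<partial>QQ) * sqrt (\<integral>z. (norm (\<Theta>' n z - \<Theta> z))^2 \<partial>QQ)"
      by (rule L2_Cauchy_Schwarz_sqrt[OF R(1) L2_diff[OF L\<Theta>' L\<Theta>]])
    also have "\<dots> \<le> sqrt RB * sqrt (\<integral>z. (norm (\<Theta>' n z - \<Theta> z))^2 \<partial>QQ)"
      using R(2)[of n] by (intro mult_right_mono) auto
    finally show ?thesis using 1 unfolding lo_def by linarith
  qed
  show "?\<kappa> \<le> (\<integral>z. Y z \<bullet> (\<Theta> z, \<Theta> z *\<^sub>R b z) \<partial>QQ)"
  proof (rule L2_midhull_inner_ge[OF X_L2(1) F FY LZ])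
    fix \<epsilon> :: real assume "\<epsilon> > 0"
    from LIMSEQ_D[OF lo this] obtain n0 where n0: "\<And>n. n \<ge> n0 \<Longrightarrow> norm (lo n - (?\<kappa>)) < \<epsilon>" by blast
    have "?\<kappa> - \<epsilon> \<le> ?J n" if "n \<ge> n0" for n using n0[OF that] low[of n] unfolding real_norm_def by linarith
    then show "\<exists>n0. \<forall>n\<ge>n0. ?\<kappa> - \<epsilon> \<le> ?J n" by blast
  qed
qed

end

end

section \<open>The limit solves the problem\<close>

context evolution_limit
begin

context
  fixes F and Y :: "'a \<times> real \<Rightarrow> real \<times> 'a"
  assumes F: "\<And>n. midhull X n (F n)" and FY: "L2_lim QQ F Y" and FY_AE: "AE z in QQ. (\<lambda>n. F n z) \<longlonglongrightarrow> Y z"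
begin

lemma limit_weak_dt: "has_weak_dt \<Omega> T u (\<lambda>z. fst (Y z))"
proof -
  have i: "integrable QQ u" "integrable QQ (\<lambda>z. fst (Y z))" proof -
    show "integrable QQ u" using u_bound by (intro integrable_bounded_set[OF Q_sets(1) Q_bounded u_measurable, of B] AE_I2) auto
    show "integrable QQ (\<lambda>z. fst (Y z))" by (rule L2_integrable[OF Q_finite L2_fst_snd(1)[OF Y_L2(1)[OF F FY FY_AE]]])
  qed
  have "(\<integral>z. u z * deriv (\<lambda>s. \<phi> (fst z, s)) (snd z) \<partial>QQ) = - (\<integral>z. fst (Y z) * \<phi> z \<partial>QQ)"
    if \<phi>: "test_function (\<Omega> \<times> {0<..<T}) \<phi>" for \<phi>
    using limit_dt[OF F FY FY_AE \<phi>] deriv_section(2)[OF test_function_smooth[OF \<phi>]] by simp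
  then show ?thesis using integrable_imp_locally_integrable[OF i(1)] integrable_imp_locally_integrable[OF i(2)] Q_sets(1)
    by (auto simp: has_weak_dt_def cylinder_def)
qed

definition \<Phi> where "\<Phi> z = fst (Y z) + b z \<bullet> snd (Y z) + c z * u z - f z"

lemma \<Phi>_integrable:
  assumes h: "h \<in> borel_measurable QQ" "AE z in QQ. \<bar>h z\<bar> \<le> H"
  shows "integrable QQ (\<lambda>z. \<Phi> z * h z)"
proof -
  note LY = L2_fst_snd[OF Y_L2(1)[OF F FY FY_AE]]
  have Lh: "L2_fun QQ h" by (rule L2_bounded[OF Q_finite h(1)]) (use h(2) in simp)
  have "L2_fun QQ (\<lambda>z. u z *\<^sub>R h z)"
    by (rule L2_bounded_mult[OF Lh u_measurable, of B]) (use u_bound in \<open>auto intro!: AE_I2\<close>)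
  from L2_mult_integrable[OF LQ(2) this] L2_mult_integrable[OF LY(1) Lh] L2_mult_integrable[OF LQ(3) Lh]
    L2_inner_integrable[OF LQ(1) L2_bounded_mult[OF LY(2) h]]
  have "integrable QQ (\<lambda>z. fst (Y z) * h z + b z \<bullet> (h z *\<^sub>R snd (Y z)) + c z * (u z *\<^sub>R h z) - f z * h z)"
    by (intro Bochner_Integration.integrable_add Bochner_Integration.integrable_diff)
  then show ?thesis by (simp add: \<Phi>_def algebra_simps)
qed

text \<open>The weight \<rho> is an arbitrary nonnegative test function of time, so the fundamental
  lemma localises. The null set still depends on \<open>s\<close> and \<open>V\<close>.\<close>

lemma limit_inequality_AE:
  assumes V: "V \<in> K s" and s: "s \<in> {0..T}"
  shows "AE t in TT. 0 \<le> (\<integral>x. \<Phi> (x, t) * (sc s t * V x - u (x, t)) \<partial>NN)"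
proof -
  let ?h = "\<lambda>z::'a \<times> real. sc s (snd z) * V (fst z) - u z"
  note LY = Y_L2(1)[OF F FY FY_AE]
  note hm = direction(1)[OF K_lip0[OF V], of s] and hB = direction(2)[OF K_lip0[OF V], of s]
  note ih = \<Phi>_integrable[OF hm hB]
  have "AE t in TT. 0 \<le> (\<integral>x. \<Phi> (x, t) * ?h (x, t) \<partial>NN)"
  proof (rule fundamental_lemma_nonneg_lebesgue_on[OF open_greaterThanLessThan lebesgue_on_Fubini(2)[OF QF ih]])
    fix \<rho> assume \<rho>: "test_function {0<..<T} \<rho>" "\<And>t. 0 \<le> \<rho> t"
    let ?\<Theta> = "\<lambda>z. \<rho> (snd z) * ?h z"
    obtain r where r: "\<And>t. \<bar>\<rho> t\<bar> \<le> r" using \<rho>(1) by (rule test_function_bounded) (rule that)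
    have "r \<ge> 0" using r[of 0] by simp
    then have \<Theta>B: "AE z in QQ. \<bar>?\<Theta> z\<bar> \<le> r * (2 * B)"
      using hB by (auto simp: abs_mult elim!: eventually_mono intro!: mult_mono r)
    have \<Theta>m: "?\<Theta> \<in> borel_measurable QQ"
      by (rule borel_measurable_times[OF snd_measurable[OF smooth_continuous[OF test_function_smooth[OF \<rho>(1)]]] hm])
    note i\<Theta> = \<Phi>_integrable[OF \<Theta>m \<Theta>B] and lim = limit_inequality[OF F FY FY_AE V s \<rho>]
    have L: "L2_fun QQ (\<lambda>z. c z * ?\<Theta> z)" "L2_fun QQ (\<lambda>z. ?\<Theta> z *\<^sub>R b z)"
      using L2_bounded_mult[OF LQ(2) \<Theta>m \<Theta>B] L2_bounded_mult[OF LQ(1) \<Theta>m \<Theta>B] by (simp_all add: mult.commute)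
    have "L2_fun QQ u" by (rule L2_bounded[OF Q_finite u_measurable, of B]) (use u_bound in \<open>auto intro!: AE_I2\<close>)
    note i = L2_mult_integrable[OF LQ(3) lim(1)] L2_mult_integrable[OF this L(1)]
    note i3 = L2_inner_integrable[OF LY L2_fun_Pair[OF lim(1) L(2)]]
    have "(\<integral>z. \<Phi> z * ?\<Theta> z \<partial>QQ) = (\<integral>z. Y z \<bullet> (?\<Theta> z, ?\<Theta> z *\<^sub>R b z) - (f z * ?\<Theta> z - u z * (c z * ?\<Theta> z)) \<partial>QQ)"
      by (intro Bochner_Integration.integral_cong) (simp_all add: \<Phi>_def inner_prod_def algebra_simps inner_commute)
    also have "\<dots> \<ge> 0"
      using lim(2) Bochner_Integration.integral_diff[OF i3 Bochner_Integration.integrable_diff[OF i]] Bochner_Integration.integral_diff[OF i] by simp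
    finally have "0 \<le> (\<integral>t. (\<integral>x. \<Phi> (x, t) * ?\<Theta> (x, t) \<partial>NN) \<partial>TT)"
      using lebesgue_on_Fubini(3)[OF QF i\<Theta>] by simp
    also have "\<dots> = (\<integral>t. \<rho> t * (\<integral>x. \<Phi> (x, t) * ?h (x, t) \<partial>NN) \<partial>TT)"
      by (simp add: mult.left_commute flip: integral_mult_right_zero)
    finally show "0 \<le> (\<integral>t. \<rho> t * (\<integral>x. \<Phi> (x, t) * ?h (x, t) \<partial>NN) \<partial>TT)" .
  qed
  then show ?thesis by simp
qed

text \<open>Countable dense subsets of the admissible sets at rational times give one null set. A
  given \<open>V\<close> admissible at time \<open>t\<close> is rescaled to a rational time
  \<open>s\<close> shortly after \<open>t\<close>, approximated there within the dense subset, and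
  rescaled back; all errors are uniform and small. The L2 premise on the residual makes the
  resulting error integral small as well.\<close>

lemma limit_variational_inequality:
  "AE t in TT. L2_fun NN (\<lambda>x. \<Phi> (x, t)) \<longrightarrow> (\<forall>V\<in>K t. 0 \<le> (\<integral>x. \<Phi> (x, t) * (V x - u (x, t)) \<partial>NN))"
proof -
  have cc: "compact (closure \<Omega>)" using bounded_dom by simp
  have "\<exists>D. \<forall>s. D s \<subseteq> K s \<and> countable (D s) \<and> (\<forall>V \<epsilon>. V \<in> K s \<longrightarrow> \<epsilon> > 0 \<longrightarrow> (\<exists>d\<in>D s. \<forall>x\<in>closure \<Omega>. norm (V x - d x) < \<epsilon>))"
  proof (intro choice allI)
    fix s
    obtain D where "D \<subseteq> K s" "countable D" "\<And>V \<epsilon>. V \<in> K s \<Longrightarrow> \<epsilon> > 0 \<Longrightarrow> \<exists>d\<in>D. \<forall>x\<in>closure \<Omega>. norm (V x - d x) < \<epsilon>"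
      by (rule countable_uniform_dense[OF cc, of "K s" "\<lambda>V. V"]) (auto intro: lip0_continuous K_lip0)
    then show "\<exists>D. D \<subseteq> K s \<and> countable D \<and> (\<forall>V \<epsilon>. V \<in> K s \<longrightarrow> \<epsilon> > 0 \<longrightarrow> (\<exists>d\<in>D. \<forall>x\<in>closure \<Omega>. norm (V x - d x) < \<epsilon>))"
      by blast
  qed
  then obtain D where D0: "\<forall>s. D s \<subseteq> K s \<and> countable (D s) \<and> (\<forall>V \<epsilon>. V \<in> K s \<longrightarrow> \<epsilon> > 0 \<longrightarrow> (\<exists>d\<in>D s. \<forall>x\<in>closure \<Omega>. norm (V x - d x) < \<epsilon>))"
    by (rule exE)
  have D: "D s \<subseteq> K s" "countable (D s)" for s using D0[rule_format, of s] by auto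
  have Dd: "\<exists>d\<in>D s. \<forall>x\<in>closure \<Omega>. norm (V x - d x) < \<epsilon>" if "V \<in> K s" "\<epsilon> > 0" for s V \<epsilon>
    using D0[rule_format, of s] that by simp
  have cr: "countable (\<rat> \<inter> {0..T})" using countable_rat by (rule countable_Int1)
  have "AE t in TT. \<forall>s\<in>\<rat> \<inter> {0..T}. \<forall>V\<in>D s. 0 \<le> (\<integral>x. \<Phi> (x, t) * (sc s t * V x - u (x, t)) \<partial>NN)"
    unfolding AE_ball_countable[OF cr] AE_ball_countable[OF D(2)]
  proof (intro ballI)
    fix s V assume "s \<in> \<rat> \<inter> {0..T}" "V \<in> D s"
    then show "AE t in TT. 0 \<le> (\<integral>x. \<Phi> (x, t) * (sc s t * V x - u (x, t)) \<partial>NN)"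
      using D(1)[of s] by (intro limit_inequality_AE) auto
  qed
  moreover have "AE t in TT. t \<in> {0<..<T}" by (rule AE_I2) simp
  ultimately show ?thesis proof eventually_elim
    case (elim t)
    have tT: "t \<in> {0..T}" using elim(2) by auto
    show ?case proof (intro impI ballI)
      fix V assume L: "L2_fun NN (\<lambda>x. \<Phi> (x, t))" and V: "V \<in> K t"
      define A where "A = (\<integral>x. \<bar>\<Phi> (x, t)\<bar> \<partial>NN)"
      have iA: "integrable NN (\<lambda>x. \<bar>\<Phi> (x, t)\<bar>)" using L2_integrable[OF dom_finite L] by simp
      have A: "A \<ge> 0" by (simp add: A_def)
      note Lu = lip0_L2[OF u_lip0[OF tT]]
      have "0 \<le> (\<integral>x. \<Phi> (x, t) * (V x - u (x, t)) \<partial>NN) + \<eta> * A" if \<eta>: "\<eta> > 0" for \<eta>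
      proof -
        \<comment> \<open>The two rescalings together cost at most 2 B (C/m) \<delta>, which is at
          most half of \<eta>; the other half is left for the approximation by
          \<open>d\<close>.\<close>
        define \<delta> where "\<delta> = \<eta> / (4 * (B * (C / m) + 1))"
        have BC: "B * (C / m) \<ge> 0" using B(1) C m by simp
        have "0 < \<eta> / (4 * (p + 1)) \<and> 2 * p * (\<eta> / (4 * (p + 1))) \<le> \<eta> / 2" if "p \<ge> 0" for p
          using that \<eta> by (simp add: field_simps)
        from this[OF BC] have \<delta>: "\<delta> > 0" "2 * (B * (C / m)) * \<delta> \<le> \<eta> / 2" unfolding \<delta>_def by blast+
        obtain s where s: "s \<in> \<rat>" "t < s" "s < min T (t + \<delta>)"
          using Rats_dense_in_real[of t "min T (t + \<delta>)"] elim(2) \<delta> by auto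
        then have sT: "s \<in> {0..T}" "s \<in> \<rat> \<inter> {0..T}" using elim(2) by auto
        have V': "(\<lambda>x. sc t s * V x) \<in> K s" by (rule K_scale[OF V tT sT(1)])
        obtain d where d: "d \<in> D s" "\<And>x. x \<in> closure \<Omega> \<Longrightarrow> norm (sc t s * V x - d x) < \<eta> / 2"
          using Dd[OF V', of "\<eta> / 2"] \<eta> by auto
        have dK: "d \<in> lip0 M" using K_lip0 D(1) d(1) by blast
        have near: "\<bar>sc s t * d x - V x\<bar> \<le> \<eta>" if "x \<in> \<Omega>" for x proof -
          have e: "1 - sc s t \<le> C / m * \<delta>" "1 - sc t s \<le> C / m * \<delta>" proof -
            have "C / m * \<bar>t - s\<bar> \<le> C / m * \<delta>" using s C m by (intro mult_left_mono) auto
            then show "1 - sc s t \<le> C / m * \<delta>" "1 - sc t s \<le> C / m * \<delta>"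
              using sc_bounds(3)[of s t] sc_bounds(3)[of t s] by (auto simp: abs_minus_commute)
          qed
          have small: "\<bar>\<sigma> * w - w\<bar> \<le> B * (C / m) * \<delta>" if "\<sigma> \<le> 1" "1 - \<sigma> \<le> C / m * \<delta>" "\<bar>w\<bar> \<le> B" for \<sigma> w :: real
          proof -
            have "\<sigma> * w - w = - ((1 - \<sigma>) * w)" by (simp add: algebra_simps)
            then have "\<bar>\<sigma> * w - w\<bar> = \<bar>1 - \<sigma>\<bar> * \<bar>w\<bar>" by (simp only: abs_minus_cancel abs_mult)
            also have "\<dots> \<le> (C / m * \<delta>) * B" using that by (intro mult_mono) auto
            finally show ?thesis by (simp only: mult_ac)
          qed
          have 1: "\<bar>sc s t * d x - d x\<bar> \<le> B * (C / m) * \<delta>" by (rule small[OF sc_bounds(2) e(1) B(2)[OF dK]])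
          have 2: "\<bar>sc t s * V x - V x\<bar> \<le> B * (C / m) * \<delta>" by (rule small[OF sc_bounds(2) e(2) B(2)[OF K_lip0[OF V]]])
          have "\<bar>sc t s * V x - d x\<bar> < \<eta> / 2" using d(2)[of x] that closure_subset[of \<Omega>] by auto
          then show ?thesis using 1 2 \<delta>(2) by linarith
        qed
        have i: "integrable NN (\<lambda>x. \<Phi> (x, t) * (V x - u (x, t)))"
          by (intro L2_mult_integrable[OF L L2_diff[OF lip0_L2[OF K_lip0[OF V]] Lu]])
        have "L2_fun NN (\<lambda>x. sc s t *\<^sub>R d x)" by (rule L2_scaleR[OF lip0_L2[OF dK]])
        from L2_mult_integrable[OF L L2_diff[OF this Lu]]
        have i2: "integrable NN (\<lambda>x. \<Phi> (x, t) * (sc s t * d x - u (x, t)))" by simp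
        have "0 \<le> (\<integral>x. \<Phi> (x, t) * (sc s t * d x - u (x, t)) \<partial>NN)" using elim(1) sT(2) d(1) by blast
        also have "\<dots> \<le> (\<integral>x. \<Phi> (x, t) * (V x - u (x, t)) + \<eta> * \<bar>\<Phi> (x, t)\<bar> \<partial>NN)"
        proof (rule integral_mono[OF i2])
          show "integrable NN (\<lambda>x. \<Phi> (x, t) * (V x - u (x, t)) + \<eta> * \<bar>\<Phi> (x, t)\<bar>)"
            using i iA by (intro Bochner_Integration.integrable_add integrable_mult_right) auto
          fix x assume "x \<in> space NN"
          then have "\<bar>\<Phi> (x, t) * (sc s t * d x - V x)\<bar> \<le> \<bar>\<Phi> (x, t)\<bar> * \<eta>"
            unfolding abs_mult using near[of x] by (intro mult_left_mono) auto
          then show "\<Phi> (x, t) * (sc s t * d x - u (x, t)) \<le> \<Phi> (x, t) * (V x - u (x, t)) + \<eta> * \<bar>\<Phi> (x, t)\<bar>"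
            by (simp add: algebra_simps abs_le_iff)
        qed
        also have "\<dots> = (\<integral>x. \<Phi> (x, t) * (V x - u (x, t)) \<partial>NN) + \<eta> * A" using i iA by (simp add: A_def)
        finally show ?thesis .
      qed
      note approx = this
      show "0 \<le> (\<integral>x. \<Phi> (x, t) * (V x - u (x, t)) \<partial>NN)" proof (rule field_le_epsilon)
        fix e :: real assume e: "e > 0"
        have "e / (A + 1) * A \<le> e" using e A by (simp add: field_simps)
        then show "0 \<le> (\<integral>x. \<Phi> (x, t) * (V x - u (x, t)) \<partial>NN) + e"
          using approx[of "e / (A + 1)"] e A by simp
      qed
    qed
  qed
qed

lemma limit_solution: "u \<in> solution_class \<Omega> T" "is_solution \<Omega> T b c g f V0 u"
proof -
  note LY = L2_fst_snd[OF Y_L2(1)[OF F FY FY_AE]] and dt = limit_weak_dt and grad = limit_grad[OF F FY FY_AE]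
  have int: "AE t in TT. t \<in> {0<..<T}" by (rule AE_I2) simp
  have ucl: "(\<lambda>x. u (x, t)) \<in> borel_measurable NN" "AE x in NN. norm (u (x, t)) \<le> B" if "t \<in> {0<..<T}" for t
    using u_lip0[of t] that u_bound[of t] by (auto intro!: lebesgue_onI lip0_measurable AE_I2)
  have cl: "closure (cylinder \<Omega> T) = closure \<Omega> \<times> {0..T}" using T by (simp add: cylinder_def closure_Times)
  have "AE t in TT. in_W1inf0 \<Omega> (\<lambda>x. u (x, t)) \<and>
      (AE x in NN. \<bar>u (x, t)\<bar> \<le> max M B \<and> norm (weak_grad \<Omega> (\<lambda>x. u (x, t)) x) \<le> max M B)"
    using grad int
  proof eventually_elim
    case (elim t)
    have tT: "t \<in> {0..T}" using elim(2) by auto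
    have G: "H10_grad (\<lambda>x. u (x, t)) (\<lambda>x. snd (Y (x, t)))" using elim by blast
    have GM: "AE x in NN. norm (snd (Y (x, t))) \<le> M" using conjunct2[OF elim(1)] gM[OF tT] by eventually_elim simp
    have "in_Linf \<Omega> (\<lambda>x. u (x, t))" "in_Linf \<Omega> (\<lambda>x. snd (Y (x, t)))"
      unfolding in_Linf_def using ucl[OF elim(2)] GM L2_measurable[OF H10_grad_L2(2)[OF G]] by blast+
    then have "in_W1inf \<Omega> (\<lambda>x. u (x, t))" using H10_grad_has_weak_grad[OF G] by (auto simp: in_W1inf_def)
    moreover have "continuous_on (closure \<Omega>) (\<lambda>x. u (x, t))" by (rule lip0_continuous[OF u_lip0[OF tT]])
    moreover have "\<forall>x\<in>frontier \<Omega>. u (x, t) = 0"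
      using u_lip0[OF tT] open_dom by (auto simp: frontier_def interior_open lip0_def)
    ultimately have "in_W1inf0 \<Omega> (\<lambda>x. u (x, t))" unfolding in_W1inf0_def by (intro conjI exI[of _ "\<lambda>x. u (x, t)"]) auto
    moreover have "AE x in NN. \<bar>u (x, t)\<bar> \<le> max M B \<and> norm (weak_grad \<Omega> (\<lambda>x. u (x, t)) x) \<le> max M B"
      using ucl(2)[OF elim(2)] H10_grad_in_H10(2)[OF G] GM by eventually_elim auto
    ultimately show ?case ..
  qed
  then have "in_Linf_W1inf0 \<Omega> T u" using u_measurable unfolding in_Linf_W1inf0_def cylinder_def by blast
  then show "u \<in> solution_class \<Omega> T"
    using u_cont dt LY(1) unfolding solution_class_def cl by (auto simp: in_L2_iff cylinder_def)
  let ?V = "\<lambda>t v. (\<integral>x. weak_dt \<Omega> T u (x, t) * (v x - u (x, t)) \<partial>NN)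
    + (\<integral>x. (b (x, t) \<bullet> weak_grad \<Omega> (\<lambda>y. u (y, t)) x) * (v x - u (x, t)) \<partial>NN)
    + (\<integral>x. c (x, t) * u (x, t) * (v x - u (x, t)) \<partial>NN) \<ge> (\<integral>x. f (x, t) * (v x - u (x, t)) \<partial>NN)"
  have Lw: "in_L2 (cylinder \<Omega> T) (\<lambda>z. fst (Y z))" using LY(1) by (simp add: in_L2_iff cylinder_def)
  have "AE t in TT. (\<lambda>x. u (x, t)) \<in> constraint_set \<Omega> (\<lambda>x. g (x, t))"
    using grad by eventually_elim (auto simp: constraint_set_iff)
  moreover have "AE t in TT. \<forall>v \<in> constraint_set \<Omega> (\<lambda>x. g (x, t)). ?V t v"
    using grad int weak_dt_section[OF dt] L2_section[OF Lw] L2_section[OF Lb] L2_section[OF Lc] L2_section[OF Lf] limit_variational_inequality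
  proof eventually_elim
    case (elim t)
    have tT: "t \<in> {0..T}" using elim(2) by auto
    have G: "H10_grad (\<lambda>x. u (x, t)) (\<lambda>x. snd (Y (x, t)))" using elim by blast
    note Gw = H10_grad_in_H10[OF G] and Lu = lip0_L2[OF u_lip0[OF tT]]
    have LG: "L2_fun NN (weak_grad \<Omega> (\<lambda>x. u (x, t)))" by (rule H10_grad_L2(2)[OF in_H10_H10_grad[OF Gw(1)]])
    have GM: "AE x in NN. norm (weak_grad \<Omega> (\<lambda>x. u (x, t)) x) \<le> M"
      using conjunct2[OF elim(1)] gM[OF tT] Gw(2) by eventually_elim simp
    have La: "L2_fun NN (\<lambda>x. weak_dt \<Omega> T u (x, t))" by (rule AE_eq_L2_fun[OF elim(4) elim(3)]) simp
    have uB: "AE x in NN. \<bar>u (x, t)\<bar> \<le> B" using ucl(2)[OF elim(2)] by simp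
    let ?\<Phi> = "\<lambda>x. weak_dt \<Omega> T u (x, t) + b (x, t) \<bullet> weak_grad \<Omega> (\<lambda>y. u (y, t)) x + c (x, t) * u (x, t) - f (x, t)"
    note vi = variational_inequality_iff[OF La elim(5,6,7) LG GM Lu uB]
    have eq: "AE x in NN. \<Phi> (x, t) = ?\<Phi> x" using elim(3) Gw(2) by eventually_elim (simp add: \<Phi>_def)
    have L\<Phi>: "L2_fun NN (\<lambda>x. \<Phi> (x, t))" by (rule AE_eq_L2_fun[OF vi(1)[OF Lu] eq]) simp
    show ?case proof
      fix v assume v: "v \<in> constraint_set \<Omega> (\<lambda>x. g (x, t))"
      \<comment> \<open>The problem allows test functions given almost everywhere; the inequality is
        known for their Lipschitz representatives.\<close>
      obtain V where V: "V \<in> K t" "AE x in NN. V x = v x" by (rule constraint_set_Kset[OF v gM[OF tT] M])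
      have Lv: "L2_fun NN v" by (rule H10_grad_L2(1)[OF in_H10_H10_grad]) (use v in \<open>simp add: constraint_set_def\<close>)
      have "0 \<le> (\<integral>x. \<Phi> (x, t) * (V x - u (x, t)) \<partial>NN)" using elim(8) L\<Phi> V(1) by blast
      also have "\<dots> = (\<integral>x. ?\<Phi> x * (v x - u (x, t)) \<partial>NN)" proof (rule integral_cong_AE)
        show "(\<lambda>x. \<Phi> (x, t) * (V x - u (x, t))) \<in> borel_measurable NN" "(\<lambda>x. ?\<Phi> x * (v x - u (x, t))) \<in> borel_measurable NN"
          using L2_measurable[OF L\<Phi>] L2_measurable[OF vi(1)[OF Lu]] L2_measurable[OF Lu] L2_measurable[OF Lv]
            L2_measurable[OF lip0_L2[OF K_lip0[OF V(1)]]] by auto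
        show "AE x in NN. \<Phi> (x, t) * (V x - u (x, t)) = ?\<Phi> x * (v x - u (x, t))" using eq V(2) by eventually_elim simp
      qed
      finally show "?V t v" using vi(2)[OF Lv] by simp
    qed
  qed
  ultimately show "is_solution \<Omega> T b c g f V0 u" unfolding is_solution_def by (simp add: u_init)
qed

end

end

context evolution
begin

lemma solution_exists: "\<exists>u\<in>solution_class \<Omega> T. is_solution \<Omega> T b c g f V0 u"
proof -
  have "\<exists>U. \<forall>n. is_scheme (Suc n) (U n)" by (intro choice allI scheme_exists) simp
  then obtain U where U: "\<And>n. is_scheme (Suc n) (U n)" by blast
  obtain u r where u: "strict_mono (r :: nat \<Rightarrow> nat)" "continuous_on (closure \<Omega> \<times> {0..T}) u"
    "\<And>t. t \<in> {0..T} \<Longrightarrow> (\<lambda>x. u (x, t)) \<in> lip0 M" "\<And>x. u (x, 0) = V0 x"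
    "\<And>\<epsilon>. \<epsilon> > 0 \<Longrightarrow> \<exists>n0. \<forall>n\<ge>n0. \<forall>x. \<forall>t\<in>{0..T}. \<bar>itp (Suc (r n)) (\<lambda>k. U (r n) k x) t - u (x, t)\<bar> < \<epsilon>"
    by (rule itp_limit[OF U]) (rule that)
  interpret L: evolution_limit \<Omega> T m C M b c f g V0 "\<lambda>n. U (r n)" "\<lambda>n. Suc (r n)" u
  proof unfold_locales
    show "(\<lambda>n. T / real (Suc (r n))) \<longlonglongrightarrow> 0"
      using LIMSEQ_subseq_LIMSEQ[OF LIMSEQ_Suc[OF lim_const_over_n[of T]] u(1)] by (simp add: o_def)
  qed (use U u in auto)
  obtain F Y where "\<And>n. midhull L.X n (F n)" "L2_lim QQ F Y" "AE z in QQ. (\<lambda>n. F n z) \<longlonglongrightarrow> Y z"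
    by (rule L2_bounded_midhull_lim[OF L.X_L2]) (rule that)
  from L.limit_solution[OF this] show ?thesis by blast
qed

end

theorem theorem2p1:
  fixes \<Omega> :: "'a::euclidean_space set"
    and T l m :: real
    and b :: "'a \<times> real \<Rightarrow> 'a"
    and c g f :: "'a \<times> real \<Rightarrow> real"
    and u0 :: "'a \<Rightarrow> real"
  assumes "open \<Omega>" and "bounded \<Omega>" and "lipschitz_boundary \<Omega>"
    and "T > 0"
    and "in_L2 (cylinder \<Omega> T) b" and "in_L2 (cylinder \<Omega> T) c"
    and "c_minus_half_div_ge \<Omega> T b c l"
    and "in_W1inf_Linf \<Omega> T g"
    and "m > 0" and "AE z in lebesgue_on (cylinder \<Omega> T). g z \<ge> m"
    and "in_L2 (cylinder \<Omega> T) f"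
    and "u0 \<in> constraint_set \<Omega> (\<lambda>x. g (x, 0))"
  shows "\<exists>u \<in> solution_class \<Omega> T. is_solution \<Omega> T b c g f u0 u \<and>
           (\<forall>u' \<in> solution_class \<Omega> T. is_solution \<Omega> T b c g f u0 u' \<longrightarrow>
              (\<forall>z \<in> closure (cylinder \<Omega> T). u' z = u z))"
proof -
  interpret lipschitz_domain \<Omega> using assms(1-3) by unfold_locales
  obtain C M where CM: "C \<ge> 0" "M \<ge> 0"
    "\<And>t. t \<in> {0..T} \<Longrightarrow> AE x in lebesgue_on \<Omega>. m \<le> g (x, t) \<and> g (x, t) \<le> M"
    "\<And>s t. s \<in> {0..T} \<Longrightarrow> t \<in> {0..T} \<Longrightarrow> AE x in lebesgue_on \<Omega>. \<bar>g (x, t) - g (x, s)\<bar> \<le> C * \<bar>t - s\<bar>"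
    by (rule W1inf_Linf_bounds[OF assms(4,8,10)]) (rule that)
  have gM: "AE x in lebesgue_on \<Omega>. g (x, t) \<le> M" if "t \<in> {0..T}" for t
    using CM(3)[OF that] by eventually_elim simp
  \<comment> \<open>The scheme needs pointwise values of the initial datum, so it starts from its
    Lipschitz representative.\<close>
  obtain V0 where V: "V0 \<in> Kset M (\<lambda>x. g (x, 0))" "AE x in lebesgue_on \<Omega>. V0 x = u0 x"
    by (rule constraint_set_Kset[OF assms(12) gM CM(2)]) (use assms(4) in simp, rule that)
  interpret evolution \<Omega> T m C M b c f g V0
    by unfold_locales (use assms CM V in auto)
  obtain u where u: "u \<in> solution_class \<Omega> T" "is_solution \<Omega> T b c g f V0 u" using solution_exists by blast
  \<comment> \<open>The initial condition is required almost everywhere only, so it transfers from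
    \<open>V0\<close> back to \<open>u0\<close>.\<close>
  have "AE x in lebesgue_on \<Omega>. u (x, 0) = u0 x"
    using u(2) V(2) unfolding is_solution_def by (auto elim: eventually_elim2)
  then have "is_solution \<Omega> T b c g f u0 u" using u(2) unfolding is_solution_def by blast
  then show ?thesis using u(1) solution_unique[OF assms(4,5,6,11,7) gM] by blast
qed

end
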